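(* Let $\Gamma\subset\mathrm{PSL}(2,\mathbb R)$ be a discrete cocompact subgroup. Then there exists a finitely generated ring (of meromorphic quasimodular forms over $\Gamma$), closed under $D=d/dz$, which contains the ring $\widetilde M_*(\Gamma)$ of quasimodular forms over $\Gamma$. One can take $\widetilde R=R[\phi]$, where $\phi\in\widetilde M_2(\Gamma;\{i\})$ satisfies $\delta(\phi)=1$ and $R$ is a ring generated over $\mathbb C$ by $\{D_\phi^j(f_m)\ (0\le j\le N,\ 1\le m\le d)\ ;\ D_\phi^l(\omega)\ (0\le l\le N)\}$ with $N\in\mathbb N^*$ such that $R$ is closed under $D_\phi$, where $\omega=\phi'-\phi^2$ and $f_1,\dots,f_d$ are homogeneous modular forms whose classes form a basis of $I/I^2$.
   Context: $\mathcal H$ is the upper half plane and $i=\sqrt{-1}\in\mathcal H$. $M_k(\Gamma)$ is the space of holomorphic modular forms of weight $k$: holomorphic $f$ on $\mathcal H$ with $f(\frac{az+b}{cz+d})=(cz+d)^kf(z)$ for all $\begin{pmatrix}a&b\\c&d\end{pmatrix}\in\Gamma$; $I=\bigoplus_{k>0}M_k(\Gamma)$. A quasimodular form of weight $k$ and depth $\le p$ over $\Gamma$ is a holomorphic $f:\mathcal H\to\mathbb C$ of moderate growth ($|f(z)|=O(((1+|z|^2)/\operatorname{Im} z)^N)$ for some $N$) for which there are functions $f_0,\dots,f_p:\mathcal H\to\mathbb C$ with $(cz+d)^{-k}f(\frac{az+b}{cz+d})=\sum_{j=0}^p f_j(z)\left(\frac{c}{cz+d}\right)^j$ for all $z$ and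 all $\begin{pmatrix}a&b\\c&d\end{pmatrix}\in\Gamma$; $\widetilde M_*(\Gamma)=\bigoplus_{k\ge0}\widetilde M_k(\Gamma)$ is the graded ring of these. $M_k(\Gamma;\{i\})$ is the space of meromorphic modular forms of weight $k$ over $\Gamma$ without poles outside the $\Gamma$-orbit of $i$. $\phi\in\widetilde M_2(\Gamma;\{i\})$ with $\delta(\phi)=1$ means: $\phi$ is meromorphic on $\mathcal H$ with all poles in the $\Gamma$-orbit of $i$ and $\phi(\frac{az+b}{cz+d})=(cz+d)^2\phi(z)+c(cz+d)$ for all $\begin{pmatrix}a&b\\c&d\end{pmatrix}\in\Gamma$. Then $\omega\in M_4(\Gamma;\{i\})$. $D_\phi:M_k(\Gamma;\{i\})\to M_{k+2}(\Gamma;\{i\})$ is $D_\phi(f)=f'-k\phi f$, extended additively. *)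

theory Defs
  imports
    "HOL-Analysis.Analysis"
    "HOL-Complex_Analysis.Complex_Analysis"
    "HOL-Computational_Algebra.Polynomial"
    "HOL-Algebra.Coset"
begin

section \<open>Discrete cocompact subgroups of PSL(2,R)\<close>

definition quotient_topology :: "'a topology \<Rightarrow> ('a \<Rightarrow> 'b) \<Rightarrow> 'b topology" where
  "quotient_topology X q =
     topology (\<lambda>U. U \<subseteq> q ` topspace X \<and> openin X {x \<in> topspace X. q x \<in> U})"

lemma openin_quotient_topology:
  "openin (quotient_topology X q) U \<longleftrightarrow>
     U \<subseteq> q ` topspace X \<and> openin X {x \<in> topspace X. q x \<in> U}"
proof -
  have "istopology (\<lambda>U. U \<subseteq> q ` topspace X \<and> openin X {x \<in> topspace X. q x \<in> U})"
    unfolding istopology_def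
  proof (intro conjI allI impI; (elim conjE)?)
    fix S T
    assume "openin X {x \<in> topspace X. q x \<in> S}" "openin X {x \<in> topspace X. q x \<in> T}"
    moreover have "{x \<in> topspace X. q x \<in> S \<inter> T} =
      {x \<in> topspace X. q x \<in> S} \<inter> {x \<in> topspace X. q x \<in> T}" by auto
    ultimately show "openin X {x \<in> topspace X. q x \<in> S \<inter> T}" by auto
  next
    fix K
    assume *: "\<forall>U\<in>K. U \<subseteq> q ` topspace X \<and> openin X {x \<in> topspace X. q x \<in> U}"
    have "{x \<in> topspace X. q x \<in> \<Union>K} = (\<Union>U\<in>K. {x \<in> topspace X. q x \<in> U})" by auto
    with * show "openin X {x \<in> topspace X. q x \<in> \<Union>K}" by auto
  qed auto
  then show ?thesis
    by (simp add: quotient_topology_def topology_inverse')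
qed

lemma quotient_map_quotient_topology: "quotient_map X (quotient_topology X q) q"
proof -
  have "topspace (quotient_topology X q) = q ` topspace X"
  proof
    show "topspace (quotient_topology X q) \<subseteq> q ` topspace X"
      using openin_quotient_topology[of X q "topspace (quotient_topology X q)"] by simp
    have "{x \<in> topspace X. q x \<in> q ` topspace X} = topspace X" by auto
    then have "openin (quotient_topology X q) (q ` topspace X)"
      by (simp add: openin_quotient_topology)
    then show "q ` topspace X \<subseteq> topspace (quotient_topology X q)"
      by (rule openin_subset)
  qed
  then show ?thesis
    by (auto simp: quotient_map_def openin_quotient_topology)
qed

definition SL2R :: "(real^2^2) monoid" where
  "SL2R = \<lparr>carrier = {A. det A = 1}, monoid.mult = (**), one = mat 1\<rparr>"

definition PSL2R :: "(real^2^2) set monoid" where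
  "PSL2R = SL2R Mod {mat 1, - mat 1}"

lemma group_SL2R: "group SL2R"
proof (rule groupI)
  fix A assume "A \<in> carrier SL2R"
  then have A: "det A = 1" by (simp add: SL2R_def)
  then have "invertible A" by (simp add: invertible_det_nz)
  then obtain B where B: "B ** A = mat 1" unfolding invertible_def by blast
  then have "det B * det A = 1" by (metis det_mul det_I)
  with A B show "\<exists>B\<in>carrier SL2R. B \<otimes>\<^bsub>SL2R\<^esub> A = \<one>\<^bsub>SL2R\<^esub>"
    by (auto simp: SL2R_def)
qed (auto simp: SL2R_def det_mul matrix_mul_assoc)

lemma group_PSL2R: "group PSL2R"
proof -
  interpret group SL2R by (rule group_SL2R)
  have m: "A ** (- mat 1) = - A" "(- mat 1) ** A = - A" for A :: "real^2^2"
    by (simp_all add: vec_eq_iff matrix_matrix_mult_def mat_def sum_2 forall_2)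
  have d: "det (- mat 1 :: real^2^2) = 1"
    by (simp add: det_2 mat_def)
  have c: "{mat 1, - mat 1} \<subseteq> carrier SL2R"
    using d by (auto simp: SL2R_def)
  have "subgroup {mat 1, - mat 1} SL2R"
  proof (rule subgroupI)
    fix A assume A: "A \<in> {mat 1, - mat 1 :: real^2^2}"
    then have "A \<otimes>\<^bsub>SL2R\<^esub> A = \<one>\<^bsub>SL2R\<^esub>" by (auto simp: SL2R_def m)
    then have "inv\<^bsub>SL2R\<^esub> A = A" using A c by (intro inv_equality) auto
    then show "inv\<^bsub>SL2R\<^esub> A \<in> {mat 1, - mat 1}" using A by simp
  next
    fix A B :: "real^2^2"
    assume "A \<in> {mat 1, - mat 1}" "B \<in> {mat 1, - mat 1}"
    then show "A \<otimes>\<^bsub>SL2R\<^esub> B \<in> {mat 1, - mat 1}" by (auto simp: SL2R_def m)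
  qed (use c in auto)
  then have "{mat 1, - mat 1} \<lhd> SL2R"
    unfolding normal_def normal_axioms_def
    by (auto simp: r_coset_def l_coset_def SL2R_def m group_SL2R[unfolded SL2R_def])
  then show ?thesis
    unfolding PSL2R_def by (rule normal.factorgroup_is_group)
qed

definition PSL2R_topology :: "(real^2^2) set topology" where
  "PSL2R_topology =
     quotient_topology (top_of_set (carrier SL2R)) (\<lambda>A. {mat 1, - mat 1} #>\<^bsub>SL2R\<^esub> A)"

definition discrete_subgroup :: "(real^2^2) set set \<Rightarrow> bool" where
  "discrete_subgroup \<Gamma> \<longleftrightarrow>
     subgroup \<Gamma> PSL2R \<and> subtopology PSL2R_topology \<Gamma> = discrete_topology \<Gamma>"

text \<open>Compactness of the space of cosets \<open>\<Gamma> g\<close>, \<open>g \<in> PSL(2,R)\<close>.\<close>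

definition cocompact :: "(real^2^2) set set \<Rightarrow> bool" where
  "cocompact \<Gamma> \<longleftrightarrow>
     compact_space (quotient_topology PSL2R_topology (\<lambda>g. \<Gamma> #>\<^bsub>PSL2R\<^esub> g))"

text \<open>
  An element of \<open>PSL(2,R)\<close> is a set \<open>{A, -A}\<close> of matrices, so that \<open>\<Union>\<Gamma>\<close> is the set of all
  matrices representing elements of \<open>\<Gamma>\<close>.
\<close>

definition automorphy :: "real^2^2 \<Rightarrow> complex \<Rightarrow> complex" where
  "automorphy A z = of_real (A$2$1) * z + of_real (A$2$2)"

definition moebius :: "real^2^2 \<Rightarrow> complex \<Rightarrow> complex" where
  "moebius A z = (of_real (A$1$1) * z + of_real (A$1$2)) / automorphy A z"

definition orbit_of :: "(real^2^2) set set \<Rightarrow> complex \<Rightarrow> complex set" where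
  "orbit_of \<Gamma> w = {moebius A w | A. A \<in> \<Union>\<Gamma>}"


section \<open>Meromorphic functions on the upper half plane\<close>

definition uhp :: "complex set" where
  "uhp = {z. Im z > 0}"

lemma open_uhp: "open uhp"
  unfolding uhp_def by (rule open_halfspace_Im_gt)

text \<open>
  A meromorphic function on \<open>uhp\<close> is represented by the function that has its removable
  singularities removed and takes the value 0 at its poles and outside \<open>uhp\<close>. With
  these conventions two meromorphic functions are equal iff they agree off their poles, and
  the functions without poles are exactly the holomorphic functions on \<open>uhp\<close>.
\<close>

typedef merofun =
  "{f :: complex \<Rightarrow> complex. f nicely_meromorphic_on uhp \<and> (\<forall>z. z \<notin> uhp \<longrightarrow> f z = 0)}"
  morphisms fun_of Abs_merofun
proof
  have "(\<lambda>_. 0) nicely_meromorphic_on uhp" by auto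
  then show "(\<lambda>_. 0) \<in> {f :: complex \<Rightarrow> complex.
    f nicely_meromorphic_on uhp \<and> (\<forall>z. z \<notin> uhp \<longrightarrow> f z = 0)}" by simp
qed

setup_lifting type_definition_merofun

definition normalise :: "(complex \<Rightarrow> complex) \<Rightarrow> complex \<Rightarrow> complex" where
  "normalise f z = (if z \<in> uhp then remove_sings f z else 0)"

lemma eventually_in_uhp: "z \<in> uhp \<Longrightarrow> eventually (\<lambda>w. w \<in> uhp) (at z)"
  using open_uhp by (simp add: eventually_at_in_open')

lemma normalise_nicely_meromorphic:
  assumes "f meromorphic_on uhp"
  shows "normalise f nicely_meromorphic_on uhp"
proof -
  have n: "remove_sings f nicely_meromorphic_on uhp"
    using assms by (rule remove_sings_nicely_meromorphic)
  have ev: "eventually (\<lambda>w. normalise f w = remove_sings f w) (at z)" if "z \<in> uhp" for z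
    using eventually_in_uhp[OF that] by eventually_elim (simp add: normalise_def)
  have "normalise f meromorphic_on uhp \<longleftrightarrow> remove_sings f meromorphic_on uhp"
    using ev by (intro meromorphic_on_cong) auto
  moreover have "is_pole (normalise f) z \<longleftrightarrow> is_pole (remove_sings f) z" if "z \<in> uhp" for z
    using ev[OF that] by (intro is_pole_cong) auto
  moreover have "normalise f \<midarrow>z\<rightarrow> c \<longleftrightarrow> remove_sings f \<midarrow>z\<rightarrow> c" if "z \<in> uhp" for z c
    using ev[OF that] by (intro filterlim_cong) auto
  ultimately show ?thesis
    using n by (auto simp: nicely_meromorphic_on_def normalise_def)
qed

lemma normalise_mem:
  assumes "f meromorphic_on uhp"
  shows "normalise f nicely_meromorphic_on uhp \<and> (\<forall>z. z \<notin> uhp \<longrightarrow> normalise f z = 0)"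
  using normalise_nicely_meromorphic[OF assms] by (simp add: normalise_def)

lemma nicely_meromorphic_imp_meromorphic: "f nicely_meromorphic_on A \<Longrightarrow> f meromorphic_on A"
  by (simp add: nicely_meromorphic_on_def)

lemma eventually_normalise:
  assumes "f meromorphic_on uhp" "z \<in> uhp"
  shows "eventually (\<lambda>w. normalise f w = f w) (at z)"
proof -
  have "isolated_singularity_at f z"
    using assms by (intro meromorphic_on_isolated_singularity) (auto intro: meromorphic_on_subset)
  from eventually_remove_sings_eq_at[OF this] eventually_in_uhp[OF assms(2)]
  show ?thesis by eventually_elim (simp add: normalise_def)
qed

lemma normalise_cong:
  assumes "\<And>z. z \<in> uhp \<Longrightarrow> eventually (\<lambda>w. f w = g w) (at z)"
  shows "normalise f = normalise g"
  using assms by (auto simp: normalise_def fun_eq_iff intro!: remove_sings_cong)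

lemma normalise_eqI:
  assumes "g nicely_meromorphic_on uhp" "\<forall>z. z \<notin> uhp \<longrightarrow> g z = 0"
    and "\<And>z. z \<in> uhp \<Longrightarrow> eventually (\<lambda>w. f w = g w) (at z)"
  shows "normalise f = g"
proof -
  have "normalise f = normalise g"
    using assms(3) by (rule normalise_cong)
  also have "\<dots> = g"
  proof
    fix z
    show "normalise g z = g z"
      using assms(1,2) by (auto simp: normalise_def nicely_meromorphic_on_def)
  qed
  finally show ?thesis .
qed

instantiation merofun :: comm_ring_1
begin

lift_definition zero_merofun :: merofun is "\<lambda>_. 0"
  by auto

lift_definition one_merofun :: merofun is "normalise (\<lambda>_. 1)"
  by (intro normalise_mem meromorphic_intros)

lift_definition plus_merofun :: "merofun \<Rightarrow> merofun \<Rightarrow> merofun"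
  is "\<lambda>f g. normalise (\<lambda>z. f z + g z)"
  by (intro normalise_mem meromorphic_intros) (auto intro: nicely_meromorphic_imp_meromorphic)

lift_definition uminus_merofun :: "merofun \<Rightarrow> merofun"
  is "\<lambda>f. normalise (\<lambda>z. - f z)"
  by (intro normalise_mem meromorphic_intros) (auto intro: nicely_meromorphic_imp_meromorphic)

lift_definition minus_merofun :: "merofun \<Rightarrow> merofun \<Rightarrow> merofun"
  is "\<lambda>f g. normalise (\<lambda>z. f z - g z)"
  by (intro normalise_mem meromorphic_intros) (auto intro: nicely_meromorphic_imp_meromorphic)

lift_definition times_merofun :: "merofun \<Rightarrow> merofun \<Rightarrow> merofun"
  is "\<lambda>f g. normalise (\<lambda>z. f z * g z)"
  by (intro normalise_mem meromorphic_intros) (auto intro: nicely_meromorphic_imp_meromorphic)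

lemma meromorphic_fun_of [meromorphic_intros]: "fun_of f meromorphic_on uhp"
  using fun_of[of f] by (simp add: nicely_meromorphic_on_def)

lemma merofun_eqI:
  assumes "\<And>z. z \<in> uhp \<Longrightarrow> eventually (\<lambda>w. fun_of f w = fun_of g w) (at z)"
  shows "f = g"
proof -
  have "normalise (fun_of f) = fun_of g"
    using fun_of[of g] assms by (intro normalise_eqI) auto
  moreover have "normalise (fun_of f) = fun_of f"
    using fun_of[of f] by (intro normalise_eqI) auto
  ultimately show ?thesis by (simp add: fun_of_inject)
qed

lemma eventually_fun_of:
  assumes "z \<in> uhp"
  shows "eventually (\<lambda>w. fun_of 1 w = 1) (at z)"
    and "eventually (\<lambda>w. fun_of (f + g) w = fun_of f w + fun_of g w) (at z)"
    and "eventually (\<lambda>w. fun_of (f - g) w = fun_of f w - fun_of g w) (at z)"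
    and "eventually (\<lambda>w. fun_of (- f) w = - fun_of f w) (at z)"
    and "eventually (\<lambda>w. fun_of (f * g) w = fun_of f w * fun_of g w) (at z)"
  unfolding plus_merofun.rep_eq minus_merofun.rep_eq uminus_merofun.rep_eq
    times_merofun.rep_eq one_merofun.rep_eq
  by (intro eventually_normalise assms meromorphic_intros)+

instance
proof
  fix f g h :: merofun
  show "f + g + h = f + (g + h)"
  proof (rule merofun_eqI)
    fix z assume z: "z \<in> uhp"
    show "eventually (\<lambda>w. fun_of (f + g + h) w = fun_of (f + (g + h)) w) (at z)"
      using eventually_fun_of(2)[OF z, of "f + g" h] eventually_fun_of(2)[OF z, of f g]
        eventually_fun_of(2)[OF z, of f "g + h"] eventually_fun_of(2)[OF z, of g h]
      by eventually_elim simp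
  qed
  show "f + g = g + f"
    by (transfer) (simp add: add.commute)
  show "0 + f = f"
    by transfer (auto intro!: normalise_eqI)
  show "- f + f = 0"
  proof (rule merofun_eqI)
    fix z assume z: "z \<in> uhp"
    show "eventually (\<lambda>w. fun_of (- f + f) w = fun_of 0 w) (at z)"
      using eventually_fun_of(2)[OF z, of "- f" f] eventually_fun_of(4)[OF z, of f]
      by eventually_elim (simp add: zero_merofun.rep_eq)
  qed
  show "f - g = f + - g"
  proof (rule merofun_eqI)
    fix z assume z: "z \<in> uhp"
    show "eventually (\<lambda>w. fun_of (f - g) w = fun_of (f + - g) w) (at z)"
      using eventually_fun_of(3)[OF z, of f g] eventually_fun_of(2)[OF z, of f "- g"]
        eventually_fun_of(4)[OF z, of g]
      by eventually_elim simp
  qed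
  show "f * g * h = f * (g * h)"
  proof (rule merofun_eqI)
    fix z assume z: "z \<in> uhp"
    show "eventually (\<lambda>w. fun_of (f * g * h) w = fun_of (f * (g * h)) w) (at z)"
      using eventually_fun_of(5)[OF z, of "f * g" h] eventually_fun_of(5)[OF z, of f g]
        eventually_fun_of(5)[OF z, of f "g * h"] eventually_fun_of(5)[OF z, of g h]
      by eventually_elim simp
  qed
  show "f * g = g * f"
    by transfer (simp add: mult.commute)
  show "1 * f = f"
  proof (rule merofun_eqI)
    fix z assume z: "z \<in> uhp"
    show "eventually (\<lambda>w. fun_of (1 * f) w = fun_of f w) (at z)"
      using eventually_fun_of(5)[OF z, of 1 f] eventually_fun_of(1)[OF z]
      by eventually_elim simp
  qed
  show "(f + g) * h = f * h + g * h"
  proof (rule merofun_eqI)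
    fix z assume z: "z \<in> uhp"
    show "eventually (\<lambda>w. fun_of ((f + g) * h) w = fun_of (f * h + g * h) w) (at z)"
      using eventually_fun_of(5)[OF z, of "f + g" h] eventually_fun_of(2)[OF z, of f g]
        eventually_fun_of(2)[OF z, of "f * h" "g * h"] eventually_fun_of(5)[OF z, of f h]
        eventually_fun_of(5)[OF z, of g h]
      by eventually_elim (simp add: distrib_right)
  qed
  show "(0::merofun) \<noteq> 1"
  proof
    assume "(0::merofun) = 1"
    then have "fun_of 0 \<i> = fun_of 1 \<i>" by simp
    then show False
      by (simp add: zero_merofun.rep_eq one_merofun.rep_eq normalise_def uhp_def)
  qed
qed

end

lift_definition mero_const :: "complex \<Rightarrow> merofun" is "\<lambda>c. normalise (\<lambda>_. c)"
  by (intro normalise_mem meromorphic_intros)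

lift_definition mero_deriv :: "merofun \<Rightarrow> merofun" is "\<lambda>f. normalise (deriv f)"
  by (intro normalise_mem meromorphic_intros) (auto intro: nicely_meromorphic_imp_meromorphic)


section \<open>Modular and quasimodular forms\<close>

definition modular_forms :: "(real^2^2) set set \<Rightarrow> nat \<Rightarrow> merofun set" where
  "modular_forms \<Gamma> k = {f. fun_of f holomorphic_on uhp \<and>
     (\<forall>A\<in>\<Union>\<Gamma>. \<forall>z\<in>uhp. fun_of f (moebius A z) = automorphy A z ^ k * fun_of f z)}"

definition moderate_growth :: "(complex \<Rightarrow> complex) \<Rightarrow> bool" where
  "moderate_growth f \<longleftrightarrow>
     (\<exists>(N::nat) C. \<forall>z\<in>uhp. norm (f z) \<le> C * ((1 + (norm z)\<^sup>2) / Im z) ^ N)"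

definition quasimodular_forms :: "(real^2^2) set set \<Rightarrow> nat \<Rightarrow> merofun set" where
  "quasimodular_forms \<Gamma> k = {f. fun_of f holomorphic_on uhp \<and> moderate_growth (fun_of f) \<and>
     (\<exists>(p::nat) (fs :: nat \<Rightarrow> complex \<Rightarrow> complex). \<forall>A\<in>\<Union>\<Gamma>. \<forall>z\<in>uhp.
        fun_of f (moebius A z) / automorphy A z ^ k =
        (\<Sum>j\<le>p. fs j z * (of_real (A$2$1) / automorphy A z) ^ j))}"

text \<open>
  In the meromorphic version the transformation law is an identity of meromorphic functions of
  \<open>z\<close>, that is, it holds outside a discrete closed subset of \<open>uhp\<close>.
\<close>

definition mero_quasimodular_forms :: "(real^2^2) set set \<Rightarrow> nat \<Rightarrow> merofun set" where
  "mero_quasimodular_forms \<Gamma> k = {f.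
     \<exists>(p::nat) (fs :: nat \<Rightarrow> merofun). \<forall>A\<in>\<Union>\<Gamma>. eventually (\<lambda>z.
        fun_of f (moebius A z) / automorphy A z ^ k =
        (\<Sum>j\<le>p. fun_of (fs j) z * (of_real (A$2$1) / automorphy A z) ^ j)) (cosparse uhp)}"

text \<open>The \<open>\<phi>\<close> of weight 2 with poles only in the orbit of \<open>\<i>\<close> and \<open>\<delta>(\<phi>) = 1\<close>.\<close>

definition delta_one_forms :: "(real^2^2) set set \<Rightarrow> merofun set" where
  "delta_one_forms \<Gamma> = {\<phi>.
     (\<forall>z\<in>uhp. is_pole (fun_of \<phi>) z \<longrightarrow> z \<in> orbit_of \<Gamma> \<i>) \<and>
     (\<forall>A\<in>\<Union>\<Gamma>. \<forall>z\<in>uhp - orbit_of \<Gamma> \<i>. fun_of \<phi> (moebius A z) =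
        automorphy A z ^ 2 * fun_of \<phi> z + of_real (A$2$1) * automorphy A z)}"


section \<open>Graded rings\<close>

text \<open>
  An element of a direct sum over the weights \<open>k\<close> of spaces \<open>M k\<close> of meromorphic functions is
  represented by the polynomial whose \<open>k\<close>-th coefficient is the component of weight \<open>k\<close>; the
  product of polynomials is then the product of the graded ring, and the homogeneous elements
  of weight \<open>k\<close> are the polynomials \<open>monom f k\<close>.
\<close>

definition graded_sum :: "(nat \<Rightarrow> merofun set) \<Rightarrow> merofun poly set" where
  "graded_sum M = {F. \<forall>k. coeff F k \<in> M k}"

definition modular_ring :: "(real^2^2) set set \<Rightarrow> merofun poly set" where
  "modular_ring \<Gamma> = graded_sum (modular_forms \<Gamma>)"

definition quasimodular_ring :: "(real^2^2) set set \<Rightarrow> merofun poly set" where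
  "quasimodular_ring \<Gamma> = graded_sum (quasimodular_forms \<Gamma>)"

definition mero_quasimodular_ring :: "(real^2^2) set set \<Rightarrow> merofun poly set" where
  "mero_quasimodular_ring \<Gamma> = graded_sum (mero_quasimodular_forms \<Gamma>)"

definition positive_ideal :: "(real^2^2) set set \<Rightarrow> merofun poly set" where
  "positive_ideal \<Gamma> = {F \<in> modular_ring \<Gamma>. coeff F 0 = 0}"

definition ideal_square :: "merofun poly set \<Rightarrow> merofun poly set" where
  "ideal_square J =
     {\<Sum>i<n. G i * H i | (n::nat) G H. \<forall>i<n. G i \<in> J \<and> H i \<in> J}"

text \<open>
  \<open>f 1, \<dots>, f d\<close> are homogeneous elements of \<open>I\<close> whose classes form a basis of the complex
  vector space \<open>I/I\<^sup>2\<close>.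
\<close>

definition homogeneous_basis_mod_square ::
  "(real^2^2) set set \<Rightarrow> nat \<Rightarrow> (nat \<Rightarrow> merofun poly) \<Rightarrow> bool" where
  "homogeneous_basis_mod_square \<Gamma> d f \<longleftrightarrow>
     (\<forall>m\<in>{1..d}. f m \<in> positive_ideal \<Gamma> \<and> (\<exists>g k. f m = monom g k)) \<and>
     (\<forall>c :: nat \<Rightarrow> complex.
        (\<Sum>m=1..d. smult (mero_const (c m)) (f m)) \<in> ideal_square (positive_ideal \<Gamma>) \<longrightarrow>
        (\<forall>m\<in>{1..d}. c m = 0)) \<and>
     (\<forall>F\<in>positive_ideal \<Gamma>. \<exists>c :: nat \<Rightarrow> complex.
        F - (\<Sum>m=1..d. smult (mero_const (c m)) (f m)) \<in> ideal_square (positive_ideal \<Gamma>))"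

inductive_set generated_algebra :: "merofun poly set \<Rightarrow> merofun poly set"
  for S :: "merofun poly set" where
  const: "[:mero_const c:] \<in> generated_algebra S"
| gen: "F \<in> S \<Longrightarrow> F \<in> generated_algebra S"
| add: "F \<in> generated_algebra S \<Longrightarrow> G \<in> generated_algebra S \<Longrightarrow> F + G \<in> generated_algebra S"
| mult: "F \<in> generated_algebra S \<Longrightarrow> G \<in> generated_algebra S \<Longrightarrow> F * G \<in> generated_algebra S"

definition finitely_generated :: "merofun poly set \<Rightarrow> bool" where
  "finitely_generated R \<longleftrightarrow> (\<exists>S. finite S \<and> R = generated_algebra S)"

definition closed_under :: "(merofun poly \<Rightarrow> merofun poly) \<Rightarrow> merofun poly set \<Rightarrow> bool" where
  "closed_under T R \<longleftrightarrow> (\<forall>F\<in>R. T F \<in> R)"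

text \<open>
  The derivation \<open>d/dz\<close> and the operator \<open>f \<mapsto> f' - k \<phi> f\<close> (on weight \<open>k\<close>), extended additively.
  Both raise the weight by 2.
\<close>

definition D_graded :: "merofun poly \<Rightarrow> merofun poly" where
  "D_graded F = (\<Sum>k\<le>degree F. monom (mero_deriv (coeff F k)) (k + 2))"

definition D_phi :: "merofun \<Rightarrow> merofun poly \<Rightarrow> merofun poly" where
  "D_phi \<phi> F =
     (\<Sum>k\<le>degree F. monom (mero_deriv (coeff F k) - of_nat k * \<phi> * coeff F k) (k + 2))"

definition omega :: "merofun \<Rightarrow> merofun poly" where
  "omega \<phi> = monom (mero_deriv \<phi> - \<phi>\<^sup>2) 4"

definition R_ring :: "merofun \<Rightarrow> nat \<Rightarrow> (nat \<Rightarrow> merofun poly) \<Rightarrow> nat \<Rightarrow> merofun poly set" where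
  "R_ring \<phi> d f N = generated_algebra
     ({(D_phi \<phi> ^^ j) (f m) | j m. j \<le> N \<and> m \<in> {1..d}} \<union>
      {(D_phi \<phi> ^^ l) (omega \<phi>) | l. l \<le> N})"

text \<open>The ring \<open>R[\<phi>]\<close>.\<close>

definition adjoin_phi :: "merofun poly set \<Rightarrow> merofun \<Rightarrow> merofun poly set" where
  "adjoin_phi R \<phi> = generated_algebra (R \<union> {monom \<phi> 2})"

end

theory Submission
  imports Defs
begin

text \<open>
  As \<open>D f = D\<^sub>\<phi> f + k \<phi> f\<close> in weight \<open>k\<close> and \<open>D \<phi> = \<omega> + \<phi>\<^sup>2\<close>, the ring \<open>R[\<phi>]\<close> is closed under \<open>D\<close> as soon
  as \<open>R\<close> is closed under \<open>D\<^sub>\<phi>\<close>.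

  If \<open>\<phi>\<close> has a pole of order \<open>m\<close> at \<open>\<i>\<close>, then every element of weight \<open>k\<close> of the ring generated by all
  \<open>D\<^sub>\<phi>\<close>-derivatives of the \<open>f\<^sub>j\<close> and of \<open>\<omega>\<close> has a pole of order at most \<open>m k / 2\<close>. The form \<open>\<omega>\<close> attains this
  bound, and some holomorphic form does not vanish at \<open>\<i>\<close>. By Dickson's lemma the pairs (weight, pole order)
  are covered by the translates, under the pairs of these two forms, of finitely many of them, so a
  finite part of the ring allows one to subtract leading terms until a holomorphic modular form is left.

  The top coefficient of a quasimodular form of weight \<open>k\<close> and depth \<open>p\<close> is a modular form \<open>g\<close> of weight
  \<open>k - 2 p\<close>. If \<open>k > 2 p\<close>, then subtracting a multiple of \<open>D\<^sup>p g\<close> reduces the depth. The case \<open>k = 2 p > 0\<close> would give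
  a holomorphic form with \<open>\<delta> = 1\<close>, but the residue theorem on the quotient, applied to
  \<open>F' / F - k \<phi>\<close> for a modular form \<open>F\<close> with \<open>F(\<i>) \<noteq> 0\<close>, shows that \<open>\<phi>\<close> has a positive residue at \<open>\<i>\<close>.

  Poincare series provide modular forms \<open>f\<^sub>j\<close> of weights \<open>k\<^sub>j > 0\<close> and forms \<open>h\<^sub>j\<close> of weights \<open>- k\<^sub>j\<close> with poles only
  in the orbit of \<open>\<i>\<close> such that the sum of the \<open>f\<^sub>j h\<^sub>j\<close> is 1; then \<open>\<phi>\<close> can be taken to be the sum of the \<open>h\<^sub>j f\<^sub>j' / k\<^sub>j\<close>.
\<close>

section \<open>The field of meromorphic functions on the upper half plane\<close>

text \<open>No Riemann surface structure is put on the compact quotient; three elementary devices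
  take the place of its theory. Poincare series supply, in one weight, poles of arbitrary order.
  Divisibility by a given form costs a number of linear conditions independent of weight and pole
  order, so some combination of these series is divisible by any prescribed form, which produces
  forms of negative weight. A pencil of two forms without common zero generates everything of large
  weight or pole order; this gives both the finiteness of \<open>I/I^2\<close> and, in weight 0,
  comaximality of functions without common zeros. The residue theorem comes from Liouville's theorem
  in an auxiliary parameter. The delicate case of the pole bound is a simple pole of \<phi>: then
  the derivative and the square of \<phi> have the same pole order, and only the sign of the residue
  keeps their leading terms from cancelling in \<omega>. The coefficient functions of a quasimodular
  form are arbitrary functions at the outset. Their holomorphy and their transformation law rest on
  there being infinitely many functions \<open>c / (c z + d)\<close>.\<close>

lemma connected_uhp: "connected uhp"
  unfolding uhp_def by (intro convex_connected convex_halfspace_Im_gt)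

lemma eventually_fun_of_const:
  "z \<in> uhp \<Longrightarrow> eventually (\<lambda>w. fun_of (mero_const c) w = c) (at z)"
  unfolding mero_const.rep_eq by (intro eventually_normalise meromorphic_intros)

lemma eventually_fun_of_deriv:
  "z \<in> uhp \<Longrightarrow> eventually (\<lambda>w. fun_of (mero_deriv f) w = deriv (fun_of f) w) (at z)"
  unfolding mero_deriv.rep_eq by (intro eventually_normalise meromorphic_intros)

text \<open>The identity theorem on the connected half plane. It is the analytic fact behind making
  \<open>merofun\<close> a field.\<close>

lemma merofun_nonzero_cosparse:
  assumes "f \<noteq> 0"
  shows "eventually (\<lambda>z. fun_of f z \<noteq> 0) (cosparse uhp)"
proof -
  have "fun_of f nicely_meromorphic_on uhp" using fun_of[of f] by simp
  from nicely_meromorphic_imp_constant_or_avoid[OF this open_uhp connected_uhp, of 0]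
  show ?thesis
  proof
    assume "\<forall>x\<in>uhp. fun_of f x = 0"
    then have "fun_of f = fun_of 0"
      using fun_of[of f] by (auto simp: zero_merofun.rep_eq fun_eq_iff)
    then show ?thesis using assms by (simp add: fun_of_inject)
  qed
qed

lemma merofun_nonzero_at:
  assumes "f \<noteq> 0" "z \<in> uhp"
  shows "eventually (\<lambda>w. fun_of f w \<noteq> 0) (at z)"
  using merofun_nonzero_cosparse[OF assms(1)] assms(2) open_uhp
  by (simp add: eventually_cosparse_open_eq)

instantiation merofun :: field
begin

lift_definition inverse_merofun :: "merofun \<Rightarrow> merofun" is "\<lambda>f. normalise (\<lambda>z. inverse (f z))"
  by (intro normalise_mem meromorphic_intros) (auto intro: nicely_meromorphic_imp_meromorphic)

definition divide_merofun :: "merofun \<Rightarrow> merofun \<Rightarrow> merofun" where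
  "divide_merofun f g = f * inverse g"

lemma eventually_fun_of_inverse:
  "z \<in> uhp \<Longrightarrow> eventually (\<lambda>w. fun_of (inverse f) w = inverse (fun_of f w)) (at z)"
  unfolding inverse_merofun.rep_eq by (intro eventually_normalise meromorphic_intros)

instance
proof
  fix f g :: merofun
  show "inverse f * f = 1" if "f \<noteq> 0"
  proof (rule merofun_eqI)
    fix z assume z: "z \<in> uhp"
    show "eventually (\<lambda>w. fun_of (inverse f * f) w = fun_of 1 w) (at z)"
      using eventually_fun_of(5)[OF z, of "inverse f" f] eventually_fun_of(1)[OF z]
        eventually_fun_of_inverse[OF z, of f] merofun_nonzero_at[OF that z]
      by eventually_elim simp
  qed
  show "f div g = f * inverse g" by (simp add: divide_merofun_def)
  show "inverse (0::merofun) = 0"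
    by (rule merofun_eqI, rule eventually_mono[OF eventually_fun_of_inverse[of _ 0]])
       (simp_all add: zero_merofun.rep_eq)
qed

end

subsection \<open>Germs\<close>

definition germ :: "complex \<Rightarrow> merofun \<Rightarrow> complex fls" where
  "germ z f = laurent_expansion (fun_of f) z"

text \<open>The zero function receives order 0 here, which breaks the usual rule for sums;
  \<open>mord_ge\<close> repairs this.\<close>

definition mord :: "complex \<Rightarrow> merofun \<Rightarrow> int" where
  "mord z f = fls_subdegree (germ z f)"

lemma has_germ:
  "z \<in> uhp \<Longrightarrow> (\<lambda>w. fun_of f (z + w)) has_laurent_expansion germ z f"
  unfolding germ_def using meromorphic_fun_of meromorphic_on_imp_has_laurent_expansion by blast

lemma germ_eqI:
  assumes "eventually (\<lambda>w. fun_of f w = g w) (at z)"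
    and "(\<lambda>w. g (z + w)) has_laurent_expansion G"
  shows "germ z f = G"
  unfolding germ_def using laurent_expansion_cong[OF assms(1) refl] laurent_expansion_eqI[OF assms(2)]
  by simp

lemma germ_add [simp]: "z \<in> uhp \<Longrightarrow> germ z (f + g) = germ z f + germ z g"
  by (rule germ_eqI[OF eventually_fun_of(2)]) (auto intro!: laurent_expansion_intros has_germ)
lemma germ_diff [simp]: "z \<in> uhp \<Longrightarrow> germ z (f - g) = germ z f - germ z g"
  by (rule germ_eqI[OF eventually_fun_of(3)]) (auto intro!: laurent_expansion_intros has_germ)
lemma germ_uminus [simp]: "z \<in> uhp \<Longrightarrow> germ z (- f) = - germ z f"
  by (rule germ_eqI[OF eventually_fun_of(4)]) (auto intro!: laurent_expansion_intros has_germ)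
lemma germ_mult [simp]: "z \<in> uhp \<Longrightarrow> germ z (f * g) = germ z f * germ z g"
  by (rule germ_eqI[OF eventually_fun_of(5)]) (auto intro!: laurent_expansion_intros has_germ)
lemma germ_1 [simp]: "z \<in> uhp \<Longrightarrow> germ z 1 = 1"
  by (rule germ_eqI[OF eventually_fun_of(1)]) auto
lemma germ_0 [simp]: "germ z 0 = 0"
  unfolding germ_def by (rule laurent_expansion_eqI) (simp add: zero_merofun.rep_eq)
lemma germ_const [simp]: "z \<in> uhp \<Longrightarrow> germ z (mero_const c) = fls_const c"
  by (rule germ_eqI[OF eventually_fun_of_const]) auto
lemma germ_inverse [simp]: "z \<in> uhp \<Longrightarrow> germ z (inverse f) = inverse (germ z f)"
  by (rule germ_eqI[OF eventually_fun_of_inverse]) (auto intro!: laurent_expansion_intros has_germ)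
lemma germ_divide [simp]: "z \<in> uhp \<Longrightarrow> germ z (f / g) = germ z f / germ z g"
  by (simp add: divide_inverse)
lemma germ_power [simp]: "z \<in> uhp \<Longrightarrow> germ z (f ^ n) = germ z f ^ n"
  by (induction n) auto
lemma germ_powi [simp]: "z \<in> uhp \<Longrightarrow> germ z (f powi n) = germ z f powi n"
  by (simp add: power_int_def)
lemma germ_sum [simp]: "z \<in> uhp \<Longrightarrow> germ z (sum f A) = (\<Sum>x\<in>A. germ z (f x))"
  by (induction A rule: infinite_finite_induct) auto
lemma germ_deriv [simp]: "z \<in> uhp \<Longrightarrow> germ z (mero_deriv f) = fls_deriv (germ z f)"
proof (rule germ_eqI[OF eventually_fun_of_deriv])
  assume "z \<in> uhp"
  have "deriv (\<lambda>w. fun_of f (z + w)) = (\<lambda>w. deriv (fun_of f) (z + w))"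
    by (rule ext) (simp add: deriv_shift_0' o_def add_ac)
  with has_laurent_expansion_deriv[OF has_germ[OF \<open>z \<in> uhp\<close>, of f]]
  show "(\<lambda>w. deriv (fun_of f) (z + w)) has_laurent_expansion fls_deriv (germ z f)" by simp
qed

lemma germ_eq_0_iff [simp]: "z \<in> uhp \<Longrightarrow> germ z f = 0 \<longleftrightarrow> f = 0"
  using has_laurent_expansion_eventually_nonzero_iff[OF has_germ, of z f] merofun_nonzero_at[of f z]
  by auto

text \<open>By this and the homomorphism rules above, an algebraic or differential identity in
  \<open>merofun\<close> is checked between Laurent series at a single point, usually
  \<open>\<i>\<close>.\<close>

lemma germ_eqD: "z \<in> uhp \<Longrightarrow> germ z f = germ z g \<Longrightarrow> f = g"
  using germ_eq_0_iff[of z "f - g"] by simp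

lemma ii_uhp [simp]: "\<i> \<in> uhp" by (simp add: uhp_def)

lemma is_pole_fun_of_iff: "z \<in> uhp \<Longrightarrow> is_pole (fun_of f) z \<longleftrightarrow> mord z f < 0"
  unfolding mord_def by (rule has_laurent_expansion_imp_is_pole_iff[OF has_germ])

text \<open>The normalisation at poles has a useful converse reading: a nonzero value of
  \<open>fun_of f\<close> at \<open>z\<close> already excludes a pole there.\<close>

lemma fun_of_pole: assumes "z \<in> uhp" "mord z f < 0" shows "fun_of f z = 0"
proof -
  have p: "is_pole (fun_of f) z" using assms is_pole_fun_of_iff by blast
  then have "\<not> fun_of f \<midarrow>z\<rightarrow> fun_of f z"
    unfolding is_pole_def using not_tendsto_and_filterlim_at_infinity[of "at z"] by auto
  then show ?thesis using assms fun_of[of f] p unfolding nicely_meromorphic_on_def by blast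
qed

lemma fun_of_analytic:
  assumes "z \<in> uhp" "mord z f \<ge> 0" shows "fun_of f analytic_on {z}"
proof -
  have "not_essential (fun_of f) z" using meromorphic_fun_of[of f] assms(1)
    by (auto simp: meromorphic_on_altdef)
  then show ?thesis using nicely_meromorphic_on_imp_analytic_at[of "fun_of f" uhp z] assms fun_of[of f]
      is_pole_fun_of_iff[of z f] by auto
qed

lemma fun_of_germ:
  assumes "z \<in> uhp" "mord z f \<ge> 0" shows "fun_of f z = fls_nth (germ z f) 0"
proof -
  have "(\<lambda>w. fun_of f (z + w)) \<midarrow>0\<rightarrow> fls_nth (germ z f) 0"
    using has_laurent_expansion_imp_tendsto_0[OF has_germ] assms unfolding mord_def by auto
  moreover have "fun_of f \<midarrow>z\<rightarrow> fun_of f z"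
    using fun_of_analytic[OF assms] analytic_at_imp_isCont isContD by blast
  then have "(\<lambda>w. fun_of f (z + w)) \<midarrow>0\<rightarrow> fun_of f z"
    by (simp add: LIM_offset_zero_iff)
  ultimately show ?thesis using LIM_unique by blast
qed

lemma holomorphic_iff_mord: "fun_of f holomorphic_on uhp \<longleftrightarrow> (\<forall>z\<in>uhp. mord z f \<ge> 0)"
proof
  assume h: "fun_of f holomorphic_on uhp"
  then have "fun_of f analytic_on uhp" using open_uhp analytic_on_open by blast
  then show "\<forall>z\<in>uhp. mord z f \<ge> 0"
    using is_pole_fun_of_iff[of _ f] analytic_at_imp_no_pole[of "fun_of f"]
    by (auto simp: analytic_on_analytic_at[of _ uhp] not_less[symmetric])
next
  assume "\<forall>z\<in>uhp. mord z f \<ge> 0"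
  then have "fun_of f analytic_on uhp" using fun_of_analytic analytic_on_analytic_at by blast
  then show "fun_of f holomorphic_on uhp" by (rule analytic_imp_holomorphic)
qed

lemma merofun_of_holomorphic:
  assumes "g holomorphic_on uhp"
  obtains f where "\<And>z. z \<in> uhp \<Longrightarrow> fun_of f z = g z" "\<And>z. z \<in> uhp \<Longrightarrow> mord z f \<ge> 0"
proof -
  define h where "h z = (if z \<in> uhp then g z else 0)" for z
  have hol: "h holomorphic_on uhp" using assms by (rule holomorphic_transform) (simp add: h_def)
  then have "h nicely_meromorphic_on uhp"
    using open_uhp analytic_on_open analytic_on_imp_nicely_meromorphic_on by blast
  then have h: "fun_of (Abs_merofun h) = h" by (intro Abs_merofun_inverse) (auto simp: h_def)
  show ?thesis
    using hol holomorphic_iff_mord[of "Abs_merofun h"] by (intro that[of "Abs_merofun h"]) (auto simp: h h_def)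
qed

lemma merofun_of_meromorphic:
  assumes "g meromorphic_on uhp"
  obtains f where "\<And>z. z \<in> uhp \<Longrightarrow> eventually (\<lambda>w. fun_of f w = g w) (at z)"
  using eventually_normalise[OF assms] Abs_merofun_inverse[of "normalise g"] normalise_mem[OF assms]
  by (intro that[of "Abs_merofun (normalise g)"]) auto

lemma merofun_eqI_hol:
  assumes "\<And>z. z \<in> uhp \<Longrightarrow> fun_of f z = fun_of g z" shows "f = g"
proof -
  have "fun_of f = fun_of g" using assms fun_of[of f] fun_of[of g] by fastforce
  then show ?thesis by (simp add: fun_of_inject)
qed

section \<open>Orders of zeros and poles\<close>

lemma mord_mult: "z \<in> uhp \<Longrightarrow> f \<noteq> 0 \<Longrightarrow> g \<noteq> 0 \<Longrightarrow> mord z (f * g) = mord z f + mord z g"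
  by (simp add: mord_def)
lemma mord_inverse [simp]: "z \<in> uhp \<Longrightarrow> mord z (inverse f) = - mord z f"
  by (simp add: mord_def)
lemma mord_divide: "z \<in> uhp \<Longrightarrow> f \<noteq> 0 \<Longrightarrow> g \<noteq> 0 \<Longrightarrow> mord z (f / g) = mord z f - mord z g"
  by (simp add: divide_inverse mord_mult)
lemma mord_power [simp]: "z \<in> uhp \<Longrightarrow> mord z (f ^ n) = int n * mord z f"
  by (simp add: mord_def fls_subdegree_pow)
lemma mord_0 [simp]: "mord z 0 = 0" by (simp add: mord_def)
lemma mord_const [simp]: "z \<in> uhp \<Longrightarrow> mord z (mero_const c) = 0" by (simp add: mord_def)
lemma mord_1 [simp]: "z \<in> uhp \<Longrightarrow> mord z 1 = 0" by (simp add: mord_def)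

text \<open>Formulated through coefficients, so that it holds for the zero function and every
  \<open>n\<close> and is therefore stable under sums.\<close>

definition mord_ge :: "complex \<Rightarrow> merofun \<Rightarrow> int \<Rightarrow> bool" where
  "mord_ge z f n \<longleftrightarrow> (\<forall>k<n. fls_nth (germ z f) k = 0)"

lemma mord_ge_iff: "z \<in> uhp \<Longrightarrow> mord_ge z f n \<longleftrightarrow> f = 0 \<or> mord z f \<ge> n"
  unfolding mord_ge_def mord_def
  by (cases "f = 0") (auto intro: fls_subdegree_geI fls_eq0_below_subdegree)

lemma mord_ge_0_iff: "z \<in> uhp \<Longrightarrow> mord_ge z f 0 \<longleftrightarrow> mord z f \<ge> 0"
  by (auto simp: mord_ge_iff)

lemma mord_ge_add: "z \<in> uhp \<Longrightarrow> mord_ge z f n \<Longrightarrow> mord_ge z g n \<Longrightarrow> mord_ge z (f + g) n"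
  by (simp add: mord_ge_def)
lemma mord_ge_diff: "z \<in> uhp \<Longrightarrow> mord_ge z f n \<Longrightarrow> mord_ge z g n \<Longrightarrow> mord_ge z (f - g) n"
  by (simp add: mord_ge_def)
lemma mord_ge_mult: "z \<in> uhp \<Longrightarrow> mord_ge z f n \<Longrightarrow> mord_ge z g m \<Longrightarrow> mord_ge z (f * g) (n + m)"
  by (cases "f = 0 \<or> g = 0") (auto simp: mord_ge_iff mord_mult)
lemma mord_ge_mono: "mord_ge z f n \<Longrightarrow> m \<le> n \<Longrightarrow> mord_ge z f m"
  by (auto simp: mord_ge_def)
lemma mord_ge_zero [simp]: "mord_ge z 0 n"
  by (simp add: mord_ge_def)
lemma mord_ge_const [simp]: "z \<in> uhp \<Longrightarrow> mord_ge z (mero_const c) 0"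
  by (simp add: mord_ge_iff)
lemma mord_ge_sum: "z \<in> uhp \<Longrightarrow> (\<And>i. i \<in> A \<Longrightarrow> mord_ge z (f i) n) \<Longrightarrow> mord_ge z (sum f A) n"
  by (induction A rule: infinite_finite_induct) (auto intro: mord_ge_add)
lemma mord_ge_deriv: "z \<in> uhp \<Longrightarrow> mord_ge z f n \<Longrightarrow> mord_ge z (mero_deriv f) (n - 1)"
  by (simp add: mord_ge_def)
lemma mord_ge_deriv0: "z \<in> uhp \<Longrightarrow> mord_ge z f 0 \<Longrightarrow> mord_ge z (mero_deriv f) 0"
proof -
  assume "z \<in> uhp" and 0: "mord_ge z f 0"
  \<comment> \<open>A derivative has no term of exponent -1, as the factor \<open>k + 1\<close>
    vanishes there. So, unlike in \<open>mord_ge_deriv\<close>, no order is lost.\<close>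
  have "of_int (k + 1) * fls_nth (germ z f) (k + 1) = 0" if "k < 0" for k
    using 0 that by (cases "k = -1") (auto simp: mord_ge_def)
  then show ?thesis using \<open>z \<in> uhp\<close> by (auto simp: mord_ge_def)
qed

lemma mero_const_add: "mero_const (a + b) = mero_const a + mero_const b"
  by (rule germ_eqD[OF ii_uhp]) (simp add: fls_plus_const)
lemma mero_const_mult: "mero_const (a * b) = mero_const a * mero_const b"
  by (rule germ_eqD[OF ii_uhp]) (simp add: fls_const_mult_const)
lemma mero_const_0 [simp]: "mero_const 0 = 0"
  by (rule germ_eqD[OF ii_uhp]) simp
lemma mero_const_1 [simp]: "mero_const 1 = 1"
  by (rule germ_eqD[OF ii_uhp]) simp
lemma mero_const_uminus: "mero_const (- a) = - mero_const a"
  by (rule germ_eqD[OF ii_uhp]) simp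
lemma mero_const_diff: "mero_const (a - b) = mero_const a - mero_const b"
  using mero_const_add[of "a - b" b] by simp
lemma mero_const_of_nat: "mero_const (of_nat n) = of_nat n"
  by (induction n) (simp_all add: mero_const_add)
lemma mero_const_of_int: "mero_const (of_int n) = of_int n"
  by (cases n rule: int_cases2) (simp_all add: mero_const_of_nat mero_const_uminus)
lemma mero_const_eq_0_iff [simp]: "mero_const c = 0 \<longleftrightarrow> c = 0"
  using germ_eq_0_iff[OF ii_uhp, of "mero_const c"] unfolding germ_const[OF ii_uhp] by simp
lemma mero_const_inverse: "mero_const (inverse a) = inverse (mero_const a)"
proof (cases "a = 0")
  case False
  have "mero_const a * mero_const (inverse a) = 1" using False by (simp flip: mero_const_mult)
  then show ?thesis by (simp add: inverse_unique)
qed simp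
lemma mero_const_inj [simp]: "mero_const a = mero_const b \<longleftrightarrow> a = b"
  using mero_const_eq_0_iff[of "a - b"] unfolding mero_const_diff by simp
lemma mero_const_power: "mero_const (c ^ n) = mero_const c ^ n"
  by (induction n) (auto simp: mero_const_mult)
lemma of_nat_merofun_eq_0 [simp]: "(of_nat n :: merofun) = 0 \<longleftrightarrow> n = 0"
  using mero_const_eq_0_iff[of "of_nat n"] unfolding mero_const_of_nat by simp
lemma germ_of_nat [simp]: "z \<in> uhp \<Longrightarrow> germ z (of_nat n) = of_nat n"
  by (simp flip: mero_const_of_nat add: fls_of_nat)
lemma germ_of_int [simp]: "z \<in> uhp \<Longrightarrow> germ z (of_int n) = of_int n"
  by (simp flip: mero_const_of_int add: fls_of_int)

lemma fun_of_const [simp]: "z \<in> uhp \<Longrightarrow> fun_of (mero_const c) z = c"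
  by (simp add: fun_of_germ)
lemma fun_of_add: "z \<in> uhp \<Longrightarrow> mord z f \<ge> 0 \<Longrightarrow> mord z g \<ge> 0 \<Longrightarrow> fun_of (f + g) z = fun_of f z + fun_of g z"
  using mord_ge_add[of z f 0 g] by (simp add: fun_of_germ mord_ge_0_iff)
lemma fun_of_diff: "z \<in> uhp \<Longrightarrow> mord z f \<ge> 0 \<Longrightarrow> mord z g \<ge> 0 \<Longrightarrow> fun_of (f - g) z = fun_of f z - fun_of g z"
  using mord_ge_diff[of z f 0 g] by (simp add: fun_of_germ mord_ge_0_iff)
lemma fun_of_mult: "z \<in> uhp \<Longrightarrow> mord z f \<ge> 0 \<Longrightarrow> mord z g \<ge> 0 \<Longrightarrow> fun_of (f * g) z = fun_of f z * fun_of g z"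
proof -
  assume a: "z \<in> uhp" "mord z f \<ge> 0" "mord z g \<ge> 0"
  have "mord z (f * g) \<ge> 0" using mord_ge_mult[of z f 0 g 0] a by (simp add: mord_ge_0_iff)
  then have "fun_of (f * g) \<midarrow>z\<rightarrow> fun_of (f * g) z"
    by (intro isContD analytic_at_imp_isCont fun_of_analytic a(1))
  moreover have "(\<lambda>w. fun_of f w * fun_of g w) \<midarrow>z\<rightarrow> fun_of f z * fun_of g z"
    by (intro tendsto_mult isContD analytic_at_imp_isCont fun_of_analytic a)
  then have "fun_of (f * g) \<midarrow>z\<rightarrow> fun_of f z * fun_of g z"
    using tendsto_cong[OF eventually_fun_of(5)[OF a(1)]] by blast
  ultimately show ?thesis using LIM_unique by blast
qed
lemma fun_of_eq_0_iff: "z \<in> uhp \<Longrightarrow> f \<noteq> 0 \<Longrightarrow> mord z f \<ge> 0 \<Longrightarrow> fun_of f z = 0 \<longleftrightarrow> mord z f > 0"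
  using nth_fls_subdegree_zero_iff[of "germ z f"] fls_eq0_below_subdegree[of 0 "germ z f"]
  by (cases "fls_subdegree (germ z f) = 0") (simp_all add: fun_of_germ mord_def)

section \<open>The derivation on meromorphic functions\<close>

lemma mero_deriv_add [simp]: "mero_deriv (f + g) = mero_deriv f + mero_deriv g"
  by (rule germ_eqD[OF ii_uhp]) simp
lemma mero_deriv_diff [simp]: "mero_deriv (f - g) = mero_deriv f - mero_deriv g"
  by (rule germ_eqD[OF ii_uhp]) simp
lemma mero_deriv_uminus [simp]: "mero_deriv (- f) = - mero_deriv f"
  by (rule germ_eqD[OF ii_uhp]) simp
lemma mero_deriv_mult: "mero_deriv (f * g) = f * mero_deriv g + mero_deriv f * g"
  by (rule germ_eqD[OF ii_uhp]) simp
lemma mero_deriv_const [simp]: "mero_deriv (mero_const c) = 0"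
  by (rule germ_eqD[OF ii_uhp]) simp
lemma mero_deriv_0 [simp]: "mero_deriv 0 = 0" using mero_deriv_const[of 0] by simp
lemma mero_deriv_1 [simp]: "mero_deriv 1 = 0" using mero_deriv_const[of 1] by simp
lemma mero_deriv_of_nat [simp]: "mero_deriv (of_nat n) = 0" by (simp flip: mero_const_of_nat)
lemma mero_deriv_power: "mero_deriv (f ^ n) = of_nat n * f ^ (n - 1) * mero_deriv f"
proof (induction n)
  case (Suc n)
  then show ?case by (cases n) (simp_all add: mero_deriv_mult algebra_simps)
qed simp
lemma mero_deriv_inverse: "mero_deriv (inverse f) = - mero_deriv f / f ^ 2"
proof (cases "f = 0")
  case False
  have "mero_deriv (f * inverse f) = 0" using False by simp
  then have "f * mero_deriv (inverse f) = - (mero_deriv f * inverse f)"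
    unfolding mero_deriv_mult by (rule eq_neg_iff_add_eq_0[THEN iffD2])
  then have "mero_deriv (inverse f) = inverse f * - (mero_deriv f * inverse f)"
    using False by (metis left_inverse mult.assoc mult_1)
  then show ?thesis by (simp add: divide_inverse power2_eq_square)
qed simp
lemma mero_deriv_powi: "f \<noteq> 0 \<Longrightarrow> mero_deriv (f powi n) = of_int n * f powi (n - 1) * mero_deriv f"
proof (cases n rule: int_cases2)
  case (nonneg m)
  assume "f \<noteq> 0"
  then show ?thesis using nonneg by (cases m) (simp_all add: mero_deriv_power power_int_def nat_add_distrib del: power_Suc)
next
  case (nonpos m)
  assume f: "f \<noteq> 0"
  have "mero_deriv (inverse (f ^ m)) = - (of_nat m * f ^ (m - 1) * mero_deriv f) / (f ^ m)^2"
    by (simp add: mero_deriv_inverse mero_deriv_power)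
  also have "\<dots> = of_int n * f powi (n - 1) * mero_deriv f"
  proof (cases m)
    case (Suc l)
    have "f powi (n - 1) * f powi (int (m + 1)) = f powi (n - 1 + int (m + 1))"
      using f by (intro power_int_add[symmetric]) auto
    then have "f powi (n - 1) * f ^ (m + 1) = 1" using nonpos unfolding power_int_of_nat by simp
    then have 1: "f powi (n - 1) * (f * f * f ^ l) = 1" using Suc by (simp add: mult_ac)
    have 2: "of_int n = - (of_nat m :: merofun)" using nonpos by simp
    have 3: "f powi (n - 1) = 1 / (f * f * f ^ l)" using 1 f by (simp add: field_simps)
    show ?thesis unfolding 2 3 Suc using f by (simp add: field_simps power2_eq_square)
  qed (use nonpos in simp)
  finally show ?thesis using nonpos by (simp add: power_int_minus power_inverse)
qed

no_notation fps_nth (infixl \<open>$\<close> 75)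

subsection \<open>Composition with Moebius transformations\<close>

text \<open>The chain rule. It is known for power series; multiplying \<open>F\<close> by the power
  \<open>X\<close> that removes its pole gives it for \<open>F * X\<close> and for \<open>X\<close>,
  and the product rule then isolates \<open>F\<close>.\<close>

lemma fls_compose_fps_deriv:
  fixes F :: "complex fls"
  assumes H: "fps_nth H 0 = 0" "H \<noteq> 0"
  shows "fls_deriv (fls_compose_fps F H) = fls_compose_fps (fls_deriv F) H * fls_deriv (fps_to_fls H)"
proof -
  have reg: "fls_deriv (fls_compose_fps (fps_to_fls P) H) =
      fls_compose_fps (fls_deriv (fps_to_fls P)) H * fls_deriv (fps_to_fls H)" for P
    using H by (simp add: fls_deriv_fps_to_fls fps_compose_deriv fls_times_fps_to_fls)
  define m where "m = nat (- fls_subdegree F)"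
  define X where "X = (fps_to_fls (fps_X ^ m) :: complex fls)"
  have "fls_subdegree (F * X) \<ge> 0 \<or> F = 0"
    by (auto simp: X_def m_def fls_subdegree_fls_to_fps)
  then have "fps_to_fls (fls_regpart (F * X)) = F * X"
    by (auto simp: fls_regpart_to_fls_trivial)
  then obtain P where P: "F * X = fps_to_fls P" by metis
  let ?C = "\<lambda>F. fls_compose_fps F H"
  have "fls_deriv (?C F * ?C X) = ?C (fls_deriv (F * X)) * fls_deriv (fps_to_fls H)"
    using reg[of P] P H by (simp flip: fls_compose_fps_mult)
  then have "?C F * fls_deriv (?C X) + fls_deriv (?C F) * ?C X =
      (?C F * ?C (fls_deriv X) + ?C (fls_deriv F) * ?C X) * fls_deriv (fps_to_fls H)"
    using H by (simp add: fls_compose_fps_mult fls_compose_fps_add)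
  moreover have "fls_deriv (?C X) = ?C (fls_deriv X) * fls_deriv (fps_to_fls H)"
    unfolding X_def by (rule reg)
  ultimately have "fls_deriv (?C F) * ?C X = (?C (fls_deriv F) * fls_deriv (fps_to_fls H)) * ?C X"
    by (simp add: algebra_simps)
  moreover have "?C X \<noteq> 0"
    using H by (simp add: fls_compose_fps_eq_0_iff X_def del: fls_compose_fps_to_fls)
  ultimately show ?thesis by simp
qed

text \<open>Invariance of the residue of a differential under a change of local coordinate. Write
  \<open>F\<close> as a derivative plus \<open>c / X\<close>: derivatives have no residue, and the
  residue of \<open>H' / H\<close> is the order of \<open>H\<close>, which is 1.\<close>

lemma fls_residue_compose_fps:
  fixes F :: "complex fls"
  assumes H: "fps_nth H 0 = 0" "fps_nth H 1 \<noteq> 0"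
  shows "fls_residue (fls_compose_fps F H * fls_deriv (fps_to_fls H)) = fls_residue F"
proof -
  have H0: "H \<noteq> 0" using H by auto
  have sH: "subdegree H = 1" using H by (intro subdegreeI) auto
  define c where "c = fls_residue F"
  have "fls_residue (F - fls_const c * fls_X_inv) = 0" by (simp add: c_def)
  then obtain Q where Q: "F - fls_const c * fls_X_inv = fls_deriv Q"
    using fls_residue_nonzero_ex_antiderivative by metis
  have F: "F = fls_deriv Q + fls_const c * inverse fls_X"
    using Q by (simp add: fls_inverse_X diff_eq_eq)
  have "fls_compose_fps F H * fls_deriv (fps_to_fls H) =
      fls_deriv (fls_compose_fps Q H) + fls_const c * (inverse (fps_to_fls H) * fls_deriv (fps_to_fls H))"
    unfolding F using H0 H
    by (simp add: fls_compose_fps_add fls_compose_fps_mult fls_compose_fps_inverse fls_compose_fps_deriv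
        algebra_simps)
  moreover have "fls_residue (inverse (fps_to_fls H) * fls_deriv (fps_to_fls H)) = 1"
    using fls_residue_deriv_times_inverse_eq_subdegree(2)[of "fps_to_fls H"] sH H0
    by (simp add: fls_subdegree_fls_to_fps)
  ultimately show ?thesis
    by (simp only: fls_residue_add fls_residue_deriv fls_residue_fls_const_times) (simp add: c_def)
qed

section \<open>Pullback under fractional linear maps\<close>

lemma det2: "det A = A$1$1 * A$2$2 - A$1$2 * A$2$1" for A :: "real^2^2"
  by (rule det_2)

context
  fixes A :: "real^2^2"
  assumes det: "det A = 1"
begin

lemma automorphy_nz [simp]: "z \<in> uhp \<Longrightarrow> automorphy A z \<noteq> 0"
proof
  assume z: "z \<in> uhp" and "automorphy A z = 0"
  then have "A$2$1 * Im z = 0" "A$2$1 * Re z + A$2$2 = 0"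
    by (auto simp: automorphy_def complex_eq_iff)
  then show False using z det by (auto simp: det2 uhp_def)
qed

lemma Im_moebius:
  assumes "z \<in> uhp" shows "Im (moebius A z) = Im z / (norm (automorphy A z))\<^sup>2"
proof -
  let ?c = "A$2$1" and ?d = "A$2$2" and ?a = "A$1$1" and ?b = "A$1$2"
  have d: "?a * ?d - ?b * ?c = 1" using det by (simp add: det2)
  have n: "(norm (automorphy A z))\<^sup>2 = (?c * Re z + ?d)\<^sup>2 + (?c * Im z)\<^sup>2"
    by (simp add: cmod_power2 automorphy_def)
  have "Im (moebius A z) = ((?a * Im z) * (?c * Re z + ?d) - (?a * Re z + ?b) * (?c * Im z)) /
      (norm (automorphy A z))\<^sup>2"
    unfolding n by (simp add: moebius_def Im_divide automorphy_def)
  also have "(?a * Im z) * (?c * Re z + ?d) - (?a * Re z + ?b) * (?c * Im z) = (?a * ?d - ?b * ?c) * Im z"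
    by (simp add: algebra_simps)
  finally show ?thesis using d by simp
qed

lemma moebius_uhp [simp]: "z \<in> uhp \<Longrightarrow> moebius A z \<in> uhp"
  using Im_moebius[of z] by (simp add: uhp_def)

lemma moebius_has_deriv:
  assumes "z \<in> uhp"
  shows "(moebius A has_field_derivative 1 / (automorphy A z)\<^sup>2) (at z)"
proof -
  have *: "of_real (A$1$1) * automorphy A z - (of_real (A$1$1) * z + of_real (A$1$2)) * of_real (A$2$1) =
     complex_of_real (det A)"
    by (simp add: automorphy_def det2 algebra_simps)
  have "((\<lambda>z. (of_real (A$1$1) * z + of_real (A$1$2)) / automorphy A z) has_field_derivative
     (of_real (A$1$1) * automorphy A z - (of_real (A$1$1) * z + of_real (A$1$2)) * of_real (A$2$1)) /
        (automorphy A z * automorphy A z)) (at z)"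
    unfolding automorphy_def
    by (rule derivative_eq_intros refl | use automorphy_nz[OF assms] in \<open>simp add: automorphy_def\<close>)+
  then show ?thesis
    using * det by (simp add: moebius_def[abs_def] power2_eq_square)
qed

lemma moebius_holomorphic: "moebius A holomorphic_on uhp"
  using moebius_has_deriv open_uhp by (auto simp: holomorphic_on_open)

lemma automorphy_mult:
  assumes "z \<in> uhp"
  shows "automorphy (B ** A) z = automorphy B (moebius A z) * automorphy A z"
proof -
  have "automorphy B (moebius A z) * automorphy A z =
      of_real (B$2$1) * (moebius A z * automorphy A z) + of_real (B$2$2) * automorphy A z"
    by (simp add: automorphy_def[of B] algebra_simps)
  also have "moebius A z * automorphy A z = of_real (A$1$1) * z + of_real (A$1$2)"
    using automorphy_nz[OF assms] by (simp add: moebius_def)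
  finally show ?thesis
    by (simp add: automorphy_def matrix_matrix_mult_def sum_2 algebra_simps)
qed

lemma moebius_mult:
  assumes "z \<in> uhp"
  shows "moebius (B ** A) z = moebius B (moebius A z)"
proof -
  have "(of_real (B$1$1) * moebius A z + of_real (B$1$2)) * automorphy A z =
      of_real (B$1$1) * (moebius A z * automorphy A z) + of_real (B$1$2) * automorphy A z"
    by (simp add: algebra_simps)
  also have "moebius A z * automorphy A z = of_real (A$1$1) * z + of_real (A$1$2)"
    using automorphy_nz[OF assms] by (simp add: moebius_def)
  also have "of_real (B$1$1) * (of_real (A$1$1) * z + of_real (A$1$2)) + of_real (B$1$2) * automorphy A z
     = of_real ((B ** A)$1$1) * z + of_real ((B ** A)$1$2)"
    by (simp add: automorphy_def matrix_matrix_mult_def sum_2 algebra_simps)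
  finally show ?thesis
    using automorphy_nz[OF assms]
    by (simp add: moebius_def[of B] moebius_def[of "B ** A"] automorphy_mult[OF assms] divide_simps)
qed

text \<open>The change of local coordinate made by \<open>moebius A\<close>, with the constant term
  removed so that germs at the image point can be composed with it.\<close>

definition mfps :: "complex \<Rightarrow> complex fps" where
  "mfps z = fps_expansion (\<lambda>w. moebius A (z + w) - moebius A z) 0"

lemma mfps:
  assumes "z \<in> uhp"
  shows "(\<lambda>w. moebius A (z + w) - moebius A z) has_fps_expansion mfps z"
    and mfps_0: "fps_nth (mfps z) 0 = 0" and mfps_1: "fps_nth (mfps z) 1 = 1 / (automorphy A z)\<^sup>2"
proof -
  have an: "moebius A analytic_on {z}"
    using moebius_holomorphic open_uhp assms analytic_on_open analytic_on_analytic_at by blast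
  then have "(moebius A \<circ> (\<lambda>w. z + w)) analytic_on {0}"
    by (intro analytic_on_compose_gen[where T = "{z}"] analytic_intros) auto
  then have "(\<lambda>w. moebius A (z + w) - moebius A z) analytic_on {0}"
    by (auto intro!: analytic_intros simp: o_def)
  then show *: "(\<lambda>w. moebius A (z + w) - moebius A z) has_fps_expansion mfps z"
    unfolding mfps_def by (rule analytic_at_imp_has_fps_expansion_0)
  show "fps_nth (mfps z) 0 = 0"
    using fps_nth_fps_expansion[OF *, of 0] by simp
  have "((\<lambda>w. moebius A (z + w) - moebius A z) has_field_derivative 1 / (automorphy A z)\<^sup>2) (at 0)"
    using DERIV_diff[OF iffD1[OF DERIV_shift[of "moebius A" _ 0 z]] DERIV_const[of "moebius A z"]]
     moebius_has_deriv[OF assms] by (simp add: add.commute)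
  from DERIV_imp_deriv[OF this] show "fps_nth (mfps z) 1 = 1 / (automorphy A z)\<^sup>2"
    using fps_nth_fps_expansion[OF *, of 1] by simp
qed

lemma mfps_nz: "z \<in> uhp \<Longrightarrow> mfps z \<noteq> 0"
  using mfps_1[of z] by auto

lemma subdegree_mfps: "z \<in> uhp \<Longrightarrow> subdegree (mfps z) = 1"
  using mfps_1[of z] mfps_0[of z] by (intro subdegreeI) auto

lemma moebius_meromorphic_compose:
  assumes "f meromorphic_on uhp" shows "(\<lambda>z. f (moebius A z)) meromorphic_on uhp"
  using meromorphic_on_compose[OF assms, of "moebius A" uhp] moebius_holomorphic open_uhp
  by (auto simp: analytic_on_open image_subset_iff)

text \<open>Plain pullback; automorphy factors are kept out so that it is a homomorphism of
  fields.\<close>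

definition mcomp :: "merofun \<Rightarrow> merofun" where
  "mcomp f = Abs_merofun (normalise (\<lambda>z. fun_of f (moebius A z)))"

lemma eventually_mcomp:
  assumes "z \<in> uhp"
  shows "eventually (\<lambda>w. fun_of (mcomp f) w = fun_of f (moebius A w)) (at z)"
proof -
  have m: "(\<lambda>z. fun_of f (moebius A z)) meromorphic_on uhp"
    by (intro moebius_meromorphic_compose meromorphic_fun_of)
  from eventually_normalise[OF this assms] show ?thesis
    unfolding mcomp_def using Abs_merofun_inverse normalise_mem[OF m] by auto
qed

lemma germ_mcomp:
  assumes "z \<in> uhp"
  shows "germ z (mcomp f) = fls_compose_fps (germ (moebius A z) f) (mfps z)"
proof (rule germ_eqI[OF eventually_mcomp[OF assms]])
  have "((\<lambda>w. fun_of f (moebius A z + w)) \<circ> (\<lambda>w. moebius A (z + w) - moebius A z)) has_laurent_expansion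
     fls_compose_fps (germ (moebius A z) f) (mfps z)"
    using assms mfps[OF assms] mfps_nz[OF assms]
    by (intro has_laurent_expansion_compose has_germ has_laurent_expansion_fps) auto
  then show "(\<lambda>w. fun_of f (moebius A (z + w))) has_laurent_expansion
     fls_compose_fps (germ (moebius A z) f) (mfps z)" by (simp add: o_def)
qed

lemma mord_mcomp: "z \<in> uhp \<Longrightarrow> mord z (mcomp f) = mord (moebius A z) f"
  by (simp add: mord_def germ_mcomp subdegree_mfps mfps_0 mfps_nz)

text \<open>This holds at every point of \<open>uhp\<close>, poles included, since both sides are
  normalised to 0 there.\<close>

lemma fun_of_mcomp:
  assumes "z \<in> uhp" shows "fun_of (mcomp f) z = fun_of f (moebius A z)"
proof (cases "mord z (mcomp f) < 0")
  case True
  then show ?thesis using assms by (simp add: fun_of_pole mord_mcomp)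
next
  case False
  have 1: "fun_of (mcomp f) \<midarrow>z\<rightarrow> fun_of (mcomp f) z"
    using False assms by (intro isContD analytic_at_imp_isCont fun_of_analytic) auto
  have "isCont (fun_of f) (moebius A z)"
    using False assms by (intro analytic_at_imp_isCont fun_of_analytic) (auto simp: mord_mcomp)
  moreover have "isCont (moebius A) z"
    using moebius_has_deriv[OF assms] DERIV_isCont by blast
  ultimately have "(\<lambda>w. fun_of f (moebius A w)) \<midarrow>z\<rightarrow> fun_of f (moebius A z)"
    using isCont_o2 isContD by blast
  then have "fun_of (mcomp f) \<midarrow>z\<rightarrow> fun_of f (moebius A z)"
    using tendsto_cong[OF eventually_mcomp[OF assms]] by blast
  with 1 show ?thesis using LIM_unique by blast
qed

lemmas germ_mcomp_simps = germ_mcomp fls_compose_fps_add fls_compose_fps_diff fls_compose_fps_mult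
  fls_compose_fps_inverse mfps_0 mfps_nz

lemma mcomp_add [simp]: "mcomp (f + g) = mcomp f + mcomp g"
  by (rule germ_eqD[OF ii_uhp]) (simp add: germ_mcomp_simps)
lemma mcomp_diff [simp]: "mcomp (f - g) = mcomp f - mcomp g"
  by (rule germ_eqD[OF ii_uhp]) (simp add: germ_mcomp_simps)
lemma mcomp_uminus [simp]: "mcomp (- f) = - mcomp f"
  by (rule germ_eqD[OF ii_uhp]) (simp add: germ_mcomp_simps)
lemma mcomp_mult [simp]: "mcomp (f * g) = mcomp f * mcomp g"
  by (rule germ_eqD[OF ii_uhp]) (simp add: germ_mcomp_simps)
lemma mcomp_inverse [simp]: "mcomp (inverse f) = inverse (mcomp f)"
  by (rule germ_eqD[OF ii_uhp]) (simp add: germ_mcomp_simps)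
lemma mcomp_divide [simp]: "mcomp (f / g) = mcomp f / mcomp g"
  by (simp add: divide_inverse)
lemma mcomp_const [simp]: "mcomp (mero_const c) = mero_const c"
  by (rule germ_eqD[OF ii_uhp]) (simp add: germ_mcomp_simps)
lemma mcomp_0 [simp]: "mcomp 0 = 0"
  using mcomp_const[of 0] by simp
lemma mcomp_1 [simp]: "mcomp 1 = 1"
  using mcomp_const[of 1] by simp
lemma mcomp_power [simp]: "mcomp (f ^ n) = mcomp f ^ n"
  by (induction n) auto
lemma mcomp_powi [simp]: "mcomp (f powi n) = mcomp f powi n"
  by (simp add: power_int_def)
lemma mcomp_sum [simp]: "mcomp (sum f S) = (\<Sum>x\<in>S. mcomp (f x))"
  by (induction S rule: infinite_finite_induct) auto

lemma mcomp_eq_0_iff [simp]: "mcomp f = 0 \<longleftrightarrow> f = 0"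
  using germ_eq_0_iff[OF ii_uhp, of "mcomp f"]
  by (simp add: germ_mcomp fls_compose_fps_eq_0_iff mfps_0 mfps_nz del: germ_eq_0_iff) simp

end

section \<open>Automorphy factors as elements of the field\<close>

definition autofun :: "real^2^2 \<Rightarrow> merofun" where
  "autofun A = (SOME f. \<forall>z\<in>uhp. fun_of f z = automorphy A z)"

lemma fun_of_autofun [simp]: "z \<in> uhp \<Longrightarrow> fun_of (autofun A) z = automorphy A z"
proof -
  have "automorphy A holomorphic_on uhp" unfolding automorphy_def[abs_def] by (intro holomorphic_intros)
  then obtain f where "\<forall>z\<in>uhp. fun_of f z = automorphy A z" using merofun_of_holomorphic by metis
  then have "\<forall>z\<in>uhp. fun_of (autofun A) z = automorphy A z" unfolding autofun_def by (rule someI)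
  then show "z \<in> uhp \<Longrightarrow> ?thesis" by blast
qed

lemma hol_autofun: "fun_of (autofun A) holomorphic_on uhp"
  by (rule holomorphic_transform[of "automorphy A"])
    (auto simp: automorphy_def[abs_def] intro!: holomorphic_intros)

context
  fixes A :: "real^2^2"
  assumes det: "det A = 1"
begin

lemma autofun_nz [simp]: "autofun A \<noteq> 0"
proof
  assume "autofun A = 0"
  then have "automorphy A \<i> = 0" using fun_of_autofun[OF ii_uhp, of A] by (simp add: zero_merofun.rep_eq)
  then show False using automorphy_nz[OF det ii_uhp] by simp
qed

lemma mord_autofun [simp]: "z \<in> uhp \<Longrightarrow> mord z (autofun A) = 0"
  using fun_of_eq_0_iff[of z "autofun A"] hol_autofun[of A] automorphy_nz[OF det, of z]
  by (simp add: holomorphic_iff_mord order_le_less) force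

lemma mord_autofun_powi [simp]: "z \<in> uhp \<Longrightarrow> mord z (autofun A powi k) = 0"
  by (simp add: mord_def power_int_def fls_subdegree_pow flip: mord_def)

lemma fun_of_autofun_powi [simp]: "z \<in> uhp \<Longrightarrow> fun_of (autofun A powi k) z = automorphy A z powi k"
proof -
  assume z: "z \<in> uhp"
  have n: "fun_of (autofun A ^ n) z = automorphy A z ^ n" for n
    using z by (induction n) (auto simp: fun_of_mult fun_of_const[where c = 1, simplified])
  show ?thesis
  proof (cases k rule: int_cases2)
    case (nonneg m) then show ?thesis using n by simp
  next
    case (nonpos m)
    have "fun_of (autofun A ^ m * autofun A powi k) z = 1"
      using nonpos z fun_of_const[OF z, of 1] by (simp add: power_int_minus)
    then have "automorphy A z ^ m * fun_of (autofun A powi k) z = 1"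
      using z by (subst (asm) fun_of_mult) (auto simp: n)
    then show ?thesis using nonpos by (simp add: power_int_minus inverse_unique)
  qed
qed

text \<open>Powers of \<open>autofun A\<close> have no zeros or poles, so the product has exactly
  the poles of \<open>f\<close>; hence the pointwise law is also correct there, by the convention
  for values at poles.\<close>

lemma mcomp_eq_powi_iff:
  "mcomp A f = autofun A powi k * f \<longleftrightarrow>
     (\<forall>z\<in>uhp. fun_of f (moebius A z) = automorphy A z powi k * fun_of f z)"
proof -
  have *: "fun_of (autofun A powi k * f) z = automorphy A z powi k * fun_of f z" if z: "z \<in> uhp" for z
  proof (cases "mord z f < 0")
    case True
    then have "mord z (autofun A powi k * f) < 0" using z by (subst mord_mult) auto
    then show ?thesis using True z by (simp add: fun_of_pole)
  next
    case False
    then show ?thesis using z by (subst fun_of_mult) auto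
  qed
  show ?thesis
    using * merofun_eqI_hol[of "mcomp A f" "autofun A powi k * f"] fun_of_mcomp[OF det, of _ f] by metis
qed

lemma mero_deriv_autofun: "mero_deriv (autofun A) = mero_const (of_real (A$2$1))"
proof (rule merofun_eqI)
  fix z assume z: "z \<in> uhp"
  have d: "deriv (fun_of (autofun A)) w = of_real (A$2$1)" if "w \<in> uhp" for w
  proof -
    have "deriv (fun_of (autofun A)) w = deriv (automorphy A) w"
      using eventually_nhds_in_open[OF open_uhp that]
      by (intro deriv_cong_ev) (auto elim: eventually_mono)
    also have "\<dots> = of_real (A$2$1)"
      unfolding automorphy_def[abs_def] by (rule DERIV_imp_deriv) (auto intro!: derivative_eq_intros)
    finally show ?thesis .
  qed
  show "eventually (\<lambda>w. fun_of (mero_deriv (autofun A)) w =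
      fun_of (mero_const (of_real (A$2$1))) w) (at z)"
    using eventually_fun_of_deriv[OF z, of "autofun A"] eventually_fun_of_const[OF z, of "of_real (A$2$1)"]
      eventually_in_uhp[OF z]
    by eventually_elim (simp add: d)
qed

lemma germ_autofun_mfps:
  assumes "z \<in> uhp"
  shows "fls_deriv (fps_to_fls (mfps A z)) = inverse (germ z (autofun A) ^ 2)"
proof -
  have "(\<lambda>w. inverse (automorphy A (z + w) ^ 2)) has_laurent_expansion inverse (germ z (autofun A) ^ 2)"
  proof -
    have "(\<lambda>w. inverse (fun_of (autofun A) (z + w) ^ 2)) has_laurent_expansion inverse (germ z (autofun A) ^ 2)"
      by (intro laurent_expansion_intros has_germ assms)
    moreover have "eventually (\<lambda>w. fun_of (autofun A) w = automorphy A w) (at z)"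
      using eventually_in_uhp[OF assms] by eventually_elim simp
    then have "eventually (\<lambda>w. inverse (fun_of (autofun A) w ^ 2) = inverse (automorphy A w ^ 2)) (at z)"
      by eventually_elim simp
    ultimately show ?thesis
      using has_laurent_expansion_cong'[of "\<lambda>w. inverse (fun_of (autofun A) w ^ 2)"
        "\<lambda>w. inverse (automorphy A w ^ 2)" z] by blast
  qed
  moreover have "(\<lambda>w. inverse (automorphy A (z + w) ^ 2)) has_laurent_expansion fls_deriv (fps_to_fls (mfps A z))"
  proof (rule has_laurent_expansion_deriv'[OF has_laurent_expansion_fps[OF mfps(1)[OF det assms]]])
    show "open {w. z + w \<in> uhp}" using
      open_vimage[OF open_uhp, of "\<lambda>w. z + w"] by (simp add: vimage_def continuous_intros)
    fix w assume w: "w \<in> {w. z + w \<in> uhp} - {0}"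
    then have "((\<lambda>w. moebius A (z + w) - moebius A z) has_field_derivative 1 / (automorphy A (z + w))\<^sup>2 - 0) (at w)"
      using moebius_has_deriv[OF det, of "z + w"] DERIV_shift[of "moebius A" _ w z]
      by (intro DERIV_diff DERIV_const) (auto simp: add.commute)
    then show "((\<lambda>w. moebius A (z + w) - moebius A z) has_field_derivative inverse (automorphy A (z + w) ^ 2)) (at w)"
      by (simp add: field_simps)
  qed (use assms in auto)
  ultimately show ?thesis using has_laurent_expansion_unique by blast
qed

lemma mero_deriv_mcomp: "mero_deriv (mcomp A f) = mcomp A (mero_deriv f) / (autofun A)\<^sup>2"
  by (rule germ_eqD[OF ii_uhp])
    (simp add: germ_mcomp[OF det] fls_compose_fps_deriv mfps_0[OF det] mfps_nz[OF det] germ_autofun_mfps det field_simps)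

text \<open>In weight 2 the differential \<open>f dz\<close> is invariant, because the derivative of
  \<open>moebius A\<close> is \<open>1 / (automorphy A z)^2\<close>.\<close>

lemma residue_germ_mcomp:
  assumes "z \<in> uhp" "mcomp A f = (autofun A)\<^sup>2 * f"
  shows "fls_residue (germ z f) = fls_residue (germ (moebius A z) f)"
proof -
  have "germ z f * germ z (autofun A) ^ 2 = germ z (mcomp A f)"
    using assms by (simp add: mult.commute)
  then have "germ z f = germ z (mcomp A f) * inverse (germ z (autofun A) ^ 2)"
    using assms(1) by (simp add: field_simps)
  also have "\<dots> = fls_compose_fps (germ (moebius A z) f) (mfps A z) * fls_deriv (fps_to_fls (mfps A z))"
    using assms(1) by (simp add: germ_mcomp[OF det] germ_autofun_mfps)
  finally show ?thesis
    using fls_residue_compose_fps[of "mfps A z"] mfps_0[OF det assms(1)] mfps_1[OF det assms(1)] assms det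
    by simp
qed

end

section \<open>Cocompact Fuchsian groups\<close>

text \<open>The adjugate: for determinant 1 it is the inverse, and it visibly has the same
  norm.\<close>

definition inv2 :: "real^2^2 \<Rightarrow> real^2^2" where
  "inv2 A = (\<chi> i j. if i = j then (if i = 1 then A$2$2 else A$1$1) else - A$i$j)"

lemma inv2_nth [simp]: "inv2 A $ 1 $ 1 = A$2$2" "inv2 A $ 2 $ 2 = A$1$1" "inv2 A $ 1 $ 2 = - A$1$2"
  "inv2 A $ 2 $ 1 = - A$2$1"
  by (simp_all add: inv2_def)

lemma mat2_eqI: "A$1$1 = B$1$1 \<Longrightarrow> A$1$2 = B$1$2 \<Longrightarrow> A$2$1 = B$2$1 \<Longrightarrow> A$2$2 = B$2$2 \<Longrightarrow> A = (B :: real^2^2)"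
  by (simp add: vec_eq_iff forall_2)

lemma mult2_nth: "((A :: real^2^2) ** (B :: real^2^2)) $ i $ j = A$i$1 * B$1$j + A$i$2 * B$2$j"
  by (simp add: matrix_matrix_mult_def sum_2)

lemma mat1_nth [simp]: "(mat 1 :: real^2^2) $ 1 $ 1 = 1" "(mat 1 :: real^2^2) $ 2 $ 2 = 1"
  "(mat 1 :: real^2^2) $ 1 $ 2 = 0" "(mat 1 :: real^2^2) $ 2 $ 1 = 0"
  by (simp_all add: mat_def)

lemma inv2_mult: "det A = 1 \<Longrightarrow> inv2 A ** A = mat 1" "det A = 1 \<Longrightarrow> A ** inv2 A = mat 1"
  by (auto intro!: mat2_eqI simp: mult2_nth det2 algebra_simps)

lemma det_inv2 [simp]: "det (inv2 A) = det A"
  by (simp add: det2 algebra_simps)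

lemma norm_mat2: "(norm (A :: real^2^2))\<^sup>2 = (A$1$1)\<^sup>2 + (A$1$2)\<^sup>2 + (A$2$1)\<^sup>2 + (A$2$2)\<^sup>2"
  by (simp add: norm_vec_def L2_set_def sum_2)

lemma norm_inv2 [simp]: "norm (inv2 A) = norm A"
proof -
  have "(norm (inv2 A))\<^sup>2 = (norm A)\<^sup>2" unfolding norm_mat2 by simp
  then show ?thesis by (simp add: power2_eq_iff_nonneg)
qed

lemma entry_le_norm: "\<bar>(A :: real^2^2)$i$j\<bar> \<le> norm A"
  using component_le_norm_cart[of "A$i" j] Finite_Cartesian_Product.norm_nth_le[of A i]
  by (auto intro: order_trans)

lemma norm_le_entries:
  assumes "\<And>i j. \<bar>(A :: real^2^2)$i$j\<bar> \<le> e" shows "norm A \<le> 2 * e"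
proof (rule power2_le_imp_le)
  have e: "(A$i$j)\<^sup>2 \<le> e\<^sup>2" for i j
    using power_mono[OF assms[of i j], of 2] by simp
  show "(norm A)\<^sup>2 \<le> (2 * e)\<^sup>2"
    using e[of 1 1] e[of 1 2] e[of 2 1] e[of 2 2] by (simp add: norm_mat2)
  show "0 \<le> 2 * e" using assms[of 1 1] by simp
qed

lemma norm_mult2_le: "norm ((A :: real^2^2) ** (B :: real^2^2)) \<le> 4 * (norm A * norm B)"
proof -
  have "\<bar>(A ** B)$i$j\<bar> \<le> 2 * (norm A * norm B)" for i j
  proof -
    have "\<bar>A$i$k * B$k$j\<bar> \<le> norm A * norm B" for k
      unfolding abs_mult by (intro mult_mono entry_le_norm) auto
    from this[of 1] this[of 2] show ?thesis unfolding mult2_nth by linarith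
  qed
  from norm_le_entries[of "A ** B", OF this] show ?thesis by simp
qed

lemma norm_ge_1:
  assumes "det (A :: real^2^2) = 1" shows "norm A \<ge> 1"
proof -
  have "2 * \<bar>A$1$1 * A$2$2\<bar> \<le> (A$1$1)\<^sup>2 + (A$2$2)\<^sup>2" "2 * \<bar>A$1$2 * A$2$1\<bar> \<le> (A$1$2)\<^sup>2 + (A$2$1)\<^sup>2"
    using sum_squares_bound[of "\<bar>A$1$1\<bar>" "\<bar>A$2$2\<bar>"] sum_squares_bound[of "\<bar>A$1$2\<bar>" "\<bar>A$2$1\<bar>"]
    by (auto simp: abs_mult)
  moreover have "A$1$1 * A$2$2 - A$1$2 * A$2$1 = 1" using assms by (simp add: det2)
  ultimately have "(norm A)\<^sup>2 \<ge> 1\<^sup>2" unfolding norm_mat2 by (simp add: abs_if split: if_splits)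
  then show ?thesis using power2_le_imp_le[of 1 "norm A"] by simp
qed

locale fuchsian =
  fixes \<Gamma> :: "(real^2^2) set set"
  assumes discrete: "discrete_subgroup \<Gamma>" and cocompact: "cocompact \<Gamma>"
begin

definition G :: "(real^2^2) set" where "G = \<Union>\<Gamma>"

abbreviation "cls \<equiv> \<lambda>A :: real^2^2. {A, - A}"

lemma mult2_minus: "(- A) ** B = - (A ** B)" "A ** (- B) = - (A ** B)" for A B :: "real^2^2"
  by (auto intro!: mat2_eqI simp: mult2_nth)

lemma coset_SL2R: "{mat 1, - mat 1} #>\<^bsub>SL2R\<^esub> A = cls A"
  by (auto simp: r_coset_def SL2R_def mult2_minus)

lemma carrier_SL2R [simp]: "A \<in> carrier SL2R \<longleftrightarrow> det A = 1"
  by (simp add: SL2R_def)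

lemma carrier_PSL2R: "X \<in> carrier PSL2R \<longleftrightarrow> (\<exists>A. det A = 1 \<and> X = cls A)"
  by (auto simp: PSL2R_def FactGroup_def RCOSETS_def coset_SL2R)

lemma mult_PSL2R: "cls A \<otimes>\<^bsub>PSL2R\<^esub> cls B = cls (A ** B)"
  by (auto simp: PSL2R_def FactGroup_def set_mult_def SL2R_def mult2_minus)

lemma one_PSL2R: "\<one>\<^bsub>PSL2R\<^esub> = cls (mat 1)"
  by (simp add: PSL2R_def FactGroup_def)

lemma sub: "subgroup \<Gamma> PSL2R"
  using discrete by (simp add: discrete_subgroup_def)

lemma det_minus2 [simp]: "det (- A) = det A" for A :: "real^2^2"
  by (simp add: det2)

lemma in_G_iff: "A \<in> G \<longleftrightarrow> det A = 1 \<and> cls A \<in> \<Gamma>"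
proof
  assume "A \<in> G"
  then obtain X where X: "X \<in> \<Gamma>" "A \<in> X" by (auto simp: G_def)
  then obtain B where B: "det B = 1" "X = cls B"
    using subgroup.subset[OF sub] carrier_PSL2R by blast
  then have "A = B \<or> A = - B" using X by auto
  then have "cls A = X" "det A = 1" using B by auto
  then show "det A = 1 \<and> cls A \<in> \<Gamma>" using X by auto
qed (auto simp: G_def)

lemma G_det: "A \<in> G \<Longrightarrow> det A = 1"
  by (simp add: in_G_iff)
lemma G_one: "mat 1 \<in> G"
  using subgroup.one_closed[OF sub] by (simp add: in_G_iff one_PSL2R)
lemma G_mult: "A \<in> G \<Longrightarrow> B \<in> G \<Longrightarrow> A ** B \<in> G"
  using subgroup.m_closed[OF sub, of "cls A" "cls B"] by (simp add: in_G_iff mult_PSL2R det_mul)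
lemma G_inv: assumes "A \<in> G" shows "inv2 A \<in> G"
proof -
  interpret PSL: group PSL2R by (rule group_PSL2R)
  have "det A = 1" "cls A \<in> \<Gamma>" using assms by (auto simp: in_G_iff)
  then have "inv\<^bsub>PSL2R\<^esub> (cls A) = cls (inv2 A)"
    by (intro PSL.inv_equality) (auto simp: mult_PSL2R one_PSL2R inv2_mult carrier_PSL2R, metis det_inv2)
  then show ?thesis using subgroup.m_inv_closed[OF sub \<open>cls A \<in> \<Gamma>\<close>] \<open>det A = 1\<close> by (simp add: in_G_iff)
qed

lemma G_isolated: obtains e where "e > 0" "\<And>A. A \<in> G \<Longrightarrow> norm (A - mat 1) < e \<Longrightarrow> A = mat 1"
proof -
  have one: "cls (mat 1) \<in> \<Gamma>" using G_one by (simp add: in_G_iff)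
  then have "openin (subtopology PSL2R_topology \<Gamma>) {cls (mat 1)}"
    using discrete by (simp add: discrete_subgroup_def)
  then obtain U where U: "openin PSL2R_topology U" "U \<inter> \<Gamma> = {cls (mat 1)}"
    by (auto simp: openin_subtopology)
  then have "openin (top_of_set (carrier SL2R)) {A \<in> carrier SL2R. cls A \<in> U}"
    by (simp add: PSL2R_topology_def openin_quotient_topology coset_SL2R)
  then obtain V where V: "open V" "{A \<in> carrier SL2R. cls A \<in> U} = carrier SL2R \<inter> V"
    by (metis (no_types, lifting) openin_open)
  have "cls (mat 1) \<in> U" using U by auto
  then have "mat 1 \<in> V" using V(2) det_I by (metis (mono_tags, lifting) IntD2 carrier_SL2R mem_Collect_eq)
  then obtain e where e: "e > 0" "ball (mat 1) e \<subseteq> V" using V(1) openE by blast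
  show ?thesis
  \<comment> \<open>The bound 1 excludes \<open>- mat 1\<close>, which represents the same class as
    \<open>mat 1\<close>.\<close>
  proof (rule that[of "min e 1"])
    fix A assume A: "A \<in> G" "norm (A - mat 1) < min e 1"
    then have "A \<in> V" using e by (auto simp: dist_norm norm_minus_commute subset_iff)
    then have "cls A \<in> U \<inter> \<Gamma>" using A V(2) in_G_iff by auto
    then have "A = mat 1 \<or> A = - mat 1" using U by auto
    moreover have "A \<noteq> - mat 1"
    proof
      assume "A = - mat 1"
      then show False using entry_le_norm[of "A - mat 1" 1 1] A by simp
    qed
    ultimately show "A = mat 1" by blast
  qed (use e in auto)
qed

lemma continuous_on_mult2: "continuous_on S (\<lambda>A. (B :: real^2^2) ** (A :: real^2^2))"
proof -
  have "linear (\<lambda>A. B ** (A :: real^2^2))"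
    by (rule linearI; rule mat2_eqI) (simp_all add: mult2_nth algebra_simps)
  then show ?thesis by (rule linear_continuous_on[OF linear_conv_bounded_linear[THEN iffD1]])
qed

text \<open>The cosets with a representative of norm less than \<open>n\<close> form open sets that
  exhaust the coset space; by compactness one \<open>n\<close> suffices.\<close>

lemma cocompact_bound:
  obtains X where "\<And>A. det A = 1 \<Longrightarrow> \<exists>B\<in>G. norm (B ** A) \<le> X"
proof -
  let ?q = "\<lambda>g. \<Gamma> #>\<^bsub>PSL2R\<^esub> g"
  let ?T = "quotient_topology PSL2R_topology ?q"
  interpret PSL: group PSL2R by (rule group_PSL2R)
  have top: "topspace PSL2R_topology = cls ` carrier SL2R"
    using quotient_imp_surjective_map[OF quotient_map_quotient_topology[of "top_of_set (carrier SL2R)" "\<lambda>A. {mat 1, - mat 1} #>\<^bsub>SL2R\<^esub> A"]]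
    by (simp add: PSL2R_topology_def coset_SL2R)
  have topT: "topspace ?T = ?q ` cls ` carrier SL2R"
    using quotient_imp_surjective_map[OF quotient_map_quotient_topology[of PSL2R_topology ?q]] top by simp
  define U where "U n = ?q ` cls ` {A. det A = 1 \<and> norm A < real n}" for n :: nat
  have q: "?q (cls A) \<in> U n \<longleftrightarrow> (\<exists>B\<in>G. norm (B ** A) < real n)" if A: "det A = 1" for A n
  proof
    assume "?q (cls A) \<in> U n"
    then obtain C where C: "det C = 1" "norm C < real n" "?q (cls A) = ?q (cls C)"
      by (auto simp: U_def)
    have "cls C \<in> ?q (cls C)"
      using C PSL.rcos_self[OF _ sub] carrier_PSL2R by blast
    then have "cls C \<in> ?q (cls A)" using C by simp
    then obtain X where X: "X \<in> \<Gamma>" "cls C = X \<otimes>\<^bsub>PSL2R\<^esub> cls A" by (auto simp: r_coset_def)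
    then obtain B where B: "det B = 1" "X = cls B" using subgroup.subset[OF sub] carrier_PSL2R by blast
    then have BG: "B \<in> G" using X in_G_iff by auto
    have "C = B ** A \<or> C = - (B ** A)" using X B mult_PSL2R[of B A] by (metis insert_iff singletonD)
    then show "\<exists>B\<in>G. norm (B ** A) < real n" using C BG by auto
  next
    assume "\<exists>B\<in>G. norm (B ** A) < real n"
    then obtain B where B: "B \<in> G" "norm (B ** A) < real n" by blast
    then have "cls (B ** A) \<in> ?q (cls A)"
      using mult_PSL2R[of B A] by (auto simp: r_coset_def in_G_iff)
    then have "?q (cls A) = ?q (cls (B ** A))"
      using PSL.repr_independence[OF _ _ sub] carrier_PSL2R A by blast
    moreover have "det (B ** A) = 1" using A B G_det by (simp add: det_mul)
    ultimately show "?q (cls A) \<in> U n" using B(2) unfolding U_def by blast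
  qed
  have op: "openin ?T (U n)" for n
  proof -
    have "openin (top_of_set (carrier SL2R)) {A \<in> carrier SL2R. ?q (cls A) \<in> U n}"
    proof -
      have "{A \<in> carrier SL2R. ?q (cls A) \<in> U n} = carrier SL2R \<inter> (\<Union>B\<in>G. {A. norm (B ** A) < real n})"
        using q by auto
      moreover have "open {A :: real^2^2. norm (B ** A) < real n}" for B :: "real^2^2"
        by (intro open_Collect_less continuous_on_norm continuous_on_mult2 continuous_on_const)
      ultimately show ?thesis by (metis (no_types, lifting) openin_open_Int open_UN)
    qed
    then have "openin PSL2R_topology {x \<in> topspace PSL2R_topology. ?q x \<in> U n}"
      unfolding PSL2R_topology_def
      by (subst openin_quotient_topology)
       (auto simp: coset_SL2R top[unfolded PSL2R_topology_def] elim!: rev_iffD1[of "openin _ _"] intro!: arg_cong[of _ _ "openin _"])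
    then show ?thesis
      by (subst openin_quotient_topology) (auto simp: U_def top)
  qed
  have cov: "topspace ?T \<subseteq> \<Union>(range U)"
  proof
    fix y assume "y \<in> topspace ?T"
    then obtain A where A: "det A = 1" "y = ?q (cls A)" using topT by auto
    obtain n where "norm A < real n" using reals_Archimedean2 by blast
    then have "y \<in> U n" using A by (auto simp: U_def)
    then show "y \<in> \<Union>(range U)" by blast
  qed
  obtain F where F: "finite F" "F \<subseteq> range U" "topspace ?T \<subseteq> \<Union>F"
    using cocompact op cov unfolding cocompact_def compact_space_alt by (metis (no_types, lifting) rangeE)
  then obtain N where N: "finite N" "F = U ` N" by (meson finite_subset_image)
  show ?thesis
  proof (rule that[of "real (Max (insert 0 N))"])
    fix A :: "real^2^2" assume A: "det A = 1"
    then have "?q (cls A) \<in> topspace ?T" unfolding topT by (intro imageI) simp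
    then have "?q (cls A) \<in> \<Union>F" using F by blast
    then obtain n where "n \<in> N" "?q (cls A) \<in> U n" using N by auto
    then obtain B where "B \<in> G" "norm (B ** A) < real n" using q[OF A] by blast
    moreover have "real n \<le> real (Max (insert 0 N))" using \<open>n \<in> N\<close> N by simp
    ultimately show "\<exists>B\<in>G. norm (B ** A) \<le> real (Max (insert 0 N))" by (intro bexI[of _ B]) auto
  qed
qed

text \<open>Each \<open>z\<close> is \<open>moebius A \<i>\<close> for an upper triangular
  \<open>A\<close> of determinant 1. If \<open>C = B ** A\<close> has norm at most \<open>X\<close>
  and rows \<open>(a, b)\<close> and \<open>(c, d)\<close>, then
  \<open>moebius B z = moebius C \<i>\<close> has imaginary part \<open>1 / (c^2 + d^2)\<close> and
  squared modulus \<open>(a^2 + b^2) / (c^2 + d^2)\<close>, both controlled by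
  \<open>X\<close>.\<close>

lemma compact_fundamental:
  obtains K where "compact K" "K \<subseteq> uhp" "\<And>z. z \<in> uhp \<Longrightarrow> \<exists>A\<in>G. moebius A z \<in> K"
proof -
  obtain X0 where X0: "\<And>A. det A = 1 \<Longrightarrow> \<exists>B\<in>G. norm (B ** A) \<le> X0" using cocompact_bound by blast
  define X where "X = max X0 1"
  have X: "X \<ge> 1" "\<And>A. det A = 1 \<Longrightarrow> \<exists>B\<in>G. norm (B ** A) \<le> X"
    using X0 by (auto simp: X_def) (meson le_max_iff_disj order_trans)
  define K where "K = {w. Im w \<ge> 1 / (2 * X\<^sup>2)} \<inter> cball 0 (2 * X\<^sup>2)"
  show ?thesis
  proof (rule that[of K])
    show "compact K" unfolding K_def
      by (intro closed_Int_compact closed_Collect_le continuous_intros compact_cball)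
    have "1 / (2 * X\<^sup>2) > 0" using X by simp
    then show "K \<subseteq> uhp" unfolding K_def uhp_def using order_less_le_trans by blast
    fix z assume z: "z \<in> uhp"
    define s where "s = sqrt (Im z)"
    have s: "s > 0" "s\<^sup>2 = Im z" using z by (auto simp: s_def uhp_def)
    define A :: "real^2^2" where "A = (\<chi> i j. if i = 1 then (if j = 1 then s else Re z / s)
      else (if j = 1 then 0 else 1 / s))"
    have A: "A$1$1 = s" "A$1$2 = Re z / s" "A$2$1 = 0" "A$2$2 = 1 / s" by (auto simp: A_def)
    have dA: "det A = 1" using s by (simp add: det2 A)
    have Ai: "moebius A \<i> = z"
      using s by (simp add: moebius_def automorphy_def A complex_eq_iff power2_eq_square flip: s(2))
    obtain B where B: "B \<in> G" "norm (B ** A) \<le> X" using X(2)[OF dA] by blast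
    define C where "C = B ** A"
    have dC: "det C = 1" using dA G_det[OF B(1)] by (simp add: C_def det_mul)
    have Bz: "moebius B z = moebius C \<i>"
      using moebius_mult[OF dA ii_uhp, of B] Ai by (simp add: C_def)
    have nC: "(C$1$1)\<^sup>2 + (C$1$2)\<^sup>2 + (C$2$1)\<^sup>2 + (C$2$2)\<^sup>2 \<le> X\<^sup>2"
      using power_mono[OF B(2), of 2] by (simp add: norm_mat2 C_def)
    let ?p = "(C$1$1)\<^sup>2 + (C$1$2)\<^sup>2" and ?r = "(C$2$1)\<^sup>2 + (C$2$2)\<^sup>2"
    have p: "?p \<le> X\<^sup>2" "?r \<le> X\<^sup>2" using nC by (smt (verit) zero_le_power2)+
    \<comment> \<open>Lagrange's identity turns the upper bound for the first row into a lower bound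
      for the second, which controls the modulus.\<close>
    have "1 = (C$1$1 * C$2$2 - C$1$2 * C$2$1)\<^sup>2" using dC by (simp add: det2)
    also have "\<dots> \<le> ?p * ?r"
    proof -
      have "?p * ?r - (C$1$1 * C$2$2 - C$1$2 * C$2$1)\<^sup>2 = (C$1$1 * C$2$1 + C$1$2 * C$2$2)\<^sup>2"
        by (simp add: power2_eq_square algebra_simps)
      then show ?thesis by (smt (verit) zero_le_power2)
    qed
    finally have pr: "1 \<le> ?p * ?r" .
    have r0: "?r > 0" using pr by (smt (verit) mult_nonneg_nonpos zero_le_power2)
    have j: "(norm (automorphy C \<i>))\<^sup>2 = ?r" by (simp add: automorphy_def cmod_power2 add.commute)
    have "Im (moebius C \<i>) = 1 / ?r" using Im_moebius[OF dC ii_uhp] j by simp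
    moreover have "1 / ?r \<ge> 1 / (2 * X\<^sup>2)" using r0 p X by (intro divide_left_mono) auto
    moreover have "norm (moebius C \<i>) \<le> 2 * X\<^sup>2"
    proof (rule power2_le_imp_le)
      have "(norm (moebius C \<i>))\<^sup>2 = (norm (of_real (C$1$1) * \<i> + of_real (C$1$2)))\<^sup>2 / ?r"
        by (simp add: moebius_def norm_divide power_divide j)
      also have "(norm (of_real (C$1$1) * \<i> + of_real (C$1$2)))\<^sup>2 = ?p"
        by (simp add: cmod_power2)
      also have "?p / ?r \<le> ?p * ?p"
      proof -
        have "?p * 1 \<le> ?p * (?p * ?r)" using pr by (intro mult_left_mono) auto
        then show ?thesis using r0 by (simp add: divide_le_eq mult.assoc)
      qed
      also have "\<dots> \<le> X\<^sup>2 * X\<^sup>2" using p by (intro mult_mono) auto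
      also have "\<dots> \<le> (2 * X\<^sup>2)\<^sup>2" using mult_nonneg_nonneg[of "X\<^sup>2" "X\<^sup>2"] by (simp add: power2_eq_square[of "2 * X\<^sup>2"])
      finally show "(norm (moebius C \<i>))\<^sup>2 \<le> (2 * X\<^sup>2)\<^sup>2" .
    qed simp
    ultimately show "\<exists>A\<in>G. moebius A z \<in> K" using B(1) Bz by (intro bexI[of _ B]) (auto simp: K_def)
  qed
qed

subsection \<open>Counting\<close>

text \<open>Isolation of the identity is carried to \<open>A\<close> by multiplication with the
  inverse of \<open>A\<close>. This stretches distances by at most a multiple of
  \<open>norm A\<close>, hence the factor \<open>norm A\<close>.\<close>

lemma G_separated:
  obtains e where "e > 0" "\<And>A B. A \<in> G \<Longrightarrow> B \<in> G \<Longrightarrow> norm (A - B) * norm A < e \<Longrightarrow> A = B"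
proof -
  obtain e where e: "e > 0" "\<And>A. A \<in> G \<Longrightarrow> norm (A - mat 1) < e \<Longrightarrow> A = mat 1"
    using G_isolated by blast
  show ?thesis
  proof (rule that[of "e / 4"])
    fix A B assume AB: "A \<in> G" "B \<in> G" "norm (A - B) * norm A < e / 4"
    have "inv2 A ** B - mat 1 = inv2 A ** (B - A)"
    proof -
      have "inv2 A ** (B - A) = inv2 A ** B - inv2 A ** A"
        by (intro mat2_eqI) (simp_all add: mult2_nth algebra_simps)
      then show ?thesis using inv2_mult[OF G_det[OF AB(1)]] by simp
    qed
    then have "norm (inv2 A ** B - mat 1) \<le> 4 * (norm A * norm (B - A))"
      using norm_mult2_le[of "inv2 A" "B - A"] by simp
    also have "\<dots> < e" using AB(3) by (simp add: mult.commute norm_minus_commute)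
    finally have "inv2 A ** B = mat 1" using e AB G_inv G_mult by blast
    then have "A ** (inv2 A ** B) = A" by simp
    then show "A = B" using inv2_mult[OF G_det[OF AB(1)]] by (simp add: matrix_mul_assoc)
  qed (use e in auto)
qed

text \<open>A volume count in dimension 4: matrices of norm at most \<open>X\<close> have mutual
  distance at least a multiple of \<open>1 / X\<close>, so each of the four entries has about
  \<open>X^2\<close> distinguishable values.\<close>

lemma G_count:
  "\<exists>C>0. \<forall>X\<ge>1. finite {A \<in> G. norm A \<le> X} \<and> real (card {A \<in> G. norm A \<le> X}) \<le> C * X ^ 8"
proof -
  obtain e where e: "e > 0" "\<And>A B. A \<in> G \<Longrightarrow> B \<in> G \<Longrightarrow> norm (A - B) * norm A < e \<Longrightarrow> A = B"
    using G_separated by blast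
  have main: "finite {A \<in> G. norm A \<le> X} \<and> real (card {A \<in> G. norm A \<le> X}) \<le> (2 * (4 / e + 1) + 3) ^ 4 * X ^ 8"
    if X: "X \<ge> 1" for X
  proof -
    \<comment> \<open>Two matrices in one cell of mesh \<open>1 / t\<close> satisfy
      \<open>norm (A - B) \<le> 2 / t\<close>, hence
      \<open>norm (A - B) * norm A \<le> e / 2\<close>.\<close>
    define t where "t = X * (4 / e)"
    have t: "t > 0" using X e by (simp add: t_def)
    let ?S = "{A \<in> G. norm A \<le> X}"
    define m where "m = nat \<lceil>X * t\<rceil> + 1"
    define f where "f A = (\<lfloor>A$1$1 * t\<rfloor>, \<lfloor>A$1$2 * t\<rfloor>, \<lfloor>A$2$1 * t\<rfloor>, \<lfloor>A$2$2 * t\<rfloor>)" for A :: "real^2^2"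
    let ?I = "{- int m..int m}"
    have inj: "inj_on f ?S"
    proof (rule inj_onI)
      fix A B assume A: "A \<in> ?S" and B: "B \<in> ?S" and f: "f A = f B"
      have fl: "\<bar>x - y\<bar> \<le> 1 / t" if "\<lfloor>x * t\<rfloor> = \<lfloor>y * t\<rfloor>" for x y :: real
      proof -
        have "\<bar>x * t - y * t\<bar> \<le> 1" using that by linarith
        then have "\<bar>x - y\<bar> * t \<le> 1" using t by (simp add: abs_mult flip: left_diff_distrib)
        then show ?thesis using t by (simp add: field_simps)
      qed
      have "\<bar>(A - B)$i$j\<bar> \<le> 1 / t" for i j
        using f fl exhaust_2[of i] exhaust_2[of j] by (auto simp: f_def)
      then have "norm (A - B) \<le> 2 / t" using norm_le_entries by fastforce
      then have "norm (A - B) * norm A \<le> 2 / t * X" using A X t by (intro mult_mono) auto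
      also have "\<dots> < e" using e X by (simp add: t_def field_simps)
      finally show "A = B" using e A B by auto
    qed
    have im: "f ` ?S \<subseteq> ?I \<times> ?I \<times> ?I \<times> ?I"
    proof -
      have *: "\<lfloor>x * t\<rfloor> \<in> ?I" if "\<bar>x\<bar> \<le> X" for x
      proof -
        have "\<bar>x * t\<bar> \<le> X * t" using that t by (simp add: abs_mult)
        then have "of_int \<lfloor>x * t\<rfloor> \<le> X * t" "of_int \<lfloor>x * t\<rfloor> \<ge> - (X * t) - 1" by linarith+
        moreover have "X * t \<le> real (nat \<lceil>X * t\<rceil>)" by (rule of_nat_ceiling)
        then have "X * t + 1 \<le> real_of_int (int m)" by (simp add: m_def)
        ultimately have "real_of_int \<lfloor>x * t\<rfloor> \<le> real_of_int (int m)"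
          "real_of_int (- int m) \<le> real_of_int \<lfloor>x * t\<rfloor>" by simp_all
        then show ?thesis unfolding of_int_le_iff by simp
      qed
      have "\<lfloor>A$i$j * t\<rfloor> \<in> ?I" if "norm A \<le> X" for A :: "real^2^2" and i j
        using *[of "A$i$j"] entry_le_norm[of A i j] that by simp
      then show ?thesis unfolding f_def by blast
    qed
    have fin: "finite (?I \<times> ?I \<times> ?I \<times> ?I)" by simp
    have "finite ?S" using inj_on_finite[OF inj im fin] .
    have "card ?S \<le> card (?I \<times> ?I \<times> ?I \<times> ?I)" by (rule card_inj_on_le[OF inj im fin])
    moreover have "card (?I \<times> ?I \<times> ?I \<times> ?I) = (2 * m + 1) ^ 4"
    proof -
      have "card ?I = 2 * m + 1" by simp
      then show ?thesis unfolding card_cartesian_product by (simp only: power4_eq_xxxx mult.assoc)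
    qed
    ultimately have "real (card ?S) \<le> real ((2 * m + 1) ^ 4)"
      by (simp only: of_nat_le_iff)
    also have "\<dots> \<le> ((2 * (4 / e + 1) + 3) * X\<^sup>2) ^ 4"
    proof -
      have "X * t \<ge> 0" using X t by simp
      then have "real m \<le> X * t + 2" unfolding m_def by linarith
      also have "X * t = 4 / e * X\<^sup>2" by (simp add: t_def power2_eq_square)
      finally have "2 * real m + 1 \<le> 2 * (4 / e) * X\<^sup>2 + 5" by simp
      also have "\<dots> \<le> 2 * (4 / e) * X\<^sup>2 + 5 * X\<^sup>2" using X by (simp add: one_le_power)
      finally have "2 * real m + 1 \<le> (2 * (4 / e + 1) + 3) * X\<^sup>2" by (simp add: algebra_simps)
      then have "(2 * real m + 1) ^ 4 \<le> ((2 * (4 / e + 1) + 3) * X\<^sup>2) ^ 4" by (intro power_mono) auto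
      moreover have "real ((2 * m + 1) ^ 4) = (2 * real m + 1) ^ 4" by (simp add: add.commute)
      ultimately show ?thesis by simp
    qed
    also have "\<dots> = (2 * (4 / e + 1) + 3) ^ 4 * X ^ 8"
      by (simp add: power_mult_distrib flip: power_mult)
    finally show ?thesis using \<open>finite ?S\<close> by simp
  qed
  have "(2 * (4 / e + 1) + 3) ^ 4 > 0" using e by (intro zero_less_power) (simp add: add_pos_pos)
  then show ?thesis using main by blast
qed

lemma finite_norm_le: "finite {A \<in> G. norm A \<le> X}"
proof -
  have "finite {A \<in> G. norm A \<le> max X 1}" using G_count by auto
  then show ?thesis by (rule rev_finite_subset) auto
qed

text \<open>The shell of norms between \<open>n\<close> and \<open>n + 1\<close> contributes at most
  a multiple of \<open>n^8 / n^l\<close>; the exponent 10 makes this at most a multiple of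
  \<open>1 / n^2\<close>.\<close>

lemma summable_norm_G:
  assumes "l \<ge> 10"
  shows "(\<lambda>A. 1 / norm A ^ l) summable_on G"
proof -
  obtain C where C: "C > 0" "\<forall>X\<ge>1. finite {A \<in> G. norm A \<le> X} \<and> real (card {A \<in> G. norm A \<le> X}) \<le> C * X ^ 8"
    using G_count by blast
  define g where "g n = C * 2 ^ 8 * (1 / real n ^ 2)" for n
  have sg: "summable g" unfolding g_def
    using inverse_power_summable[of 2, where 'a = real] by (intro summable_mult) (simp add: field_simps)
  show ?thesis
  proof (rule nonneg_bdd_above_summable_on)
    show "bdd_above (sum (\<lambda>A. 1 / norm A ^ l) ` {F. F \<subseteq> G \<and> finite F})"
    proof (rule bdd_aboveI2)
      fix F assume "F \<in> {F. F \<subseteq> G \<and> finite F}"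
      then have F: "F \<subseteq> G" "finite F" by auto
      define h where "h A = nat \<lfloor>norm A\<rfloor>" for A :: "real^2^2"
      have "(\<Sum>A\<in>F. 1 / norm A ^ l) = (\<Sum>n\<in>h ` F. \<Sum>A\<in>{A\<in>F. h A = n}. 1 / norm A ^ l)"
        using F by (intro sum.group[symmetric]) auto
      also have "\<dots> \<le> (\<Sum>n\<in>h ` F. g n)"
      proof (rule sum_mono)
        fix n assume "n \<in> h ` F"
        then obtain A0 where A0: "A0 \<in> F" "n = h A0" by blast
        have n1: "n \<ge> 1" using norm_ge_1[OF G_det] A0 F by (auto simp: h_def le_nat_iff)
        have b: "real n \<le> norm A" "norm A \<le> real (n + 1)" if "A \<in> F" "h A = n" for A
          using that by (auto simp: h_def) linarith
        have "(\<Sum>A\<in>{A\<in>F. h A = n}. 1 / norm A ^ l) \<le> (\<Sum>A\<in>{A\<in>F. h A = n}. 1 / real n ^ l)"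
        proof (rule sum_mono)
          fix A assume "A \<in> {A\<in>F. h A = n}"
          then have "real n \<le> norm A" "real n > 0" using b(1) n1 by auto
          then have "real n \<le> norm A" "real n > 0" "norm A > 0" by linarith+
          then show "1 / norm A ^ l \<le> 1 / real n ^ l"
            by (intro divide_left_mono power_mono mult_pos_pos zero_less_power) auto
        qed
        also have "\<dots> = real (card {A\<in>F. h A = n}) * (1 / real n ^ l)" by simp
        also have "\<dots> \<le> (C * real (n + 1) ^ 8) * (1 / real n ^ l)"
        proof (intro mult_right_mono)
          have "card {A\<in>F. h A = n} \<le> card {A \<in> G. norm A \<le> real (n + 1)}"
            using b F finite_norm_le by (intro card_mono) auto
          then show "real (card {A\<in>F. h A = n}) \<le> C * real (n + 1) ^ 8"
            using C(2)[rule_format, of "real (n + 1)"] by simp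
        qed auto
        also have "\<dots> \<le> (C * (2 * real n) ^ 8) * (1 / real n ^ l)"
          using n1 C by (intro mult_right_mono mult_left_mono power_mono) auto
        also have "\<dots> = C * 2 ^ 8 * (real n ^ 8 / real n ^ l)" by (simp add: power_mult_distrib)
        also have "\<dots> \<le> g n"
        proof -
          have "real n ^ 8 / real n ^ l \<le> real n ^ 8 / real n ^ 10"
            using n1 assms by (intro divide_left_mono power_increasing) auto
          also have "\<dots> = 1 / real n ^ 2" using n1 by (simp add: field_simps eval_nat_numeral)
          finally show ?thesis unfolding g_def using C by (intro mult_left_mono) auto
        qed
        finally show "(\<Sum>A\<in>{A\<in>F. h A = n}. 1 / norm A ^ l) \<le> g n" .
      qed
      also have "\<dots> \<le> suminf g"
        using F C by (intro sum_le_suminf sg) (auto simp: g_def)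
      finally show "(\<Sum>A\<in>F. 1 / norm A ^ l) \<le> suminf g" .
    qed
  qed auto
qed

subsection \<open>Proper discontinuity\<close>

lemma compact_uhp_bounds:
  assumes "compact K" "K \<subseteq> uhp"
  obtains \<delta> M where "\<delta> > 0" "M > 0" "\<And>z. z \<in> K \<Longrightarrow> Im z \<ge> \<delta>" "\<And>z. z \<in> K \<Longrightarrow> norm z \<le> M"
proof (cases "K = {}")
  case True
  then show ?thesis using that[of 1 1] by auto
next
  case False
  have "continuous_on K Im" by (intro continuous_intros)
  then obtain w where w: "w \<in> K" "\<And>z. z \<in> K \<Longrightarrow> Im w \<le> Im z"
    using continuous_attains_inf[OF assms(1) False] by blast
  obtain M where "\<forall>z\<in>K. norm z \<le> M" using assms(1) compact_imp_bounded bounded_iff by blast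
  then have "norm z \<le> max M 1" if "z \<in> K" for z using that by fastforce
  then show ?thesis using w assms(2) by (intro that[of "Im w" "max M 1"]) (auto simp: uhp_def)
qed

text \<open>The imaginary part controls \<open>c\<close>; the triangle inequality then controls
  \<open>d\<close>.\<close>

lemma norm_linear_form_ge:
  assumes "\<delta> > 0" "Im z \<ge> \<delta>" "norm z \<le> M" "M \<ge> 1" "\<delta> \<le> 1"
  shows "norm (of_real c * z + of_real d) \<ge> \<delta> / (4 * M) * (\<bar>c\<bar> + \<bar>d\<bar>)"
proof -
  let ?w = "of_real c * z + of_real d"
  have 1: "\<bar>c\<bar> * \<delta> \<le> norm ?w"
  proof -
    have "\<bar>c\<bar> * \<delta> \<le> \<bar>c\<bar> * \<bar>Im z\<bar>" using assms by (intro mult_left_mono) auto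
    also have "\<dots> = \<bar>Im ?w\<bar>" by (simp add: abs_mult)
    also have "\<dots> \<le> norm ?w" by (rule abs_Im_le_cmod)
    finally show ?thesis .
  qed
  have "\<bar>d\<bar> = norm (?w - of_real c * z)" by simp
  also have "\<dots> \<le> norm ?w + norm (of_real c * z)" by (rule norm_triangle_ineq4)
  also have "norm (of_real c * z) \<le> \<bar>c\<bar> * M" using assms by (simp add: norm_mult mult_left_mono)
  finally have 2: "\<bar>d\<bar> \<le> norm ?w + \<bar>c\<bar> * M" by simp
  have "\<delta> * (\<bar>c\<bar> + \<bar>d\<bar>) \<le> \<bar>c\<bar> * \<delta> + \<delta> * (norm ?w + \<bar>c\<bar> * M)"
    using mult_left_mono[OF 2, of \<delta>] assms by (simp add: algebra_simps)
  also have "\<dots> \<le> norm ?w + (1 * norm ?w + M * norm ?w)"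
  proof -
    have "\<delta> * norm ?w \<le> 1 * norm ?w" using assms by (intro mult_right_mono) auto
    moreover have "M * (\<bar>c\<bar> * \<delta>) \<le> M * norm ?w" using 1 assms by (intro mult_left_mono) auto
    ultimately show ?thesis using 1 by (simp add: algebra_simps)
  qed
  also have "\<dots> \<le> 4 * M * norm ?w"
  proof -
    have "1 * norm ?w \<le> M * norm ?w" using assms by (intro mult_right_mono) auto
    then show ?thesis using norm_ge_zero[of ?w] by linarith
  qed
  finally show ?thesis using assms by (simp add: field_simps)
qed

lemma sum_entries_ge_norm: "norm (A :: real^2^2) \<le> \<bar>A$1$1\<bar> + \<bar>A$1$2\<bar> + \<bar>A$2$1\<bar> + \<bar>A$2$2\<bar>"
proof (rule power2_le_imp_le)
  show "(norm A)\<^sup>2 \<le> (\<bar>A$1$1\<bar> + \<bar>A$1$2\<bar> + \<bar>A$2$1\<bar> + \<bar>A$2$2\<bar>)\<^sup>2"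
    unfolding norm_mat2 by (simp add: power2_sum power2_abs)
qed auto

text \<open>The form is \<open>(moebius A z - cnj w) * automorphy A z\<close>. As
  \<open>moebius A z\<close> and \<open>cnj w\<close> lie in opposite half planes, it dominates
  \<open>automorphy A z\<close>, hence also the numerator of \<open>moebius A z\<close>, and these
  two linear forms control all entries. Both proper discontinuity and the convergence of Poincare
  series rest on this bound.\<close>

lemma cross_form_ge:
  assumes "compact K" "K \<subseteq> uhp"
  obtains c where "c > 0" "\<And>z w A. z \<in> K \<Longrightarrow> w \<in> K \<Longrightarrow> det A = 1 \<Longrightarrow>
    norm (of_real (A$1$1) * z + of_real (A$1$2) - cnj w * automorphy A z) \<ge> c * norm A"
proof -
  obtain \<delta>0 M0 where b0: "\<delta>0 > 0" "M0 > 0" "\<And>z. z \<in> K \<Longrightarrow> Im z \<ge> \<delta>0" "\<And>z. z \<in> K \<Longrightarrow> norm z \<le> M0"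
    using compact_uhp_bounds[OF assms] by blast
  define \<delta> where "\<delta> = min \<delta>0 1"
  define M where "M = max M0 1"
  have b: "\<delta> > 0" "\<delta> \<le> 1" "M \<ge> 1" "\<And>z. z \<in> K \<Longrightarrow> Im z \<ge> \<delta>" "\<And>z. z \<in> K \<Longrightarrow> norm z \<le> M"
    using b0 by (force simp: \<delta>_def M_def)+
  define k where "k = \<delta> / (4 * M)"
  have k: "k > 0" using b by (simp add: k_def)
  define c where "c = k * \<delta> / (4 * M)"
  have "norm (of_real (A$1$1) * z + of_real (A$1$2) - cnj w * automorphy A z) \<ge> c * norm A"
    if z: "z \<in> K" and w: "w \<in> K" and A: "det A = 1" for z w and A :: "real^2^2"
  proof -
    let ?p = "of_real (A$1$1) * z + of_real (A$1$2)" and ?j = "automorphy A z"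
    let ?u = "?p - cnj w * ?j"
    have zu: "z \<in> uhp" "w \<in> uhp" using z w assms by auto
    have p: "norm ?p \<ge> k * (\<bar>A$1$1\<bar> + \<bar>A$1$2\<bar>)"
      using norm_linear_form_ge[OF b(1) b(4)[OF z] b(5)[OF z] b(3,2)] by (simp add: k_def)
    have j: "norm ?j \<ge> k * (\<bar>A$2$1\<bar> + \<bar>A$2$2\<bar>)"
      using norm_linear_form_ge[OF b(1) b(4)[OF z] b(5)[OF z] b(3,2)] by (simp add: k_def automorphy_def)
    have u1: "norm ?u \<ge> \<delta> * norm ?j"
    proof -
      have "?u = (moebius A z - cnj w) * ?j"
        using automorphy_nz[OF A zu(1)] by (simp add: moebius_def field_simps)
      moreover have "norm (moebius A z - cnj w) \<ge> \<delta>"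
      proof -
        have "\<delta> \<le> Im (moebius A z - cnj w)"
          using moebius_uhp[OF A zu(1)] b(4)[OF w] by (simp add: uhp_def)
        also have "\<dots> \<le> norm (moebius A z - cnj w)"
          using abs_Im_le_cmod[of "moebius A z - cnj w"] by linarith
        finally show ?thesis .
      qed
      ultimately show ?thesis by (simp add: norm_mult mult_right_mono)
    qed
    have u2: "norm ?p \<le> norm ?u + M * norm ?j"
    proof -
      have "norm ?p = norm (?u + cnj w * ?j)" by simp
      also have "\<dots> \<le> norm ?u + norm (cnj w * ?j)" by (rule norm_triangle_ineq)
      also have "norm (cnj w * ?j) \<le> M * norm ?j"
        unfolding norm_mult using b(5)[OF w] by (intro mult_right_mono) auto
      finally show ?thesis by simp
    qed
    have "k * norm A \<le> k * (\<bar>A$1$1\<bar> + \<bar>A$1$2\<bar> + \<bar>A$2$1\<bar> + \<bar>A$2$2\<bar>)"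
      using k sum_entries_ge_norm[of A] by (intro mult_left_mono) auto
    also have "\<dots> \<le> norm ?p + norm ?j" using p j by (simp add: algebra_simps)
    also have "\<dots> \<le> norm ?u + 2 * M * norm ?j"
    proof -
      have "1 * norm ?j \<le> M * norm ?j" using b by (intro mult_right_mono) auto
      then show ?thesis using u2 by simp
    qed
    finally have "\<delta> * (k * norm A) \<le> \<delta> * (norm ?u + 2 * M * norm ?j)"
      using b by (intro mult_left_mono) auto
    also have "\<dots> \<le> norm ?u + 2 * M * norm ?u"
    proof -
      have "\<delta> * norm ?u \<le> 1 * norm ?u" using b by (intro mult_right_mono) auto
      moreover have "2 * M * (\<delta> * norm ?j) \<le> 2 * M * norm ?u" using u1 b by (intro mult_left_mono) auto
      ultimately show ?thesis by (simp add: algebra_simps)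
    qed
    also have "\<dots> \<le> 4 * M * norm ?u"
    proof -
      have "1 * norm ?u \<le> M * norm ?u" using b by (intro mult_right_mono) auto
      then show ?thesis using norm_ge_zero[of ?u] by linarith
    qed
    finally show ?thesis using b by (simp add: c_def field_simps)
  qed
  moreover have "c > 0" using k b by (simp add: c_def)
  ultimately show ?thesis using that by blast
qed

text \<open>For \<open>w = moebius A z\<close> the form in \<open>cross_form_ge\<close> is
  \<open>2 \<i> Im (moebius A z)\<close> times \<open>automorphy A z\<close>, which is bounded when
  \<open>z\<close> and \<open>moebius A z\<close> stay in \<open>K\<close>. So \<open>norm A\<close>
  is bounded.\<close>

lemma proper_discontinuity:
  assumes "compact K" "K \<subseteq> uhp"
  shows "finite {A \<in> G. \<exists>z\<in>K. moebius A z \<in> K}"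
proof -
  obtain c where c: "c > 0" "\<And>z w A. z \<in> K \<Longrightarrow> w \<in> K \<Longrightarrow> det A = 1 \<Longrightarrow>
    norm (of_real (A$1$1) * z + of_real (A$1$2) - cnj w * automorphy A z) \<ge> c * norm A"
    using cross_form_ge[OF assms] by metis
  obtain \<delta> M where b: "\<delta> > 0" "M > 0" "\<And>z. z \<in> K \<Longrightarrow> Im z \<ge> \<delta>" "\<And>z. z \<in> K \<Longrightarrow> norm z \<le> M"
    using compact_uhp_bounds[OF assms] by blast
  have "norm A \<le> 2 * M * sqrt (M / \<delta>) / c" if A: "A \<in> G" and z: "z \<in> K" and Az: "moebius A z \<in> K" for A z
  proof -
    have d: "det A = 1" and zu: "z \<in> uhp" using A G_det z assms by auto
    have "of_real (A$1$1) * z + of_real (A$1$2) - cnj (moebius A z) * automorphy A z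
      = (moebius A z - cnj (moebius A z)) * automorphy A z"
      using automorphy_nz[OF d zu] by (simp add: moebius_def[of A z] field_simps)
    then have "c * norm A \<le> norm (moebius A z - cnj (moebius A z)) * norm (automorphy A z)"
      using c(2)[OF z Az d] by (simp add: norm_mult)
    also have "\<dots> \<le> (2 * M) * sqrt (M / \<delta>)"
    proof (intro mult_mono)
      show "norm (moebius A z - cnj (moebius A z)) \<le> 2 * M"
        using norm_triangle_ineq4[of "moebius A z" "cnj (moebius A z)"] b(4)[OF Az] by simp
      have "Im (moebius A z) \<ge> \<delta>" using b Az by blast
      then have "\<delta> * (norm (automorphy A z))\<^sup>2 \<le> Im z"
        using Im_moebius[OF d zu] automorphy_nz[OF d zu] by (simp add: field_simps)
      also have "Im z \<le> M" using b(4)[OF z] abs_Im_le_cmod[of z] by linarith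
      finally have "(norm (automorphy A z))\<^sup>2 \<le> M / \<delta>" using b by (simp add: field_simps)
      then show "norm (automorphy A z) \<le> sqrt (M / \<delta>)" by (rule real_le_rsqrt)
    qed (use b in auto)
    finally show ?thesis using c by (simp add: field_simps)
  qed
  then show ?thesis by (intro finite_subset[OF _ finite_norm_le[of "2 * M * sqrt (M / \<delta>) / c"]]) auto
qed

section \<open>Stabilizers and orbits\<close>

lemma moebius_one [simp]: "moebius (mat 1) z = z" "automorphy (mat 1) z = 1"
  by (simp_all add: moebius_def automorphy_def)

lemma moebius_inv2:
  assumes "A \<in> G" "z \<in> uhp"
  shows "moebius (inv2 A) (moebius A z) = z" "moebius A (moebius (inv2 A) z) = z"
  using moebius_mult[of A z "inv2 A"] moebius_mult[of "inv2 A" z A] inv2_mult[of A] G_det[OF assms(1)] assms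
  by auto

text \<open>Taken among matrices, so that with \<open>A\<close> it contains \<open>- A\<close>; its
  order is twice that of the stabilizer in \<Gamma>.\<close>

definition stab :: "complex \<Rightarrow> (real^2^2) set" where
  "stab z = {A \<in> G. moebius A z = z}"

lemma finite_stab: "z \<in> uhp \<Longrightarrow> finite (stab z)"
  using proper_discontinuity[of "{z}"] by (auto simp: stab_def)

lemma stab_one: "mat 1 \<in> stab z" by (simp add: stab_def G_one)

lemma card_stab_pos: "z \<in> uhp \<Longrightarrow> card (stab z) > 0"
  using finite_stab[of z] stab_one[of z] card_gt_0_iff by blast

definition orb :: "complex \<Rightarrow> complex set" where
  "orb w = {moebius A w | A. A \<in> G}"

lemma orb_orbit_of: "orb w = orbit_of \<Gamma> w"
  by (simp add: orb_def orbit_of_def G_def)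

lemma orb_self: "w \<in> orb w"
  unfolding orb_def using G_one by (intro CollectI exI[of _ "mat 1"]) simp

lemma orb_uhp: "w \<in> uhp \<Longrightarrow> z \<in> orb w \<Longrightarrow> z \<in> uhp"
  by (auto simp: orb_def G_det)

lemma moebius_in_orb_iff:
  assumes "A \<in> G" "z \<in> uhp" "w \<in> uhp" shows "moebius A z \<in> orb w \<longleftrightarrow> z \<in> orb w"
proof
  assume "z \<in> orb w"
  then obtain B where "B \<in> G" "z = moebius B w" by (auto simp: orb_def)
  then have "moebius A z = moebius (A ** B) w" using moebius_mult[OF G_det assms(3)] by simp
  then show "moebius A z \<in> orb w" using G_mult[OF assms(1) \<open>B \<in> G\<close>] by (auto simp: orb_def)
next
  assume "moebius A z \<in> orb w"
  then obtain B where "B \<in> G" "moebius A z = moebius B w" by (auto simp: orb_def)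
  then have "z = moebius (inv2 A ** B) w"
    using moebius_inv2(1)[OF assms(1,2)] moebius_mult[OF G_det assms(3)] by simp
  then show "z \<in> orb w" using G_mult[OF G_inv[OF assms(1)] \<open>B \<in> G\<close>] by (auto simp: orb_def)
qed

lemma orb_sym: "w \<in> uhp \<Longrightarrow> z \<in> orb w \<Longrightarrow> w \<in> orb z"
  unfolding orb_def using moebius_inv2(1) G_inv by (force simp: G_det)

lemma orb_eq: "w \<in> uhp \<Longrightarrow> z \<in> orb w \<Longrightarrow> orb z = orb w"
proof -
  assume w: "w \<in> uhp" and z: "z \<in> orb w"
  then obtain B where B: "B \<in> G" "z = moebius B w" by (auto simp: orb_def)
  have zu: "z \<in> uhp" using orb_uhp w z by blast
  have "x \<in> orb z \<longleftrightarrow> x \<in> orb w" for x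
  proof
    assume "x \<in> orb z"
    then obtain A where "A \<in> G" "x = moebius A z" by (auto simp: orb_def)
    then show "x \<in> orb w" using moebius_in_orb_iff[of A z w] zu w z by simp
  next
    assume "x \<in> orb w"
    then obtain A where "A \<in> G" "x = moebius A w" by (auto simp: orb_def)
    then show "x \<in> orb z" using moebius_in_orb_iff[of A w z] zu w orb_sym[OF w z] by simp
  qed
  then show ?thesis by blast
qed

text \<open>By proper discontinuity only finitely many \<open>A\<close> bring the initial discs
  together without sending \<open>z\<close> to \<open>w\<close>. Each of them is excluded on smaller
  discs by continuity at \<open>z\<close>, and the least of these radii is taken.\<close>

lemma separating_radius:
  assumes "z \<in> uhp" "w \<in> uhp"
  obtains e where "e > 0" "cball z e \<subseteq> uhp" "cball w e \<subseteq> uhp"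
    "\<And>A x. A \<in> G \<Longrightarrow> x \<in> cball z e \<Longrightarrow> moebius A x \<in> cball w e \<Longrightarrow> moebius A z = w"
proof -
  obtain e0 where e0: "e0 > 0" "cball z e0 \<subseteq> uhp" "cball w e0 \<subseteq> uhp"
  proof -
    obtain a b where "a > 0" "cball z a \<subseteq> uhp" "b > 0" "cball w b \<subseteq> uhp"
      using open_contains_cball open_uhp assms by metis
    then show ?thesis using that[of "min a b"] by (auto simp: subset_iff)
  qed
  let ?F = "{A \<in> G. (\<exists>x\<in>cball z e0 \<union> cball w e0. moebius A x \<in> cball z e0 \<union> cball w e0) \<and> moebius A z \<noteq> w}"
  have fin: "finite ?F"
    by (rule finite_subset[OF _ proper_discontinuity[of "cball z e0 \<union> cball w e0"]])
      (use e0 in \<open>auto simp: compact_Un\<close>)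
  have ex: "\<exists>e. e > 0 \<and> e \<le> e0 \<and> (\<forall>x\<in>cball z e. moebius A x \<notin> cball w e)" if A: "A \<in> ?F" for A
  proof -
    have "isCont (moebius A) z" using A G_det moebius_has_deriv[of A z] assms DERIV_isCont by blast
    then have "\<forall>e>0. \<exists>d>0. \<forall>x. dist x z < d \<longrightarrow> dist (moebius A x) (moebius A z) < e"
      by (simp add: continuous_at_eps_delta)
    moreover define r where "r = dist (moebius A z) w / 2"
    moreover have "r > 0" using A by (simp add: r_def)
    ultimately obtain d where d: "d > 0" "\<And>x. dist x z < d \<Longrightarrow> dist (moebius A x) (moebius A z) < r" by metis
    let ?e = "min e0 (min (d / 2) r)"
    have "moebius A x \<notin> cball w ?e" if "x \<in> cball z ?e" for x
    proof
      assume "moebius A x \<in> cball w ?e"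
      then have "dist (moebius A x) w \<le> r" by (simp add: dist_commute)
      moreover have "dist (moebius A x) (moebius A z) < r" using that d by (simp add: dist_commute)
      ultimately have "dist (moebius A z) w < 2 * r"
        using dist_triangle[of "moebius A z" w "moebius A x"] by (simp add: dist_commute)
      then show False by (simp add: r_def)
    qed
    then show ?thesis using e0 d \<open>r > 0\<close> by (intro exI[of _ ?e]) auto
  qed
  have "\<exists>r. \<forall>A\<in>?F. r A > 0 \<and> r A \<le> e0 \<and> (\<forall>x\<in>cball z (r A). moebius A x \<notin> cball w (r A))"
    by (rule bchoice) (use ex in blast)
  then obtain r where r: "\<And>A. A \<in> ?F \<Longrightarrow> r A > 0 \<and> r A \<le> e0 \<and> (\<forall>x\<in>cball z (r A). moebius A x \<notin> cball w (r A))"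
    by blast
  define e where "e = Min (insert e0 (r ` ?F))"
  have e: "e \<le> e0" "\<And>A. A \<in> ?F \<Longrightarrow> e \<le> r A" using fin by (auto simp: e_def)
  have epos: "e > 0" unfolding e_def using fin r e0 by (subst Min_gr_iff) auto
  show ?thesis
  proof (rule that[OF epos])
    show "cball z e \<subseteq> uhp" "cball w e \<subseteq> uhp" using e0 e(1) by (meson order_trans subset_cball)+
    fix A x assume A: "A \<in> G" "x \<in> cball z e" "moebius A x \<in> cball w e"
    show "moebius A z = w"
    proof (rule ccontr)
      assume "moebius A z \<noteq> w"
      moreover have "x \<in> cball z e0" "moebius A x \<in> cball w e0" using A e(1) by auto
      ultimately have F: "A \<in> ?F" using A(1) by blast
      then have "x \<in> cball z (r A)" "moebius A x \<in> cball w (r A)" using A e(2)[OF F] by auto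
      then show False using r[OF F] by blast
    qed
  qed
qed

subsection \<open>Meromorphic forms of integral weight\<close>

definition wt :: "int \<Rightarrow> merofun set" where
  "wt k = {f. \<forall>A\<in>G. mcomp A f = autofun A powi k * f}"

text \<open>\<open>MI k\<close> is the paper's \<open>M\<^sub>k(\<Gamma>;{\<i>})\<close>, with \<open>k\<close> of either sign; in \<open>MP k n\<close> the poles have order at
  most \<open>n\<close>.\<close>

definition MI :: "int \<Rightarrow> merofun set" where
  "MI k = {f \<in> wt k. \<forall>z\<in>uhp - orb \<i>. mord_ge z f 0}"

definition MP :: "int \<Rightarrow> int \<Rightarrow> merofun set" where
  "MP k n = {f \<in> MI k. mord_ge \<i> f (- n)}"

lemma wt_0 [simp]: "0 \<in> wt k" by (simp add: wt_def G_det)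
lemma wt_add: "f \<in> wt k \<Longrightarrow> g \<in> wt k \<Longrightarrow> f + g \<in> wt k"
  by (simp add: wt_def G_det algebra_simps)
lemma wt_diff: "f \<in> wt k \<Longrightarrow> g \<in> wt k \<Longrightarrow> f - g \<in> wt k"
  by (simp add: wt_def G_det algebra_simps)
lemma wt_mult: "f \<in> wt k \<Longrightarrow> g \<in> wt l \<Longrightarrow> f * g \<in> wt (k + l)"
  by (simp add: wt_def G_det power_int_add mult_ac)
lemma wt_inverse: "f \<in> wt k \<Longrightarrow> inverse f \<in> wt (- k)"
  by (simp add: wt_def G_det power_int_minus)
lemma wt_divide: "f \<in> wt k \<Longrightarrow> g \<in> wt l \<Longrightarrow> f / g \<in> wt (k - l)"
  using wt_mult[OF _ wt_inverse, of f k g l] by (simp add: divide_inverse)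
lemma wt_const [simp]: "mero_const c \<in> wt 0"
  by (simp add: wt_def G_det)
lemma mord_wt:
  assumes "f \<in> wt k" "A \<in> G" "z \<in> uhp" shows "mord (moebius A z) f = mord z f"
proof (cases "f = 0")
  case False
  have "mord (moebius A z) f = mord z (mcomp A f)" using assms G_det by (simp add: mord_mcomp)
  also have "\<dots> = mord z (autofun A powi k * f)" using assms by (simp add: wt_def)
  also have "\<dots> = mord z f" using False assms G_det by (simp add: mord_mult)
  finally show ?thesis .
qed simp

lemma mord_ge_wt:
  "f \<in> wt k \<Longrightarrow> A \<in> G \<Longrightarrow> z \<in> uhp \<Longrightarrow> mord_ge (moebius A z) f n \<longleftrightarrow> mord_ge z f n"
  using mord_wt[of f k A z] G_det by (simp add: mord_ge_iff)

lemma mord_ge_orb: "f \<in> wt k \<Longrightarrow> w \<in> uhp \<Longrightarrow> z \<in> orb w \<Longrightarrow> mord_ge z f n \<longleftrightarrow> mord_ge w f n"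
  by (auto simp: orb_def mord_ge_wt)

lemma MI_wt: "f \<in> MI k \<Longrightarrow> f \<in> wt k" by (simp add: MI_def)
lemma MP_MI: "f \<in> MP k n \<Longrightarrow> f \<in> MI k" by (simp add: MP_def)
lemma MP_wt: "f \<in> MP k n \<Longrightarrow> f \<in> wt k" by (simp add: MP_def MI_def)
lemma MI_regular: "f \<in> MI k \<Longrightarrow> z \<in> uhp \<Longrightarrow> z \<notin> orb \<i> \<Longrightarrow> mord_ge z f 0" by (simp add: MI_def)

lemma MI_0 [simp]: "0 \<in> MI k" by (simp add: MI_def)
lemma MI_add: "f \<in> MI k \<Longrightarrow> g \<in> MI k \<Longrightarrow> f + g \<in> MI k"
  by (auto simp: MI_def intro: wt_add mord_ge_add)
lemma MI_mult: "f \<in> MI k \<Longrightarrow> g \<in> MI l \<Longrightarrow> f * g \<in> MI (k + l)"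
  using mord_ge_mult[of _ f 0 g 0] by (auto simp: MI_def intro: wt_mult)
lemma MI_const [simp]: "mero_const c \<in> MI 0"
  by (simp add: MI_def)
lemma MI_sum: "(\<And>i. i \<in> S \<Longrightarrow> f i \<in> MI k) \<Longrightarrow> sum f S \<in> MI k"
  by (induction S rule: infinite_finite_induct) (auto intro: MI_add)
lemma MI_power: "f \<in> MI k \<Longrightarrow> f ^ n \<in> MI (int n * k)"
proof (induction n)
  case 0 then show ?case using MI_const[of 1] by simp
next
  case (Suc n) then show ?case using MI_mult[of f k "f ^ n" "int n * k"] by (simp add: algebra_simps)
qed

lemma MP_0 [simp]: "0 \<in> MP k n" by (simp add: MP_def)
lemma MP_add: "f \<in> MP k n \<Longrightarrow> g \<in> MP k n \<Longrightarrow> f + g \<in> MP k n"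
  by (auto simp: MP_def intro: MI_add mord_ge_add)
lemma MP_mult: "f \<in> MP k n \<Longrightarrow> g \<in> MP l m \<Longrightarrow> f * g \<in> MP (k + l) (n + m)"
  using mord_ge_mult[of \<i> f "- n" g "- m"] by (auto simp: MP_def intro: MI_mult)
lemma MP_const [simp]: "mero_const c \<in> MP 0 0"
  by (simp add: MP_def)
lemma MP_const_mult: "f \<in> MP k n \<Longrightarrow> mero_const c * f \<in> MP k n"
  using MP_mult[OF MP_const, of f k n] by simp
lemma MP_sum: "(\<And>i. i \<in> S \<Longrightarrow> f i \<in> MP k n) \<Longrightarrow> sum f S \<in> MP k n"
  by (induction S rule: infinite_finite_induct) (auto intro: MP_add)
lemma MP_power: "f \<in> MP k n \<Longrightarrow> f ^ m \<in> MP (int m * k) (int m * n)"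
proof (induction m)
  case 0 then show ?case using MP_const[of 1] by simp
next
  case (Suc m) then show ?case using MP_mult[of f k n "f ^ m" "int m * k" "int m * n"] by (simp add: algebra_simps)
qed
lemma MP_mono: "f \<in> MP k n \<Longrightarrow> n \<le> m \<Longrightarrow> f \<in> MP k m"
  by (auto simp: MP_def intro: mord_ge_mono)
text \<open>Invariance carries regularity at \<open>\<i>\<close> to its whole orbit; so
  \<open>MP k 0\<close> consists of the holomorphic forms of weight \<open>k\<close>.\<close>

lemma MP_0_iff: "f \<in> MP k 0 \<longleftrightarrow> f \<in> wt k \<and> (\<forall>z\<in>uhp. mord_ge z f 0)"
  using mord_ge_orb[of f k \<i>] by (auto simp: MP_def MI_def)

lemma modular_forms_eq: "modular_forms \<Gamma> k = MP (int k) 0"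
proof -
  have "f \<in> wt (int k) \<longleftrightarrow>
     (\<forall>A\<in>G. \<forall>z\<in>uhp. fun_of f (moebius A z) = automorphy A z ^ k * fun_of f z)" for f
    using mcomp_eq_powi_iff[of _ f "int k"] G_det by (simp add: wt_def)
  then show ?thesis
    by (auto simp: modular_forms_def MP_0_iff holomorphic_iff_mord mord_ge_0_iff G_def)
qed

lemma mcomp_deriv_wt:
  assumes "f \<in> wt k" "A \<in> G"
  shows "mcomp A (mero_deriv f) = autofun A powi (k + 2) * mero_deriv f +
    of_int k * mero_const (of_real (A$2$1)) * autofun A powi (k + 1) * f"
proof -
  let ?J = "autofun A"
  have d: "det A = 1" using assms G_det by blast
  have J: "?J \<noteq> 0" using d by simp
  have "mcomp A (mero_deriv f) = mero_deriv (mcomp A f) * ?J ^ 2"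
    using J by (simp add: mero_deriv_mcomp[OF d])
  also have "mcomp A f = ?J powi k * f" using assms by (simp add: wt_def)
  also have "mero_deriv (?J powi k * f) =
     ?J powi k * mero_deriv f + of_int k * ?J powi (k - 1) * mero_const (of_real (A$2$1)) * f"
    using J by (simp add: mero_deriv_mult mero_deriv_powi mero_deriv_autofun[OF d])
  also have "\<dots> * ?J ^ 2 = (?J powi k * ?J powi 2) * mero_deriv f +
      of_int k * mero_const (of_real (A$2$1)) * (?J powi (k - 1) * ?J powi 2) * f"
    by (simp add: algebra_simps)
  also have "?J powi k * ?J powi 2 = ?J powi (k + 2)" using J by (intro power_int_add[symmetric]) auto
  also have "?J powi (k - 1) * ?J powi 2 = ?J powi (k - 1 + 2)" using J by (intro power_int_add[symmetric]) auto
  finally show ?thesis by (simp add: add.commute)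
qed

subsection \<open>Zeros and poles\<close>

lemma mord_0I:
  assumes "z \<in> uhp" "fun_of f z \<noteq> 0" shows "mord z f = 0"
proof -
  have "mord z f \<ge> 0" using fun_of_pole assms by force
  moreover have "f \<noteq> 0" using assms by (auto simp: zero_merofun.rep_eq)
  ultimately show ?thesis using fun_of_eq_0_iff[of z f] assms by auto
qed

lemma finite_mord_nz:
  assumes "compact K" "K \<subseteq> uhp"
  shows "finite {z \<in> K. mord z f \<noteq> 0}"
proof (cases "f = 0")
  case False
  show ?thesis
  proof (rule ccontr)
    assume "infinite {z \<in> K. mord z f \<noteq> 0}"
    then obtain x where x: "x \<in> K" "x islimpt {z \<in> K. mord z f \<noteq> 0}"
      using Heine_Borel_imp_Bolzano_Weierstrass[OF assms(1)] by blast
    then have xu: "x \<in> uhp" using assms by blast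
    have "eventually (\<lambda>w. mord w f = 0) (at x)"
      using merofun_nonzero_at[OF False xu] eventually_in_uhp[OF xu]
      by eventually_elim (simp add: mord_0I)
    then have "eventually (\<lambda>w. w \<notin> {z \<in> K. mord z f \<noteq> 0}) (at x)"
      by (rule eventually_mono) simp
    then show False using x(2) unfolding islimpt_iff_eventually by blast
  qed
qed simp

definition FK :: "complex set" where
  "FK = (SOME K. compact K \<and> K \<subseteq> uhp \<and> (\<forall>z\<in>uhp. \<exists>A\<in>G. moebius A z \<in> K))"

lemma FK: "compact FK" "FK \<subseteq> uhp" "\<And>z. z \<in> uhp \<Longrightarrow> \<exists>A\<in>G. moebius A z \<in> FK"
proof -
  have "\<exists>K. compact K \<and> K \<subseteq> uhp \<and> (\<forall>z\<in>uhp. \<exists>A\<in>G. moebius A z \<in> K)"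
    using compact_fundamental by metis
  from someI_ex[OF this] show "compact FK" "FK \<subseteq> uhp" "\<And>z. z \<in> uhp \<Longrightarrow> \<exists>A\<in>G. moebius A z \<in> FK"
    unfolding FK_def by auto
qed

text \<open>For \<open>f\<close> of weight \<open>-m\<close>, the function \<open>\<bar>f\<bar>\<^sup>2 y\<^sup>-\<^sup>m\<close> is invariant and so has a maximum, at \<open>z0\<close> say. As
  \<open>y / \<bar>z - cnj z0\<bar>\<^sup>2\<close> is maximal exactly at \<open>z0\<close>, the maximum principle applies to \<open>f(z) / (z - cnj z0)\<^sup>m\<close>.\<close>

lemma nonpositive_weight:
  assumes f: "f \<in> wt (- int m)" "\<And>z. z \<in> uhp \<Longrightarrow> mord_ge z f 0"
  shows "\<exists>c. f = mero_const c" "m > 0 \<Longrightarrow> f = 0"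
proof -
  define \<Phi> where "\<Phi> z = (norm (fun_of f z))\<^sup>2 / Im z ^ m" for z
  have hol: "fun_of f holomorphic_on uhp"
    using f(2) by (auto simp: holomorphic_iff_mord mord_ge_0_iff)
  have inv: "\<Phi> (moebius A z) = \<Phi> z" if A: "A \<in> G" and z: "z \<in> uhp" for A z
  proof -
    have d: "det A = 1" using A G_det by blast
    have j: "norm (automorphy A z) \<noteq> 0" using d z by simp
    have "fun_of f (moebius A z) = automorphy A z powi (- int m) * fun_of f z"
      using mcomp_eq_powi_iff[OF d, of f "- int m"] f(1) A z by (simp add: wt_def)
    then have "(norm (fun_of f (moebius A z)))\<^sup>2 = (norm (fun_of f z))\<^sup>2 / ((norm (automorphy A z))\<^sup>2) ^ m"
      by (simp add: norm_mult norm_inverse norm_power norm_divide power_int_minus power_divide divide_inverse power_mult_distrib power_inverse mult.commute flip: power_mult)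
    moreover have "Im z > 0" using z by (simp add: uhp_def)
    ultimately show ?thesis
      using j unfolding \<Phi>_def Im_moebius[OF d z] by (simp add: power_divide)
  qed
  have cont: "continuous_on FK \<Phi>"
    unfolding \<Phi>_def using FK(2) holomorphic_on_imp_continuous_on[OF hol]
    by (intro continuous_intros) (auto simp: uhp_def intro: continuous_on_subset)
  have "FK \<noteq> {}" using FK(3)[OF ii_uhp] by blast
  then obtain z0 where z0: "z0 \<in> FK" "\<And>z. z \<in> FK \<Longrightarrow> \<Phi> z \<le> \<Phi> z0"
    using continuous_attains_sup[OF FK(1) _ cont] by blast
  have z0u: "z0 \<in> uhp" using z0 FK by blast
  have max: "\<Phi> z \<le> \<Phi> z0" if "z \<in> uhp" for z
    using FK(3)[OF that] inv[OF _ that] z0(2) by metis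
  define H where "H z = fun_of f z / (z - cnj z0) ^ m" for z
  have nz: "z - cnj z0 \<noteq> 0" if "z \<in> uhp" for z
    using that z0u by (auto simp: uhp_def complex_eq_iff)
  define q where "q z = Im z / (norm (z - cnj z0))\<^sup>2" for z
  have nH: "(norm (H z))\<^sup>2 = \<Phi> z * q z ^ m" if "z \<in> uhp" for z
    using that nz[OF that] by (simp add: H_def \<Phi>_def q_def norm_divide norm_power power_divide uhp_def mult.commute flip: power_mult)
  have qd: "(norm (z - cnj z0))\<^sup>2 = (norm (z - z0))\<^sup>2 + 4 * Im z * Im z0" for z
    unfolding cmod_power2 by (simp add: power2_eq_square algebra_simps)
  have q0: "q z0 = 1 / (4 * Im z0)" using z0u by (simp add: q_def qd uhp_def)
  have qle: "q z \<le> q z0" "z \<noteq> z0 \<Longrightarrow> q z < q z0" "q z > 0" if "z \<in> uhp" for z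
  proof -
    have pos: "Im z > 0" "Im z0 > 0" using that z0u by (auto simp: uhp_def)
    then have p: "(norm (z - z0))\<^sup>2 + 4 * Im z * Im z0 > 0" by (simp add: add_nonneg_pos)
    show "q z \<le> q z0" using pos p unfolding q0 unfolding q_def qd by (simp add: field_simps)
    show "q z < q z0" if "z \<noteq> z0"
    proof -
      have "(norm (z - z0))\<^sup>2 > 0" using that by simp
      then show ?thesis using pos p unfolding q0 unfolding q_def qd by (simp add: field_simps)
    qed
    show "q z > 0" using pos p unfolding q_def qd by simp
  qed
  have le: "norm (H z) \<le> norm (H z0)" if "z \<in> uhp" for z
  proof (rule power2_le_imp_le)
    show "(norm (H z))\<^sup>2 \<le> (norm (H z0))\<^sup>2" unfolding nH[OF that] nH[OF z0u]
      using max[OF that] qle[OF that] z0u by (intro mult_mono power_mono) (auto simp: \<Phi>_def uhp_def)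
  qed simp
  have "H holomorphic_on uhp" unfolding H_def using nz by (intro holomorphic_intros hol) auto
  then have "H constant_on uhp"
    by (rule maximum_modulus_principle[where U = uhp and \<xi> = z0])
      (use open_uhp connected_uhp z0u le in auto)
  then have const: "H z = H z0" if "z \<in> uhp" for z using that z0u unfolding constant_on_def by metis
  show "f = 0" if m: "m > 0"
  proof -
    \<comment> \<open>Any point other than \<open>z0\<close> would do: \<open>q\<close> is strictly
      smaller there, so constancy of \<open>H\<close> forces \<open>\<Phi> z0 = 0\<close>.\<close>
    let ?z = "z0 + \<i>"
    have z: "?z \<in> uhp" using z0u by (simp add: uhp_def)
    have "\<Phi> z0 = 0"
    proof (rule ccontr)
      assume "\<Phi> z0 \<noteq> 0"
      moreover have "\<Phi> z0 \<ge> 0" using z0u by (simp add: \<Phi>_def uhp_def)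
      ultimately have pos: "\<Phi> z0 > 0" by simp
      have "q ?z ^ m < q z0 ^ m" using qle(2,3)[OF z] m by (intro power_strict_mono) auto
      then have "\<Phi> z0 * q ?z ^ m < \<Phi> z0 * q z0 ^ m" using pos by simp
      moreover have "\<Phi> ?z * q ?z ^ m \<le> \<Phi> z0 * q ?z ^ m"
        using max[OF z] qle(3)[OF z] by (intro mult_right_mono) auto
      ultimately have "(norm (H ?z))\<^sup>2 < (norm (H z0))\<^sup>2" unfolding nH[OF z] nH[OF z0u] by simp
      then show False using const[OF z] by simp
    qed
    then have "\<Phi> z \<le> 0" if "z \<in> uhp" for z using max that by metis
    have "fun_of f z = 0" if "z \<in> uhp" for z
    proof -
      have "Im z ^ m > 0" using that by (simp add: uhp_def)
      then have "(norm (fun_of f z))\<^sup>2 \<le> 0"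
        using \<open>\<And>z. z \<in> uhp \<Longrightarrow> \<Phi> z \<le> 0\<close>[OF that] unfolding \<Phi>_def by (simp add: divide_le_0_iff)
      then show ?thesis by simp
    qed
    then show "f = 0" by (intro merofun_eqI_hol) (simp add: zero_merofun.rep_eq)
  qed
  show "\<exists>c. f = mero_const c"
  proof (cases "m = 0")
    case True
    then have "f = mero_const (H z0)" using const by (intro merofun_eqI_hol) (simp add: H_def)
    then show ?thesis ..
  next
    case False
    then have "f = mero_const 0" using \<open>m > 0 \<Longrightarrow> f = 0\<close> by simp
    then show ?thesis ..
  qed
qed

lemma MP_neg_weight: "k < 0 \<Longrightarrow> f \<in> MP k 0 \<Longrightarrow> f = 0"
  using nonpositive_weight(2)[of f "nat (- k)"] by (simp add: MP_0_iff)

lemma MP_0_const: "f \<in> MP 0 0 \<Longrightarrow> \<exists>c. f = mero_const c"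
  using nonpositive_weight(1)[of f 0] by (simp add: MP_0_iff)

text \<open>Otherwise \<open>inverse f\<close> would be a nonzero holomorphic form of negative
  weight.\<close>

lemma positive_weight_zero:
  assumes "k > 0" "f \<in> MP k 0" shows "\<exists>z\<in>uhp. f = 0 \<or> mord z f > 0"
proof (rule ccontr)
  assume *: "\<not> ?thesis"
  then have f: "f \<noteq> 0" using ii_uhp by blast
  have 0: "mord z f = 0" if "z \<in> uhp" for z
    using * that f assms by (force simp: MP_0_iff mord_ge_iff)
  have "inverse f \<in> MP (- k) 0"
    using assms(2) 0 unfolding MP_0_iff by (auto intro: wt_inverse simp: mord_ge_iff)
  then have "inverse f = 0" using MP_neg_weight[of "- k" "inverse f"] assms by simp
  then show False using f by simp
qed

end

lemma eventually_moebius: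
  assumes "det A = 1" "z \<in> uhp" "eventually P (at (moebius A z))"
  shows "eventually (\<lambda>w. P (moebius A w)) (at z)"
proof -
  have "isCont (moebius A) z" using moebius_has_deriv[OF assms(1,2)] DERIV_isCont by blast
  then have "(moebius A \<longlongrightarrow> moebius A z) (at z)" by (rule isContD)
  moreover have "eventually (\<lambda>w. moebius A w \<noteq> moebius A z) (at z)"
  proof -
    have "w = z" if "w \<in> uhp" "moebius A w = moebius A z" for w
    proof -
      have "moebius (inv2 A ** A) w = moebius (inv2 A ** A) z"
        using moebius_mult[OF assms(1)] that assms(2) by simp
      then show ?thesis by (simp add: inv2_mult(1)[OF assms(1)] moebius_def automorphy_def)
    qed
    moreover have "eventually (\<lambda>w. w \<in> uhp \<and> w \<noteq> z) (at z)"
      using eventually_in_uhp[OF assms(2)] by (auto simp: eventually_at_filter elim: eventually_mono)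
    ultimately show ?thesis by (auto elim: eventually_mono)
  qed
  ultimately have "filterlim (moebius A) (at (moebius A z)) (at z)" by (simp add: filterlim_at)
  then show ?thesis using assms(3) by (rule eventually_compose_filterlim[rotated])
qed

context fuchsian
begin

section \<open>Poincare series\<close>

text \<open>This is \<open>(moebius A z - w) * automorphy A z\<close>, written as an affine function
  of \<open>z\<close>.\<close>

definition uform :: "complex \<Rightarrow> real^2^2 \<Rightarrow> complex \<Rightarrow> complex" where
  "uform w A z = of_real (A$1$1) * z + of_real (A$1$2) - w * automorphy A z"

text \<open>The weight \<open>l\<close> translate by \<open>A\<close> of \<open>((z - cnj z0) / (z - z0))\<^sup>n / (z - cnj z0)\<^sup>l\<close>.\<close>

definition pterm :: "complex \<Rightarrow> nat \<Rightarrow> nat \<Rightarrow> real^2^2 \<Rightarrow> complex \<Rightarrow> complex" where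
  "pterm z0 l n A z = (uform (cnj z0) A z / uform z0 A z) ^ n / uform (cnj z0) A z ^ l"

definition poinc :: "complex \<Rightarrow> nat \<Rightarrow> nat \<Rightarrow> complex \<Rightarrow> complex" where
  "poinc z0 l n z = (\<Sum>\<^sub>\<infinity>A\<in>G. pterm z0 l n A z)"

lemma uform_eq:
  assumes "det A = 1" "z \<in> uhp" shows "uform w A z = (moebius A z - w) * automorphy A z"
  using automorphy_nz[OF assms] by (simp add: uform_def moebius_def field_simps)

lemma uform_cnj_nz:
  assumes "z0 \<in> uhp" "det A = 1" "z \<in> uhp" shows "uform (cnj z0) A z \<noteq> 0"
proof -
  have "moebius A z \<noteq> cnj z0"
  proof
    assume "moebius A z = cnj z0"
    then have "Im (moebius A z) = - Im z0" by simp
    then show False using moebius_uhp[OF assms(2,3)] assms(1) by (simp add: uhp_def)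
  qed
  then show ?thesis using automorphy_nz[OF assms(2,3)] by (simp add: uform_eq[OF assms(2,3)])
qed

lemma pterm_moebius:
  assumes A: "det A = 1" and B: "det B = 1" and z: "z \<in> uhp"
  shows "pterm z0 l n A (moebius B z) = automorphy B z ^ l * pterm z0 l n (A ** B) z"
proof -
  have "uform w A (moebius B z) = uform w (A ** B) z / automorphy B z" for w
    using automorphy_nz[OF B z] A B z
    by (simp add: uform_eq det_mul moebius_mult[OF B z] automorphy_mult[OF B z])
  then show ?thesis using automorphy_nz[OF B z] by (simp add: pterm_def power_divide)
qed

lemma poinc_moebius:
  assumes B: "B \<in> G" and z: "z \<in> uhp"
  shows "poinc z0 l n (moebius B z) = automorphy B z ^ l * poinc z0 l n z"
proof -
  have bij: "bij_betw (\<lambda>A. A ** B) G G"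
  proof (rule bij_betw_byWitness[where f' = "\<lambda>A. A ** inv2 B"])
    have "A ** B ** inv2 B = A" "A ** inv2 B ** B = A" for A
      using inv2_mult[OF G_det[OF B]] by (simp_all flip: matrix_mul_assoc)
    then show "\<forall>A\<in>G. A ** B ** inv2 B = A" "\<forall>A\<in>G. A ** inv2 B ** B = A" by auto
  qed (use B G_mult G_inv in auto)
  have "poinc z0 l n (moebius B z) = (\<Sum>\<^sub>\<infinity>A\<in>G. automorphy B z ^ l * pterm z0 l n (A ** B) z)"
    unfolding poinc_def using G_det B z by (intro infsum_cong pterm_moebius) auto
  also have "\<dots> = automorphy B z ^ l * (\<Sum>\<^sub>\<infinity>A\<in>G. pterm z0 l n (A ** B) z)"
    by (rule infsum_cmult_right')
  also have "(\<Sum>\<^sub>\<infinity>A\<in>G. pterm z0 l n (A ** B) z) = poinc z0 l n z"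
    unfolding poinc_def by (rule infsum_reindex_bij_betw[OF bij])
  finally show ?thesis .
qed

text \<open>\<open>moebius A z - cnj z0\<close> and \<open>moebius A z - z0\<close> differ by a
  constant of modulus \<open>2 * Im z0\<close>, so their quotient is bounded away from
  \<open>z0\<close>; the remaining denominator is bounded below by
  \<open>cross_form_ge\<close>.\<close>

lemma pterm_bound:
  assumes "z0 \<in> uhp" "compact C" "C \<subseteq> uhp" "\<delta> > 0"
  obtains c where "\<And>A z. A \<in> G \<Longrightarrow> z \<in> C \<Longrightarrow> moebius A z \<notin> cball z0 \<delta> \<Longrightarrow> norm (pterm z0 l n A z) \<le> c * (1 / norm A ^ l)"
proof -
  have "compact (insert z0 C)" "insert z0 C \<subseteq> uhp" using assms by auto
  then obtain k where k: "k > 0" "\<And>z w A. z \<in> insert z0 C \<Longrightarrow> w \<in> insert z0 C \<Longrightarrow> det A = 1 \<Longrightarrow>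
    norm (of_real (A$1$1) * z + of_real (A$1$2) - cnj w * automorphy A z) \<ge> k * norm A"
    using cross_form_ge by metis
  define q where "q = 1 + 2 * Im z0 / \<delta>"
  have q0: "q \<ge> 0" using assms by (simp add: q_def uhp_def)
  show ?thesis
  proof (rule that[of "q ^ n / k ^ l"])
    fix A z assume A: "A \<in> G" and z: "z \<in> C" and n: "moebius A z \<notin> cball z0 \<delta>"
    have d: "det A = 1" and zu: "z \<in> uhp" using A z assms G_det by auto
    have N: "norm A \<ge> 1" using norm_ge_1[OF d] .
    have u: "norm (uform (cnj z0) A z) \<ge> k * norm A" using k(2)[of z z0 A] z d by (simp add: uform_def)
    have d0: "norm (moebius A z - z0) > \<delta>" using n by (simp add: dist_norm norm_minus_commute)
    have "norm (uform (cnj z0) A z / uform z0 A z) = norm (moebius A z - cnj z0) / norm (moebius A z - z0)"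
      using automorphy_nz[OF d zu] by (simp add: uform_eq[OF d zu] norm_divide)
    also have "\<dots> \<le> (norm (moebius A z - z0) + 2 * Im z0) / norm (moebius A z - z0)"
    proof (intro divide_right_mono)
      have "norm (z0 - cnj z0) = 2 * Im z0"
        using assms(1) by (simp add: complex_diff_cnj norm_mult uhp_def)
      then show "norm (moebius A z - cnj z0) \<le> norm (moebius A z - z0) + 2 * Im z0"
        using norm_triangle_ineq[of "moebius A z - z0" "z0 - cnj z0"] by simp
    qed simp
    also have "\<dots> \<le> q"
    proof -
      have "2 * Im z0 / norm (moebius A z - z0) \<le> 2 * Im z0 / \<delta>"
        using d0 assms by (intro divide_left_mono mult_pos_pos) (auto simp: uhp_def)
      moreover have "norm (moebius A z - z0) \<noteq> 0" using d0 assms(4) by linarith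
      ultimately show ?thesis unfolding q_def add_divide_distrib by simp
    qed
    finally have r: "norm (uform (cnj z0) A z / uform z0 A z) \<le> q" .
    have "norm (pterm z0 l n A z) = norm (uform (cnj z0) A z / uform z0 A z) ^ n / norm (uform (cnj z0) A z) ^ l"
      unfolding pterm_def by (simp add: norm_divide norm_power)
    also have "\<dots> \<le> q ^ n / (k * norm A) ^ l"
      using r u k N q0 by (intro frac_le power_mono zero_less_power mult_pos_pos) auto
    finally show "norm (pterm z0 l n A z) \<le> q ^ n / k ^ l * (1 / norm A ^ l)"
      by (simp add: power_mult_distrib)
  qed
qed

text \<open>Only finitely many \<open>A\<close> send \<open>z1\<close> to \<open>z0\<close>, and
  only their terms can have a pole at \<open>z1\<close>; the others converge uniformly nearby. The
  value of \<open>h\<close> at \<open>z1\<close> is recorded for the proof that a series does not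
  vanish.\<close>

lemma poinc_local:
  assumes z0: "z0 \<in> uhp" and z1: "z1 \<in> uhp" and l: "l \<ge> 10"
  shows "\<exists>r h. r > 0 \<and> ball z1 r \<subseteq> uhp \<and> h holomorphic_on ball z1 r \<and>
    (\<forall>z\<in>ball z1 r. poinc z0 l n z = (\<Sum>A\<in>{A \<in> G. moebius A z1 = z0}. pterm z0 l n A z) + h z) \<and>
    h z1 = (\<Sum>\<^sub>\<infinity>A\<in>G - {A \<in> G. moebius A z1 = z0}. pterm z0 l n A z1)"
proof -
  let ?E = "{A \<in> G. moebius A z1 = z0}"
  obtain r where r: "r > 0" "cball z1 r \<subseteq> uhp" "cball z0 r \<subseteq> uhp"
    "\<And>A x. A \<in> G \<Longrightarrow> x \<in> cball z1 r \<Longrightarrow> moebius A x \<in> cball z0 r \<Longrightarrow> moebius A z1 = z0"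
    using separating_radius[OF z1 z0] by metis
  have finE: "finite ?E"
    by (rule finite_subset[OF _ proper_discontinuity[of "{z0, z1}"]]) (use z0 z1 in auto)
  define h where "h z = (\<Sum>\<^sub>\<infinity>A\<in>G - ?E. pterm z0 l n A z)" for z
  have nE: "moebius A z \<notin> cball z0 r" if "A \<in> G - ?E" "z \<in> cball z1 r" for A z
    using r(4) that by blast
  obtain c where c: "\<And>A z. A \<in> G \<Longrightarrow> z \<in> cball z1 r \<Longrightarrow> moebius A z \<notin> cball z0 r \<Longrightarrow>
      norm (pterm z0 l n A z) \<le> c * (1 / norm A ^ l)"
    using pterm_bound[OF z0 _ r(2) r(1)] by (metis compact_cball)
  have sM: "(\<lambda>A. c * (1 / norm A ^ l)) summable_on (G - ?E)"
    by (intro summable_on_cmult_right summable_on_subset_banach[OF summable_norm_G[OF l]]) auto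
  have bound: "norm (pterm z0 l n A z) \<le> c * (1 / norm A ^ l)" if "A \<in> G - ?E" "z \<in> cball z1 r" for A z
    using c nE that by blast
  have unif: "uniform_limit (cball z1 r) (\<lambda>X z. \<Sum>A\<in>X. pterm z0 l n A z) h (finite_subsets_at_top (G - ?E))"
    unfolding h_def by (rule Weierstrass_m_test_general[OF _ sM]) (use bound in auto)
  have hol1: "pterm z0 l n A holomorphic_on cball z1 r" if A: "A \<in> G - ?E" for A
  proof -
    have "uform (cnj z0) A z \<noteq> 0" "uform z0 A z \<noteq> 0" if "z \<in> cball z1 r" for z
    proof -
      have zu: "z \<in> uhp" and d: "det A = 1" using that r A G_det by auto
      show "uform (cnj z0) A z \<noteq> 0" using uform_cnj_nz[OF z0 d zu] .
      have "moebius A z \<noteq> z0" using nE[OF A that] r(1) by auto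
      then show "uform z0 A z \<noteq> 0" using automorphy_nz[OF d zu] by (simp add: uform_eq[OF d zu])
    qed
    then show ?thesis unfolding pterm_def[abs_def] uform_def automorphy_def by (intro holomorphic_intros) auto
  qed
  have "h holomorphic_on ball z1 r"
  proof (rule holomorphic_uniform_limit[OF _ unif])
    show "\<forall>\<^sub>F X in finite_subsets_at_top (G - ?E). continuous_on (cball z1 r) (\<lambda>z. \<Sum>A\<in>X. pterm z0 l n A z) \<and>
       (\<lambda>z. \<Sum>A\<in>X. pterm z0 l n A z) holomorphic_on ball z1 r"
    proof (rule eventually_finite_subsets_at_top_weakI)
      fix X assume "finite X" "X \<subseteq> G - ?E"
      then have "(\<lambda>z. \<Sum>A\<in>X. pterm z0 l n A z) holomorphic_on cball z1 r"
        using hol1 by (intro holomorphic_on_sum) auto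
      then show "continuous_on (cball z1 r) (\<lambda>z. \<Sum>A\<in>X. pterm z0 l n A z) \<and>
        (\<lambda>z. \<Sum>A\<in>X. pterm z0 l n A z) holomorphic_on ball z1 r"
        by (meson ball_subset_cball holomorphic_on_imp_continuous_on holomorphic_on_subset)
    qed
  qed auto
  moreover have "poinc z0 l n z = (\<Sum>A\<in>?E. pterm z0 l n A z) + h z" if z: "z \<in> ball z1 r" for z
  proof -
    have "(\<lambda>A. norm (pterm z0 l n A z)) summable_on (G - ?E)"
      using z by (intro Infinite_Sum.abs_summable_on_comparison_test'[OF sM] bound) auto
    then have s: "(\<lambda>A. pterm z0 l n A z) summable_on (G - ?E)" by (rule abs_summable_summable)
    have "poinc z0 l n z = infsum (\<lambda>A. pterm z0 l n A z) (?E \<union> (G - ?E))"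
      unfolding poinc_def by (rule arg_cong[where f = "infsum _"]) auto
    also have "\<dots> = infsum (\<lambda>A. pterm z0 l n A z) ?E + h z"
      unfolding h_def using finE s by (intro infsum_Un_disjoint) auto
    finally show ?thesis using finE by simp
  qed
  moreover have "ball z1 r \<subseteq> uhp" using r(2) ball_subset_cball by blast
  ultimately show ?thesis using r(1) h_def by blast
qed

lemma meromorphic_pterm: "pterm z0 l n A meromorphic_on S"
  unfolding pterm_def[abs_def] uform_def automorphy_def by (intro meromorphic_intros)

lemma poinc_meromorphic:
  assumes "z0 \<in> uhp" "l \<ge> 10"
  shows "poinc z0 l n meromorphic_on uhp"
proof (subst meromorphic_on_meromorphic_at, intro ballI)
  fix z1 assume z1: "z1 \<in> uhp"
  obtain r h where r: "r > 0" "ball z1 r \<subseteq> uhp" "h holomorphic_on ball z1 r"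
    "\<And>z. z \<in> ball z1 r \<Longrightarrow> poinc z0 l n z = (\<Sum>A\<in>{A \<in> G. moebius A z1 = z0}. pterm z0 l n A z) + h z"
    "h z1 = (\<Sum>\<^sub>\<infinity>A\<in>G - {A \<in> G. moebius A z1 = z0}. pterm z0 l n A z1)"
    using poinc_local[OF assms(1) z1 assms(2), of n] by blast
  have "h analytic_on {z1}" using r analytic_on_open[of "ball z1 r" h] analytic_on_subset
    by (metis analytic_at centre_in_ball open_ball)
  then have "(\<lambda>z. (\<Sum>A\<in>{A \<in> G. moebius A z1 = z0}. pterm z0 l n A z) + h z) meromorphic_on {z1}"
    by (intro meromorphic_intros meromorphic_pterm analytic_on_imp_meromorphic_on)
  moreover have "eventually (\<lambda>z. poinc z0 l n z = (\<Sum>A\<in>{A \<in> G. moebius A z1 = z0}. pterm z0 l n A z) + h z) (at z1)"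
    using eventually_at_in_open'[of "ball z1 r" z1] r by (auto elim: eventually_mono)
  ultimately show "poinc z0 l n meromorphic_on {z1}"
    by (subst meromorphic_on_cong) auto
qed

lemma stab_mult: "A \<in> stab z \<Longrightarrow> B \<in> stab z \<Longrightarrow> z \<in> uhp \<Longrightarrow> A ** B \<in> stab z"
  by (auto simp: stab_def G_mult G_det moebius_mult)

lemma stab_inv: "A \<in> stab z \<Longrightarrow> z \<in> uhp \<Longrightarrow> inv2 A \<in> stab z"
  using moebius_inv2(1)[of A z] by (auto simp: stab_def G_inv)

text \<open>On the stabilizer the automorphy factor at \<open>z\<close> is multiplicative.
  Reindexing its product over this finite group by \<open>B \<mapsto> B ** A\<close> multiplies the
  product by the power in question.\<close>

lemma stab_automorphy_power:
  assumes z: "z \<in> uhp" and A: "A \<in> stab z"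
  shows "automorphy A z ^ card (stab z) = 1"
proof -
  have bij: "bij_betw (\<lambda>B. B ** A) (stab z) (stab z)"
  proof (rule bij_betw_byWitness[where f' = "\<lambda>B. B ** inv2 A"])
    have dA: "det A = 1" using A G_det by (simp add: stab_def)
    have "B ** A ** inv2 A = B" "B ** inv2 A ** A = B" for B
      using inv2_mult[OF dA] by (simp_all flip: matrix_mul_assoc)
    then show "\<forall>B\<in>stab z. B ** A ** inv2 A = B" "\<forall>B\<in>stab z. B ** inv2 A ** A = B" by auto
  qed (use A z stab_mult stab_inv in auto)
  have "(\<Prod>B\<in>stab z. automorphy B z) = (\<Prod>B\<in>stab z. automorphy (B ** A) z)"
    by (rule prod.reindex_bij_betw[OF bij, symmetric])
  also have "\<dots> = (\<Prod>B\<in>stab z. automorphy B z * automorphy A z)"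
    using A z by (intro prod.cong) (auto simp: automorphy_mult stab_def G_det)
  also have "\<dots> = (\<Prod>B\<in>stab z. automorphy B z) * automorphy A z ^ card (stab z)"
    by (simp add: prod.distrib)
  finally have eq: "(\<Prod>B\<in>stab z. automorphy B z) = (\<Prod>B\<in>stab z. automorphy B z) * automorphy A z ^ card (stab z)" .
  have "(\<Prod>B\<in>stab z. automorphy B z) \<noteq> 0"
    using z finite_stab by (auto simp: stab_def G_det)
  then show ?thesis using eq by simp
qed

text \<open>\<open>A\<close> fixes \<open>z0\<close> and \<open>cnj z0\<close>, so the two affine
  forms are \<open>k * (z - z0)\<close> and \<open>cnj k * (z - cnj z0)\<close> with a root of unity
  \<open>k\<close>. Divisibility of \<open>l\<close> and \<open>n\<close> by the order of the
  stabilizer removes \<open>k\<close>, so that the stabilizer terms add up instead of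
  cancelling.\<close>

lemma pterm_stab:
  assumes z0: "z0 \<in> uhp" and A: "A \<in> stab z0" and "card (stab z0) dvd l" "card (stab z0) dvd n"
  shows "pterm z0 l n A z = ((z - cnj z0) / (z - z0)) ^ n / (z - cnj z0) ^ l"
proof -
  have d: "det A = 1" and fx0: "moebius A z0 = z0" using A G_det by (auto simp: stab_def)
  let ?a = "complex_of_real (A$1$1)" and ?b = "complex_of_real (A$1$2)"
    and ?c = "complex_of_real (A$2$1)" and ?d = "complex_of_real (A$2$2)"
  have fx: "?a * z0 + ?b = z0 * (?c * z0 + ?d)"
    using fx0 automorphy_nz[OF d z0] by (simp add: moebius_def automorphy_def divide_eq_eq)
  then have "cnj (?a * z0 + ?b) = cnj (z0 * (?c * z0 + ?d))" by simp
  then have fx': "?a * cnj z0 + ?b = cnj z0 * (?c * cnj z0 + ?d)" by simp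
  define k where "k = ?a - ?c * z0"
  have v: "uform z0 A z = k * (z - z0)"
    using fx by (simp add: uform_def automorphy_def k_def algebra_simps)
  have u: "uform (cnj z0) A z = cnj k * (z - cnj z0)"
    using fx' by (simp add: uform_def automorphy_def k_def algebra_simps)
  have "k * automorphy A z0 = ?a * (?c * z0 + ?d) - ?c * (z0 * (?c * z0 + ?d))"
    by (simp add: k_def automorphy_def algebra_simps)
  also have "\<dots> = ?a * ?d - ?b * ?c" unfolding fx[symmetric] by (simp add: algebra_simps)
  also have "\<dots> = of_real (det A)" by (simp add: det2)
  finally have kj: "k * automorphy A z0 = 1" using d by simp
  have "k ^ card (stab z0) * automorphy A z0 ^ card (stab z0) = 1"
    using kj by (simp flip: power_mult_distrib)
  then have ke: "k ^ card (stab z0) = 1" using stab_automorphy_power[OF z0 A] by simp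
  then have "cnj k ^ card (stab z0) = 1" by (metis complex_cnj_one complex_cnj_power)
  with ke have kl: "k ^ m = 1" "cnj k ^ m = 1" if "card (stab z0) dvd m" for m
    using that by (auto simp: power_mult dvd_def)
  show ?thesis unfolding pterm_def u v
    using kl assms by (simp add: power_mult_distrib power_divide)
qed

lemma mord_eqI:
  assumes "z \<in> uhp" "r > 0" "g holomorphic_on ball z r" "g z \<noteq> 0"
    and "eventually (\<lambda>w. fun_of f w = g w * (w - z) powi n) (at z)"
  shows "mord z f = n" "f \<noteq> 0"
proof -
  have "zorder (fun_of f) z = zorder (\<lambda>w. g w * (w - z) powi n) z"
    by (rule zorder_cong[OF assms(5) refl])
  also have "\<dots> = n"
    by (rule zorder_eqI[of "ball z r" z g]) (use assms in auto)
  finally have zo: "zorder (fun_of f) z = n" .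
  have "isCont g z"
    using assms(2,3) by (metis centre_in_ball continuous_on_eq_continuous_at holomorphic_on_imp_continuous_on open_ball)
  then have "eventually (\<lambda>w. g w \<noteq> 0) (at z)" using assms(4) continuous_within tendsto_imp_eventually_ne by blast
  then have "eventually (\<lambda>w. fun_of f w \<noteq> 0) (at z)"
    using assms(5) eventually_neq_at_within[of z z UNIV] by eventually_elim auto
  then have g: "germ z f \<noteq> 0" using has_laurent_expansion_eventually_nonzero_iff[OF has_germ[OF assms(1), of f]] by simp
  then show "f \<noteq> 0" by auto
  show "mord z f = n" using has_laurent_expansion_zorder[OF has_germ[OF assms(1)] g] zo by (simp add: mord_def)
qed

text \<open>At \<open>z0\<close> the stabilizer terms are equal and have a pole of exact order
  \<open>n\<close>, while all others are regular. For \<open>n > 0\<close> this pole cannot cancel;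
  for \<open>n = 0\<close> the hypothesis makes the other terms smaller at \<open>z0\<close> than a
  single stabilizer term, whose modulus is \<open>1 / (2 * Im z0) ^ l\<close>.\<close>

lemma poincare_series:
  assumes z0: "z0 \<in> uhp" and l: "l \<ge> 10" "card (stab z0) dvd l" "card (stab z0) dvd n"
    and n: "n > 0 \<or> norm (\<Sum>\<^sub>\<infinity>A\<in>G - stab z0. 1 / uform (cnj z0) A z0 ^ l) < 1 / (2 * Im z0) ^ l"
  obtains Q where "Q \<in> wt (int l)" "\<And>z. z \<in> uhp \<Longrightarrow> z \<notin> orb z0 \<Longrightarrow> mord_ge z Q 0"
    "mord z0 Q = - int n" "Q \<noteq> 0"
proof -
  obtain Q where Q: "\<And>z. z \<in> uhp \<Longrightarrow> eventually (\<lambda>w. fun_of Q w = poinc z0 l n w) (at z)"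
    using merofun_of_meromorphic[OF poinc_meromorphic[OF z0 l(1)]] by metis
  have "mcomp B Q = autofun B powi (int l) * Q" if B: "B \<in> G" for B
  proof (rule merofun_eqI)
    fix z assume z: "z \<in> uhp"
    have d: "det B = 1" using B G_det by blast
    have "eventually (\<lambda>w. fun_of Q (moebius B w) = poinc z0 l n (moebius B w)) (at z)"
      using eventually_moebius[OF d z Q] z d by simp
    then show "eventually (\<lambda>w. fun_of (mcomp B Q) w = fun_of (autofun B powi (int l) * Q) w) (at z)"
      using Q[OF z] eventually_fun_of(5)[OF z, of "autofun B powi (int l)" Q] eventually_in_uhp[OF z]
        eventually_mcomp[OF d z, of Q]
      by eventually_elim (simp add: poinc_moebius[OF B] fun_of_autofun_powi[OF d] del: power_int_of_nat,
          simp add: power_int_of_nat)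
  qed
  then have wt: "Q \<in> wt (int l)" by (simp add: wt_def)
  have reg: "mord_ge z1 Q 0" if z1: "z1 \<in> uhp" "z1 \<notin> orb z0" for z1
  proof -
    obtain r h where r: "r > 0" "ball z1 r \<subseteq> uhp" "h holomorphic_on ball z1 r"
      "\<And>z. z \<in> ball z1 r \<Longrightarrow> poinc z0 l n z = (\<Sum>A\<in>{A \<in> G. moebius A z1 = z0}. pterm z0 l n A z) + h z"
    "h z1 = (\<Sum>\<^sub>\<infinity>A\<in>G - {A \<in> G. moebius A z1 = z0}. pterm z0 l n A z1)"
      using poinc_local[OF z0 z1(1) l(1), of n] by blast
    have "{A \<in> G. moebius A z1 = z0} = {}"
      using z1 orb_sym[of z1 z0] by (auto simp: orb_def)
    then have ph: "poinc z0 l n z = h z" if "z \<in> ball z1 r" for z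
      using r(4)[OF that] by (simp only: sum.empty add_0)
    have "eventually (\<lambda>w. w \<in> ball z1 r) (at z1)"
      using eventually_at_in_open'[of "ball z1 r" z1] r(1) by simp
    then have "eventually (\<lambda>w. fun_of Q w = h w) (at z1)"
      using Q[OF z1(1)] by eventually_elim (simp add: ph)
    then have "is_pole (fun_of Q) z1 \<longleftrightarrow> is_pole h z1" by (intro is_pole_cong) auto
    moreover have "\<not> is_pole h z1"
      using r by (intro not_is_pole_holomorphic[of "ball z1 r"]) auto
    ultimately show ?thesis using is_pole_fun_of_iff[OF z1(1), of Q] z1(1) by (simp add: mord_ge_0_iff)
  qed
  obtain r h where r: "r > 0" "ball z0 r \<subseteq> uhp" "h holomorphic_on ball z0 r"
      "\<And>z. z \<in> ball z0 r \<Longrightarrow> poinc z0 l n z = (\<Sum>A\<in>stab z0. pterm z0 l n A z) + h z"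
      "h z0 = (\<Sum>\<^sub>\<infinity>A\<in>G - stab z0. pterm z0 l n A z0)"
    using poinc_local[OF z0 z0 l(1), of n] unfolding stab_def by blast
  define e where "e = card (stab z0)"
  have e: "e > 0" using card_stab_pos[OF z0] by (simp add: e_def)
  \<comment> \<open>The series multiplied by \<open>(z - z0) ^ n\<close>, from which
    \<open>mord_eqI\<close> reads off the order.\<close>
  define g where "g z = of_nat e * ((z - cnj z0) ^ n / (z - cnj z0) ^ l) + h z * (z - z0) ^ n" for z
  have nz: "z - cnj z0 \<noteq> 0" if "z \<in> uhp" for z
    using that z0 by (auto simp: uhp_def complex_eq_iff)
  have nzb: "z - cnj z0 \<noteq> 0" if "z \<in> ball z0 r" for z using nz r(2) that by blast
  have g_hol: "g holomorphic_on ball z0 r"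
    unfolding g_def by (intro holomorphic_intros r(3) power_not_zero nzb)
  have nn: "norm (z0 - cnj z0) = 2 * Im z0"
    using z0 by (simp add: complex_diff_cnj norm_mult uhp_def)
  have "g z0 \<noteq> 0"
  proof (cases "n > 0")
    case True
    then have "g z0 = of_nat e * ((z0 - cnj z0) ^ n / (z0 - cnj z0) ^ l)" by (simp add: g_def power_0_left)
    then show ?thesis using e nz[OF z0] by simp
  next
    case False
    then have n0: "n = 0" by simp
    then have small: "norm (h z0) < 1 / (2 * Im z0) ^ l" using n r(5) by (simp add: pterm_def)
    have "norm (of_nat e * (1 / (z0 - cnj z0) ^ l)) = of_nat e * (1 / (2 * Im z0) ^ l)"
      by (simp add: norm_mult norm_divide norm_power nn)
    also have "\<dots> \<ge> 1 * (1 / (2 * Im z0) ^ l)"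
      using e z0 by (intro mult_right_mono) (auto simp: uhp_def)
    finally have "norm (h z0) < norm (of_nat e * (1 / (z0 - cnj z0) ^ l))" using small by simp
    moreover have "g z0 = of_nat e * (1 / (z0 - cnj z0) ^ l) + h z0" by (simp add: g_def n0)
    ultimately show ?thesis by (metis add_eq_0_iff norm_minus_cancel order_less_irrefl)
  qed
  moreover have "eventually (\<lambda>w. fun_of Q w = g w * (w - z0) powi (- int n)) (at z0)"
  proof -
    have "eventually (\<lambda>w. w \<in> ball z0 r - {z0}) (at z0)"
      using r by (intro eventually_at_in_open) auto
    then show ?thesis using Q[OF z0]
    proof eventually_elim
      case (elim w)
      have "poinc z0 l n w = of_nat e * (((w - cnj z0) / (w - z0)) ^ n / (w - cnj z0) ^ l) + h w"
        using r(4)[of w] elim pterm_stab[OF z0 _ l(2,3)] by (simp add: e_def)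
      also have "\<dots> = g w * (w - z0) powi (- int n)"
        using elim by (simp add: g_def power_int_minus power_divide field_simps)
      finally show ?case using elim by simp
    qed
  qed
  ultimately have "mord z0 Q = - int n" "Q \<noteq> 0"
    using mord_eqI[OF z0 r(1) g_hol] by blast+
  then show ?thesis using that wt reg by blast
qed

text \<open>Relative to a stabilizer term, every other term is at most a power
  \<open>q ^ (- l)\<close> for one common \<open>q > 1\<close>; splitting off the exponent 10 for
  convergence leaves a factor that tends to 0 with growing \<open>l\<close>.\<close>

lemma poincare_dominates:
  assumes z0: "z0 \<in> uhp"
  obtains L where "\<And>l. l \<ge> L \<Longrightarrow>
    norm (\<Sum>\<^sub>\<infinity>A\<in>G - stab z0. 1 / uform (cnj z0) A z0 ^ l) < 1 / (2 * Im z0) ^ l"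
proof -
  let ?S = "G - stab z0"
  have y: "Im z0 > 0" using z0 by (simp add: uhp_def)
  \<comment> \<open>\<open>N A\<close> is the hyperbolic cosine of half the distance from
    \<open>z0\<close> to \<open>moebius A z0\<close>, hence greater than 1 off the
    stabilizer.\<close>
  define N where "N A = norm (uform (cnj z0) A z0) / (2 * Im z0)" for A
  have N1: "N A > 1" if A: "A \<in> ?S" for A
  proof -
    have d: "det A = 1" and ne: "moebius A z0 \<noteq> z0" using A G_det by (auto simp: stab_def)
    let ?w = "moebius A z0" and ?j = "automorphy A z0"
    have j: "norm ?j > 0" using automorphy_nz[OF d z0] by simp
    have "(norm (uform (cnj z0) A z0))\<^sup>2 = (norm (?w - cnj z0))\<^sup>2 * (norm ?j)\<^sup>2"
      by (simp add: uform_eq[OF d z0] norm_mult power_mult_distrib)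
    also have "(norm (?w - cnj z0))\<^sup>2 = (norm (?w - z0))\<^sup>2 + 4 * Im ?w * Im z0"
      unfolding cmod_power2 by (simp add: power2_eq_square algebra_simps)
    also have "Im ?w = Im z0 / (norm ?j)\<^sup>2" by (rule Im_moebius[OF d z0])
    also have "((norm (?w - z0))\<^sup>2 + 4 * (Im z0 / (norm ?j)\<^sup>2) * Im z0) * (norm ?j)\<^sup>2
       = (norm (?w - z0))\<^sup>2 * (norm ?j)\<^sup>2 + (2 * Im z0)\<^sup>2"
      using j by (simp add: field_simps power2_eq_square)
    also have "\<dots> > (2 * Im z0)\<^sup>2" using ne j by simp
    finally have "2 * Im z0 < norm (uform (cnj z0) A z0)" by (rule power2_less_imp_less) simp
    then show ?thesis using y by (simp add: N_def)
  qed
  obtain k where k: "k > 0" "\<And>A. det A = 1 \<Longrightarrow> N A \<ge> k * norm A"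
  proof -
    obtain k where k: "k > 0" "\<And>z w A. z \<in> {z0} \<Longrightarrow> w \<in> {z0} \<Longrightarrow> det A = 1 \<Longrightarrow>
      norm (of_real (A$1$1) * z + of_real (A$1$2) - cnj w * automorphy A z) \<ge> k * norm A"
      using cross_form_ge[of "{z0}"] z0 by auto
    have "N A \<ge> k / (2 * Im z0) * norm A" if "det A = 1" for A
      using k(2)[of z0 z0 A] that y by (simp add: N_def uform_def divide_right_mono)
    then show ?thesis using that[of "k / (2 * Im z0)"] k y by simp
  qed
  let ?F = "{A \<in> ?S. norm A \<le> 2 / k}"
  have finF: "finite ?F" by (rule finite_subset[OF _ finite_norm_le[of "2 / k"]]) auto
  \<comment> \<open>Finitely many \<open>A\<close> enter the minimum: those of norm above
    \<open>2 / k\<close> have \<open>N A \<ge> 2\<close> anyway.\<close>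
  define q where "q = Min (insert 2 (N ` ?F))"
  have q1: "q > 1" unfolding q_def using finF N1 by (subst Min_gr_iff) auto
  have qN: "N A \<ge> q" if A: "A \<in> ?S" for A
  proof (cases "A \<in> ?F")
    case True then show ?thesis unfolding q_def using finF by (intro Min_le) auto
  next
    case False
    then have "norm A > 2 / k" using A by simp
    then have "k * norm A > 2" using k by (simp add: field_simps)
    then have "N A \<ge> 2" using k(2)[of A] A G_det by force
    moreover have "q \<le> 2" unfolding q_def using finF by (intro Min_le) auto
    ultimately show ?thesis by simp
  qed
  have s10: "(\<lambda>A. 1 / N A ^ 10) summable_on ?S"
  proof (rule summable_on_comparison_test)
    show "(\<lambda>A. (1 / k ^ 10) * (1 / norm A ^ 10)) summable_on ?S"
      by (intro summable_on_cmult_right summable_on_subset_banach[OF summable_norm_G]) auto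
    fix A assume A: "A \<in> ?S"
    have d: "det A = 1" using A G_det by blast
    have "1 / N A ^ 10 \<le> 1 / (k * norm A) ^ 10"
      using k(1) k(2)[OF d] norm_ge_1[OF d] N1[OF A] by (intro divide_left_mono power_mono mult_pos_pos zero_less_power) auto
    then show "1 / N A ^ 10 \<le> (1 / k ^ 10) * (1 / norm A ^ 10)" by (simp add: power_mult_distrib)
    show "0 \<le> 1 / N A ^ 10" using N1[OF A] by simp
  qed
  define T where "T = (\<Sum>\<^sub>\<infinity>A\<in>?S. 1 / N A ^ 10)"
  obtain m where m: "q ^ m > T" using real_arch_pow[OF q1] by blast
  show ?thesis
  proof (rule that[of "m + 10"])
    fix l assume l: "l \<ge> m + 10"
    let ?c = "1 / (2 * Im z0) ^ l * (1 / q ^ (l - 10))"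
    have b: "norm (1 / uform (cnj z0) A z0 ^ l) \<le> ?c * (1 / N A ^ 10)" if A: "A \<in> ?S" for A
    proof -
      have "norm (1 / uform (cnj z0) A z0 ^ l) = 1 / (2 * Im z0 * N A) ^ l"
        using y by (simp add: N_def norm_divide norm_power)
      also have "\<dots> = 1 / (2 * Im z0) ^ l * (1 / (N A ^ (l - 10) * N A ^ 10))"
        using l by (simp add: power_mult_distrib flip: power_add)
      also have "\<dots> \<le> 1 / (2 * Im z0) ^ l * (1 / (q ^ (l - 10) * N A ^ 10))"
        using y q1 qN[OF A] N1[OF A]
        by (intro mult_left_mono divide_left_mono mult_right_mono power_mono mult_pos_pos zero_less_power) auto
      finally show ?thesis by simp
    qed
    have sc: "(\<lambda>A. ?c * (1 / N A ^ 10)) summable_on ?S" by (intro summable_on_cmult_right s10)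
    have sn: "(\<lambda>A. norm (1 / uform (cnj z0) A z0 ^ l)) summable_on ?S"
      using b by (rule Infinite_Sum.abs_summable_on_comparison_test'[OF sc])
    have "norm (\<Sum>\<^sub>\<infinity>A\<in>?S. 1 / uform (cnj z0) A z0 ^ l) \<le> ?c * T"
    proof (rule norm_infsum_le[OF _ _ b])
      show "((\<lambda>A. 1 / uform (cnj z0) A z0 ^ l) has_sum (\<Sum>\<^sub>\<infinity>A\<in>?S. 1 / uform (cnj z0) A z0 ^ l)) ?S"
        using abs_summable_summable[OF sn] by (rule has_sum_infsum)
      show "((\<lambda>A. ?c * (1 / N A ^ 10)) has_sum (?c * T)) ?S"
        unfolding T_def by (intro has_sum_cmult_right has_sum_infsum s10)
    qed
    also have "\<dots> < 1 / (2 * Im z0) ^ l"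
    proof -
      have "T < q ^ (l - 10)"
        using m power_increasing[of m "l - 10" q] q1 l by linarith
      then have "1 / q ^ (l - 10) * T < 1" using q1 by (simp add: divide_less_eq)
      then have "1 / (2 * Im z0) ^ l * (1 / q ^ (l - 10) * T) < 1 / (2 * Im z0) ^ l * 1"
        using y by (intro mult_strict_left_mono) auto
      then show ?thesis by (simp add: mult.assoc)
    qed
    finally show "norm (\<Sum>\<^sub>\<infinity>A\<in>?S. 1 / uform (cnj z0) A z0 ^ l) < 1 / (2 * Im z0) ^ l" .
  qed
qed

lemma modular_form_nonvanishing:
  assumes z0: "z0 \<in> uhp"
  obtains F l where "l > 0" "F \<in> MP l 0" "mord z0 F = 0" "F \<noteq> 0"
proof -
  obtain L where L: "\<And>l. l \<ge> L \<Longrightarrow>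
    norm (\<Sum>\<^sub>\<infinity>A\<in>G - stab z0. 1 / uform (cnj z0) A z0 ^ l) < 1 / (2 * Im z0) ^ l"
    using poincare_dominates[OF z0] by metis
  \<comment> \<open>A multiple of the stabilizer order that exceeds both thresholds \<open>L\<close>
    and 10.\<close>
  define l where "l = card (stab z0) * (L + 10)"
  have ge: "l \<ge> L + 10" unfolding l_def using card_stab_pos[OF z0] by simp
  obtain Q where Q: "Q \<in> wt (int l)" "\<And>z. z \<in> uhp \<Longrightarrow> z \<notin> orb z0 \<Longrightarrow> mord_ge z Q 0"
    "mord z0 Q = - int 0" "Q \<noteq> 0"
  proof (rule poincare_series[OF z0, of l 0])
    show "l \<ge> 10" using ge by linarith
    show "card (stab z0) dvd l" by (simp add: l_def)
    show "0 < (0::nat) \<or> norm (\<Sum>\<^sub>\<infinity>A\<in>G - stab z0. 1 / uform (cnj z0) A z0 ^ l) < 1 / (2 * Im z0) ^ l"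
      using L[of l] ge by simp
  qed auto
  have "mord_ge z Q 0" if "z \<in> uhp" for z
    using Q(2)[OF that] Q(3) mord_ge_orb[OF Q(1) z0, of z 0] mord_ge_0_iff[OF z0, of Q] by auto
  then have "Q \<in> MP (int l) 0" unfolding MP_0_iff using Q(1) by blast
  then show ?thesis using that[of "int l" Q] ge Q by simp
qed

text \<open>The weight does not depend on the pole order. Poles of arbitrarily large order in one
  weight are what \<open>negative_weight_form\<close> exploits.\<close>

lemma poincare_pole:
  assumes z0: "z0 \<in> uhp"
  obtains l where "l > 0" "\<And>n. n > 0 \<Longrightarrow> \<exists>Q\<in>wt (int l). (\<forall>z\<in>uhp - orb z0. mord_ge z Q 0) \<and>
     mord z0 Q = - int (card (stab z0) * n) \<and> Q \<noteq> 0"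
proof (rule that)
  show "card (stab z0) * 10 > 0" using card_stab_pos[OF z0] by simp
  fix n :: nat assume n: "n > 0"
  have "card (stab z0) * 10 \<ge> 10" using card_stab_pos[OF z0] by simp
  then show "\<exists>Q\<in>wt (int (card (stab z0) * 10)). (\<forall>z\<in>uhp - orb z0. mord_ge z Q 0) \<and>
     mord z0 Q = - int (card (stab z0) * n) \<and> Q \<noteq> 0"
    using poincare_series[OF z0, of "card (stab z0) * 10" "card (stab z0) * n"] card_stab_pos[OF z0] n
    by (metis DiffD1 DiffD2 dvd_triv_left nat_0_less_mult_iff)
qed

end

section \<open>Division and pencils\<close>

text \<open>Fewer linear equations than unknowns; one nontrivial equation eliminates the unknown
  \<open>p\<close>.\<close>

lemma common_kernel:
  fixes lf :: "'j \<Rightarrow> 'i \<Rightarrow> complex"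
  assumes "finite J" "finite I" "card J < card I"
  shows "\<exists>c. (\<exists>i\<in>I. c i \<noteq> 0) \<and> (\<forall>j\<in>J. (\<Sum>i\<in>I. c i * lf j i) = 0)"
  using assms
proof (induction J arbitrary: I lf rule: finite_induct)
  case empty
  then obtain i where "i \<in> I" by fastforce
  then show ?case by (intro exI[of _ "\<lambda>_. 1"]) auto
next
  case (insert j0 J)
  show ?case
  proof (cases "\<forall>i\<in>I. lf j0 i = 0")
    case True
    obtain c where c: "\<exists>i\<in>I. c i \<noteq> 0" "\<forall>j\<in>J. (\<Sum>i\<in>I. c i * lf j i) = 0"
      using insert.IH[of I lf] insert.prems insert.hyps by auto
    have "(\<Sum>i\<in>I. c i * lf j0 i) = 0" using True by (intro sum.neutral) auto
    then show ?thesis using c by (intro exI[of _ c]) auto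
  next
    case False
    then obtain p where p: "p \<in> I" "lf j0 p \<noteq> 0" by blast
    define lf' where "lf' j i = lf j i - lf j p * lf j0 i / lf j0 p" for j i
    have "card (I - {p}) = card I - 1" using p insert.prems by simp
    then have "card J < card (I - {p})" using insert.prems insert.hyps by auto
    then obtain c where c: "\<exists>i\<in>I - {p}. c i \<noteq> 0" "\<forall>j\<in>J. (\<Sum>i\<in>I - {p}. c i * lf' j i) = 0"
      using insert.IH[of "I - {p}" lf'] insert.prems by auto
    define s where "s = (\<Sum>i\<in>I - {p}. c i * lf j0 i)"
    define c' where "c' = c(p := - s / lf j0 p)"
    have split: "(\<Sum>i\<in>I. c' i * lf j i) = - s / lf j0 p * lf j p + (\<Sum>i\<in>I - {p}. c i * lf j i)" for j
      using p insert.prems by (subst sum.remove[of I p]) (auto simp: c'_def intro!: sum.cong)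
    have "(\<Sum>i\<in>I. c' i * lf j0 i) = 0" unfolding split using p by (simp add: s_def)
    moreover have "(\<Sum>i\<in>I. c' i * lf j i) = 0" if "j \<in> J" for j
    proof -
      have "0 = (\<Sum>i\<in>I - {p}. c i * lf' j i)" using c(2) that by simp
      also have "\<dots> = (\<Sum>i\<in>I - {p}. c i * lf j i - lf j p / lf j0 p * (c i * lf j0 i))"
        by (intro sum.cong) (simp_all add: lf'_def algebra_simps)
      also have "\<dots> = (\<Sum>i\<in>I - {p}. c i * lf j i) - lf j p / lf j0 p * s"
        by (simp only: sum_subtractf s_def sum_distrib_left)
      finally show ?thesis unfolding split by (simp add: algebra_simps)
    qed
    ultimately show ?thesis using c(1) p by (intro exI[of _ c']) (auto simp: c'_def)
  qed
qed

abbreviation lincomb :: "nat \<Rightarrow> (nat \<Rightarrow> complex) \<Rightarrow> (nat \<Rightarrow> merofun) \<Rightarrow> merofun" where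
  "lincomb n c b \<equiv> (\<Sum>i<n. mero_const (c i) * b i)"

lemma fls_nth_sum: "fls_nth (\<Sum>i\<in>S. f i) n = (\<Sum>i\<in>S. fls_nth (f i) n)"
  by (induction S rule: infinite_finite_induct) auto

lemma fls_nth_lincomb:
  "z \<in> uhp \<Longrightarrow> fls_nth (germ z (lincomb n c b)) k = (\<Sum>i<n. c i * fls_nth (germ z (b i)) k)"
  by (simp add: fls_nth_sum)

text \<open>If \<open>f\<close> works on \<open>Z\<close> and \<open>g\<close> at \<open>z0\<close>,
  then \<open>f + c g\<close> works on both for all but finitely many \<open>c\<close>.\<close>

lemma generic_nonvanishing:
  assumes "finite Z" "Z \<subseteq> uhp"
    and V: "\<And>f g. f \<in> V \<Longrightarrow> g \<in> V \<Longrightarrow> f + g \<in> V" "\<And>f c. f \<in> V \<Longrightarrow> mero_const c * f \<in> V" "V \<noteq> {}"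
    and ex: "\<And>z. z \<in> Z \<Longrightarrow> \<exists>f\<in>V. fls_nth (germ z f) 0 \<noteq> 0"
  shows "\<exists>f\<in>V. \<forall>z\<in>Z. fls_nth (germ z f) 0 \<noteq> 0"
  using assms(1,2) ex
proof (induction Z rule: finite_induct)
  case empty then show ?case using V(3) by auto
next
  case (insert z0 Z)
  then obtain f where f: "f \<in> V" "\<forall>z\<in>Z. fls_nth (germ z f) 0 \<noteq> 0" by auto
  obtain g where g: "g \<in> V" "fls_nth (germ z0 g) 0 \<noteq> 0" using insert.prems by auto
  have "finite ((\<lambda>z. - fls_nth (germ z f) 0 / fls_nth (germ z g) 0) ` insert z0 Z)" using insert by auto
  then obtain c :: complex where c: "c \<notin> (\<lambda>z. - fls_nth (germ z f) 0 / fls_nth (germ z g) 0) ` insert z0 Z"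
    using ex_new_if_finite[OF infinite_UNIV_char_0] by blast
  have "fls_nth (germ z (f + mero_const c * g)) 0 \<noteq> 0" if z: "z \<in> insert z0 Z" for z
  proof -
    have zu: "z \<in> uhp" using insert.prems z by auto
    have "fls_nth (germ z f) 0 + c * fls_nth (germ z g) 0 \<noteq> 0"
    proof (cases "fls_nth (germ z g) 0 = 0")
      case True then show ?thesis using z f(2) g(2) by auto
    next
      case False
      have "c \<noteq> - fls_nth (germ z f) 0 / fls_nth (germ z g) 0" using c z by blast
      then show ?thesis using False by (auto simp: field_simps add_eq_0_iff)
    qed
    then show ?thesis using zu by simp
  qed
  then show ?case using V f g by blast
qed

context fuchsian
begin

lemma MP_lincomb: "(\<And>i. i < n \<Longrightarrow> b i \<in> MP k m) \<Longrightarrow> lincomb n c b \<in> MP k m"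
  by (intro MP_sum MP_const_mult) auto

text \<open>Divisibility by \<open>F\<close> amounts to finitely many linear conditions on the germs at the zeros of \<open>F\<close>, since
  these are finite in number modulo \<open>\<Gamma>\<close>.\<close>

lemma division:
  assumes F: "F \<in> MP K p" "F \<noteq> 0"
  shows "\<exists>C. \<forall>k n m b. m > C \<and> (\<forall>i<m. b i \<in> MP k n) \<longrightarrow>
    (\<exists>c. (\<exists>i<m. c i \<noteq> 0) \<and> (\<exists>h\<in>MP (k - K) (n - p). lincomb m c b = F * h))"
proof -
  define Z where "Z = {z \<in> FK. mord z F \<noteq> 0 \<and> z \<notin> orb \<i>}"
  have Z: "finite Z" "Z \<subseteq> uhp"
    using finite_mord_nz[OF FK(1,2), of F] FK(2) unfolding Z_def by (auto elim: rev_finite_subset)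
  \<comment> \<open>The number of conditions depends on \<open>F\<close> and \<open>p\<close> alone.
    At \<open>\<i>\<close> the coefficients from order \<open>- n\<close> up to
    \<open>- n + mord \<i> F + p - 1\<close> must vanish, so \<open>n\<close> merely shifts the
    range.\<close>
  define J where "J = (SIGMA z:Z. {j. j < nat (mord z F)}) \<union> {\<i>} \<times> {j. j < nat (mord \<i> F + p)}"
  have J: "finite J" unfolding J_def using Z by auto
  have "\<exists>c. (\<exists>i<m. c i \<noteq> 0) \<and> (\<exists>h\<in>MP (k - K) (n - p). lincomb m c b = F * h)"
    if m: "m > card J" and b: "\<forall>i<m. b i \<in> MP k n" for k n m and b :: "nat \<Rightarrow> merofun"
  proof -
    define lf where "lf x i = fls_nth (germ (fst x) (b i)) (if fst x = \<i> then int (snd x) - n else int (snd x))"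
      for x :: "complex \<times> nat" and i
    obtain c where c: "\<exists>i\<in>{..<m}. c i \<noteq> 0" "\<forall>j\<in>J. (\<Sum>i<m. c i * lf j i) = 0"
      using common_kernel[OF J, of "{..<m}" lf] m by auto
    define g where "g = lincomb m c b"
    have g: "g \<in> MP k n" unfolding g_def using b by (intro MP_lincomb) auto
    have W: "g / F \<in> wt (k - K)" using g F by (intro wt_divide MP_wt)
    have orbi: "\<i> \<notin> Z" using orb_self by (auto simp: Z_def)
    have 1: "mord_ge z (g / F) 0" if z: "z \<in> uhp" "z \<notin> orb \<i>" for z
    proof -
      obtain A where A: "A \<in> G" "moebius A z \<in> FK" using FK(3)[OF z(1)] by blast
      let ?w = "moebius A z"
      have w: "?w \<in> uhp" "?w \<notin> orb \<i>" using A z FK(2) moebius_in_orb_iff[OF A(1) z(1) ii_uhp] by auto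
      have Fw: "mord ?w F \<ge> 0" using F w MI_regular[OF MP_MI] by (metis mord_ge_0_iff)
      have "mord_ge ?w g (mord ?w F)"
        unfolding mord_ge_def
      proof (intro allI impI)
        fix j assume j: "j < mord ?w F"
        show "fls_nth (germ ?w g) j = 0"
        proof (cases "j < 0")
          case True
          then show ?thesis using MI_regular[OF MP_MI[OF g] w] by (auto simp: mord_ge_def)
        next
          case False
          then have "?w \<in> Z" using A w j by (auto simp: Z_def)
          then have "(?w, nat j) \<in> J" using j False by (auto simp: J_def)
          then have "(\<Sum>i<m. c i * lf (?w, nat j) i) = 0" using c(2) by blast
          moreover have "?w \<noteq> \<i>" using orbi \<open>?w \<in> Z\<close> by metis
          ultimately show ?thesis using False unfolding g_def fls_nth_lincomb[OF w(1)]
            by (simp add: lf_def)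
        qed
      qed
      then have "mord_ge ?w (g / F) 0" using w F by (cases "g = 0") (auto simp: mord_ge_iff mord_divide)
      then show ?thesis using mord_ge_wt[OF W A(1) z(1)] by simp
    qed
    have 2: "mord_ge \<i> (g / F) (- (n - p))"
    proof -
      have "mord_ge \<i> g (- n + mord \<i> F + p)"
        unfolding mord_ge_def
      proof (intro allI impI)
        fix j assume j: "j < - n + mord \<i> F + p"
        show "fls_nth (germ \<i> g) j = 0"
        proof (cases "j < - n")
          case True
          then show ?thesis using g by (auto simp: MP_def mord_ge_def)
        next
          case False
          then have "(\<i>, nat (j + n)) \<in> J" using j by (auto simp: J_def)
          then have "(\<Sum>i<m. c i * lf (\<i>, nat (j + n)) i) = 0" using c(2) by blast
          then show ?thesis using False unfolding g_def fls_nth_lincomb[OF ii_uhp] by (auto simp: lf_def)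
        qed
      qed
      then show ?thesis using F by (cases "g = 0") (auto simp: mord_ge_iff mord_divide)
    qed
    have "g / F \<in> MP (k - K) (n - p)" using W 1 2 by (simp add: MP_def MI_def)
    moreover have "lincomb m c b = F * (g / F)" using F by (simp add: g_def)
    ultimately show ?thesis using c(1) by blast
  qed
  then show ?thesis by blast
qed

text \<open>Poles of order up to \<open>p\<close> at \<open>\<i>\<close> are allowed, as for
  sections of a twisted line bundle: a section that does not vanish at \<open>\<i>\<close> has order
  exactly \<open>- p\<close> there.\<close>

definition no_common_zero :: "int \<Rightarrow> merofun \<Rightarrow> merofun \<Rightarrow> bool" where
  "no_common_zero p F H \<longleftrightarrow> (\<forall>z\<in>uhp - orb \<i>. mord z F = 0 \<or> mord z H = 0) \<and>
     (mord \<i> F = - p \<or> mord \<i> H = - p)"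

text \<open>\<open>g / F\<close> equals \<open>a / H\<close>, and at each point one of the two
  denominators does not vanish in the sense of \<open>no_common_zero\<close>.\<close>

lemma pencil_syzygy:
  assumes F: "F \<in> MP K p" "F \<noteq> 0" and H: "H \<in> MP K p" "H \<noteq> 0" and nc: "no_common_zero p F H"
    and g: "g \<in> MP k n" "a \<in> MP k n" "H * g = F * a"
  shows "\<exists>h\<in>MP (k - K) (n - p). g = F * h"
proof -
  have eq: "g / F = a / H" using g(3) F H by (simp add: field_simps)
  have W: "g / F \<in> wt (k - K)" using g F by (intro wt_divide MP_wt)
  have "mord_ge z (g / F) 0" if z: "z \<in> uhp" "z \<notin> orb \<i>" for z
  proof -
    have gz: "mord_ge z g 0" "mord_ge z a 0" using g MI_regular[OF MP_MI] z by blast+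
    show ?thesis
    proof (cases "mord z F = 0")
      case True
      then show ?thesis using gz z F by (cases "g = 0") (auto simp: mord_ge_iff mord_divide)
    next
      case False
      then have "mord z H = 0" using nc z by (auto simp: no_common_zero_def)
      then have "mord_ge z (a / H) 0" using gz z H by (cases "a = 0") (auto simp: mord_ge_iff mord_divide)
      then show ?thesis using eq by simp
    qed
  qed
  moreover have "mord_ge \<i> (g / F) (- (n - p))"
  proof -
    have gi: "mord_ge \<i> g (- n)" "mord_ge \<i> a (- n)" using g by (auto simp: MP_def)
    show ?thesis
    proof (cases "mord \<i> F = - p")
      case True
      then show ?thesis using gi F by (cases "g = 0") (auto simp: mord_ge_iff mord_divide)
    next
      case False
      then have "mord \<i> H = - p" using nc by (auto simp: no_common_zero_def)
      then have "mord_ge \<i> (a / H) (- (n - p))" using gi H by (cases "a = 0") (auto simp: mord_ge_iff mord_divide)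
      then show ?thesis using eq by simp
    qed
  qed
  ultimately have "g / F \<in> MP (k - K) (n - p)" using W by (simp add: MP_def MI_def)
  moreover have "g = F * (g / F)" using F by simp
  ultimately show ?thesis by blast
qed

text \<open>Multiplication by \<open>H\<close> induces injections \<open>V\<^sub>t / F V\<^sub>t\<^sub>-\<^sub>1 \<rightarrow> V\<^sub>t\<^sub>+\<^sub>1 / F V\<^sub>t\<close> between spaces of
  bounded dimension, which are therefore bijective for large \<open>t\<close>.\<close>

lemma pencil:
  assumes F: "F \<in> MP K p" "F \<noteq> 0" and H: "H \<in> MP K p" "H \<noteq> 0" and nc: "no_common_zero p F H"
  shows "\<exists>T::nat. \<forall>t\<ge>T. \<forall>f\<in>MP (k + int (Suc t) * K) (n + int (Suc t) * p).
    \<exists>a\<in>MP (k + int t * K) (n + int t * p). \<exists>b\<in>MP (k + int t * K) (n + int t * p). f = F * a + H * b"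
proof -
  define V where "V t = MP (k + int t * K) (n + int t * p)" for t
  have V_lin: "lincomb m c b \<in> V t" if "\<And>i. i < m \<Longrightarrow> b i \<in> V t" for m c b t
    using that unfolding V_def by (intro MP_lincomb)
  have V_mult: "H * f \<in> V (Suc t)" if "f \<in> V t" for f t
    using MP_mult[OF H(1) that[unfolded V_def]] by (simp add: V_def algebra_simps)
  have V_syz: "\<exists>h\<in>V t. g = F * h" if "g \<in> V (Suc t)" "a \<in> V (Suc t)" "H * g = F * a" for g a t
    using pencil_syzygy[OF F H nc that[unfolded V_def]] by (simp add: V_def algebra_simps)
  \<comment> \<open>Independence of \<open>s\<close> elements of \<open>V (Suc t)\<close> modulo
    \<open>F\<close> times \<open>V t\<close>. By \<open>division\<close>, \<open>s\<close> is
    bounded independently of \<open>t\<close>.\<close>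
  define ind where "ind t s b \<longleftrightarrow> (\<forall>i<s. b i \<in> V (Suc t)) \<and>
    (\<forall>c. (\<exists>h\<in>V t. lincomb s c b = F * h) \<longrightarrow> (\<forall>i<s. c i = 0))" for t s b
  obtain C where C: "\<And>k n m b. m > C \<Longrightarrow> (\<forall>i<m. b i \<in> MP k n) \<Longrightarrow>
    (\<exists>c. (\<exists>i<m. c i \<noteq> 0) \<and> (\<exists>h\<in>MP (k - K) (n - p). lincomb m c b = F * h))"
    using division[OF F] by blast
  have bound: "s \<le> C" if i: "ind t s b" for t s b
  proof (rule ccontr)
    assume "\<not> s \<le> C"
    then obtain c where c: "\<exists>i<s. c i \<noteq> 0"
      "\<exists>h\<in>MP (k + int (Suc t) * K - K) (n + int (Suc t) * p - p). lincomb s c b = F * h"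
      using C[of s b "k + int (Suc t) * K" "n + int (Suc t) * p"] i unfolding ind_def V_def by auto
    then have "\<exists>h\<in>V t. lincomb s c b = F * h" by (simp add: V_def algebra_simps)
    then show False using i c(1) unfolding ind_def by blast
  qed
  define S where "S = {s. \<exists>t b. ind t s b}"
  have "S \<subseteq> {..C}" using bound by (auto simp: S_def)
  then have fin: "finite S" by (rule finite_subset) simp
  have "ind 0 0 (\<lambda>_. 0)" by (simp add: ind_def)
  then have "S \<noteq> {}" unfolding S_def by blast
  define s where "s = Max S"
  have "s \<in> S" unfolding s_def using fin \<open>S \<noteq> {}\<close> by (rule Max_in)
  then obtain T b0 where T: "ind T s b0" by (auto simp: S_def)
  have max: "s' \<le> s" if "ind t s' b" for t s' b
    unfolding s_def using that fin by (intro Max_ge) (auto simp: S_def)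
  have step: "ind (Suc t) s (\<lambda>i. H * b i)" if i: "ind t s b" for t b
    unfolding ind_def
  proof (intro conjI allI impI)
    fix j assume "j < s"
    then show "H * b j \<in> V (Suc (Suc t))" using i V_mult unfolding ind_def by blast
  next
    fix c j assume h: "\<exists>h\<in>V (Suc t). (\<Sum>i<s. mero_const (c i) * (H * b i)) = F * h" and j: "j < s"
    have bV: "lincomb s c b \<in> V (Suc t)" using i V_lin[of s b "Suc t"] unfolding ind_def by blast
    have "(\<Sum>i<s. mero_const (c i) * (H * b i)) = H * lincomb s c b"
      by (simp add: sum_distrib_left algebra_simps)
    then have "\<exists>h\<in>V t. lincomb s c b = F * h" using h V_syz[OF bV] by auto
    then show "c j = 0" using i j unfolding ind_def by blast
  qed
  have all: "\<exists>b. ind t s b" if "t \<ge> T" for t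
    using that
  proof (induction t rule: dec_induct)
    case base then show ?case using T by blast
  next
    case (step t) then show ?case using \<open>\<And>t b. ind t s b \<Longrightarrow> ind (Suc t) s (\<lambda>i. H * b i)\<close> by blast
  qed
  \<comment> \<open>From \<open>T\<close> on, \<open>H\<close> times a maximal independent family of
    the previous level is again maximal; adjoining \<open>f\<close> makes it dependent, and the
    coefficient of \<open>f\<close> cannot vanish. Going back one level is the reason for
    \<open>Suc T\<close>.\<close>
  have "\<exists>a\<in>V t. \<exists>b\<in>V t. f = F * a + H * b" if t: "t \<ge> Suc T" and f: "f \<in> V (Suc t)" for t f
  proof -
    obtain u where u: "t = Suc u" "u \<ge> T" using t by (cases t) auto
    obtain b where b: "ind u s b" using all[OF u(2)] by blast
    have b': "ind t s (\<lambda>i. H * b i)" using step[OF b] u by simp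
    define b'' where "b'' i = (if i < s then H * b i else f)" for i
    have "\<not> ind t (Suc s) b''" using max[of t "Suc s" b''] by auto
    moreover have "\<forall>i<Suc s. b'' i \<in> V (Suc t)" using b' f unfolding ind_def b''_def by auto
    ultimately obtain c h j where c: "h \<in> V t" "lincomb (Suc s) c b'' = F * h" "j < Suc s" "c j \<noteq> 0"
      unfolding ind_def by blast
    have eq: "(\<Sum>i<s. mero_const (c i) * (H * b i)) + mero_const (c s) * f = F * h"
      using c(2) by (simp add: b''_def)
    have cs: "c s \<noteq> 0"
    proof
      assume 0: "c s = 0"
      then have "(\<Sum>i<s. mero_const (c i) * (H * b i)) = F * h" using eq by simp
      then have "\<forall>i<s. c i = 0" using b' c(1) unfolding ind_def by blast
      then show False using c(3,4) 0 by (cases "j = s") auto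
    qed
    let ?k = "mero_const (inverse (c s))"
    have k: "?k * mero_const (c s) = 1" using cs by (simp flip: mero_const_mult)
    have "f = ?k * (mero_const (c s) * f)" using k by (simp flip: mult.assoc)
    also have "mero_const (c s) * f = F * h - H * lincomb s c b"
      using eq by (simp add: sum_distrib_left algebra_simps)
    finally have "f = F * (?k * h) + H * (mero_const (- inverse (c s)) * lincomb s c b)"
      by (simp add: mero_const_uminus algebra_simps)
    moreover have "?k * h \<in> V t" using c(1) MP_const_mult by (simp add: V_def)
    moreover have "lincomb s c b \<in> V t" using b u V_lin[of s b t] unfolding ind_def by blast
    then have "mero_const (- inverse (c s)) * lincomb s c b \<in> V t" unfolding V_def by (rule MP_const_mult)
    ultimately show ?thesis by blast
  qed
  then show ?thesis unfolding V_def by blast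
qed

subsection \<open>Modular forms\<close>

lemma modular_power_nonvanishing:
  assumes "F \<in> MP l 0" "mord z F = 0" "F \<noteq> 0" "z \<in> uhp"
  shows "F ^ m \<in> MP (int m * l) 0" "fls_nth (germ z (F ^ m)) 0 \<noteq> 0" "F ^ m \<noteq> 0"
proof -
  show "F ^ m \<in> MP (int m * l) 0" using MP_power[OF assms(1), of m] by simp
  show "F ^ m \<noteq> 0" using assms by simp
  then have "germ z (F ^ m) \<noteq> 0" using assms(4) germ_eq_0_iff by blast
  moreover have "mord z (F ^ m) = 0" using assms by simp
  ultimately show "fls_nth (germ z (F ^ m)) 0 \<noteq> 0" unfolding mord_def
    by (metis nth_fls_subdegree_nonzero)
qed

text \<open>A form not vanishing at \<open>\<i>\<close> has finitely many zeros modulo \<Gamma>. At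
  each of them some form does not vanish; powers bring these forms to one weight, and a generic
  combination avoids all the zeros at once.\<close>

lemma modular_pair:
  obtains K F H where "K > 0" "F \<in> MP (int K) 0" "H \<in> MP (int K) 0" "F \<noteq> 0" "H \<noteq> 0" "mord \<i> F = 0"
    "no_common_zero 0 F H"
proof -
  obtain F0 l0 where F0: "l0 > 0" "F0 \<in> MP l0 0" "mord \<i> F0 = 0" "F0 \<noteq> 0"
    using modular_form_nonvanishing[OF ii_uhp] by metis
  define Z where "Z = insert \<i> {z \<in> FK. mord z F0 \<noteq> 0}"
  have Z: "finite Z" "Z \<subseteq> uhp" unfolding Z_def using finite_mord_nz[OF FK(1,2)] FK(2) by auto
  have "\<forall>z\<in>Z. \<exists>Fl. snd Fl > 0 \<and> fst Fl \<in> MP (snd Fl) 0 \<and> mord z (fst Fl) = 0 \<and> fst Fl \<noteq> 0"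
    using modular_form_nonvanishing Z(2) by (metis fst_conv snd_conv subsetD)
  from bchoice[OF this] obtain Fl where
    Fl: "\<And>z. z \<in> Z \<Longrightarrow> snd (Fl z) > 0 \<and> fst (Fl z) \<in> MP (snd (Fl z)) 0 \<and> mord z (fst (Fl z)) = 0 \<and> fst (Fl z) \<noteq> 0"
    by blast
  define P where "P = (\<Prod>z\<in>Z. snd (Fl z))"
  have P: "P > 0" unfolding P_def using Fl by (intro prod_pos) auto
  \<comment> \<open>A common multiple of \<open>l0\<close> and of the weights of all the forms in
    \<open>Fl\<close>.\<close>
  define K where "K = nat (l0 * P)"
  have K: "int K = l0 * P" "K > 0" using F0 P by (auto simp: K_def)
  have ex: "\<exists>f\<in>MP (int K) 0. fls_nth (germ z f) 0 \<noteq> 0" if z: "z \<in> Z" for z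
  proof -
    have "snd (Fl z) dvd int K" unfolding K(1) P_def using Z z by (intro dvd_mult dvd_prodI) auto
    then obtain q where q: "int K = snd (Fl z) * q" by (auto simp: dvd_def)
    then have "q > 0" using K Fl[OF z] by (metis of_nat_0_less_iff zero_less_mult_pos)
    then have "int (nat q) * snd (Fl z) = int K" using q by simp
    moreover have "z \<in> uhp" using Z z by blast
    ultimately have "fst (Fl z) ^ nat q \<in> MP (int K) 0" "fls_nth (germ z (fst (Fl z) ^ nat q)) 0 \<noteq> 0"
      using modular_power_nonvanishing[of "fst (Fl z)" "snd (Fl z)" z "nat q"] Fl[OF z] by metis+
    then show ?thesis by blast
  qed
  have "\<exists>f\<in>MP (int K) 0. \<forall>z\<in>Z. fls_nth (germ z f) 0 \<noteq> 0"
    by (rule generic_nonvanishing[OF Z]) (use MP_add MP_const_mult MP_0 ex in blast)+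
  then obtain H where H: "H \<in> MP (int K) 0" "\<And>z. z \<in> Z \<Longrightarrow> fls_nth (germ z H) 0 \<noteq> 0" by blast
  have mH: "mord z H = 0" if "z \<in> Z" for z
  proof -
    have "z \<in> uhp" using that Z by blast
    then have "mord z H \<ge> 0" using H(1) by (simp add: MP_0_iff mord_ge_0_iff)
    moreover have "\<not> mord z H > 0" using H(2)[OF that] unfolding mord_def by auto
    ultimately show ?thesis by simp
  qed
  have H0: "H \<noteq> 0" using H(2)[of \<i>] by (auto simp: Z_def)
  define F where "F = F0 ^ nat P"
  have F: "F \<in> MP (int K) 0" "F \<noteq> 0" "mord \<i> F = 0"
    using MP_power[OF F0(2), of "nat P"] F0 P K by (auto simp: F_def mult.commute)
  have "mord z F = 0 \<or> mord z H = 0" if z: "z \<in> uhp" for z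
  proof -
    obtain A where A: "A \<in> G" "moebius A z \<in> FK" using FK(3)[OF z] by blast
    have "mord (moebius A z) F0 = 0 \<or> moebius A z \<in> Z" using A by (auto simp: Z_def)
    then have "mord z F0 = 0 \<or> mord z H = 0"
      using mH mord_wt[OF MP_wt[OF F0(2)] A(1) z] mord_wt[OF MP_wt[OF H(1)] A(1) z] by auto
    then show ?thesis using z by (auto simp: F_def)
  qed
  then have "no_common_zero 0 F H" using F by (simp add: no_common_zero_def)
  then show ?thesis using that K F H H0 by blast
qed

text \<open>The pencil statement for each residue class of the weight modulo \<open>K\<close>, with
  the largest of the finitely many thresholds. It places all forms of large weight in the square of
  the ideal of positive weight.\<close>

lemma modular_form_split:
  obtains W K F H where "K > 0" "F \<in> MP (int K) 0" "H \<in> MP (int K) 0" "W > K"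
    "\<And>k f. k \<ge> W \<Longrightarrow> f \<in> MP (int k) 0 \<Longrightarrow> \<exists>a\<in>MP (int (k - K)) 0. \<exists>b\<in>MP (int (k - K)) 0. f = F * a + H * b"
proof -
  obtain K F H where P: "K > 0" "F \<in> MP (int K) 0" "H \<in> MP (int K) 0" "F \<noteq> 0" "H \<noteq> 0" "mord \<i> F = 0"
    "no_common_zero 0 F H" by (rule modular_pair)
  have "\<forall>r. \<exists>T::nat. \<forall>t\<ge>T. \<forall>f\<in>MP (int r + int (Suc t) * int K) 0.
    \<exists>a\<in>MP (int r + int t * int K) 0. \<exists>b\<in>MP (int r + int t * int K) 0. f = F * a + H * b"
    using pencil[OF P(2,4,3,5,7), of "int _" 0] by simp
  then obtain T :: "nat \<Rightarrow> nat" where T: "\<And>r t f. t \<ge> T r \<Longrightarrow> f \<in> MP (int r + int (Suc t) * int K) 0 \<Longrightarrow>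
    \<exists>a\<in>MP (int r + int t * int K) 0. \<exists>b\<in>MP (int r + int t * int K) 0. f = F * a + H * b" by metis
  define M where "M = Max (T ` {..<K})"
  have M: "T r \<le> M" if "r < K" for r unfolding M_def using that by (intro Max_ge) auto
  show ?thesis
  proof (rule that[OF P(1,2,3), of "K * (M + 2)"])
    show "K * (M + 2) > K" using P(1) by simp
    fix k f assume k: "k \<ge> K * (M + 2)" and f: "f \<in> MP (int k) 0"
    define r where "r = k mod K"
    have "k div K \<ge> M + 2" using k P(1) by (simp add: less_eq_div_iff_mult_less_eq mult.commute)
    then obtain t where t: "k div K = Suc t" "t \<ge> M" by (cases "k div K") auto
    have keq: "k = r + Suc t * K" using t div_mult_mod_eq[of k K] by (simp add: r_def)
    have "int k = int r + int (Suc t) * int K" "int (k - K) = int r + int t * int K"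
      using keq by (auto simp: algebra_simps)
    moreover have "T r \<le> t" using M[of r] t P(1) by (auto simp: r_def)
    ultimately show "\<exists>a\<in>MP (int (k - K)) 0. \<exists>b\<in>MP (int (k - K)) 0. f = F * a + H * b"
      using T[of r t f] f by simp
  qed
qed

text \<open>The weight of \<open>F ^ Suc k\<close> exceeds \<open>k\<close>, so a form of weight
  \<open>k\<close> divisible by it has a quotient of negative weight and is 0.\<close>

lemma modular_forms_finite_dim:
  obtains N where "\<And>m b. m > N \<Longrightarrow> (\<forall>i<m. b i \<in> MP (int k) 0) \<Longrightarrow> \<exists>c. (\<exists>i<m. c i \<noteq> 0) \<and> lincomb m c b = 0"
proof -
  obtain K F H where P: "K > 0" "F \<in> MP (int K) 0" "H \<in> MP (int K) 0" "F \<noteq> 0" "H \<noteq> 0" "mord \<i> F = 0"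
    "no_common_zero 0 F H" by (rule modular_pair)
  have Fk: "F ^ Suc k \<in> MP (int (Suc k) * int K) 0" "F ^ Suc k \<noteq> 0"
    using MP_power[OF P(2), of "Suc k"] P by (auto simp del: power_Suc)
  obtain C where C: "\<And>k' n m b. m > C \<Longrightarrow> (\<forall>i<m. b i \<in> MP k' n) \<Longrightarrow>
    (\<exists>c. (\<exists>i<m. c i \<noteq> 0) \<and> (\<exists>h\<in>MP (k' - int (Suc k) * int K) (n - 0). lincomb m c b = F ^ Suc k * h))"
    using division[OF Fk] by blast
  have neg: "int k - int (Suc k) * int K < 0"
  proof -
    have "int (Suc k) * 1 \<le> int (Suc k) * int K" using P(1) by (intro mult_left_mono) auto
    then show ?thesis by (simp add: algebra_simps)
  qed
  show ?thesis
  proof (rule that[of C])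
    fix m b assume "m > C" "\<forall>i<m. b i \<in> MP (int k) 0"
    then obtain c h where "\<exists>i<m. c i \<noteq> 0" "h \<in> MP (int k - int (Suc k) * int K) (0 - 0)" "lincomb m c b = F ^ Suc k * h"
      using C[of m b "int k" 0] by blast
    then show "\<exists>c. (\<exists>i<m. c i \<noteq> 0) \<and> lincomb m c b = 0"
      using MP_neg_weight[OF neg] by auto
  qed
qed

section \<open>Existence of \<open>\<phi>\<close>\<close>

subsection \<open>Forms of negative weight\<close>

text \<open>The leading coefficient of the term of least order that occurs cannot be
  cancelled.\<close>

lemma lincomb_distinct_orders:
  assumes z: "z \<in> uhp" and b: "\<And>i. i < m \<Longrightarrow> b i \<noteq> 0"
    and mono: "\<And>i j. i < j \<Longrightarrow> j < m \<Longrightarrow> mord z (b j) < mord z (b i)"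
    and c: "\<exists>i<m. c i \<noteq> 0"
  shows "lincomb m c b \<noteq> 0"
proof -
  define i where "i = Max {i. i < m \<and> c i \<noteq> 0}"
  have "i \<in> {i. i < m \<and> c i \<noteq> 0}" unfolding i_def using c by (intro Max_in) auto
  then have i: "i < m" "c i \<noteq> 0" by auto
  have max: "j \<le> i" if "j < m" "c j \<noteq> 0" for j unfolding i_def using that by (intro Max_ge) auto
  have "fls_nth (germ z (lincomb m c b)) (mord z (b i)) = (\<Sum>j<m. c j * fls_nth (germ z (b j)) (mord z (b i)))"
    by (rule fls_nth_lincomb[OF z])
  also have "\<dots> = (\<Sum>j\<in>{i}. c j * fls_nth (germ z (b j)) (mord z (b i)))"
  proof (rule sum.mono_neutral_right)
    show "\<forall>j\<in>{..<m} - {i}. c j * fls_nth (germ z (b j)) (mord z (b i)) = 0"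
    proof
      fix j assume j: "j \<in> {..<m} - {i}"
      show "c j * fls_nth (germ z (b j)) (mord z (b i)) = 0"
      proof (cases "c j = 0")
        case False
        then have "j < i" using max[of j] j by auto
        then have "mord z (b i) < mord z (b j)" using mono i by blast
        then show ?thesis by (simp add: mord_def)
      qed simp
    qed
  qed (use i in auto)
  also have "\<dots> \<noteq> 0"
    using i b[OF i(1)] z nth_fls_subdegree_nonzero[of "germ z (b i)"] by (simp add: mord_def)
  finally show ?thesis by auto
qed

text \<open>Poincare series of one weight \<open>l\<close> with ever larger poles outnumber the
  conditions for divisibility by \<open>F ^ m\<close>. The resulting combination
  \<open>F ^ m * h\<close> is nonzero, as the pole orders are distinct, and \<open>h\<close> has
  weight \<open>l - m K\<close>, which is as negative as desired.\<close>

lemma negative_weight_form: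
  obtains k h where "k > B" "h \<in> MI (- k)" "h \<noteq> 0"
proof -
  obtain l where l: "l > 0" "\<And>n. n > 0 \<Longrightarrow> \<exists>Q\<in>wt (int l). (\<forall>z\<in>uhp - orb \<i>. mord_ge z Q 0) \<and>
     mord \<i> Q = - int (card (stab \<i>) * n) \<and> Q \<noteq> 0"
    using poincare_pole[OF ii_uhp] by metis
  then obtain Q where Q: "\<And>n. n > 0 \<Longrightarrow> Q n \<in> wt (int l) \<and> (\<forall>z\<in>uhp - orb \<i>. mord_ge z (Q n) 0) \<and>
     mord \<i> (Q n) = - int (card (stab \<i>) * n) \<and> Q n \<noteq> 0" by metis
  obtain F K where F: "K > 0" "F \<in> MP K 0" "mord \<i> F = 0" "F \<noteq> 0"
    using modular_form_nonvanishing[OF ii_uhp] by metis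
  define m where "m = nat (\<bar>B\<bar> + int l + 1)"
  define k where "k = int m * K - int l"
  have "int m * 1 \<le> int m * K" using F(1) by (intro mult_left_mono) auto
  moreover have "int m = \<bar>B\<bar> + int l + 1" by (simp add: m_def)
  ultimately have kB: "k > B" unfolding k_def by linarith
  have Fm: "F ^ m \<in> MP (int m * K) 0" "F ^ m \<noteq> 0" using MP_power[OF F(2), of m] F by auto
  obtain C where C: "\<And>k' n m' b. m' > C \<Longrightarrow> (\<forall>i<m'. b i \<in> MP k' n) \<Longrightarrow>
    (\<exists>c. (\<exists>i<m'. c i \<noteq> 0) \<and> (\<exists>h\<in>MP (k' - int m * K) (n - 0). lincomb m' c b = F ^ m * h))"
    using division[OF Fm] by blast
  define b where "b i = Q (Suc i)" for i
  define N where "N = int (card (stab \<i>) * Suc C)"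
  have bN: "b i \<in> MP (int l) N" if "i < Suc C" for i
  proof -
    have "card (stab \<i>) * Suc i \<le> card (stab \<i>) * Suc C" using that by (intro mult_left_mono) auto
    then have "mord \<i> (b i) \<ge> - N" using Q[of "Suc i"] unfolding b_def N_def by linarith
    then show ?thesis using Q[of "Suc i"] by (auto simp: MP_def MI_def b_def mord_ge_iff)
  qed
  then obtain c h where ch: "\<exists>i<Suc C. c i \<noteq> 0" "h \<in> MP (int l - int m * K) (N - 0)" "lincomb (Suc C) c b = F ^ m * h"
    using C[of "Suc C" b "int l" N] by blast
  have "lincomb (Suc C) c b \<noteq> 0"
  proof (rule lincomb_distinct_orders[OF ii_uhp _ _ ch(1)])
    show "b i \<noteq> 0" for i using Q[of "Suc i"] by (simp add: b_def)
    show "mord \<i> (b j) < mord \<i> (b i)" if "i < j" for i j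
      using Q[of "Suc i"] Q[of "Suc j"] that card_stab_pos[OF ii_uhp] by (simp add: b_def)
  qed
  then have "h \<noteq> 0" using ch(3) by auto
  moreover have "h \<in> MI (- k)" using MP_MI[OF ch(2)] by (simp add: k_def)
  ultimately show ?thesis using that kB by blast
qed

text \<open>A form \<open>h0\<close> of negative weight may vanish at \<open>z0\<close>; a power of it is multiplied by a form of fixed positive
  weight whose only poles, on the orbit of \<open>z0\<close>, cancel the zeros.\<close>

lemma dual_pair:
  assumes z0: "z0 \<in> uhp" "z0 \<notin> orb \<i>"
  obtains k f h where "k > 0" "f \<in> MP k 0" "h \<in> MI (- k)" "fls_nth (germ z0 (f * h)) 0 \<noteq> 0"
proof -
  define e where "e = card (stab z0)"
  have e: "e > 0" using card_stab_pos z0 by (simp add: e_def)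
  obtain l where l: "l > 0" "\<And>n. n > 0 \<Longrightarrow> \<exists>Q\<in>wt (int l). (\<forall>z\<in>uhp - orb z0. mord_ge z Q 0) \<and>
     mord z0 Q = - int (e * n) \<and> Q \<noteq> 0"
    using poincare_pole[OF z0(1)] unfolding e_def by metis
  \<comment> \<open>The bound \<open>l\<close> ensures that multiplying a power of \<open>h0\<close>
    by a form of weight \<open>l\<close> leaves the weight negative.\<close>
  obtain k0 h0 where h0: "k0 > int l" "h0 \<in> MI (- k0)" "h0 \<noteq> 0" by (rule negative_weight_form)
  have v0: "mord z0 h0 \<ge> 0" using MI_regular[OF h0(2)] z0 by (simp add: mord_ge_0_iff)
  have "\<exists>k h. k > 0 \<and> h \<in> MI (- k) \<and> h \<noteq> 0 \<and> mord z0 h = 0"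
  proof (cases "mord z0 h0 = 0")
    case True
    then show ?thesis using h0 by (intro exI[of _ k0] exI[of _ h0]) auto
  next
    case False
    then obtain n where n: "mord z0 h0 = int n" "n > 0" using v0 by (metis gr_zeroI of_nat_0 zero_le_imp_eq_int)
    obtain Q where Q: "Q \<in> wt (int l)" "\<And>z. z \<in> uhp - orb z0 \<Longrightarrow> mord_ge z Q 0"
      "mord z0 Q = - int (e * n)" "Q \<noteq> 0" using l(2)[OF n(2)] by blast
    \<comment> \<open>Pole orders of the available series are multiples of \<open>e\<close>; with
      the power \<open>e\<close>, the orders \<open>e n\<close> and \<open>- e n\<close>
      cancel.\<close>
    define h where "h = h0 ^ e * Q"
    define k where "k = int e * k0 - int l"
    have "int e * k0 \<ge> 1 * k0" using e h0(1) by (intro mult_right_mono) auto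
    then have k: "k > 0" using h0(1) unfolding k_def by linarith
    have he: "h0 ^ e \<in> MI (int e * (- k0))" by (rule MI_power[OF h0(2)])
    have hw: "h \<in> wt (- k)" using wt_mult[OF MI_wt[OF he] Q(1)] by (simp add: h_def k_def)
    have h1: "mord z0 h = 0" "h \<noteq> 0"
      using z0 h0(3) Q(3,4) n by (auto simp: h_def mord_mult)
    have "mord_ge z h 0" if z: "z \<in> uhp" "z \<notin> orb \<i>" for z
    proof (cases "z \<in> orb z0")
      case True
      then show ?thesis using mord_ge_orb[OF hw z0(1) True, of 0] h1 z0 by (simp add: mord_ge_0_iff)
    next
      case False
      then show ?thesis using mord_ge_mult[OF z(1) MI_regular[OF he z] Q(2)[of z]] z by (simp add: h_def)
    qed
    then have "h \<in> MI (- k)" using hw by (simp add: MI_def)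
    then show ?thesis using k h1 by blast
  qed
  then obtain k h where h: "k > 0" "h \<in> MI (- k)" "h \<noteq> 0" "mord z0 h = 0" by blast
  obtain f j where f: "j > 0" "f \<in> MP j 0" "mord z0 f = 0" "f \<noteq> 0"
    using modular_form_nonvanishing[OF z0(1)] by metis
  define f' where "f' = f ^ nat k"
  define h' where "h' = h ^ nat j"
  have "f' \<in> MP (k * j) 0" using MP_power[OF f(2), of "nat k"] h(1) by (simp add: f'_def)
  moreover have "h' \<in> MI (- (k * j))" using MI_power[OF h(2), of "nat j"] f(1) by (simp add: h'_def mult.commute)
  moreover have "k * j > 0" using h f by simp
  moreover have nz: "f' * h' \<noteq> 0" "mord z0 (f' * h') = 0" using z0 h f by (auto simp: f'_def h'_def mord_mult)
  have "germ z0 (f' * h') \<noteq> 0" using nz(1) germ_eq_0_iff[OF z0(1)] by blast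
  from nth_fls_subdegree_nonzero[OF this] nz(2) have "fls_nth (germ z0 (f' * h')) 0 \<noteq> 0"
    unfolding mord_def by metis
  ultimately show ?thesis using that by blast
qed

subsection \<open>The coordinate ring of the affine curve\<close>

lemma MI_0_pole:
  assumes "a \<in> MI 0" "\<And>c. a \<noteq> mero_const c" shows "mord \<i> a < 0"
proof (rule ccontr)
  assume "\<not> mord \<i> a < 0"
  then have "a \<in> MP 0 0" using assms(1) by (simp add: MP_def mord_ge_0_iff)
  then show False using MP_0_const assms(2) by blast
qed

lemma comaximal_pair:
  assumes a: "a \<in> MI 0" "a \<noteq> 0" and b: "b \<in> MI 0" "b \<noteq> 0"
    and nc: "\<And>z. z \<in> uhp \<Longrightarrow> z \<notin> orb \<i> \<Longrightarrow> mord z a = 0 \<or> mord z b = 0"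
  obtains x y where "x \<in> MI 0" "y \<in> MI 0" "a * x + b * y = 1"
proof (cases "(\<exists>c. a = mero_const c) \<or> (\<exists>c. b = mero_const c)")
  case True
  then show ?thesis
  proof
    assume "\<exists>c. a = mero_const c"
    then obtain c where c: "a = mero_const c" by blast
    then have "c \<noteq> 0" using a by auto
    then have "a * mero_const (inverse c) + b * 0 = 1" using c by (simp flip: mero_const_mult)
    then show ?thesis using that[of "mero_const (inverse c)" 0] by simp
  next
    assume "\<exists>c. b = mero_const c"
    then obtain c where c: "b = mero_const c" by blast
    then have "c \<noteq> 0" using b by auto
    then have "a * 0 + b * mero_const (inverse c) = 1" using c by (simp flip: mero_const_mult)
    then show ?thesis using that[of 0 "mero_const (inverse c)"] by simp
  qed
next
  case False
  then have "mord \<i> a < 0" "mord \<i> b < 0" using MI_0_pole a b by blast+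
  then obtain p q where p: "mord \<i> a = - int p" "p > 0" and q: "mord \<i> b = - int q" "q > 0"
    by (metis int_cases2 neg_0_less_iff_less of_nat_0_less_iff verit_minus_simplify(4) of_nat_less_0_iff)
  define F where "F = a ^ q"
  define H where "H = b ^ p"
  have P: "F \<in> MP 0 (int (p * q))" "H \<in> MP 0 (int (p * q))" "F \<noteq> 0" "H \<noteq> 0"
    "mord \<i> F = - int (p * q)"
    using MI_power[OF a(1), of q] MI_power[OF b(1), of p] a b p q
    by (auto simp: F_def H_def MP_def mord_ge_iff mult.commute)
  have "no_common_zero (int (p * q)) F H"
    using P(5) nc unfolding no_common_zero_def by (auto simp: F_def H_def)
  from pencil[OF P(1,3,2,4) this, of 0 0] obtain T where
    T: "\<forall>f\<in>MP (0 + int (Suc T) * 0) (0 + int (Suc T) * int (p * q)).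
      \<exists>x\<in>MP (0 + int T * 0) (0 + int T * int (p * q)). \<exists>y\<in>MP (0 + int T * 0) (0 + int T * int (p * q)). f = F * x + H * y"
    by blast
  have "1 \<in> MP (0 + int (Suc T) * 0) (0 + int (Suc T) * int (p * q))"
    using MP_mono[OF MP_const[of 1], of "int (Suc T) * int (p * q)"] by simp
  then obtain x y where x: "x \<in> MP (0 + int T * 0) (0 + int T * int (p * q))"
    "y \<in> MP (0 + int T * 0) (0 + int T * int (p * q))" "1 = F * x + H * y" using T by blast
  have xy: "x \<in> MI 0" "y \<in> MI 0" "1 = F * x + H * y" using MP_MI[OF x(1)] MP_MI[OF x(2)] x(3) by simp_all
  have "a * (a ^ (q - 1) * x) + b * (b ^ (p - 1) * y) = 1"
    using xy(3) p q by (simp add: F_def H_def power_eq_if mult.assoc)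
  moreover have "a ^ (q - 1) * x \<in> MI 0" "b ^ (p - 1) * y \<in> MI 0"
    using MI_mult[OF MI_power[OF a(1), of "q - 1"] xy(1)] MI_mult[OF MI_power[OF b(1), of "p - 1"] xy(2)] by auto
  ultimately show ?thesis using that by blast
qed

text \<open>The sums of products \<open>f h\<close> form an ideal of \<open>MI 0\<close>. It is
  nonzero, and by \<open>dual_pair\<close> it has no common zero, so two suitable elements satisfy
  the assumptions of \<open>comaximal_pair\<close>.\<close>

lemma dual_unity:
  "\<exists>(n::nat) k f h. (\<forall>j<n. k j > (0::int) \<and> f j \<in> MP (k j) 0 \<and> h j \<in> MI (- k j)) \<and> (\<Sum>j<n. f j * h j) = 1"
proof -
  define V where "V = {a. \<exists>n k f h. (\<forall>j<(n::nat). k j > (0::int) \<and> f j \<in> MP (k j) 0 \<and> h j \<in> MI (- k j)) \<and>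
     a = (\<Sum>j<n. f j * h j)}"
  have V0: "0 \<in> V" unfolding V_def by (intro CollectI exI[of _ 0]) auto
  have V_single: "f * h \<in> V" if "k > 0" "f \<in> MP k 0" "h \<in> MI (- k)" for k f h
    unfolding V_def using that
    by (intro CollectI exI[of _ 1] exI[of _ "\<lambda>_. k"] exI[of _ "\<lambda>_. f"] exI[of _ "\<lambda>_. h"]) auto
  have V_add: "a + b \<in> V" if ab: "a \<in> V" "b \<in> V" for a b
  proof -
    obtain n k f h where 1: "\<forall>j<(n::nat). k j > (0::int) \<and> f j \<in> MP (k j) 0 \<and> h j \<in> MI (- k j)"
      "a = (\<Sum>j<n. f j * h j)" using ab(1) by (auto simp: V_def)
    obtain n' k' f' h' where 2: "\<forall>j<(n'::nat). k' j > (0::int) \<and> f' j \<in> MP (k' j) 0 \<and> h' j \<in> MI (- k' j)"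
      "b = (\<Sum>j<n'. f' j * h' j)" using ab(2) by (auto simp: V_def)
    define K where "K j = (if j < n then k j else k' (j - n))" for j
    define F where "F j = (if j < n then f j else f' (j - n))" for j
    define H where "H j = (if j < n then h j else h' (j - n))" for j
    have "(\<Sum>j<n + n'. F j * H j) = (\<Sum>j<n. F j * H j) + (\<Sum>j=n..<n + n'. F j * H j)"
      by (simp add: lessThan_atLeast0 sum.atLeastLessThan_concat)
    also have "(\<Sum>j=n..<n + n'. F j * H j) = (\<Sum>j<n'. F (j + n) * H (j + n))"
      using sum.shift_bounds_nat_ivl[of "\<lambda>j. F j * H j" 0 n n'] by (simp add: lessThan_atLeast0 add.commute)
    finally have "(\<Sum>j<n + n'. F j * H j) = a + b"
      using 1(2) 2(2) by (simp add: F_def H_def)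
    moreover have "\<forall>j<n + n'. K j > 0 \<and> F j \<in> MP (K j) 0 \<and> H j \<in> MI (- K j)"
      using 1(1) 2(1) by (auto simp: K_def F_def H_def)
    ultimately show ?thesis unfolding V_def by (intro CollectI exI[of _ "n + n'"] exI[of _ K] exI[of _ F] exI[of _ H]) auto
  qed
  have V_mult: "x * a \<in> V" if x: "x \<in> MI 0" and a: "a \<in> V" for x a
  proof -
    obtain n k f h where 1: "\<forall>j<(n::nat). k j > (0::int) \<and> f j \<in> MP (k j) 0 \<and> h j \<in> MI (- k j)"
      "a = (\<Sum>j<n. f j * h j)" using a by (auto simp: V_def)
    have "x * a = (\<Sum>j<n. f j * (x * h j))" unfolding 1(2) by (simp add: sum_distrib_left algebra_simps)
    moreover have "\<forall>j<n. x * h j \<in> MI (- k j)" using 1(1) MI_mult[OF x] by fastforce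
    ultimately show ?thesis unfolding V_def
      using 1(1) by (intro CollectI exI[of _ n] exI[of _ k] exI[of _ f] exI[of _ "\<lambda>j. x * h j"]) auto
  qed
  have V_MI: "a \<in> MI 0" if a: "a \<in> V" for a
  proof -
    obtain n k f h where 1: "\<forall>j<(n::nat). k j > (0::int) \<and> f j \<in> MP (k j) 0 \<and> h j \<in> MI (- k j)"
      "a = (\<Sum>j<n. f j * h j)" using a by (auto simp: V_def)
    have "f j * h j \<in> MI 0" if "j < n" for j
      using 1(1) that MI_mult[of "f j" "k j" "h j" "- k j"] MP_MI by auto
    then show ?thesis unfolding 1(2) by (intro MI_sum) auto
  qed
  obtain a where a: "a \<in> V" "a \<noteq> 0"
  proof -
    obtain k h where h: "k > 0" "h \<in> MI (- k)" "h \<noteq> 0" by (rule negative_weight_form)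
    obtain f j where f: "j > 0" "f \<in> MP j 0" "mord \<i> f = 0" "f \<noteq> 0"
      using modular_form_nonvanishing[OF ii_uhp] by metis
    have "f ^ nat k * h ^ nat j \<in> V"
      using MP_power[OF f(2), of "nat k"] MI_power[OF h(2), of "nat j"] h f
      by (intro V_single[of "k * j"]) (auto simp: mult.commute)
    then show ?thesis using that h f by (metis mult_eq_0_iff power_not_zero)
  qed
  define Z where "Z = {z \<in> FK. mord z a \<noteq> 0 \<and> z \<notin> orb \<i>}"
  have Z: "finite Z" "Z \<subseteq> uhp"
    using finite_mord_nz[OF FK(1,2), of a] FK(2) unfolding Z_def by (auto elim: rev_finite_subset)
  have "\<exists>b\<in>V. \<forall>z\<in>Z. fls_nth (germ z b) 0 \<noteq> 0"
  proof (rule generic_nonvanishing[OF Z])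
    fix z assume "z \<in> Z"
    then have "z \<in> uhp" "z \<notin> orb \<i>" using Z by (auto simp: Z_def)
    then obtain k f h where "k > 0" "f \<in> MP k 0" "h \<in> MI (- k)" "fls_nth (germ z (f * h)) 0 \<noteq> 0" by (rule dual_pair)
    then show "\<exists>f\<in>V. fls_nth (germ z f) 0 \<noteq> 0" using V_single by blast
  qed (use V_add V_mult[OF MI_const] V0 in auto)
  then obtain b0 where b0: "b0 \<in> V" "\<And>z. z \<in> Z \<Longrightarrow> fls_nth (germ z b0) 0 \<noteq> 0" by blast
  \<comment> \<open>If \<open>a\<close> has no zeros off the orbit of \<open>\<i>\<close>, then
    \<open>b0\<close> may be 0 and \<open>a\<close> itself serves.\<close>
  define b where "b = (if Z = {} then a else b0)"
  have b: "b \<in> V" "\<And>z. z \<in> Z \<Longrightarrow> fls_nth (germ z b) 0 \<noteq> 0" "b \<noteq> 0"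
    using a b0 by (auto simp: b_def)
  have "mord z a = 0 \<or> mord z b = 0" if z: "z \<in> uhp" "z \<notin> orb \<i>" for z
  proof -
    obtain A where A: "A \<in> G" "moebius A z \<in> FK" using FK(3)[OF z(1)] by blast
    let ?w = "moebius A z"
    have w: "?w \<in> uhp" "?w \<notin> orb \<i>" using A z FK(2) moebius_in_orb_iff[OF A(1) z(1) ii_uhp] by auto
    have "mord ?w a = 0 \<or> mord ?w b = 0"
    proof (cases "?w \<in> Z")
      case True
      have "mord ?w b \<ge> 0" using MI_regular[OF V_MI[OF b(1)] w] w by (simp add: mord_ge_0_iff)
      moreover have "\<not> mord ?w b > 0" using b(2)[OF True] unfolding mord_def by auto
      ultimately show ?thesis by simp
    next
      case False
      then show ?thesis using A w by (auto simp: Z_def)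
    qed
    then show ?thesis using mord_wt[OF MI_wt[OF V_MI[OF a(1)]] A(1) z(1)] mord_wt[OF MI_wt[OF V_MI[OF b(1)]] A(1) z(1)] by simp
  qed
  then obtain x y where xy: "x \<in> MI 0" "y \<in> MI 0" "a * x + b * y = 1"
    using comaximal_pair[OF V_MI[OF a(1)] a(2) V_MI[OF b(1)] b(3)] by metis
  then have "1 \<in> V" using V_add[OF V_mult[OF xy(1) a(1)] V_mult[OF xy(2) b(1)]] by (simp add: mult.commute)
  then obtain n k f h where 1: "\<forall>j<(n::nat). k j > (0::int) \<and> f j \<in> MP (k j) 0 \<and> h j \<in> MI (- k j)"
      "1 = (\<Sum>j<n. f j * h j)" by (auto simp: V_def)
  then show ?thesis by metis
qed

subsection \<open>Quasimodular forms of weight 2\<close>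

definition quasi2 :: "merofun \<Rightarrow> bool" where
  "quasi2 \<phi> \<longleftrightarrow> (\<forall>A\<in>G. mcomp A \<phi> = (autofun A)\<^sup>2 * \<phi> + mero_const (of_real (A$2$1)) * autofun A)"

lemma eventually_not_orb:
  assumes "z \<in> uhp" "w \<in> uhp" shows "eventually (\<lambda>x. x \<notin> orb w) (at z)"
proof -
  obtain e where e: "e > 0" "cball z e \<subseteq> uhp" "cball w e \<subseteq> uhp"
    "\<And>A x. A \<in> G \<Longrightarrow> x \<in> cball z e \<Longrightarrow> moebius A x \<in> cball w e \<Longrightarrow> moebius A z = w"
    using separating_radius[OF assms] by metis
  have "eventually (\<lambda>x. x \<in> ball z e - {z}) (at z)" using e by (intro eventually_at_in_open) auto
  then show ?thesis
  proof eventually_elim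
    case (elim x)
    show ?case
    proof
      assume "x \<in> orb w"
      then obtain B where B: "B \<in> G" "x = moebius B w" by (auto simp: orb_def)
      then have "moebius (inv2 B) x = w" using moebius_inv2(1)[OF B(1) assms(2)] by simp
      then have "moebius (inv2 B) z = w" using e(1) e(4)[OF G_inv[OF B(1)], of x] elim by simp
      then have "z = x" using moebius_inv2(2)[OF B(1) assms(1)] B by simp
      then show False using elim by simp
    qed
  qed
qed

lemma fun_of_quasi2:
  assumes d: "det A = 1" and z: "z \<in> uhp" "mord_ge z \<phi> 0"
  shows "fun_of ((autofun A)\<^sup>2 * \<phi> + mero_const (of_real (A$2$1)) * autofun A) z =
    automorphy A z ^ 2 * fun_of \<phi> z + of_real (A$2$1) * automorphy A z"
proof -
  have m: "mord z \<phi> \<ge> 0" using z by (simp add: mord_ge_0_iff)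
  have "mord z ((autofun A)\<^sup>2) = 0" using d z by simp
  moreover have sq: "fun_of ((autofun A)\<^sup>2) z = automorphy A z ^ 2"
    using d z by (simp add: power2_eq_square fun_of_mult)
  moreover have "mord z ((autofun A)\<^sup>2 * \<phi>) \<ge> 0" "mord z (mero_const (of_real (A$2$1)) * autofun A) \<ge> 0"
    using mord_ge_mult[of z "(autofun A)\<^sup>2" 0 \<phi> 0] mord_ge_mult[of z "mero_const (of_real (A$2$1))" 0 "autofun A" 0] d z
    by (auto simp: mord_ge_0_iff)
  ultimately show ?thesis using d z m by (simp add: fun_of_add fun_of_mult)
qed

text \<open>The orbit of \<open>\<i>\<close> has no accumulation point in \<open>uhp\<close>, so a
  law that holds off the orbit is an identity of meromorphic functions.\<close>

lemma delta_one_forms_iff: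
  "\<phi> \<in> delta_one_forms \<Gamma> \<longleftrightarrow> quasi2 \<phi> \<and> (\<forall>z\<in>uhp - orb \<i>. mord_ge z \<phi> 0)"
proof -
  have reg: "(\<forall>z\<in>uhp. is_pole (fun_of \<phi>) z \<longrightarrow> z \<in> orb \<i>) \<longleftrightarrow> (\<forall>z\<in>uhp - orb \<i>. mord_ge z \<phi> 0)"
    by (auto simp: is_pole_fun_of_iff mord_ge_0_iff not_less[symmetric])
  have "(\<forall>z\<in>uhp - orb \<i>. fun_of \<phi> (moebius A z) =
        automorphy A z ^ 2 * fun_of \<phi> z + of_real (A$2$1) * automorphy A z) \<longleftrightarrow>
      mcomp A \<phi> = (autofun A)\<^sup>2 * \<phi> + mero_const (of_real (A$2$1)) * autofun A"
    if r: "\<forall>z\<in>uhp - orb \<i>. mord_ge z \<phi> 0" and A: "A \<in> G" for A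
  proof
    assume *: "\<forall>z\<in>uhp - orb \<i>. fun_of \<phi> (moebius A z) =
        automorphy A z ^ 2 * fun_of \<phi> z + of_real (A$2$1) * automorphy A z"
    show "mcomp A \<phi> = (autofun A)\<^sup>2 * \<phi> + mero_const (of_real (A$2$1)) * autofun A"
    proof (rule merofun_eqI)
      fix z assume z: "z \<in> uhp"
      show "eventually (\<lambda>w. fun_of (mcomp A \<phi>) w =
          fun_of ((autofun A)\<^sup>2 * \<phi> + mero_const (of_real (A$2$1)) * autofun A) w) (at z)"
        using eventually_not_orb[OF z ii_uhp] eventually_in_uhp[OF z]
      proof eventually_elim
        case (elim w)
        then show ?case using * r fun_of_quasi2[OF G_det[OF A], of w \<phi>] fun_of_mcomp[OF G_det[OF A], of w \<phi>]
          by simp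
      qed
    qed
  next
    assume *: "mcomp A \<phi> = (autofun A)\<^sup>2 * \<phi> + mero_const (of_real (A$2$1)) * autofun A"
    show "\<forall>z\<in>uhp - orb \<i>. fun_of \<phi> (moebius A z) =
        automorphy A z ^ 2 * fun_of \<phi> z + of_real (A$2$1) * automorphy A z"
    proof
      fix z assume z: "z \<in> uhp - orb \<i>"
      have "fun_of \<phi> (moebius A z) = fun_of (mcomp A \<phi>) z" using z fun_of_mcomp[OF G_det[OF A], of z \<phi>] by simp
      then show "fun_of \<phi> (moebius A z) =
        automorphy A z ^ 2 * fun_of \<phi> z + of_real (A$2$1) * automorphy A z"
        using * z r fun_of_quasi2[OF G_det[OF A], of z \<phi>] by simp
    qed
  qed
  then show ?thesis
    unfolding delta_one_forms_def quasi2_def orb_orbit_of[symmetric] G_def[symmetric] mem_Collect_eq reg by blast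
qed

text \<open>Each \<open>f' / (k f)\<close> obeys the law with \<open>\<delta> = 1\<close> but has
  poles at the zeros of \<open>f\<close>. The mean with weights \<open>f h\<close>, which sum to 1,
  keeps the law, and the factors \<open>f\<close> remove those poles.\<close>

lemma delta_one_exists: "\<exists>\<phi>. \<phi> \<in> delta_one_forms \<Gamma>"
proof -
  obtain n :: nat and k f h where d: "\<And>j. j < n \<Longrightarrow> k j > (0::int) \<and> f j \<in> MP (k j) 0 \<and> h j \<in> MI (- k j)"
    "(\<Sum>j<n. f j * h j) = 1" using dual_unity by blast
  define \<phi> where "\<phi> = (\<Sum>j<n. mero_const (1 / of_int (k j)) * (h j * mero_deriv (f j)))"
  have "mcomp A \<phi> = (autofun A)\<^sup>2 * \<phi> + mero_const (of_real (A$2$1)) * autofun A" if A: "A \<in> G" for A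
  proof -
    have dA: "det A = 1" using A G_det by blast
    let ?J = "autofun A" and ?c = "mero_const (of_real (A$2$1))"
    have "mcomp A (mero_const (1 / of_int (k j)) * (h j * mero_deriv (f j))) =
       ?J\<^sup>2 * (mero_const (1 / of_int (k j)) * (h j * mero_deriv (f j))) + ?c * ?J * (f j * h j)"
      if j: "j < n" for j
    proof -
      let ?q = "mero_const (1 / of_int (k j))"
      have J: "?J \<noteq> 0" using dA by simp
      have q: "?q * of_int (k j) = 1" using d(1)[OF j] by (simp flip: mero_const_of_int mero_const_mult)
      have h: "mcomp A (h j) = ?J powi (- k j) * h j" using MI_wt d(1)[OF j] A by (simp add: wt_def)
      have f: "mcomp A (mero_deriv (f j)) = ?J powi (k j + 2) * mero_deriv (f j) + of_int (k j) * ?c * ?J powi (k j + 1) * f j"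
        using d(1)[OF j] by (intro mcomp_deriv_wt A) (auto intro: MP_wt)
      have p: "?J powi (- k j) * ?J powi (k j + 2) = ?J\<^sup>2" "?J powi (- k j) * ?J powi (k j + 1) = ?J"
        using J by (simp_all flip: power_int_add)
      have "mcomp A (?q * (h j * mero_deriv (f j))) = ?q * ((?J powi (- k j) * ?J powi (k j + 2)) * (h j * mero_deriv (f j)))
         + (?q * of_int (k j)) * ?c * (?J powi (- k j) * ?J powi (k j + 1)) * (f j * h j)"
        using dA by (simp add: h f algebra_simps)
      then show ?thesis unfolding p q by (simp add: algebra_simps)
    qed
    then have "mcomp A \<phi> = ?J\<^sup>2 * \<phi> + ?c * ?J * (\<Sum>j<n. f j * h j)"
      unfolding \<phi>_def using dA by (simp add: sum.distrib sum_distrib_left)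
    then show ?thesis using d(2) by simp
  qed
  moreover have "mord_ge z \<phi> 0" if z: "z \<in> uhp" "z \<notin> orb \<i>" for z
    unfolding \<phi>_def
  proof (intro mord_ge_sum z(1))
    fix j assume j: "j \<in> {..<n}"
    have "mord_ge z (h j) 0" using MI_regular d(1) j z by blast
    moreover have "mord_ge z (mero_deriv (f j)) 0"
      using mord_ge_deriv0[OF z(1)] MI_regular MP_MI d(1) j z by blast
    ultimately show "mord_ge z (mero_const (1 / of_int (k j)) * (h j * mero_deriv (f j))) 0"
      using mord_ge_mult[OF z(1) mord_ge_const[OF z(1)] mord_ge_mult[OF z(1)], of "h j" 0 "mero_deriv (f j)" 0] by simp
  qed
  ultimately show ?thesis unfolding delta_one_forms_iff quasi2_def by blast
qed

end

section \<open>The residue theorem on the quotient\<close>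

definition res :: "complex \<Rightarrow> merofun \<Rightarrow> complex" where
  "res z q = fls_residue (germ z q)"

lemma res_regular: "z \<in> uhp \<Longrightarrow> mord z q \<ge> 0 \<Longrightarrow> res z q = 0"
  unfolding res_def mord_def by (rule fls_residue_power_series)

lemma residue_fun_of: "z \<in> uhp \<Longrightarrow> residue (fun_of q) z = res z q"
  unfolding res_def by (rule has_laurent_expansion_residue[OF has_germ])

lemma ball_residues:
  assumes e: "e > 0" "cball z e \<subseteq> uhp" and reg: "\<And>x. x \<in> sphere z e \<Longrightarrow> mord x q \<ge> 0"
    and P: "finite P" "P \<subseteq> ball z e" "\<And>x. x \<in> ball z e \<Longrightarrow> mord x q < 0 \<Longrightarrow> x \<in> P"
  shows "contour_integral (circlepath z e) (fun_of q) = 2 * of_real pi * \<i> * (\<Sum>x\<in>P. res x q)"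
proof -
  \<comment> \<open>The lowest point of the closed disc lies in \<open>uhp\<close>, which leaves
    room for a larger disc on which the residue theorem can be applied.\<close>
  have "z - \<i> * of_real e \<in> cball z e" using e(1) by (simp add: dist_norm norm_mult)
  then have "z - \<i> * of_real e \<in> uhp" using e(2) by blast
  then have ez: "e < Im z" by (simp add: uhp_def)
  define r where "r = (e + Im z) / 2"
  have r: "e < r" "r < Im z" using ez by (auto simp: r_def)
  have cr: "cball z r \<subseteq> uhp"
  proof
    fix x assume "x \<in> cball z r"
    then have "\<bar>Im z - Im x\<bar> \<le> r" using abs_Im_le_cmod[of "z - x"] by (simp add: dist_norm)
    then show "x \<in> uhp" using r by (simp add: uhp_def)
  qed
  define pts where "pts = {x \<in> ball z r. mord x q < 0}"
  have "pts \<subseteq> {x \<in> cball z r. (if mord x q < 0 then True else False)}" by (auto simp: pts_def)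
  have fin: "finite pts"
  proof -
    have "finite {x \<in> cball z r. mord x q \<noteq> 0}"
    proof (cases "q = 0")
      case False
      show ?thesis
      proof (rule ccontr)
        assume "infinite {x \<in> cball z r. mord x q \<noteq> 0}"
        then obtain x where x: "x \<in> cball z r" "x islimpt {x \<in> cball z r. mord x q \<noteq> 0}"
          using Heine_Borel_imp_Bolzano_Weierstrass[OF compact_cball] by blast
        then have xu: "x \<in> uhp" using cr by blast
        have "eventually (\<lambda>w. w \<notin> {x \<in> cball z r. mord x q \<noteq> 0}) (at x)"
          using merofun_nonzero_at[OF False xu] eventually_in_uhp[OF xu]
        proof eventually_elim
          case (elim w)
          have "mord w q \<ge> 0" using elim fun_of_pole by force
          then show ?case using elim fun_of_eq_0_iff[OF elim(2) False] by auto
        qed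
        then show False using x(2) unfolding islimpt_iff_eventually by blast
      qed
    qed simp
    then show ?thesis by (rule rev_finite_subset) (auto simp: pts_def)
  qed
  have ps: "x \<in> ball z e" if "x \<in> pts" "x \<in> cball z e" for x
    using that reg[of x] by (auto simp: pts_def sphere_def ball_def cball_def less_le)
  have "contour_integral (circlepath z e) (fun_of q) =
      2 * pi * \<i> * (\<Sum>p\<in>pts. winding_number (circlepath z e) p * residue (fun_of q) p)"
  proof (rule Residue_theorem[of "ball z r"])
    show "fun_of q holomorphic_on ball z r - pts"
    proof -
      have "fun_of q analytic_on {x}" if "x \<in> ball z r - pts" for x
        using that cr ball_subset_cball by (intro fun_of_analytic) (auto simp: pts_def)
      then have "fun_of q analytic_on (ball z r - pts)" using analytic_on_analytic_at by blast
      then show ?thesis by (rule analytic_imp_holomorphic)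
    qed
    show "path_image (circlepath z e) \<subseteq> ball z r - pts"
      using reg r e(1) by (auto simp: pts_def path_image_circlepath)
        (metis linorder_not_less mem_sphere)
    show "\<forall>x. x \<notin> ball z r \<longrightarrow> winding_number (circlepath z e) x = 0"
      using r e(1) by (intro allI impI winding_number_zero_outside[of _ "cball z e"])
        (auto simp: path_image_circlepath)
  qed (use fin in auto)
  also have "(\<Sum>p\<in>pts. winding_number (circlepath z e) p * residue (fun_of q) p) = (\<Sum>p\<in>pts \<inter> ball z e. res p q)"
  proof -
    have "(\<Sum>p\<in>pts. winding_number (circlepath z e) p * residue (fun_of q) p) =
       (\<Sum>p\<in>pts \<inter> ball z e. winding_number (circlepath z e) p * residue (fun_of q) p)"
    proof (rule sum.mono_neutral_right[OF fin])
      show "\<forall>p\<in>pts - pts \<inter> ball z e. winding_number (circlepath z e) p * residue (fun_of q) p = 0"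
      proof
        fix p assume p: "p \<in> pts - pts \<inter> ball z e"
        then have "p \<notin> cball z e" using ps by auto
        then have "winding_number (circlepath z e) p = 0"
          using e(1) by (intro winding_number_zero_outside[of _ "cball z e"]) (auto simp: path_image_circlepath)
        then show "winding_number (circlepath z e) p * residue (fun_of q) p = 0" by simp
      qed
    qed auto
    also have "\<dots> = (\<Sum>p\<in>pts \<inter> ball z e. res p q)"
    proof (rule sum.cong[OF refl])
      fix p assume p: "p \<in> pts \<inter> ball z e"
      then have "p \<in> uhp" using cr by (auto simp: pts_def)
      moreover have "winding_number (circlepath z e) p = 1"
        using p by (intro winding_number_circlepath) (auto simp: dist_norm norm_minus_commute)
      ultimately show "winding_number (circlepath z e) p * residue (fun_of q) p = res p q"
        by (simp add: residue_fun_of)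
    qed
    finally show ?thesis .
  qed
  also have "(\<Sum>p\<in>pts \<inter> ball z e. res p q) = (\<Sum>x\<in>P. res x q)"
  proof (rule sum.mono_neutral_left[OF P(1)])
    show "pts \<inter> ball z e \<subseteq> P" using P(3) by (auto simp: pts_def)
    show "\<forall>x\<in>P - pts \<inter> ball z e. res x q = 0"
    proof
      fix x assume x: "x \<in> P - pts \<inter> ball z e"
      then have "x \<in> ball z e" "x \<in> ball z r" using P(2) r by auto
      then show "res x q = 0" using x cr by (intro res_regular) (auto simp: pts_def)
    qed
  qed
  finally show ?thesis by simp
qed

text \<open>Differentiation under the integral: on the circle the difference quotients of the
  integrand converge uniformly, with error at most \<open>M / d ^ 3 * norm (w - w1)\<close>.\<close>

lemma contour_integral_parameter_holomorphic:
  fixes u v :: "complex \<Rightarrow> complex"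
  assumes r: "r > 0" and u: "continuous_on (sphere z r) u" and v: "continuous_on (sphere z r) v"
    and d: "d > 0" "\<And>x. x \<in> sphere z r \<Longrightarrow> norm (v x - w0) \<ge> 2 * d"
  shows "(\<lambda>w. contour_integral (circlepath z r) (\<lambda>x. u x / (v x - w))) holomorphic_on ball w0 d"
proof -
  have far: "norm (v x - w) \<ge> d" if "x \<in> sphere z r" "w \<in> ball w0 d" for x w
  proof -
    have "2 * d \<le> norm (v x - w) + norm (w - w0)" using norm_triangle_ineq[of "v x - w" "w - w0"] d(2)[OF that(1)] by simp
    moreover have "norm (w - w0) < d" using that(2) by (simp add: dist_norm norm_minus_commute)
    ultimately show ?thesis by simp
  qed
  obtain M where M: "\<And>x. x \<in> sphere z r \<Longrightarrow> norm (u x) \<le> M" "M \<ge> 0"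
  proof -
    have "bounded (u ` sphere z r)" by (intro compact_imp_bounded compact_continuous_image u) simp
    then show ?thesis using that by (metis bounded_pos imageI less_imp_le)
  qed
  have int: "(\<lambda>x. u x / (v x - w)) contour_integrable_on circlepath z r" if "w \<in> ball w0 d" for w
    using r far[OF _ that] d
    by (intro contour_integrable_continuous_circlepath continuous_intros)
      (force simp: path_image_circlepath intro: continuous_on_subset[OF u] continuous_on_subset[OF v])+
  have "((\<lambda>w. contour_integral (circlepath z r) (\<lambda>x. u x / (v x - w))) has_field_derivative
      contour_integral (circlepath z r) (\<lambda>x. u x / (v x - w1)\<^sup>2)) (at w1)" if w1: "w1 \<in> ball w0 d" for w1
  proof -
    define g where "g w x = u x / ((v x - w) * (v x - w1))" for w x
    have ev: "eventually (\<lambda>w. w \<in> ball w0 d - {w1}) (at w1)" using w1 by (intro eventually_at_in_open) auto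
    have eq: "g w x = (u x / (v x - w) - u x / (v x - w1)) / (w - w1)"
      if "x \<in> sphere z r" "w \<in> ball w0 d" "w \<noteq> w1" for w x
    proof -
      have "v x - w \<noteq> 0" "v x - w1 \<noteq> 0" "w - w1 \<noteq> 0" using far[OF that(1,2)] far[OF that(1) w1] d that by auto
      then show ?thesis unfolding g_def by (simp add: divide_simps) (simp add: algebra_simps)
    qed
    have 1: "eventually (\<lambda>w. g w contour_integrable_on circlepath z r) (at w1)"
      using ev
    proof eventually_elim
      case (elim w)
      then have w: "w \<in> ball w0 d" by auto
      show ?case unfolding g_def
        using r far[OF _ w] far[OF _ w1] d
        by (intro contour_integrable_continuous_circlepath continuous_intros)
          (force simp: path_image_circlepath intro: continuous_on_subset[OF u] continuous_on_subset[OF v])+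
    qed
    have 2: "uniform_limit (sphere z r) g (\<lambda>x. u x / (v x - w1)\<^sup>2) (at w1)"
    proof (rule uniform_limitI)
      fix e :: real assume e: "e > 0"
      have lim: "((\<lambda>w. M / d ^ 3 * norm (w - w1)) \<longlongrightarrow> M / d ^ 3 * norm (w1 - w1)) (at w1)"
        by (intro tendsto_intros)
      then have "eventually (\<lambda>w. M / d ^ 3 * norm (w - w1) < e) (at w1)"
        using e by (intro order_tendstoD) auto
      then show "eventually (\<lambda>w. \<forall>x\<in>sphere z r. dist (g w x) (u x / (v x - w1)\<^sup>2) < e) (at w1)"
        using ev
      proof eventually_elim
        case (elim w)
        show ?case
        proof
          fix x assume x: "x \<in> sphere z r"
          have f: "norm (v x - w) \<ge> d" "norm (v x - w1) \<ge> d" using far[OF x] w1 elim by auto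
          then have nz: "v x - w \<noteq> 0" "v x - w1 \<noteq> 0" using d by auto
          have "g w x - u x / (v x - w1)\<^sup>2 = u x * (w - w1) / ((v x - w) * (v x - w1)\<^sup>2)"
            using nz by (simp add: g_def divide_simps power2_eq_square) (simp add: algebra_simps)
          then have "dist (g w x) (u x / (v x - w1)\<^sup>2) = norm (u x) * norm (w - w1) / (norm (v x - w) * (norm (v x - w1))\<^sup>2)"
            by (simp add: dist_norm norm_mult norm_divide norm_power)
          also have "\<dots> \<le> M * norm (w - w1) / (d * d\<^sup>2)"
            using f d M(1)[of x] M(2) x by (intro frac_le mult_mono mult_pos_pos power_mono) auto
          also have "\<dots> = M / d ^ 3 * norm (w - w1)" by (simp add: power3_eq_cube power2_eq_square)
          also have "\<dots> < e" using elim by simp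
          finally show "dist (g w x) (u x / (v x - w1)\<^sup>2) < e" .
        qed
      qed
    qed
    have "((\<lambda>w. contour_integral (circlepath z r) (g w)) \<longlongrightarrow> contour_integral (circlepath z r) (\<lambda>x. u x / (v x - w1)\<^sup>2)) (at w1)"
      using contour_integral_uniform_limit_circlepath(2)[OF 1 2 _ r] by simp
    moreover have "eventually (\<lambda>w. contour_integral (circlepath z r) (g w) =
       (contour_integral (circlepath z r) (\<lambda>x. u x / (v x - w)) - contour_integral (circlepath z r) (\<lambda>x. u x / (v x - w1))) / (w - w1)) (at w1)"
      using ev
    proof eventually_elim
      case (elim w)
      have "contour_integral (circlepath z r) (g w) =
         contour_integral (circlepath z r) (\<lambda>x. (u x / (v x - w) - u x / (v x - w1)) / (w - w1))"
        using eq elim r by (intro contour_integral_cong refl) (auto simp: path_image_circlepath)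
      also have "\<dots> = (contour_integral (circlepath z r) (\<lambda>x. u x / (v x - w) - u x / (v x - w1))) / (w - w1)"
        by (rule contour_integral_div) (use int[of w] int[OF w1] elim in \<open>auto intro!: contour_integrable_diff\<close>)
      also have "contour_integral (circlepath z r) (\<lambda>x. u x / (v x - w) - u x / (v x - w1)) =
        contour_integral (circlepath z r) (\<lambda>x. u x / (v x - w)) - contour_integral (circlepath z r) (\<lambda>x. u x / (v x - w1))"
        using int[of w] int[OF w1] elim by (intro contour_integral_diff) auto
      finally show ?case .
    qed
    ultimately show ?thesis unfolding has_field_derivative_iff by (simp add: tendsto_cong)
  qed
  then show ?thesis unfolding holomorphic_on_open[OF open_ball] by blast
qed

section \<open>Residues summed over orbits\<close>

context fuchsian
begin

lemma res_wt2: "q \<in> wt 2 \<Longrightarrow> A \<in> G \<Longrightarrow> z \<in> uhp \<Longrightarrow> res (moebius A z) q = res z q"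
  using residue_germ_mcomp[of A z q] G_det by (simp add: wt_def res_def)

text \<open>This is \<open>card (stab z)\<close> times the number of points of \<open>FK\<close> in
  the orbit of \<open>z\<close>. Dividing by it in \<open>ressum\<close> compensates for
  \<open>FK\<close> meeting an orbit several times and leaves each orbit with weight
  \<open>1 / card (stab z)\<close>.\<close>

definition nret :: "complex \<Rightarrow> nat" where
  "nret z = card {A \<in> G. moebius A z \<in> FK}"

lemma finite_nret: "z \<in> uhp \<Longrightarrow> finite {A \<in> G. moebius A z \<in> FK}"
  by (rule finite_subset[OF _ proper_discontinuity[of "insert z FK"]]) (use FK(1,2) in auto)

lemma nret_pos: "z \<in> uhp \<Longrightarrow> nret z > 0"
  unfolding nret_def using FK(3)[of z] finite_nret[of z] by (auto simp: card_gt_0_iff)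

lemma nret_moebius:
  assumes "B \<in> G" "z \<in> uhp" shows "nret (moebius B z) = nret z"
proof -
  have "bij_betw (\<lambda>A. A ** B) {A \<in> G. moebius A (moebius B z) \<in> FK} {A \<in> G. moebius A z \<in> FK}"
  proof (rule bij_betw_byWitness[where f' = "\<lambda>A. A ** inv2 B"])
    have "A ** B ** inv2 B = A" "A ** inv2 B ** B = A" for A
      using inv2_mult[OF G_det[OF assms(1)]] by (simp_all flip: matrix_mul_assoc)
    then show "\<forall>A\<in>{A \<in> G. moebius A (moebius B z) \<in> FK}. A ** B ** inv2 B = A"
      "\<forall>A\<in>{A \<in> G. moebius A z \<in> FK}. A ** inv2 B ** B = A" by auto
    show "(\<lambda>A. A ** B) ` {A \<in> G. moebius A (moebius B z) \<in> FK} \<subseteq> {A \<in> G. moebius A z \<in> FK}"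
      using assms by (auto simp: G_mult moebius_mult G_det)
    have "moebius (A ** inv2 B) (moebius B z) = moebius A z" for A
      using moebius_mult[of "inv2 B" "moebius B z" A] moebius_inv2(1)[OF assms] assms G_det by simp
    then show "(\<lambda>A. A ** inv2 B) ` {A \<in> G. moebius A z \<in> FK} \<subseteq> {A \<in> G. moebius A (moebius B z) \<in> FK}"
      using assms by (auto simp: G_mult G_inv)
  qed
  then show ?thesis unfolding nret_def by (rule bij_betw_same_card)
qed

definition ressum :: "merofun \<Rightarrow> complex" where
  "ressum q = (\<Sum>x\<in>{x \<in> FK. mord x q < 0}. res x q / of_nat (nret x))"

lemma finite_poles: "compact C \<Longrightarrow> C \<subseteq> uhp \<Longrightarrow> finite {x \<in> C. mord x q < 0}"
  using finite_mord_nz[of C q] by (rule rev_finite_subset) auto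

text \<open>The sum of the residues over the classes of poles, each divided by the order of the stabilizer, evaluated
  with the fundamental set \<open>FK\<close> on one side and with neighbourhoods \<open>U z\<close> of representatives on the other.\<close>

lemma ressum_eq:
  assumes q: "q \<in> wt 2" and Z: "finite Z" "Z \<subseteq> uhp"
    and C: "compact C" "C \<subseteq> uhp" "\<And>z. z \<in> Z \<Longrightarrow> U z \<subseteq> C"
    and inv: "\<And>z A x. z \<in> Z \<Longrightarrow> A \<in> stab z \<Longrightarrow> x \<in> U z \<Longrightarrow> moebius A x \<in> U z"
    and sep: "\<And>z z' A x. z \<in> Z \<Longrightarrow> z' \<in> Z \<Longrightarrow> A \<in> G \<Longrightarrow> x \<in> U z \<Longrightarrow> moebius A x \<in> U z' \<Longrightarrow> z = z' \<and> A \<in> stab z"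
    and cov: "\<And>x. x \<in> uhp \<Longrightarrow> mord x q < 0 \<Longrightarrow> \<exists>z\<in>Z. \<exists>A\<in>G. moebius A x \<in> U z"
  shows "ressum q = (\<Sum>z\<in>Z. (\<Sum>y\<in>{y \<in> U z. mord y q < 0}. res y q) / of_nat (card (stab z)))"
proof -
  define X where "X = {x \<in> FK. mord x q < 0}"
  define Y where "Y z = {y \<in> U z. mord y q < 0}" for z
  have X: "finite X" "X \<subseteq> uhp" unfolding X_def using finite_poles[OF FK(1,2)] FK(2) by auto
  have Yf: "finite (Y z)" "Y z \<subseteq> uhp" if "z \<in> Z" for z
  proof -
    show "finite (Y z)" by (rule finite_subset[OF _ finite_poles[OF C(1,2), of q]]) (use C(3)[OF that] in \<open>auto simp: Y_def\<close>)
    show "Y z \<subseteq> uhp" using C(2) C(3)[OF that] by (auto simp: Y_def)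
  qed
  have Yu: "y \<in> uhp" if "z \<in> Z" "y \<in> Y z" for z y using Yf(2)[OF that(1)] that(2) by blast
  \<comment> \<open>All ways of moving the pole \<open>x\<close> into one of the neighbourhoods; by
    \<open>sep\<close> they lead to one point \<open>z0\<close> and form a coset of
    \<open>stab z0\<close>.\<close>
  define T where "T x = {(z, A). z \<in> Z \<and> A \<in> G \<and> moebius A x \<in> U z}" for x
  have T: "\<exists>z0\<in>Z. finite (T x) \<and> card (T x) = card (stab z0) \<and> (\<forall>t\<in>T x. fst t = z0)" if x: "x \<in> X" for x
  proof -
    have xu: "x \<in> uhp" "mord x q < 0" using x X by (auto simp: X_def)
    obtain z0 A0 where z0: "z0 \<in> Z" "A0 \<in> G" "moebius A0 x \<in> U z0" using cov[OF xu] by blast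
    have dA0: "det A0 = 1" using z0 G_det by blast
    have can: "A ** A0 ** inv2 A0 = A" "A ** inv2 A0 ** A0 = A" for A :: "real^2^2"
      using inv2_mult[OF dA0] by (simp_all flip: matrix_mul_assoc)
    have "bij_betw (\<lambda>S. (z0, S ** A0)) (stab z0) (T x)"
    proof (rule bij_betw_byWitness[where f' = "\<lambda>t. snd t ** inv2 A0"])
      have key: "z' = z0 \<and> A ** inv2 A0 \<in> stab z0" if "(z', A) \<in> T x" for z' A
      proof -
        have A: "z' \<in> Z" "A \<in> G" "moebius A x \<in> U z'" using that by (auto simp: T_def)
        have "moebius (A ** inv2 A0) (moebius A0 x) = moebius A x"
          using moebius_mult[of "inv2 A0" "moebius A0 x" A] moebius_inv2(1)[OF z0(2) xu(1)] xu(1) dA0 by simp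
        then show ?thesis using sep[OF z0(1) A(1) G_mult[OF A(2) G_inv[OF z0(2)]] z0(3)] A(3) by auto
      qed
      show "(\<lambda>t. snd t ** inv2 A0) ` T x \<subseteq> stab z0"
      proof (rule image_subsetI)
        fix t assume "t \<in> T x"
        then show "snd t ** inv2 A0 \<in> stab z0" using key[of "fst t" "snd t"] by simp
      qed
      show "\<forall>t\<in>T x. (z0, snd t ** inv2 A0 ** A0) = t"
      proof
        fix t assume "t \<in> T x"
        then have "fst t = z0" using key[of "fst t" "snd t"] by simp
        then show "(z0, snd t ** inv2 A0 ** A0) = t" unfolding can by (simp add: prod_eq_iff)
      qed
      show "\<forall>S\<in>stab z0. snd (z0, S ** A0) ** inv2 A0 = S" using can by simp
      show "(\<lambda>S. (z0, S ** A0)) ` stab z0 \<subseteq> T x"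
        using z0 inv[OF z0(1) _ z0(3)] xu(1) dA0 by (auto simp: T_def G_mult moebius_mult stab_def)
    qed
    then have "card (T x) = card (stab z0)" "finite (T x)" "T x = (\<lambda>S. (z0, S ** A0)) ` stab z0"
      using bij_betw_same_card bij_betw_finite finite_stab z0(1) Z(2) bij_betw_imp_surj_on by (metis subsetD)+
    then show ?thesis using z0(1) by auto
  qed
  define w where "w z x = res x q / (of_nat (nret x) * of_nat (card (stab z)))" for z x
  have "ressum q = (\<Sum>x\<in>X. \<Sum>t\<in>T x. w (fst t) x)"
    unfolding ressum_def X_def[symmetric]
  proof (rule sum.cong[OF refl])
    fix x assume x: "x \<in> X"
    then obtain z0 where z0: "z0 \<in> Z" "finite (T x)" "card (T x) = card (stab z0)" "\<forall>t\<in>T x. fst t = z0" using T by blast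
    have "(\<Sum>t\<in>T x. w (fst t) x) = (\<Sum>t\<in>T x. w z0 x)" using z0(4) by (intro sum.cong) auto
    also have "\<dots> = of_nat (card (stab z0)) * w z0 x" by (simp add: z0(3))
    also have "\<dots> = res x q / of_nat (nret x)" using card_stab_pos[of z0] z0(1) Z(2) by (auto simp: w_def)
    finally show "res x q / of_nat (nret x) = (\<Sum>t\<in>T x. w (fst t) x)" by simp
  qed
  also have "\<dots> = (\<Sum>(x, t)\<in>Sigma X T. w (fst t) x)"
    using X T by (subst sum.Sigma) (auto simp: case_prod_unfold)
  \<comment> \<open>Double counting: \<open>(x, z, A)\<close> corresponds to
    \<open>(z, y, B)\<close> with \<open>y = moebius A x\<close> and \<open>B\<close> the inverse of
    \<open>A\<close>. All quantities in the summand are invariant.\<close>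
  also have "\<dots> = (\<Sum>(u, B)\<in>(SIGMA u:Sigma Z Y. {B \<in> G. moebius B (snd u) \<in> FK}). w (fst u) (snd u))"
  proof (rule sum.reindex_bij_witness[where i = "\<lambda>(u, B). (moebius B (snd u), (fst u, inv2 B))"
        and j = "\<lambda>(x, t). ((fst t, moebius (snd t) x), inv2 (snd t))"])
    have ii: "inv2 (inv2 A) = A" for A by (intro mat2_eqI) simp_all
    have b1: "moebius A x \<in> uhp" "moebius (inv2 A) (moebius A x) = x" "mord (moebius A x) q = mord x q"
      "nret (moebius A x) = nret x" "res (moebius A x) q = res x q" if "A \<in> G" "x \<in> uhp" for A x
      using that G_det moebius_inv2(1) mord_wt[OF q] nret_moebius res_wt2[OF q] by auto
    fix p assume p: "p \<in> Sigma X T"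
    obtain x z A where px: "p = (x, (z, A))" by (metis surj_pair)
    have h: "x \<in> FK" "mord x q < 0" "x \<in> uhp" "z \<in> Z" "A \<in> G" "moebius A x \<in> U z"
      using p X by (auto simp: px T_def X_def)
    show "(case case p of (x, t) \<Rightarrow> ((fst t, moebius (snd t) x), inv2 (snd t)) of
        (u, B) \<Rightarrow> (moebius B (snd u), (fst u, inv2 B))) = p"
      using b1[OF h(5,3)] by (simp add: px ii)
    show "(case p of (x, t) \<Rightarrow> ((fst t, moebius (snd t) x), inv2 (snd t))) \<in>
        (SIGMA u:Sigma Z Y. {B \<in> G. moebius B (snd u) \<in> FK})"
      using b1[OF h(5,3)] h by (simp add: px Y_def G_inv)
    show "(case case p of (x, t) \<Rightarrow> ((fst t, moebius (snd t) x), inv2 (snd t)) of (u, B) \<Rightarrow> w (fst u) (snd u)) =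
        (case p of (x, t) \<Rightarrow> w (fst t) x)"
      using b1[OF h(5,3)] by (simp add: px w_def)
  next
    have ii: "inv2 (inv2 A) = A" for A by (intro mat2_eqI) simp_all
    fix p assume p: "p \<in> (SIGMA u:Sigma Z Y. {B \<in> G. moebius B (snd u) \<in> FK})"
    obtain z y B where px: "p = ((z, y), B)" by (metis surj_pair)
    have h: "z \<in> Z" "y \<in> U z" "mord y q < 0" "y \<in> uhp" "B \<in> G" "moebius B y \<in> FK"
      using p Yu by (auto simp: px Y_def)
    have b: "moebius (inv2 B) (moebius B y) = y" "mord (moebius B y) q = mord y q"
      using moebius_inv2(1)[OF h(5,4)] mord_wt[OF q h(5,4)] by auto
    show "(case case p of (u, B) \<Rightarrow> (moebius B (snd u), (fst u, inv2 B)) of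
        (x, t) \<Rightarrow> ((fst t, moebius (snd t) x), inv2 (snd t))) = p"
      using b by (simp add: px ii)
    show "(case p of (u, B) \<Rightarrow> (moebius B (snd u), (fst u, inv2 B))) \<in> Sigma X T"
      using b h by (simp add: px X_def T_def G_inv)
  qed
  also have "\<dots> = (\<Sum>u\<in>Sigma Z Y. \<Sum>B\<in>{B \<in> G. moebius B (snd u) \<in> FK}. w (fst u) (snd u))"
  proof -
    have "finite (Sigma Z Y)" using Z Yf by auto
    moreover have "\<forall>u\<in>Sigma Z Y. finite {B \<in> G. moebius B (snd u) \<in> FK}"
    proof
      fix u assume "u \<in> Sigma Z Y"
      then have "snd u \<in> uhp" using Yu by auto
      then show "finite {B \<in> G. moebius B (snd u) \<in> FK}" by (rule finite_nret)
    qed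
    ultimately show ?thesis by (subst sum.Sigma) (simp_all add: case_prod_unfold)
  qed
  also have "\<dots> = (\<Sum>(z, y)\<in>Sigma Z Y. res y q / of_nat (card (stab z)))"
  proof (rule sum.cong[OF refl])
    fix u assume "u \<in> Sigma Z Y"
    then obtain z y where u: "u = (z, y)" "z \<in> Z" "y \<in> uhp" using Yu by auto
    have "(\<Sum>B\<in>{B \<in> G. moebius B (snd u) \<in> FK}. w (fst u) (snd u)) = of_nat (nret y) * w z y"
      by (simp add: u(1) nret_def)
    also have "\<dots> = res y q / of_nat (card (stab z))" using nret_pos[OF u(3)] by (simp add: w_def)
    finally show "(\<Sum>B\<in>{B \<in> G. moebius B (snd u) \<in> FK}. w (fst u) (snd u)) = (case u of (z, y) \<Rightarrow> res y q / of_nat (card (stab z)))"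
      by (simp add: u(1))
  qed
  also have "\<dots> = (\<Sum>z\<in>Z. \<Sum>y\<in>Y z. res y q / of_nat (card (stab z)))"
    using Z Yf by (subst sum.Sigma) auto
  finally show ?thesis by (simp add: Y_def sum_divide_distrib)
qed

definition inequivalent :: "complex set \<Rightarrow> bool" where
  "inequivalent Z \<longleftrightarrow> (\<forall>z\<in>Z. \<forall>z'\<in>Z. z' \<in> orb z \<longrightarrow> z' = z)"

lemma representatives:
  assumes "finite Z0" "Z0 \<subseteq> uhp"
  obtains Z where "Z \<subseteq> Z0" "inequivalent Z" "\<And>z. z \<in> Z0 \<Longrightarrow> \<exists>z'\<in>Z. z \<in> orb z'"
proof -
  define f where "f S = (SOME z. z \<in> Z0 \<and> z \<in> S)" for S
  have f: "f (orb z) \<in> Z0 \<and> f (orb z) \<in> orb z" if "z \<in> Z0" for z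
    unfolding f_def by (rule someI[of _ z]) (use that orb_self in auto)
  show ?thesis
  proof (rule that[of "(\<lambda>z. f (orb z)) ` Z0"])
    show "(\<lambda>z. f (orb z)) ` Z0 \<subseteq> Z0" using f by auto
    show "inequivalent ((\<lambda>z. f (orb z)) ` Z0)" unfolding inequivalent_def
    proof (clarify)
      fix z z' assume z: "z \<in> Z0" "z' \<in> Z0" "f (orb z') \<in> orb (f (orb z))"
      have "orb (f (orb z)) = orb z" "orb (f (orb z')) = orb z'" using f z assms orb_eq by blast+
      moreover have "orb (f (orb z')) = orb (f (orb z))" using z(3) orb_eq f[OF z(1)] assms by blast
      ultimately show "f (orb z') = f (orb z)" by metis
    qed
    show "\<exists>z'\<in>(\<lambda>z. f (orb z)) ` Z0. z \<in> orb z'" if "z \<in> Z0" for z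
      using f[OF that] that orb_sym assms by (intro bexI[of _ "f (orb z)"]) auto
  qed
qed

text \<open>Only the points of \<open>Z\<close> and their images can be limits of poles of the family \<open>q w\<close>.\<close>

lemma ressum_contour:
  fixes q :: "'w \<Rightarrow> merofun"
  assumes Z: "finite Z" "Z \<subseteq> uhp" "inequivalent Z"
    and q: "\<And>w. q w \<in> wt 2"
    and reg: "\<And>x. x \<in> uhp \<Longrightarrow> (\<And>z. z \<in> Z \<Longrightarrow> x \<notin> orb z) \<Longrightarrow>
      \<exists>N. open N \<and> x \<in> N \<and> eventually (\<lambda>w. \<forall>y\<in>N. y \<in> uhp \<longrightarrow> mord y (q w) \<ge> 0) F"
  shows "\<exists>e>0. (\<forall>z\<in>Z. cball z e \<subseteq> uhp \<and> (\<forall>x\<in>cball z e - {z}. \<forall>z'\<in>Z. x \<notin> orb z')) \<and>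
    eventually (\<lambda>w. (\<forall>z\<in>Z. \<forall>x\<in>sphere z e. mord x (q w) \<ge> 0) \<and>
      ressum (q w) = (\<Sum>z\<in>Z. contour_integral (circlepath z e) (fun_of (q w)) / (2 * of_real pi * \<i> * of_nat (card (stab z))))) F"
proof -
  have "\<forall>p\<in>Z \<times> Z. \<exists>e>0. cball (fst p) e \<subseteq> uhp \<and> cball (snd p) e \<subseteq> uhp \<and>
    (\<forall>A\<in>G. \<forall>x\<in>cball (fst p) e. moebius A x \<in> cball (snd p) e \<longrightarrow> moebius A (fst p) = snd p)"
  proof
    fix p assume "p \<in> Z \<times> Z"
    then have "fst p \<in> uhp" "snd p \<in> uhp" using Z(2) by auto
    then show "\<exists>e>0. cball (fst p) e \<subseteq> uhp \<and> cball (snd p) e \<subseteq> uhp \<and>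
      (\<forall>A\<in>G. \<forall>x\<in>cball (fst p) e. moebius A x \<in> cball (snd p) e \<longrightarrow> moebius A (fst p) = snd p)"
    proof (rule separating_radius)
      fix e assume *: "e > 0" "cball (fst p) e \<subseteq> uhp" "cball (snd p) e \<subseteq> uhp"
        "\<And>A x. A \<in> G \<Longrightarrow> x \<in> cball (fst p) e \<Longrightarrow> moebius A x \<in> cball (snd p) e \<Longrightarrow> moebius A (fst p) = snd p"
      show ?thesis by (intro exI[of _ e] conjI ballI impI *)
    qed
  qed
  from bchoice[OF this] obtain \<epsilon> where \<epsilon>0: "\<forall>p\<in>Z \<times> Z. \<epsilon> p > 0 \<and> cball (fst p) (\<epsilon> p) \<subseteq> uhp \<and> cball (snd p) (\<epsilon> p) \<subseteq> uhp \<and>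
    (\<forall>A\<in>G. \<forall>x\<in>cball (fst p) (\<epsilon> p). moebius A x \<in> cball (snd p) (\<epsilon> p) \<longrightarrow> moebius A (fst p) = snd p)" ..
  have \<epsilon>: "\<epsilon> p > 0 \<and> cball (fst p) (\<epsilon> p) \<subseteq> uhp \<and> cball (snd p) (\<epsilon> p) \<subseteq> uhp \<and>
    (\<forall>A\<in>G. \<forall>x\<in>cball (fst p) (\<epsilon> p). moebius A x \<in> cball (snd p) (\<epsilon> p) \<longrightarrow> moebius A (fst p) = snd p)" if "p \<in> Z \<times> Z" for p using \<epsilon>0 that by (rule bspec)
  define e where "e = Min (insert 1 (\<epsilon> ` (Z \<times> Z)))"
  have fin: "finite (insert 1 (\<epsilon> ` (Z \<times> Z)))" using Z by auto
  have e0: "e > 0" unfolding e_def using fin \<epsilon> by (subst Min_gr_iff) auto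
  have e\<epsilon>: "e \<le> \<epsilon> (z, z')" if "z \<in> Z" "z' \<in> Z" for z z' unfolding e_def using fin that by (intro Min_le) auto
  have cb: "cball z e \<subseteq> uhp" if "z \<in> Z" for z
    using \<epsilon>[of "(z, z)"] e\<epsilon>[OF that that] that subset_cball by (auto intro: order_trans)
  have sep: "z = z' \<and> A \<in> stab z"
    if "z \<in> Z" "z' \<in> Z" "A \<in> G" "x \<in> cball z e" "moebius A x \<in> cball z' e" for z z' A x
  proof -
    have "x \<in> cball z (\<epsilon> (z, z'))" "moebius A x \<in> cball z' (\<epsilon> (z, z'))"
      using e\<epsilon>[OF that(1,2)] that(4,5) by auto
    then have "moebius A z = z'" using \<epsilon>[of "(z, z')"] that(1-3) by (metis SigmaI fst_conv snd_conv)
    moreover have "z' = z" using calculation Z(3) that unfolding inequivalent_def orb_def by auto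
    ultimately show ?thesis using that(3) by (simp add: stab_def)
  qed
  \<comment> \<open>The disc itself need not be invariant under \<open>stab z\<close>; the
    intersection of its preimages is.\<close>
  define U where "U z = {x \<in> uhp. \<forall>A\<in>stab z. moebius A x \<in> ball z e}" for z
  have Uball: "U z \<subseteq> ball z e" for z unfolding U_def using stab_one[of z] by force
  have Uinv: "moebius A x \<in> U z" if "z \<in> Z" "A \<in> stab z" "x \<in> U z" for z A x
  proof -
    have zu: "z \<in> uhp" and d: "det A = 1" using that Z(2) G_det by (auto simp: stab_def)
    have "moebius B (moebius A x) \<in> ball z e" if B: "B \<in> stab z" for B
      using \<open>x \<in> U z\<close> stab_mult[OF B \<open>A \<in> stab z\<close> zu] moebius_mult[OF d, of x B] by (auto simp: U_def)
    then show ?thesis using that(3) d by (auto simp: U_def)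
  qed
  have Uopen: "open (U z)" if z: "z \<in> Z" for z
  proof -
    have "U z = (\<Inter>A\<in>stab z. {x \<in> uhp. moebius A x \<in> ball z e})"
      unfolding U_def using stab_one[of z] by auto
    moreover have "open {x \<in> uhp. moebius A x \<in> ball z e}" if "A \<in> stab z" for A
    proof -
      have "continuous_on uhp (moebius A)"
        using that G_det moebius_holomorphic[of A] by (auto simp: stab_def intro: holomorphic_on_imp_continuous_on)
      then show ?thesis using continuous_open_preimage[OF _ open_uhp open_ball, of "moebius A" z e]
        by (simp add: vimage_def Int_def)
    qed
    moreover have "finite (stab z)" using finite_stab z Z(2) by blast
    ultimately show ?thesis by (simp only:) (rule open_INT, auto)
  qed
  have zU: "z \<in> U z" if "z \<in> Z" for z using that Z(2) e0 by (auto simp: U_def stab_def)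
  define W where "W = {x \<in> uhp. \<exists>z\<in>Z. \<exists>A\<in>G. moebius A x \<in> U z}"
  have Wopen: "open W"
  proof -
    have "W = (\<Union>z\<in>Z. \<Union>A\<in>G. {x \<in> uhp. moebius A x \<in> U z})" by (auto simp: W_def)
    moreover have "open {x \<in> uhp. moebius A x \<in> U z}" if "A \<in> G" "z \<in> Z" for A z
    proof -
      have "continuous_on uhp (moebius A)"
        using that G_det moebius_holomorphic[of A] by (auto intro: holomorphic_on_imp_continuous_on)
      then show ?thesis using continuous_open_preimage[OF _ open_uhp Uopen[OF that(2)], of "moebius A"]
        by (simp add: vimage_def Int_def)
    qed
    ultimately show ?thesis by auto
  qed
  define C where "C = FK \<union> (\<Union>z\<in>Z. cball z e)"
  have C: "compact C" "C \<subseteq> uhp" unfolding C_def using FK(1,2) Z cb by (auto intro!: compact_Un compact_UN)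
  \<comment> \<open>Outside the saturation \<open>W\<close> of these neighbourhoods, compactness
    makes the local regularity assumption uniform, so that eventually all poles in \<open>C\<close>
    lie in \<open>W\<close>.\<close>
  define K' where "K' = C - W"
  have K': "compact K'" unfolding K'_def using C(1) Wopen by (rule compact_diff)
  have "\<forall>x\<in>K'. \<exists>N. open N \<and> x \<in> N \<and> eventually (\<lambda>w. \<forall>y\<in>N. y \<in> uhp \<longrightarrow> mord y (q w) \<ge> 0) F"
  proof
    fix x assume x: "x \<in> K'"
    then have xu: "x \<in> uhp" using C by (auto simp: K'_def)
    have "x \<notin> orb z" if z: "z \<in> Z" for z
    proof
      assume "x \<in> orb z"
      then have "z \<in> orb x" using orb_sym z Z(2) by blast
      then obtain A where "A \<in> G" "z = moebius A x" by (auto simp: orb_def)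
      then have "x \<in> W" using zU[OF z] z xu by (auto simp: W_def)
      then show False using x by (simp add: K'_def)
    qed
    then show "\<exists>N. open N \<and> x \<in> N \<and> eventually (\<lambda>w. \<forall>y\<in>N. y \<in> uhp \<longrightarrow> mord y (q w) \<ge> 0) F"
      using reg[OF xu] by blast
  qed
  from bchoice[OF this] obtain N where N: "\<And>x. x \<in> K' \<Longrightarrow> open (N x) \<and> x \<in> N x \<and>
    eventually (\<lambda>w. \<forall>y\<in>N x. y \<in> uhp \<longrightarrow> mord y (q w) \<ge> 0) F" by blast
  obtain D where D: "D \<subseteq> K'" "finite D" "K' \<subseteq> (\<Union>x\<in>D. N x)"
    by (rule compactE_image[OF K', of K' N]) (use N in auto)
  have "eventually (\<lambda>w. \<forall>x\<in>D. \<forall>y\<in>N x. y \<in> uhp \<longrightarrow> mord y (q w) \<ge> 0) F"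
    using N D by (intro eventually_ball_finite) auto
  then have ev: "eventually (\<lambda>w. \<forall>y\<in>C. y \<in> W \<or> mord y (q w) \<ge> 0) F"
  proof eventually_elim
    case (elim w)
    show ?case
    proof
      fix y assume y: "y \<in> C"
      show "y \<in> W \<or> mord y (q w) \<ge> 0"
      proof (cases "y \<in> W")
        case False
        then have "y \<in> K'" using y by (simp add: K'_def)
        then obtain x where "x \<in> D" "y \<in> N x" using D(3) by blast
        then show ?thesis using elim y C(2) by blast
      qed simp
    qed
  qed
  have "eventually (\<lambda>w. (\<forall>z\<in>Z. \<forall>x\<in>sphere z e. mord x (q w) \<ge> 0) \<and>
      ressum (q w) = (\<Sum>z\<in>Z. contour_integral (circlepath z e) (fun_of (q w)) / (2 * of_real pi * \<i> * of_nat (card (stab z))))) F"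
    using ev
  proof eventually_elim
    case (elim w)
    have inU: "x \<in> U z" if x: "x \<in> cball z e" "mord x (q w) < 0" and z: "z \<in> Z" for x z
    proof -
      have "x \<in> C" using x z by (auto simp: C_def)
      then have "x \<in> W" using elim x(2) by force
      then obtain z' A where A: "z' \<in> Z" "A \<in> G" "moebius A x \<in> U z'" "x \<in> uhp" by (auto simp: W_def)
      then have "moebius A x \<in> cball z' e" using Uball by force
      then have zz: "z = z'" "A \<in> stab z" using sep[OF z A(1,2) x(1)] by auto
      then have "moebius (inv2 A) (moebius A x) \<in> U z"
        using Uinv[OF z stab_inv] A(3) z Z(2) by blast
      then show ?thesis using moebius_inv2(1)[OF A(2,4)] by simp
    qed
    have sph: "mord x (q w) \<ge> 0" if "z \<in> Z" "x \<in> sphere z e" for z x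
    proof (rule ccontr)
      assume "\<not> mord x (q w) \<ge> 0"
      then have "x \<in> U z" using inU[of x z] that by auto
      then show False using Uball[of z] that(2) by auto
    qed
    have "ressum (q w) = (\<Sum>z\<in>Z. (\<Sum>y\<in>{y \<in> U z. mord y (q w) < 0}. res y (q w)) / of_nat (card (stab z)))"
    proof (rule ressum_eq[OF q Z(1,2) C])
      show "U z \<subseteq> C" if "z \<in> Z" for z using Uball[of z] ball_subset_cball[of z e] that unfolding C_def by blast
      show "moebius A x \<in> U z" if "z \<in> Z" "A \<in> stab z" "x \<in> U z" for z A x using Uinv that by blast
      show "z = z' \<and> A \<in> stab z" if "z \<in> Z" "z' \<in> Z" "A \<in> G" "x \<in> U z" "moebius A x \<in> U z'" for z z' A x
        using sep[OF that(1,2,3)] Uball that(4,5) by (meson ball_subset_cball subsetD)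
      show "\<exists>z\<in>Z. \<exists>A\<in>G. moebius A x \<in> U z" if x: "x \<in> uhp" "mord x (q w) < 0" for x
      proof -
        obtain B where B: "B \<in> G" "moebius B x \<in> FK" using FK(3)[OF x(1)] by blast
        then have "moebius B x \<in> W" using elim mord_wt[OF q B(1) x(1), of w] x(2) by (force simp: C_def)
        then obtain z A where A: "z \<in> Z" "A \<in> G" "moebius A (moebius B x) \<in> U z" by (auto simp: W_def)
        then show ?thesis using moebius_mult[OF G_det[OF B(1)] x(1), of A] G_mult[OF A(2) B(1)]
          by (intro bexI[of _ z] bexI[of _ "A ** B"]) simp_all
      qed
    qed
    also have "\<dots> = (\<Sum>z\<in>Z. contour_integral (circlepath z e) (fun_of (q w)) / (2 * of_real pi * \<i> * of_nat (card (stab z))))"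
    proof (rule sum.cong[OF refl])
      fix z assume z: "z \<in> Z"
      have "contour_integral (circlepath z e) (fun_of (q w)) = 2 * of_real pi * \<i> * (\<Sum>y\<in>{y \<in> U z. mord y (q w) < 0}. res y (q w))"
      proof (rule ball_residues[OF e0 cb[OF z]])
        show "finite {y \<in> U z. mord y (q w) < 0}"
          by (rule finite_subset[OF _ finite_poles[OF compact_cball cb[OF z], of "q w"]])
            (use Uball[of z] ball_subset_cball[of z e] in auto)
      qed (use sph z Uball inU in auto)
      then show "(\<Sum>y\<in>{y \<in> U z. mord y (q w) < 0}. res y (q w)) / of_nat (card (stab z)) =
         contour_integral (circlepath z e) (fun_of (q w)) / (2 * of_real pi * \<i> * of_nat (card (stab z)))"
        by simp
    qed
    finally show ?case using sph by blast
  qed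
  moreover have "x \<notin> orb z'" if z: "z \<in> Z" "z' \<in> Z" and x: "x \<in> cball z e - {z}" for x z z'
  proof
    assume "x \<in> orb z'"
    then obtain A where A: "A \<in> G" "x = moebius A z'" by (auto simp: orb_def)
    have "moebius A z' \<in> cball z e" using x A by auto
    then have "z' = z \<and> A \<in> stab z'" using sep[OF z(2,1) A(1), of z'] e0 by auto
    then show False using x A by (auto simp: stab_def)
  qed
  ultimately show ?thesis using e0 cb by (intro exI[of _ e]) blast
qed

lemma regular_nhd:
  assumes x: "x \<in> uhp" and f: "mord x f \<ge> 0"
  obtains N where "open N" "x \<in> N" "N \<subseteq> uhp" "\<And>y. y \<in> N \<Longrightarrow> mord y f \<ge> 0"
proof (cases "f = 0")
  case True
  then show ?thesis using that[of uhp] x open_uhp by simp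
next
  case False
  have "eventually (\<lambda>w. w \<in> uhp \<and> mord w f \<ge> 0) (at x)"
    using merofun_nonzero_at[OF False x] eventually_in_uhp[OF x]
    by eventually_elim (auto simp: mord_0I)
  then have "eventually (\<lambda>w. w \<in> uhp \<and> mord w f \<ge> 0) (nhds x)"
    using x f by (simp add: eventually_nhds_conv_at)
  then show ?thesis using that unfolding eventually_nhds by blast
qed

lemma continuous_on_fun_of:
  assumes "S \<subseteq> uhp" "\<And>x. x \<in> S \<Longrightarrow> mord x f \<ge> 0"
  shows "continuous_on S (fun_of f)"
proof -
  have "isCont (fun_of f) x" if "x \<in> S" for x
    using assms that by (intro analytic_at_imp_isCont fun_of_analytic) auto
  then show ?thesis by (simp add: continuous_at_imp_continuous_on)
qed

lemma mord_shift:
  assumes "y \<in> uhp" "mord y a \<ge> 0" "fun_of a y \<noteq> w"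
  shows "mord y (a - mero_const w) = 0"
  using assms by (intro mord_0I) (auto simp: fun_of_diff)

lemma fun_of_divide:
  assumes y: "y \<in> uhp" "mord y f \<ge> 0" "mord y g = 0" "g \<noteq> 0"
  shows "fun_of (f / g) y = fun_of f y / fun_of g y" "mord y (f / g) \<ge> 0"
proof -
  show m: "mord y (f / g) \<ge> 0" using y by (cases "f = 0") (auto simp: mord_divide)
  have "fun_of (f / g * g) y = fun_of (f / g) y * fun_of g y"
    using y m by (intro fun_of_mult) auto
  moreover have "fun_of g y \<noteq> 0" using fun_of_eq_0_iff[of y g] y by auto
  ultimately show "fun_of (f / g) y = fun_of f y / fun_of g y" using y by (simp add: field_simps)
qed

text \<open>A nonzero form of negative weight must have a pole at \<open>\<i>\<close>. A form of
  positive weight that does not vanish at \<open>\<i>\<close> balances the weight, both raised to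
  suitable powers.\<close>

lemma nonconstant_function:
  obtains a where "a \<in> MI 0" "mord \<i> a < 0"
proof -
  obtain k h where h: "k > 0" "h \<in> MI (- k)" "h \<noteq> 0" by (rule negative_weight_form)
  obtain f j where f: "j > 0" "f \<in> MP j 0" "mord \<i> f = 0" "f \<noteq> 0"
    using modular_form_nonvanishing[OF ii_uhp] by metis
  have "mord \<i> h < 0"
  proof (rule ccontr)
    assume "\<not> mord \<i> h < 0"
    then have "h \<in> MP (- k) 0" using h(2) by (simp add: MP_def mord_ge_0_iff)
    then show False using MP_neg_weight[of "- k" h] h by simp
  qed
  then have "mord \<i> (f ^ nat k * h ^ nat j) < 0"
    using f h by (auto simp: mord_mult mult_pos_neg)
  moreover have "f ^ nat k * h ^ nat j \<in> MI 0"
    using MI_mult[OF MI_power[OF MP_MI[OF f(2)], of "nat k"] MI_power[OF h(2), of "nat j"]] f h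
    by (simp add: mult.commute)
  ultimately show ?thesis using that by blast
qed

text \<open>The sum \<open>S(w)\<close> of the residues of \<open>\<eta> / (a - w)\<close>, for a nonconstant function \<open>a\<close>, is an entire function of \<open>w\<close>
  and tends to 0 at infinity. Hence it vanishes, and so does the limit of \<open>- w S(w)\<close>, which is the sum of
  the residues of \<open>\<eta>\<close>.\<close>

lemma residue_theorem:
  assumes \<eta>: "\<eta> \<in> wt 2"
    and Z: "finite Z" "Z \<subseteq> uhp" "inequivalent Z" "\<i> \<in> Z"
    and poles: "\<And>x. x \<in> uhp \<Longrightarrow> mord x \<eta> < 0 \<Longrightarrow> \<exists>z\<in>Z. x \<in> orb z"
  shows "(\<Sum>z\<in>Z. res z \<eta> / of_nat (card (stab z))) = 0"
proof -
  obtain a where a: "a \<in> MI 0" "mord \<i> a < 0" by (rule nonconstant_function)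
  have areg: "mord x a \<ge> 0" if "x \<in> uhp" "x \<notin> orb \<i>" for x
    using MI_regular[OF a(1) that] that by (simp add: mord_ge_0_iff)
  define b where "b w = a - mero_const w" for w
  have bwt: "b w \<in> wt 0" for w unfolding b_def using MI_wt[OF a(1)] by (intro wt_diff) auto
  have bi: "mord \<i> (b w) < 0" for w
  proof (rule ccontr)
    assume "\<not> mord \<i> (b w) < 0"
    then have "mord_ge \<i> (b w + mero_const w) 0" by (intro mord_ge_add) (auto simp: mord_ge_0_iff)
    then show False using a(2) by (simp add: b_def mord_ge_0_iff)
  qed
  have b0: "b w \<noteq> 0" for w using bi[of w] by auto
  define q where "q w = \<eta> / b w" for w
  have qwt: "q w \<in> wt 2" for w using wt_divide[OF \<eta> bwt, of w] by (simp add: q_def)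
  have qreg: "mord y (q w) \<ge> 0" "fun_of (q w) y = fun_of \<eta> y / (fun_of a y - w)"
    if y: "y \<in> uhp" "mord y a \<ge> 0" "mord y \<eta> \<ge> 0" "fun_of a y \<noteq> w" for y w
  proof -
    have "mord y (b w) = 0" unfolding b_def using y by (intro mord_shift)
    then show "mord y (q w) \<ge> 0" "fun_of (q w) y = fun_of \<eta> y / (fun_of a y - w)"
      using fun_of_divide[of y \<eta> "b w"] y b0[of w] by (auto simp: q_def b_def fun_of_diff)
  qed
  have nhd: "\<exists>N. open N \<and> x \<in> N \<and> N \<subseteq> uhp \<and> (\<forall>y\<in>N. mord y a \<ge> 0 \<and> mord y \<eta> \<ge> 0 \<and> norm (fun_of a y - fun_of a x) < d)"
    if x: "x \<in> uhp" "mord x a \<ge> 0" "mord x \<eta> \<ge> 0" and d: "d > 0" for x d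
  proof -
    obtain N1 where N1: "open N1" "x \<in> N1" "N1 \<subseteq> uhp" "\<And>y. y \<in> N1 \<Longrightarrow> mord y a \<ge> 0"
      using regular_nhd[OF x(1,2)] by blast
    obtain N2 where N2: "open N2" "x \<in> N2" "N2 \<subseteq> uhp" "\<And>y. y \<in> N2 \<Longrightarrow> mord y \<eta> \<ge> 0"
      using regular_nhd[OF x(1,3)] by blast
    have "continuous_on N1 (fun_of a)" using N1 by (intro continuous_on_fun_of) auto
    then have "open (N1 \<inter> fun_of a -` ball (fun_of a x) d)" by (intro continuous_open_preimage N1) auto
    then have "open (N2 \<inter> (N1 \<inter> fun_of a -` ball (fun_of a x) d))" using N2 by blast
    then show ?thesis using N1 N2 d
      by (intro exI[of _ "N2 \<inter> (N1 \<inter> fun_of a -` ball (fun_of a x) d)"])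
        (auto simp: dist_norm norm_minus_commute)
  qed
  define c where "c z = 2 * of_real pi * \<i> * (of_nat (card (stab z)) :: complex)" for z
  define S where "S w = ressum (q w)" for w
  have "\<exists>r>0. S holomorphic_on ball w0 r" for w0
  proof -
    \<comment> \<open>For \<open>w\<close> near \<open>w0\<close>, poles of \<open>q w\<close> can
      only occur near the orbits of these points.\<close>
    define Z0 where "Z0 = {x \<in> FK. mord x (b w0) \<noteq> 0} \<union> {x \<in> FK. mord x \<eta> \<noteq> 0}"
    have Z0: "finite Z0" "Z0 \<subseteq> uhp" unfolding Z0_def using finite_mord_nz[OF FK(1,2)] FK(2) by auto
    obtain Y where Y: "Y \<subseteq> Z0" "inequivalent Y" "\<And>z. z \<in> Z0 \<Longrightarrow> \<exists>z'\<in>Y. z \<in> orb z'"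
      using representatives[OF Z0] by metis
    have Yf: "finite Y" "Y \<subseteq> uhp" using Y(1) Z0 finite_subset by blast+
    have off: "mord x a \<ge> 0 \<and> mord x \<eta> \<ge> 0 \<and> fun_of a x \<noteq> w0"
      if x: "x \<in> uhp" and nx: "\<And>z. z \<in> Y \<Longrightarrow> x \<notin> orb z" for x
    proof -
      obtain A where A: "A \<in> G" "moebius A x \<in> FK" using FK(3)[OF x] by blast
      have "moebius A x \<notin> Z0"
      proof
        assume "moebius A x \<in> Z0"
        then obtain z where z: "z \<in> Y" "moebius A x \<in> orb z" using Y(3) by blast
        then have "x \<in> orb z" using moebius_in_orb_iff[OF A(1) x, of z] Yf by blast
        then show False using nx z by blast
      qed
      then have "mord (moebius A x) (b w0) = 0" "mord (moebius A x) \<eta> = 0" using A by (auto simp: Z0_def)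
      then have m: "mord x (b w0) = 0" "mord x \<eta> = 0" using mord_wt[OF bwt A(1) x] mord_wt[OF \<eta> A(1) x] by auto
      have "mord_ge x (b w0 + mero_const w0) 0" using m x by (intro mord_ge_add) (auto simp: mord_ge_0_iff)
      then have ma: "mord x a \<ge> 0" using x by (simp add: b_def mord_ge_0_iff)
      have "fun_of (b w0) x \<noteq> 0" using fun_of_eq_0_iff[OF x b0, of w0] m by simp
      then have "fun_of a x \<noteq> w0" using x ma by (auto simp: b_def fun_of_diff)
      then show ?thesis using ma m by simp
    qed
    have reg: "\<exists>N. open N \<and> x \<in> N \<and> eventually (\<lambda>w. \<forall>y\<in>N. y \<in> uhp \<longrightarrow> mord y (q w) \<ge> 0) (nhds w0)"
      if x: "x \<in> uhp" and nx: "\<And>z. z \<in> Y \<Longrightarrow> x \<notin> orb z" for x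
    proof -
      define d where "d = norm (fun_of a x - w0) / 2"
      have d: "d > 0" using off[OF x nx] by (simp add: d_def)
      obtain N where N: "open N" "x \<in> N" "N \<subseteq> uhp"
        "\<forall>y\<in>N. mord y a \<ge> 0 \<and> mord y \<eta> \<ge> 0 \<and> norm (fun_of a y - fun_of a x) < d"
        using nhd[OF x _ _ d] off[OF x nx] by blast
      have "eventually (\<lambda>w. w \<in> ball w0 d) (nhds w0)" using d by (intro eventually_nhds_in_open) auto
      then have "eventually (\<lambda>w. \<forall>y\<in>N. y \<in> uhp \<longrightarrow> mord y (q w) \<ge> 0) (nhds w0)"
      proof eventually_elim
        case (elim w)
        show ?case
        proof (intro ballI impI)
          fix y assume y: "y \<in> N" "y \<in> uhp"
          have "fun_of a y \<noteq> w"
          proof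
            assume "fun_of a y = w"
            then have "norm (fun_of a x - w0) < d + d"
              using norm_triangle_ineq[of "fun_of a x - w" "w - w0"] elim N(4) y
              by (auto simp: dist_norm norm_minus_commute)
            then show False by (simp add: d_def)
          qed
          then show "mord y (q w) \<ge> 0" using qreg(1) N(4) y by blast
        qed
      qed
      then show ?thesis using N by blast
    qed
    from ressum_contour[OF Yf Y(2), of q "nhds w0", OF qwt reg]
    obtain e where E: "e > 0 \<and> (\<forall>z\<in>Y. cball z e \<subseteq> uhp \<and> (\<forall>x\<in>cball z e - {z}. \<forall>z'\<in>Y. x \<notin> orb z')) \<and>
      eventually (\<lambda>w. (\<forall>z\<in>Y. \<forall>x\<in>sphere z e. mord x (q w) \<ge> 0) \<and>
        ressum (q w) = (\<Sum>z\<in>Y. contour_integral (circlepath z e) (fun_of (q w)) / (2 * of_real pi * \<i> * of_nat (card (stab z))))) (nhds w0)" ..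
    have e: "e > 0" "\<And>z. z \<in> Y \<Longrightarrow> cball z e \<subseteq> uhp"
      "\<And>z x z'. z \<in> Y \<Longrightarrow> x \<in> cball z e - {z} \<Longrightarrow> z' \<in> Y \<Longrightarrow> x \<notin> orb z'"
      using E by (blast, blast, blast)
    have ev: "eventually (\<lambda>w. S w = (\<Sum>z\<in>Y. contour_integral (circlepath z e) (fun_of (q w)) / c z)) (nhds w0)"
      unfolding S_def c_def by (rule eventually_mono[OF conjunct2[OF conjunct2[OF E]]]) (rule conjunct2)
    have sph: "mord x a \<ge> 0 \<and> mord x \<eta> \<ge> 0 \<and> fun_of a x \<noteq> w0 \<and> x \<in> uhp" if "z \<in> Y" "x \<in> sphere z e" for x z
    proof -
      have "x \<in> cball z e - {z}" using that e(1) by auto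
      moreover have "x \<in> uhp" using calculation e(2)[OF that(1)] by blast
      ultimately have "x \<in> cball z e - {z}" "x \<in> uhp" by blast+
      then show ?thesis using off[of x] e(3)[OF that(1)] by blast
    qed
    have "\<forall>z\<in>Y. \<exists>d>0. \<forall>x\<in>sphere z e. norm (fun_of a x - w0) \<ge> 2 * d"
    proof
      fix z assume z: "z \<in> Y"
      have ne: "sphere z e \<noteq> {}" using e(1) by auto
      have cont: "continuous_on (sphere z e) (\<lambda>x. norm (fun_of a x - w0))"
        using sph[OF z] by (intro continuous_intros continuous_on_fun_of) auto
      obtain x0 where x0: "x0 \<in> sphere z e" "\<forall>x\<in>sphere z e. norm (fun_of a x0 - w0) \<le> norm (fun_of a x - w0)"
        using continuous_attains_inf[OF compact_sphere ne cont] by blast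
      then show "\<exists>d>0. \<forall>x\<in>sphere z e. norm (fun_of a x - w0) \<ge> 2 * d"
        using sph[OF z x0(1)] by (intro exI[of _ "norm (fun_of a x0 - w0) / 2"]) auto
    qed
    from bchoice[OF this] obtain d where d0: "\<forall>z\<in>Y. d z > 0 \<and> (\<forall>x\<in>sphere z e. norm (fun_of a x - w0) \<ge> 2 * d z)" ..
    define d1 where "d1 = Min (insert 1 (d ` Y))"
    have d1: "d1 > 0" "\<And>z. z \<in> Y \<Longrightarrow> d1 \<le> d z"
      unfolding d1_def using Yf d0 by (auto simp: Min_gr_iff)
    obtain r where r: "r > 0" "\<And>w. w \<in> ball w0 r \<Longrightarrow> S w = (\<Sum>z\<in>Y. contour_integral (circlepath z e) (fun_of (q w)) / c z)"
    proof -
      obtain T where T: "open T" "w0 \<in> T" "\<And>w. w \<in> T \<Longrightarrow> S w = (\<Sum>z\<in>Y. contour_integral (circlepath z e) (fun_of (q w)) / c z)"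
        using ev unfolding eventually_nhds by blast
      then obtain r where "r > 0" "ball w0 r \<subseteq> T" using openE by blast
      then show ?thesis using that T by blast
    qed
    define r' where "r' = min r d1"
    have "(\<lambda>w. \<Sum>z\<in>Y. contour_integral (circlepath z e) (\<lambda>x. fun_of \<eta> x / (fun_of a x - w)) / c z) holomorphic_on ball w0 r'"
    proof (rule holomorphic_on_sum)
      fix z assume z: "z \<in> Y"
      have "(\<lambda>w. contour_integral (circlepath z e) (\<lambda>x. fun_of \<eta> x / (fun_of a x - w))) holomorphic_on ball w0 d1"
      proof (rule contour_integral_parameter_holomorphic[OF e(1)])
        show "continuous_on (sphere z e) (fun_of \<eta>)" "continuous_on (sphere z e) (fun_of a)"
          using sph[OF z] by (auto intro!: continuous_on_fun_of)
        show "2 * d1 \<le> norm (fun_of a x - w0)" if "x \<in> sphere z e" for x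
          using d0 d1(2)[OF z] z that by fastforce
      qed (use d1 in auto)
      then have "(\<lambda>w. contour_integral (circlepath z e) (\<lambda>x. fun_of \<eta> x / (fun_of a x - w))) holomorphic_on ball w0 r'"
        by (rule holomorphic_on_subset) (auto simp: r'_def)
      then show "(\<lambda>w. contour_integral (circlepath z e) (\<lambda>x. fun_of \<eta> x / (fun_of a x - w)) / c z) holomorphic_on ball w0 r'"
        using card_stab_pos z Yf(2) by (intro holomorphic_intros) (auto simp: c_def)
    qed
    moreover have "S w = (\<Sum>z\<in>Y. contour_integral (circlepath z e) (\<lambda>x. fun_of \<eta> x / (fun_of a x - w)) / c z)"
      if w: "w \<in> ball w0 r'" for w
    proof -
      have "contour_integral (circlepath z e) (fun_of (q w)) =
          contour_integral (circlepath z e) (\<lambda>x. fun_of \<eta> x / (fun_of a x - w))" if z: "z \<in> Y" for z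
      proof (rule contour_integral_cong[OF refl])
        fix x assume "x \<in> path_image (circlepath z e)"
        then have x: "x \<in> sphere z e" using e(1) by (simp add: path_image_circlepath)
        have "fun_of a x \<noteq> w"
        proof
          assume "fun_of a x = w"
          then have "norm (w - w0) \<ge> 2 * d z" using d0 z x by blast
          moreover have "norm (w - w0) < d1" using w by (simp add: r'_def dist_norm norm_minus_commute)
          ultimately show False using d1(2)[OF z] d1(1) by linarith
        qed
        then show "fun_of (q w) x = fun_of \<eta> x / (fun_of a x - w)" using qreg(2) sph[OF z x] by blast
      qed
      then show ?thesis using r(2)[of w] w by (simp add: r'_def)
    qed
    ultimately have "S holomorphic_on ball w0 r'" by (subst holomorphic_cong[OF refl]) auto
    then show ?thesis using r(1) d1(1) by (intro exI[of _ r']) (auto simp: r'_def)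
  qed
  then have "S holomorphic_on (\<Union>w0. ball w0 (SOME r. r > 0 \<and> S holomorphic_on ball w0 r))"
    by (intro holomorphic_on_UN_open) (auto intro: someI2_ex)
  moreover have "(\<Union>w0. ball w0 (SOME r. r > 0 \<and> S holomorphic_on ball w0 r)) = UNIV"
  proof -
    have "w0 \<in> ball w0 (SOME r. r > 0 \<and> S holomorphic_on ball w0 r)" for w0
      using someI_ex[OF \<open>\<And>w0. \<exists>r>0. S holomorphic_on ball w0 r\<close>[of w0]] by simp
    then show ?thesis by blast
  qed
  ultimately have S_hol: "S holomorphic_on UNIV" by simp
  have off: "mord x a \<ge> 0 \<and> mord x \<eta> \<ge> 0" if x: "x \<in> uhp" and nx: "\<And>z. z \<in> Z \<Longrightarrow> x \<notin> orb z" for x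
    using poles[OF x] nx areg[OF x] Z(4) by (metis not_le)
  have reg: "\<exists>N. open N \<and> x \<in> N \<and> eventually (\<lambda>w. \<forall>y\<in>N. y \<in> uhp \<longrightarrow> mord y (q w) \<ge> 0) at_infinity"
    if x: "x \<in> uhp" and nx: "\<And>z. z \<in> Z \<Longrightarrow> x \<notin> orb z" for x
  proof -
    obtain N where N: "open N" "x \<in> N" "N \<subseteq> uhp"
        "\<forall>y\<in>N. mord y a \<ge> 0 \<and> mord y \<eta> \<ge> 0 \<and> norm (fun_of a y - fun_of a x) < 1"
      using nhd[OF x _ _ zero_less_one] off[OF x nx] by blast
    have "eventually (\<lambda>w. norm (fun_of a x) + 1 \<le> norm w) at_infinity"
      unfolding eventually_at_infinity by blast
    then have "eventually (\<lambda>w. \<forall>y\<in>N. y \<in> uhp \<longrightarrow> mord y (q w) \<ge> 0) at_infinity"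
    proof eventually_elim
      case (elim w)
      show ?case
      proof (intro ballI impI)
        fix y assume y: "y \<in> N" "y \<in> uhp"
        have "norm (fun_of a y) < norm (fun_of a x) + 1"
          using N(4) y norm_triangle_ineq2[of "fun_of a y" "fun_of a x"] by fastforce
        then have "fun_of a y \<noteq> w" using elim by auto
        then show "mord y (q w) \<ge> 0" using qreg(1) N(4) y by blast
      qed
    qed
    then show ?thesis using N by blast
  qed
  from ressum_contour[OF Z(1-3), of q "at_infinity", OF qwt reg]
  obtain e where E: "e > 0 \<and> (\<forall>z\<in>Z. cball z e \<subseteq> uhp \<and> (\<forall>x\<in>cball z e - {z}. \<forall>z'\<in>Z. x \<notin> orb z')) \<and>
    eventually (\<lambda>w. (\<forall>z\<in>Z. \<forall>x\<in>sphere z e. mord x (q w) \<ge> 0) \<and>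
      ressum (q w) = (\<Sum>z\<in>Z. contour_integral (circlepath z e) (fun_of (q w)) / (2 * of_real pi * \<i> * of_nat (card (stab z))))) (at_infinity)" ..
  have e: "e > 0" "\<And>z. z \<in> Z \<Longrightarrow> cball z e \<subseteq> uhp"
    "\<And>z x z'. z \<in> Z \<Longrightarrow> x \<in> cball z e - {z} \<Longrightarrow> z' \<in> Z \<Longrightarrow> x \<notin> orb z'"
    using E by (blast, blast, blast)
  have ev: "eventually (\<lambda>w. S w = (\<Sum>z\<in>Z. contour_integral (circlepath z e) (fun_of (q w)) / c z)) (at_infinity)"
    unfolding S_def c_def by (rule eventually_mono[OF conjunct2[OF conjunct2[OF E]]]) (rule conjunct2)
  have sph: "mord x a \<ge> 0 \<and> mord x \<eta> \<ge> 0 \<and> x \<in> uhp" if "z \<in> Z" "x \<in> cball z e - {z}" for x z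
    using off[of x] e(2)[OF that(1)] e(3)[OF that] that by blast
  \<comment> \<open>On the circle \<open>w / (a - w)\<close> tends uniformly to -1.\<close>
  have lim: "((\<lambda>w. w * contour_integral (circlepath z e) (fun_of (q w))) \<longlongrightarrow>
      - contour_integral (circlepath z e) (fun_of \<eta>)) at_infinity" if z: "z \<in> Z" for z
  proof -
    have sp: "mord x a \<ge> 0 \<and> mord x \<eta> \<ge> 0 \<and> x \<in> uhp" if "x \<in> sphere z e" for x
      using sph[OF z, of x] that e(1) by auto
    have ca: "continuous_on (sphere z e) (fun_of a)" and c\<eta>: "continuous_on (sphere z e) (fun_of \<eta>)"
      using sp by (auto intro!: continuous_on_fun_of)
    obtain M where M: "M > 0" "\<And>x. x \<in> sphere z e \<Longrightarrow> norm (fun_of a x) \<le> M"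
      using compact_imp_bounded[OF compact_continuous_image[OF ca compact_sphere]] by (auto simp: bounded_pos)
    obtain L where L: "L > 0" "\<And>x. x \<in> sphere z e \<Longrightarrow> norm (fun_of \<eta> x) \<le> L"
      using compact_imp_bounded[OF compact_continuous_image[OF c\<eta> compact_sphere]] by (auto simp: bounded_pos)
    have big: "eventually (\<lambda>w. 2 * M \<le> norm w) at_infinity" unfolding eventually_at_infinity by blast
    have ne: "fun_of a x \<noteq> w" if "x \<in> sphere z e" "2 * M \<le> norm w" for x w using M that by force
    have 1: "eventually (\<lambda>w. (\<lambda>x. w * (fun_of \<eta> x / (fun_of a x - w))) contour_integrable_on circlepath z e) at_infinity"
      using big
    proof eventually_elim
      case (elim w)
      have nz: "fun_of a x - w \<noteq> 0" if "x \<in> sphere z e" for x using ne[OF that elim] by simp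
      have "continuous_on (sphere z e) (\<lambda>x. w * (fun_of \<eta> x / (fun_of a x - w)))"
        by (intro continuous_intros ca c\<eta> ballI nz)
      then show ?case using e(1) by (intro contour_integrable_continuous_circlepath) (simp add: path_image_circlepath)
    qed
    have 2: "uniform_limit (sphere z e) (\<lambda>w x. w * (fun_of \<eta> x / (fun_of a x - w))) (\<lambda>x. - fun_of \<eta> x) at_infinity"
    proof (rule uniform_limitI)
      fix \<epsilon> :: real assume \<epsilon>: "\<epsilon> > 0"
      have "eventually (\<lambda>w::complex. 2 * L * M / \<epsilon> + 1 \<le> norm w) at_infinity" unfolding eventually_at_infinity by blast
      then show "eventually (\<lambda>w. \<forall>x\<in>sphere z e. dist (w * (fun_of \<eta> x / (fun_of a x - w))) (- fun_of \<eta> x) < \<epsilon>) at_infinity"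
        using big
      proof eventually_elim
        case (elim w)
        show ?case
        proof
          fix x assume x: "x \<in> sphere z e"
          have nz: "fun_of a x - w \<noteq> 0" using ne[OF x elim(2)] by simp
          have w0: "norm w > 0" using elim M by linarith
          have half: "norm (fun_of a x - w) \<ge> norm w / 2"
          proof -
            have "norm w \<le> norm (fun_of a x - w) + norm (fun_of a x)"
              using norm_triangle_ineq4[of "fun_of a x" "fun_of a x - w"] by simp
            then show ?thesis using M(2)[OF x] elim(2) by linarith
          qed
          have "w * (fun_of \<eta> x / (fun_of a x - w)) - - fun_of \<eta> x = fun_of \<eta> x * fun_of a x / (fun_of a x - w)"
            using nz by (simp add: divide_simps) (simp add: algebra_simps)
          then have "dist (w * (fun_of \<eta> x / (fun_of a x - w))) (- fun_of \<eta> x) =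
              norm (fun_of \<eta> x) * norm (fun_of a x) / norm (fun_of a x - w)"
            by (simp only: dist_norm norm_mult norm_divide)
          also have "\<dots> \<le> L * M / (norm w / 2)"
            using half w0 L M x by (intro frac_le mult_mono) auto
          also have "\<dots> < \<epsilon>" using elim(1) \<epsilon> w0 by (simp add: field_simps)
          finally show "dist (w * (fun_of \<eta> x / (fun_of a x - w))) (- fun_of \<eta> x) < \<epsilon>" .
        qed
      qed
    qed
    have "((\<lambda>w. contour_integral (circlepath z e) (\<lambda>x. w * (fun_of \<eta> x / (fun_of a x - w)))) \<longlongrightarrow>
        contour_integral (circlepath z e) (\<lambda>x. - fun_of \<eta> x)) at_infinity"
      using contour_integral_uniform_limit_circlepath(2)[OF 1 2 _ e(1)] trivial_limit_at_infinity by auto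
    moreover have "contour_integral (circlepath z e) (\<lambda>x. - fun_of \<eta> x) = - contour_integral (circlepath z e) (fun_of \<eta>)"
      using c\<eta> e(1) by (intro contour_integral_neg contour_integrable_continuous_circlepath)
    moreover have "eventually (\<lambda>w. contour_integral (circlepath z e) (\<lambda>x. w * (fun_of \<eta> x / (fun_of a x - w))) =
        w * contour_integral (circlepath z e) (fun_of (q w))) at_infinity"
      using big eventually_not_equal_at_infinity[of "0::complex"]
    proof eventually_elim
      case (elim w)
      have "contour_integral (circlepath z e) (\<lambda>x. w * (fun_of \<eta> x / (fun_of a x - w))) =
         contour_integral (circlepath z e) (\<lambda>x. w * fun_of (q w) x)"
      proof (rule contour_integral_cong[OF refl])
        fix x assume "x \<in> path_image (circlepath z e)"
        then have x: "x \<in> sphere z e" using e(1) by (simp add: path_image_circlepath)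
        show "w * (fun_of \<eta> x / (fun_of a x - w)) = w * fun_of (q w) x"
          using qreg(2)[of x w] sp[OF x] ne[OF x elim(1)] by simp
      qed
      also have "\<dots> = w * contour_integral (circlepath z e) (fun_of (q w))"
      proof (rule contour_integral_lmul)
        have "continuous_on (sphere z e) (fun_of (q w))"
          using qreg(1) sp ne[OF _ elim(1)] by (intro continuous_on_fun_of) auto
        then show "fun_of (q w) contour_integrable_on circlepath z e"
          using e(1) by (intro contour_integrable_continuous_circlepath) (simp add: path_image_circlepath)
      qed
      finally show ?case .
    qed
    ultimately show ?thesis using tendsto_cong by force
  qed
  let ?L = "\<Sum>z\<in>Z. (- contour_integral (circlepath z e) (fun_of \<eta>)) / c z"
  have "((\<lambda>w. \<Sum>z\<in>Z. (w * contour_integral (circlepath z e) (fun_of (q w))) / c z) \<longlongrightarrow> ?L) at_infinity"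
    using lim card_stab_pos Z(2) by (intro tendsto_sum tendsto_divide tendsto_const) (auto simp: c_def)
  moreover have "eventually (\<lambda>w. (\<Sum>z\<in>Z. (w * contour_integral (circlepath z e) (fun_of (q w))) / c z) = w * S w) at_infinity"
    using ev by eventually_elim (simp add: sum_distrib_left)
  ultimately have limS: "((\<lambda>w. w * S w) \<longlongrightarrow> ?L) at_infinity" by (rule Lim_transform_eventually)
  have "((\<lambda>w. inverse w * (w * S w)) \<longlongrightarrow> 0 * ?L) at_infinity"
    by (intro tendsto_mult limS tendsto_inverse_0)
  then have "((\<lambda>w. inverse w * (w * S w)) \<longlongrightarrow> 0) at_infinity" by simp
  moreover have "eventually (\<lambda>w. inverse w * (w * S w) = S w) at_infinity"
    using eventually_not_equal_at_infinity[of "0::complex"] by eventually_elim simp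
  ultimately have "(S \<longlongrightarrow> 0) at_infinity" by (rule Lim_transform_eventually)
  then have S0: "S w = 0" for w using Liouville_weak_0[OF S_hol] by blast
  then have "((\<lambda>w::complex. 0) \<longlongrightarrow> ?L) at_infinity" using limS by simp
  then have L0: "?L = 0" by (rule tendsto_unique[OF trivial_limit_at_infinity _ tendsto_const])
  have "contour_integral (circlepath z e) (fun_of \<eta>) = 2 * of_real pi * \<i> * (\<Sum>x\<in>{z}. res x \<eta>)" if z: "z \<in> Z" for z
  proof (rule ball_residues[OF e(1) e(2)[OF z]])
    show "mord x \<eta> \<ge> 0" if "x \<in> sphere z e" for x using sph[OF z, of x] that e(1) by auto
    show "x \<in> {z}" if "x \<in> ball z e" "mord x \<eta> < 0" for x using sph[OF z, of x] that by force
  qed (use e(1) in auto)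
  then have "?L = (\<Sum>z\<in>Z. - (res z \<eta> / of_nat (card (stab z))))"
    by (intro sum.cong refl) (simp add: c_def)
  then show ?thesis using L0 by (simp add: sum_negf)
qed

text \<open>\<open>F' / F\<close> and \<open>k \<phi>\<close> fail the law of weight 2 by the same
  term \<open>k c (c z + d)\<close>.\<close>

lemma wt_log_deriv_diff:
  assumes F: "F \<in> wt k" "F \<noteq> 0" and \<phi>: "quasi2 \<phi>"
  shows "mero_deriv F / F - of_int k * \<phi> \<in> wt 2"
  unfolding wt_def
proof (intro CollectI ballI)
  fix A assume A: "A \<in> G"
  then have d: "det A = 1" by (rule G_det)
  let ?J = "autofun A"
  have J: "?J \<noteq> 0" using d by simp
  have "mcomp A (of_int k) = (of_int k :: merofun)"
    using mcomp_const[OF d, of "of_int k"] by (simp add: mero_const_of_int)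
  then have "mcomp A (mero_deriv F / F - of_int k * \<phi>) =
     (?J powi (k + 2) * mero_deriv F + of_int k * mero_const (of_real (A$2$1)) * ?J powi (k + 1) * F) / (?J powi k * F)
      - of_int k * (?J\<^sup>2 * \<phi> + mero_const (of_real (A$2$1)) * ?J)"
    using d mcomp_deriv_wt[OF F(1) A] F(1) A \<phi> by (simp add: wt_def quasi2_def)
  also have "?J powi (k + 2) = ?J powi k * ?J\<^sup>2" using J by (simp add: power_int_add)
  also have "?J powi (k + 1) = ?J powi k * ?J" using J by (simp add: power_int_add)
  finally have "mcomp A (mero_deriv F / F - of_int k * \<phi>) =
     (?J powi k * ?J\<^sup>2 * mero_deriv F + of_int k * mero_const (of_real (A$2$1)) * (?J powi k * ?J) * F) / (?J powi k * F)
      - of_int k * (?J\<^sup>2 * \<phi> + mero_const (of_real (A$2$1)) * ?J)" .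
  moreover have alg: "(X * ?J\<^sup>2 * mero_deriv F + of_int k * C * (X * ?J) * F) / (X * F) = ?J\<^sup>2 * (mero_deriv F / F) + of_int k * C * ?J"
    if "X \<noteq> 0" for X C using F(2) that by (simp add: field_simps)
  have "?J powi k \<noteq> 0" using J by simp
  ultimately have "mcomp A (mero_deriv F / F - of_int k * \<phi>) =
      (?J\<^sup>2 * (mero_deriv F / F) + of_int k * mero_const (of_real (A$2$1)) * ?J)
      - of_int k * (?J\<^sup>2 * \<phi> + mero_const (of_real (A$2$1)) * ?J)"
    using alg[OF \<open>?J powi k \<noteq> 0\<close>, of "mero_const (of_real (A$2$1))"] by simp
  then show "mcomp A (mero_deriv F / F - of_int k * \<phi>) = ?J powi 2 * (mero_deriv F / F - of_int k * \<phi>)"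
    by (simp add: algebra_simps)
qed

lemma res_log_deriv: "z \<in> uhp \<Longrightarrow> F \<noteq> 0 \<Longrightarrow> res z (mero_deriv F / F) = of_int (mord z F)"
  using fls_residue_deriv_times_inverse_eq_subdegree(1)[of "germ z F"]
  by (simp add: res_def mord_def divide_inverse)

lemma quasi2_residue_positive:
  assumes \<phi>: "\<phi> \<in> delta_one_forms \<Gamma>"
  obtains r where "r > 0" "res \<i> \<phi> = of_real r"
proof -
  have q: "quasi2 \<phi>" and reg: "\<And>z. z \<in> uhp \<Longrightarrow> z \<notin> orb \<i> \<Longrightarrow> mord_ge z \<phi> 0"
    using \<phi> by (auto simp: delta_one_forms_iff)
  obtain F k where F: "k > 0" "F \<in> MP k 0" "mord \<i> F = 0" "F \<noteq> 0"
    using modular_form_nonvanishing[OF ii_uhp] by metis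
  define \<eta> where "\<eta> = mero_deriv F / F - of_int k * \<phi>"
  have \<eta>: "\<eta> \<in> wt 2" unfolding \<eta>_def by (intro wt_log_deriv_diff MP_wt[OF F(2)] F(4) q)
  define Z0 where "Z0 = {x \<in> FK. mord x F \<noteq> 0}"
  have Z0: "finite Z0" "Z0 \<subseteq> uhp" unfolding Z0_def using finite_mord_nz[OF FK(1,2)] FK(2) by auto
  obtain Y where Y: "Y \<subseteq> Z0" "inequivalent Y" "\<And>z. z \<in> Z0 \<Longrightarrow> \<exists>z'\<in>Y. z \<in> orb z'"
    using representatives[OF Z0] by metis
  have Yf: "finite Y" "Y \<subseteq> uhp" using Y(1) Z0 finite_subset by blast+
  have nonneg: "mord x F \<ge> 0" if "x \<in> uhp" for x using F(2) that by (simp add: MP_0_iff mord_ge_0_iff)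
  have zi: "z \<notin> orb \<i>" if z: "z \<in> Y" for z
  proof
    assume "z \<in> orb \<i>"
    then obtain A where "A \<in> G" "z = moebius A \<i>" by (auto simp: orb_def)
    then have "mord z F = 0" using mord_wt[OF MP_wt[OF F(2)], of A \<i>] F(3) by simp
    then show False using z Y(1) by (auto simp: Z0_def)
  qed
  have covY: "\<exists>z\<in>Y. x \<in> orb z" if x: "x \<in> uhp" "mord x F \<noteq> 0" for x
  proof -
    obtain A where A: "A \<in> G" "moebius A x \<in> FK" using FK(3)[OF x(1)] by blast
    then have "moebius A x \<in> Z0" using mord_wt[OF MP_wt[OF F(2)] A(1) x(1)] x by (auto simp: Z0_def)
    then obtain z where z: "z \<in> Y" "moebius A x \<in> orb z" using Y(3) by blast
    then show ?thesis using moebius_in_orb_iff[OF A(1) x(1), of z] Yf by blast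
  qed
  have kreg: "mord_ge x (of_int k * \<phi>) 0" if "x \<in> uhp" "x \<notin> orb \<i>" for x
    using mord_ge_mult[OF that(1) mord_ge_const[OF that(1), of "of_int k"] reg[OF that]]
    by (simp add: mero_const_of_int)
  have "(\<Sum>z\<in>insert \<i> Y. res z \<eta> / of_nat (card (stab z))) = 0"
  proof (rule residue_theorem[OF \<eta>])
    show "finite (insert \<i> Y)" "insert \<i> Y \<subseteq> uhp" using Yf by auto
    show "inequivalent (insert \<i> Y)"
      using Y(2) zi orb_sym Yf unfolding inequivalent_def by (metis ii_uhp insert_iff subsetD)
    show "\<exists>z\<in>insert \<i> Y. x \<in> orb z" if x: "x \<in> uhp" "mord x \<eta> < 0" for x
    proof (rule ccontr)
      assume no: "\<not> (\<exists>z\<in>insert \<i> Y. x \<in> orb z)"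
      then have m: "mord x F = 0" "x \<notin> orb \<i>" using covY[OF x(1)] by blast+
      have "mord_ge x (mero_deriv F) 0" using m x by (intro mord_ge_deriv0) (auto simp: mord_ge_0_iff)
      then have "mord_ge x (mero_deriv F / F) 0"
        using m x F(4) by (cases "mero_deriv F = 0") (auto simp: mord_ge_iff mord_divide)
      then have "mord_ge x \<eta> 0" unfolding \<eta>_def using kreg x m by (intro mord_ge_diff) auto
      then show False using x by (simp add: mord_ge_0_iff)
    qed
  qed simp
  moreover have "\<i> \<notin> Y" using zi orb_self by blast
  moreover have "res z \<eta> = of_int (mord z F)" if z: "z \<in> Y" for z
  proof -
    have zu: "z \<in> uhp" using z Yf by blast
    have "res z (of_int k * \<phi>) = 0" using kreg[OF zu zi[OF z]] zu by (intro res_regular) (auto simp: mord_ge_0_iff)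
    then show ?thesis unfolding \<eta>_def using res_log_deriv[OF zu F(4)] zu by (simp add: res_def)
  qed
  moreover have "res \<i> \<eta> = - (of_int k * res \<i> \<phi>)"
  proof -
    have "res \<i> (mero_deriv F / F) = 0" using res_log_deriv[OF ii_uhp F(4)] F(3) by simp
    moreover have "res \<i> (of_int k * \<phi>) = of_int k * res \<i> \<phi>"
      unfolding res_def using fls_residue_of_int_times(1)[of k "germ \<i> \<phi>"] by simp
    ultimately show ?thesis by (simp add: \<eta>_def res_def)
  qed
  \<comment> \<open>A valence formula: the residue of \<phi> is a positive multiple of the weighted
    number of zeros of \<open>F\<close> modulo \<Gamma>. That number is positive, since a form of
    positive weight has a zero.\<close>
  ultimately have eq: "of_int k * res \<i> \<phi> / of_nat (card (stab \<i>)) = (\<Sum>z\<in>Y. of_int (mord z F) / of_nat (card (stab z)))"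
    using Yf(1) by simp
  define s :: real where "s = (\<Sum>z\<in>Y. of_int (mord z F) / of_nat (card (stab z)))"
  obtain x where x: "x \<in> uhp" "mord x F > 0" using positive_weight_zero[OF F(1,2)] F(4) by blast
  then obtain z where z: "z \<in> Y" using covY[of x] by auto
  have "s > 0" unfolding s_def
  proof (rule sum_pos[OF Yf(1)])
    show "Y \<noteq> {}" using z by blast
    fix z assume z: "z \<in> Y"
    then have "mord z F \<noteq> 0" "z \<in> uhp" using Y(1) Yf(2) by (auto simp: Z0_def)
    then have "mord z F > 0" using nonneg[of z] by simp
    then show "0 < real_of_int (mord z F) / real (card (stab z))"
      using card_stab_pos[of z] \<open>z \<in> uhp\<close> by simp
  qed
  moreover have "(\<Sum>z\<in>Y. of_int (mord z F) / of_nat (card (stab z))) = complex_of_real s"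
    unfolding s_def by simp
  then have "res \<i> \<phi> = of_real (s * real (card (stab \<i>)) / real_of_int k)"
    using eq F(1) card_stab_pos[OF ii_uhp] by (simp add: field_simps)
  moreover have "s * real (card (stab \<i>)) / real_of_int k > 0"
    using calculation(1) F(1) card_stab_pos[OF ii_uhp] by simp
  ultimately show ?thesis using that by blast
qed

lemma delta_one_pole: "\<phi> \<in> delta_one_forms \<Gamma> \<Longrightarrow> mord \<i> \<phi> < 0"
  using quasi2_residue_positive[of \<phi>] res_regular[OF ii_uhp, of \<phi>] by (metis less_irrefl not_le of_real_eq_0_iff)

end

section \<open>Graded rings\<close>

lemma sum_concat:
  fixes f g :: "nat \<Rightarrow> 'a :: comm_monoid_add"
  shows "(\<Sum>i<n. f i) + (\<Sum>i<m. g i) = (\<Sum>i<n + m. if i < n then f i else g (i - n))"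
proof -
  have "(\<Sum>i<n + m. if i < n then f i else g (i - n)) =
     (\<Sum>i<n. if i < n then f i else g (i - n)) + (\<Sum>i=n..<n + m. if i < n then f i else g (i - n))"
    unfolding lessThan_atLeast0 by (rule sum.atLeastLessThan_concat[symmetric]) auto
  also have "(\<Sum>i<n. if i < n then f i else g (i - n)) = (\<Sum>i<n. f i)" by (intro sum.cong) auto
  also have "(\<Sum>i=n..<n + m. if i < n then f i else g (i - n)) = (\<Sum>i<m. g i)"
    using sum.shift_bounds_nat_ivl[of "\<lambda>i. if i < n then f i else g (i - n)" 0 n m]
    by (simp add: lessThan_atLeast0 add.commute)
  finally show ?thesis by simp
qed

lemma smult_sum_right: "smult c (sum f X) = (\<Sum>x\<in>X. smult c (f x))"
  by (rule poly_eqI) (simp add: coeff_sum sum_distrib_left)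

lemma ideal_square_0: "0 \<in> ideal_square J"
  unfolding ideal_square_def by (intro CollectI exI[of _ 0]) auto

lemma ideal_square_mult: "F \<in> J \<Longrightarrow> H \<in> J \<Longrightarrow> F * H \<in> ideal_square J"
  unfolding ideal_square_def by (intro CollectI exI[of _ 1] exI[of _ "\<lambda>_. F"] exI[of _ "\<lambda>_. H"]) auto

lemma ideal_square_add:
  assumes "F \<in> ideal_square J" "H \<in> ideal_square J" shows "F + H \<in> ideal_square J"
proof -
  obtain n G1 H1 where 1: "F = (\<Sum>i<n. G1 i * H1 i)" "\<forall>i<(n::nat). G1 i \<in> J \<and> H1 i \<in> J"
    using assms(1) unfolding ideal_square_def by blast
  obtain m G2 H2 where 2: "H = (\<Sum>i<m. G2 i * H2 i)" "\<forall>i<(m::nat). G2 i \<in> J \<and> H2 i \<in> J"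
    using assms(2) unfolding ideal_square_def by blast
  define G3 where "G3 i = (if i < n then G1 i else G2 (i - n))" for i
  define H3 where "H3 i = (if i < n then H1 i else H2 (i - n))" for i
  have "F + H = (\<Sum>i<n + m. G3 i * H3 i)"
    unfolding 1(1) 2(1) sum_concat by (intro sum.cong) (auto simp: G3_def H3_def)
  moreover have "\<forall>i<n + m. G3 i \<in> J \<and> H3 i \<in> J" using 1(2) 2(2) by (auto simp: G3_def H3_def)
  ultimately show ?thesis unfolding ideal_square_def by blast
qed

lemma ideal_square_smult:
  assumes J: "\<And>G. G \<in> J \<Longrightarrow> smult c G \<in> J" and F: "F \<in> ideal_square J"
  shows "smult c F \<in> ideal_square J"
proof -
  obtain n G1 H1 where 1: "F = (\<Sum>i<n. G1 i * H1 i)" "\<forall>i<(n::nat). G1 i \<in> J \<and> H1 i \<in> J"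
    using F unfolding ideal_square_def by blast
  have "smult c F = (\<Sum>i<n. smult c (G1 i) * H1 i)" unfolding 1(1)
    by (simp add: poly_eq_iff coeff_sum sum_distrib_left)
  then show ?thesis using 1(2) J unfolding ideal_square_def
    by (intro CollectI exI[of _ n] exI[of _ "\<lambda>i. smult c (G1 i)"] exI[of _ H1]) auto
qed

text \<open>In weight \<open>k\<close> an element of the square is a sum of products of forms whose
  weights lie strictly between 0 and \<open>k\<close>; this is what makes induction on the weight
  possible.\<close>

lemma coeff_ideal_square:
  assumes F: "F \<in> ideal_square {F. (\<forall>k. coeff F k \<in> M k) \<and> coeff F 0 = 0}"
    and P: "P 0" "\<And>a b. P a \<Longrightarrow> P b \<Longrightarrow> P (a + b)"
    "\<And>a b p q. p > 0 \<Longrightarrow> q > 0 \<Longrightarrow> p + q = k \<Longrightarrow> a \<in> M p \<Longrightarrow> b \<in> M q \<Longrightarrow> P (a * b)"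
  shows "P (coeff F k)"
proof -
  have sumP': "P (sum f S)" if "\<And>x. x \<in> S \<Longrightarrow> P (f x)" for f :: "nat \<Rightarrow> merofun" and S
    using that by (induction S rule: infinite_finite_induct) (auto intro: P)
  obtain n G H where 1: "F = (\<Sum>i<n. G i * H i)"
    "\<And>i. i < (n::nat) \<Longrightarrow> (\<forall>k. coeff (G i) k \<in> M k) \<and> coeff (G i) 0 = 0 \<and> (\<forall>k. coeff (H i) k \<in> M k) \<and> coeff (H i) 0 = 0"
    using F unfolding ideal_square_def by blast
  show ?thesis unfolding 1(1) coeff_sum coeff_mult
  proof (intro sumP')
    fix i j assume i: "i \<in> {..<n}" and j: "j \<in> {..k}"
    show "P (coeff (G i) j * coeff (H i) (k - j))"
    proof (cases "j = 0 \<or> j = k")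
      case True
      then show ?thesis using 1(2)[of i] i P(1) by auto
    next
      case False
      then show ?thesis using 1(2)[of i] i j by (intro P(3)[of j "k - j"]) auto
    qed
  qed
qed

section \<open>Algebras generated by homogeneous elements\<close>

lemma generated_algebra_0: "0 \<in> generated_algebra S"
  using generated_algebra.const[of 0 S] by simp

lemma generated_algebra_1: "1 \<in> generated_algebra S"
  using generated_algebra.const[of 1 S] by (simp add: one_pCons)

lemma generated_algebra_sum: "(\<And>x. x \<in> X \<Longrightarrow> f x \<in> generated_algebra S) \<Longrightarrow> sum f X \<in> generated_algebra S"
  by (induction X rule: infinite_finite_induct) (auto intro: generated_algebra.add generated_algebra_0)

lemma generated_algebra_power: "F \<in> generated_algebra S \<Longrightarrow> F ^ n \<in> generated_algebra S"
  by (induction n) (auto intro: generated_algebra.mult generated_algebra_1)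

lemma generated_algebra_smult:
  assumes "F \<in> generated_algebra S" shows "smult (mero_const c) F \<in> generated_algebra S"
  using generated_algebra.mult[OF generated_algebra.const assms, of c] by simp

lemma generated_algebra_diff:
  assumes "F \<in> generated_algebra S" "H \<in> generated_algebra S" shows "F - H \<in> generated_algebra S"
  using generated_algebra.add[OF assms(1) generated_algebra_smult[OF assms(2), of "-1"]]
  by (simp add: mero_const_uminus)

lemma generated_algebra_subset:
  assumes "F \<in> generated_algebra S" "S \<subseteq> generated_algebra T" shows "F \<in> generated_algebra T"
  using assms by (induction rule: generated_algebra.induct) (auto intro: generated_algebra.intros)

lemma generated_algebra_mono: "S \<subseteq> T \<Longrightarrow> generated_algebra S \<subseteq> generated_algebra T"
  using generated_algebra_subset[of _ S T] generated_algebra.gen by blast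

lemma generated_algebra_component:
  assumes "F \<in> generated_algebra S" "\<And>H. H \<in> S \<Longrightarrow> \<exists>g k. H = monom g k"
  shows "monom (coeff F k) k \<in> generated_algebra S"
  using assms(1)
proof (induction arbitrary: k rule: generated_algebra.induct)
  case (const c)
  then show ?case
    using generated_algebra_0 generated_algebra.const[of c S] by (cases k) (auto simp: monom_0)
next
  case (gen F)
  then obtain g l where "F = monom g l" using assms(2) by blast
  then show ?case using gen generated_algebra_0 generated_algebra.gen by (cases "k = l") auto
next
  case (add F H)
  then show ?case by (auto simp: add_monom[symmetric] intro: generated_algebra.add)
next
  case (mult F H)
  have "monom (coeff (F * H) k) k = (\<Sum>i\<le>k. monom (coeff F i) i * monom (coeff H (k - i)) (k - i))"
    by (simp add: coeff_mult mult_monom monom_sum)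
  then show ?case using mult by (auto intro!: generated_algebra_sum generated_algebra.mult)
qed

text \<open>A multiplicative family of spaces \<open>M k\<close> that contains the components of the
  generators contains those of the whole algebra. It is applied to pole bounds and to
  quasimodularity.\<close>

lemma generated_algebra_coeff:
  assumes F: "F \<in> generated_algebra S" and c: "\<And>c. mero_const c \<in> M 0" and z: "\<And>k. 0 \<in> M k"
    and S: "\<And>H k. H \<in> S \<Longrightarrow> coeff H k \<in> M k"
    and a: "\<And>k a b. a \<in> M k \<Longrightarrow> b \<in> M k \<Longrightarrow> a + b \<in> M k"
    and m: "\<And>k l a b. a \<in> M k \<Longrightarrow> b \<in> M l \<Longrightarrow> a * b \<in> M (k + l)"
  shows "coeff F k \<in> M k"
  using F
proof (induction arbitrary: k rule: generated_algebra.induct)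
  case (const x)
  then show ?case using c z by (cases k) auto
next
  case (mult F H)
  have sumM: "sum f X \<in> M k" if "\<And>x. x \<in> X \<Longrightarrow> f x \<in> M k" for f X
    using that by (induction X rule: infinite_finite_induct) (auto intro: a z)
  show ?case unfolding coeff_mult
  proof (rule sumM)
    fix i assume "i \<in> {..k}"
    then show "coeff F i * coeff H (k - i) \<in> M k" using m[OF mult.IH(1)[of i] mult.IH(2)[of "k - i"]] by simp
  qed
qed (use S a in auto)

subsection \<open>The derivations\<close>

lemma coeff_D_phi:
  "coeff (D_phi \<phi> F) k = (if k < 2 then 0 else
     mero_deriv (coeff F (k - 2)) - of_nat (k - 2) * \<phi> * coeff F (k - 2))"
proof -
  have "coeff (D_phi \<phi> F) k = (\<Sum>j\<le>degree F. if j + 2 = k then mero_deriv (coeff F j) - of_nat j * \<phi> * coeff F j else 0)"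
    by (simp add: D_phi_def coeff_sum)
  also have "\<dots> = (\<Sum>j\<le>degree F. if j = k - 2 then (if k < 2 then 0 else mero_deriv (coeff F j) - of_nat j * \<phi> * coeff F j) else 0)"
    by (intro sum.cong) auto
  also have "\<dots> = (if k < 2 then 0 else
     mero_deriv (coeff F (k - 2)) - of_nat (k - 2) * \<phi> * coeff F (k - 2))"
    by (auto simp: coeff_eq_0)
  finally show ?thesis .
qed

text \<open>Lets the rules for \<open>D_phi\<close> serve for \<open>d/dz\<close> as well.\<close>

lemma D_graded_eq: "D_graded F = D_phi 0 F"
  by (simp add: D_graded_def D_phi_def)

lemma D_phi_add: "D_phi \<phi> (F + H) = D_phi \<phi> F + D_phi \<phi> H"
  by (rule poly_eqI) (simp add: coeff_D_phi algebra_simps)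

lemma D_phi_0 [simp]: "D_phi \<phi> 0 = 0"
  by (rule poly_eqI) (simp add: coeff_D_phi)

lemma D_phi_sum: "D_phi \<phi> (sum f X) = (\<Sum>x\<in>X. D_phi \<phi> (f x))"
  by (induction X rule: infinite_finite_induct) (auto simp: D_phi_add)

lemma D_phi_monom: "D_phi \<phi> (monom g k) = monom (mero_deriv g - of_nat k * \<phi> * g) (k + 2)"
  by (rule poly_eqI) (auto simp: coeff_D_phi)

lemma D_phi_const: "D_phi \<phi> [:mero_const c:] = 0"
  using D_phi_monom[of \<phi> "mero_const c" 0] by (simp add: monom_0)

lemma D_phi_mult: "D_phi \<phi> (F * H) = F * D_phi \<phi> H + D_phi \<phi> F * H"
proof -
  have mm: "D_phi \<phi> (monom a i * monom b j) = monom a i * D_phi \<phi> (monom b j) + D_phi \<phi> (monom a i) * monom b j" for a b i j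
  proof -
    have "D_phi \<phi> (monom a i * monom b j) = monom (mero_deriv (a * b) - of_nat (i + j) * \<phi> * (a * b)) (i + j + 2)"
      by (simp add: mult_monom D_phi_monom)
    also have "mero_deriv (a * b) - of_nat (i + j) * \<phi> * (a * b) =
        a * (mero_deriv b - of_nat j * \<phi> * b) + (mero_deriv a - of_nat i * \<phi> * a) * b"
      by (simp add: mero_deriv_mult algebra_simps)
    also have "monom \<dots> (i + j + 2) = monom (a * (mero_deriv b - of_nat j * \<phi> * b)) (i + j + 2)
        + monom ((mero_deriv a - of_nat i * \<phi> * a) * b) (i + j + 2)" by (rule add_monom[symmetric])
    finally show ?thesis by (simp add: mult_monom D_phi_monom ac_simps)
  qed
  have mH: "D_phi \<phi> (monom a i * H) = monom a i * D_phi \<phi> H + D_phi \<phi> (monom a i) * H" for a i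
  proof -
    have "D_phi \<phi> (monom a i * (\<Sum>j\<le>degree H. monom (coeff H j) j)) =
      monom a i * D_phi \<phi> (\<Sum>j\<le>degree H. monom (coeff H j) j) + D_phi \<phi> (monom a i) * (\<Sum>j\<le>degree H. monom (coeff H j) j)"
      by (simp add: sum_distrib_left D_phi_sum mm sum.distrib)
    then show ?thesis by (simp add: poly_as_sum_of_monoms)
  qed
  have "D_phi \<phi> ((\<Sum>i\<le>degree F. monom (coeff F i) i) * H) =
     (\<Sum>i\<le>degree F. monom (coeff F i) i) * D_phi \<phi> H + D_phi \<phi> (\<Sum>i\<le>degree F. monom (coeff F i) i) * H"
    by (simp add: sum_distrib_right D_phi_sum mH sum.distrib)
  then show ?thesis by (simp add: poly_as_sum_of_monoms)
qed

lemma D_phi_generated_algebra: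
  assumes "F \<in> generated_algebra S" "\<And>H. H \<in> S \<Longrightarrow> D_phi \<phi> H \<in> generated_algebra S"
  shows "D_phi \<phi> F \<in> generated_algebra S"
  using assms(1)
  by (induction rule: generated_algebra.induct)
    (auto simp: D_phi_const D_phi_add D_phi_mult assms(2) generated_algebra_0 intro: generated_algebra.add generated_algebra.mult)

lemma monom_power: "monom g k ^ n = monom (g ^ n) (k * n)"
  by (induction n) (simp_all add: mult_monom monom_0 one_pCons)

section \<open>Generators of the ring of modular forms\<close>

context fuchsian
begin

lemma positive_ideal_eq: "positive_ideal \<Gamma> = {F. (\<forall>k. coeff F k \<in> MP (int k) 0) \<and> coeff F 0 = 0}"
  by (auto simp: positive_ideal_def modular_ring_def graded_sum_def modular_forms_eq)

lemma monom_positive_ideal: "monom g k \<in> positive_ideal \<Gamma> \<longleftrightarrow> g \<in> MP (int k) 0 \<and> (k = 0 \<longrightarrow> g = 0)"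
  by (auto simp: positive_ideal_eq)

lemma positive_ideal_smult: "F \<in> positive_ideal \<Gamma> \<Longrightarrow> smult (mero_const c) F \<in> positive_ideal \<Gamma>"
  by (auto simp: positive_ideal_eq intro: MP_const_mult)

text \<open>The graded form of Nakayama's lemma: modulo products of forms of smaller positive
  weight, a form of weight \<open>k > 0\<close> is a combination of the \<open>f m\<close>.\<close>

lemma modular_generated:
  assumes b: "homogeneous_basis_mod_square \<Gamma> d f"
  shows "g \<in> MP (int k) 0 \<Longrightarrow> monom g k \<in> generated_algebra (f ` {1..d})"
proof (induction k arbitrary: g rule: less_induct)
  case (less k)
  let ?A = "generated_algebra (f ` {1..d})"
  show ?case
  proof (cases "k = 0")
    case True
    then obtain c where "g = mero_const c" using MP_0_const less.prems by auto
    then show ?thesis using True generated_algebra.const[of c] by (simp add: monom_0)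
  next
    case False
    then have "monom g k \<in> positive_ideal \<Gamma>" using less.prems by (simp add: monom_positive_ideal)
    then obtain c :: "nat \<Rightarrow> complex" where
      c: "monom g k - (\<Sum>m=1..d. smult (mero_const (c m)) (f m)) \<in> ideal_square (positive_ideal \<Gamma>)"
      using b unfolding homogeneous_basis_mod_square_def by blast
    define s where "s = coeff (monom g k - (\<Sum>m=1..d. smult (mero_const (c m)) (f m))) k"
    have "monom s k \<in> ?A" unfolding s_def
    proof (rule coeff_ideal_square[OF c[unfolded positive_ideal_eq], of "\<lambda>x. monom x k \<in> ?A"])
      show "monom 0 k \<in> ?A" by (simp add: generated_algebra_0)
      show "monom (a + b) k \<in> ?A" if "monom a k \<in> ?A" "monom b k \<in> ?A" for a b
        using generated_algebra.add[OF that] by (simp add: add_monom)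
      show "monom (a * b) k \<in> ?A" if "p > 0" "q > 0" "p + q = k" "a \<in> MP (int p) 0" "b \<in> MP (int q) 0" for a b p q
      proof -
        have "monom a p \<in> ?A" "monom b q \<in> ?A" using less.IH[of p a] less.IH[of q b] that by auto
        then have "monom a p * monom b q \<in> ?A" by (rule generated_algebra.mult)
        then show ?thesis using that(3) by (simp add: mult_monom)
      qed
    qed
    moreover have "monom (coeff (f m) k) k \<in> ?A" if m: "m \<in> {1..d}" for m
    proof -
      have "\<exists>h l. f m = monom h l" using b m unfolding homogeneous_basis_mod_square_def by blast
      then obtain h l where h: "f m = monom h l" by blast
      then show ?thesis
        using generated_algebra.gen[of "f m" "f ` {1..d}", OF imageI[OF m]] generated_algebra_0 by (cases "l = k") auto
    qed
    then have "(\<Sum>m=1..d. smult (mero_const (c m)) (monom (coeff (f m) k) k)) \<in> ?A"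
      by (intro generated_algebra_sum generated_algebra_smult)
    ultimately have "monom s k + (\<Sum>m=1..d. smult (mero_const (c m)) (monom (coeff (f m) k) k)) \<in> ?A"
      by (rule generated_algebra.add)
    moreover have "monom g k = monom s k + (\<Sum>m=1..d. smult (mero_const (c m)) (monom (coeff (f m) k) k))"
      by (rule poly_eqI) (auto simp: s_def coeff_sum)
    ultimately show ?thesis by simp
  qed
qed

text \<open>\<open>I/I^2\<close> vanishes in weights at least \<open>W\<close> by
  \<open>modular_form_split\<close>, and each smaller weight has finite dimension. So homogeneous
  independent families have bounded size, and one of maximal size is a basis.\<close>

lemma basis_exists: "\<exists>d f. homogeneous_basis_mod_square \<Gamma> d f"
proof -
  let ?I = "positive_ideal \<Gamma>" and ?I2 = "ideal_square (positive_ideal \<Gamma>)"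
  define ind where "ind n f \<longleftrightarrow> (\<forall>m\<in>{1..n}. f m \<in> ?I \<and> (\<exists>g k. f m = monom g k)) \<and>
     (\<forall>c :: nat \<Rightarrow> complex. (\<Sum>m=1..n. smult (mero_const (c m)) (f m)) \<in> ?I2 \<longrightarrow> (\<forall>m\<in>{1..n}. c m = 0))" for n f
  obtain W K F H where W: "K > 0" "F \<in> MP (int K) 0" "H \<in> MP (int K) 0" "W > K"
    "\<And>k f. k \<ge> W \<Longrightarrow> f \<in> MP (int k) 0 \<Longrightarrow> \<exists>a\<in>MP (int (k - K)) 0. \<exists>b\<in>MP (int (k - K)) 0. f = F * a + H * b"
    using modular_form_split by metis
  have large: "monom g k \<in> ?I2" if k: "k \<ge> W" and g: "g \<in> MP (int k) 0" for g k
  proof -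
    obtain a b where ab: "a \<in> MP (int (k - K)) 0" "b \<in> MP (int (k - K)) 0" "g = F * a + H * b"
      using W(5)[OF k g] by blast
    have "monom g k = monom F K * monom a (k - K) + monom H K * monom b (k - K)"
      using k W(4) by (simp add: ab(3) mult_monom add_monom)
    moreover have "monom F K \<in> ?I" "monom H K \<in> ?I" "monom a (k - K) \<in> ?I" "monom b (k - K) \<in> ?I"
      using W k ab by (auto simp: monom_positive_ideal)
    ultimately show ?thesis by (auto intro: ideal_square_add ideal_square_mult)
  qed
  have "\<forall>k. \<exists>N. \<forall>m b. m > N \<and> (\<forall>i<m. b i \<in> MP (int k) 0) \<longrightarrow> (\<exists>c. (\<exists>i<m. c i \<noteq> 0) \<and> lincomb m c b = 0)"
  proof
    fix k
    show "\<exists>N. \<forall>m b. m > N \<and> (\<forall>i<m. b i \<in> MP (int k) 0) \<longrightarrow> (\<exists>c. (\<exists>i<m. c i \<noteq> 0) \<and> lincomb m c b = 0)"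
      by (rule modular_forms_finite_dim[of k]) blast
  qed
  from choice[OF this] obtain N where
    N: "\<forall>k. \<forall>m b. m > N k \<and> (\<forall>i<m. b i \<in> MP (int k) 0) \<longrightarrow> (\<exists>c. (\<exists>i<m. c i \<noteq> 0) \<and> lincomb m c b = 0)" ..
  have bound: "n \<le> (\<Sum>k<W. N k)" if i: "ind n f" for n f
  proof -
    have "\<forall>m\<in>{1..n}. \<exists>gk. f m = monom (fst gk) (snd gk)" using i unfolding ind_def by force
    from bchoice[OF this] obtain gk where gk: "\<forall>m\<in>{1..n}. f m = monom (fst (gk m)) (snd (gk m))" ..
    define g where "g m = fst (gk m)" for m
    define \<kappa> where "\<kappa> m = snd (gk m)" for m
    have f: "f m = monom (g m) (\<kappa> m)" "g m \<in> MP (int (\<kappa> m)) 0" if "m \<in> {1..n}" for m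
      using gk i that unfolding ind_def g_def \<kappa>_def by (auto simp: monom_positive_ideal)
    have imp: "\<forall>c :: nat \<Rightarrow> complex. (\<Sum>m=1..n. smult (mero_const (c m)) (f m)) \<in> ?I2 \<longrightarrow> (\<forall>m\<in>{1..n}. c m = 0)"
      using i unfolding ind_def by (rule conjunct2)
    have notI2: "f m \<notin> ?I2" if m: "m \<in> {1..n}" for m
    proof
      assume fm: "f m \<in> ?I2"
      have "(\<Sum>j=1..n. smult (mero_const (if j = m then 1 else 0)) (f j)) = f m"
      proof -
        have "(\<Sum>j=1..n. smult (mero_const (if j = m then 1 else 0)) (f j)) = (\<Sum>j=1..n. if j = m then f j else 0)"
          by (intro sum.cong) auto
        then show ?thesis using m by simp
      qed
      then have mem: "(\<Sum>j=1..n. smult (mero_const (if j = m then 1 else 0)) (f j)) \<in> ?I2"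
        using fm by (simp only:)
      from mp[OF spec[OF imp, of "\<lambda>j. if j = m then 1 else 0"] mem]
      have "\<forall>j\<in>{1..n}. (if j = m then 1 else 0) = (0::complex)" .
      from bspec[OF this m] show False by simp
    qed
    have \<kappa>W: "\<kappa> m < W" if "m \<in> {1..n}" for m
      using notI2[OF that] large[of "\<kappa> m" "g m"] f[OF that] by (metis not_less)
    have cardN: "card {m \<in> {1..n}. \<kappa> m = k} \<le> N k" for k
    proof (rule ccontr)
      assume big: "\<not> card {m \<in> {1..n}. \<kappa> m = k} \<le> N k"
      let ?X = "{m \<in> {1..n}. \<kappa> m = k}"
      obtain h where h: "bij_betw h {..<card ?X} ?X"
        using ex_bij_betw_nat_finite[of ?X] by (auto simp: lessThan_atLeast0)
      have hX: "h i \<in> ?X" if "i < card ?X" for i using h that by (auto simp: bij_betw_def)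
      have "\<forall>i<card ?X. g (h i) \<in> MP (int k) 0" using hX f(2) by fastforce
      moreover have "card ?X > N k" using big by simp
      ultimately have "\<exists>c. (\<exists>i<card ?X. c i \<noteq> 0) \<and> lincomb (card ?X) c (\<lambda>i. g (h i)) = 0"
        by (intro mp[OF spec[OF spec[OF spec[OF N, of k], of "card ?X"], of "\<lambda>i. g (h i)"]] conjI)
      then obtain c where c: "\<exists>i<card ?X. c i \<noteq> 0" "lincomb (card ?X) c (\<lambda>i. g (h i)) = 0" by blast
      define c' where "c' m = (if m \<in> ?X then c (inv_into {..<card ?X} h m) else 0)" for m
      have c'h: "c' (h i) = c i" if "i < card ?X" for i
        using hX[OF that] that h by (auto simp: c'_def bij_betw_def inv_into_f_f)
      have "(\<Sum>m=1..n. smult (mero_const (c' m)) (f m)) = (\<Sum>m\<in>?X. smult (mero_const (c' m)) (f m))"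
        by (rule sum.mono_neutral_right) (auto simp: c'_def)
      also have "\<dots> = (\<Sum>m\<in>?X. monom (mero_const (c' m) * g m) k)"
        using f(1) by (intro sum.cong) (auto simp: smult_monom)
      also have "\<dots> = (\<Sum>i<card ?X. monom (mero_const (c' (h i)) * g (h i)) k)"
        by (rule sum.reindex_bij_betw[OF h, symmetric])
      also have "\<dots> = monom (lincomb (card ?X) c (\<lambda>i. g (h i))) k"
        using c'h by (simp add: monom_sum)
      finally have mem: "(\<Sum>m=1..n. smult (mero_const (c' m)) (f m)) \<in> ?I2" using c(2) ideal_square_0 by simp
      from mp[OF spec[OF imp, of c'] mem] have z: "\<forall>m\<in>{1..n}. c' m = 0" .
      obtain i where i: "i < card ?X" "c i \<noteq> 0" using c(1) by blast
      then show False using bspec[OF z, of "h i"] c'h[OF i(1)] hX[OF i(1)] by simp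
    qed
    have "{1..n} = (\<Union>k<W. {m \<in> {1..n}. \<kappa> m = k})" using \<kappa>W by auto
    then have "n = card (\<Union>k<W. {m \<in> {1..n}. \<kappa> m = k})" by (metis card_atLeastAtMost diff_Suc_1)
    also have "\<dots> \<le> (\<Sum>k<W. card {m \<in> {1..n}. \<kappa> m = k})" by (rule card_UN_le) simp
    also have "\<dots> \<le> (\<Sum>k<W. N k)" using cardN by (intro sum_mono)
    finally show ?thesis .
  qed
  define S where "S = {n. \<exists>f. ind n f}"
  have "finite S" using bound by (intro finite_subset[of S "{..(\<Sum>k<W. N k)}"]) (auto simp: S_def)
  have "ind 0 (\<lambda>_. 0)" by (simp add: ind_def)
  then have "S \<noteq> {}" by (auto simp: S_def)
  define d where "d = Max S"
  have "d \<in> S" unfolding d_def using \<open>finite S\<close> \<open>S \<noteq> {}\<close> by (rule Max_in)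
  then obtain f where f: "ind d f" by (auto simp: S_def)
  have max: "\<not> ind (Suc d) f'" for f'
  proof
    assume "ind (Suc d) f'"
    then have "Suc d \<le> d" unfolding d_def using \<open>finite S\<close> by (intro Max_ge) (auto simp: S_def)
    then show False by simp
  qed
  define P where "P F \<longleftrightarrow> (\<exists>c :: nat \<Rightarrow> complex. F - (\<Sum>m=1..d. smult (mero_const (c m)) (f m)) \<in> ?I2)" for F
  have P0: "P 0" unfolding P_def using ideal_square_0 by (intro exI[of _ "\<lambda>_. 0"]) simp
  have Padd: "P (A + B)" if PA: "P A" and PB: "P B" for A B
  proof -
    obtain a b :: "nat \<Rightarrow> complex" where ab: "A - (\<Sum>m=1..d. smult (mero_const (a m)) (f m)) \<in> ?I2"
      "B - (\<Sum>m=1..d. smult (mero_const (b m)) (f m)) \<in> ?I2" using PA PB unfolding P_def by blast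
    have "(A + B) - (\<Sum>m=1..d. smult (mero_const (a m + b m)) (f m)) =
      (A - (\<Sum>m=1..d. smult (mero_const (a m)) (f m))) + (B - (\<Sum>m=1..d. smult (mero_const (b m)) (f m)))"
      by (simp add: mero_const_add smult_add_left sum.distrib)
    then show ?thesis unfolding P_def using ideal_square_add[OF ab]
      by (intro exI[of _ "\<lambda>m. a m + b m"]) (simp only:)
  qed
  have Psum: "P (sum A X)" if "\<And>x. x \<in> X \<Longrightarrow> P (A x)" for A :: "nat \<Rightarrow> merofun poly" and X
    using that by (induction X rule: infinite_finite_induct) (auto intro: P0 Padd)
  \<comment> \<open>By maximality the family enlarged by \<open>monom g k\<close> is dependent, and
    the coefficient of the new member cannot vanish.\<close>
  have Phom: "P (monom g k)" if h: "monom g k \<in> ?I" for g k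
  proof -
    let ?f = "f(Suc d := monom g k)"
    have hom: "\<forall>m\<in>{1..Suc d}. ?f m \<in> ?I \<and> (\<exists>g k. ?f m = monom g k)"
      using f h unfolding ind_def by (auto simp: le_Suc_eq)
    have "\<not> (\<forall>c :: nat \<Rightarrow> complex. (\<Sum>m=1..Suc d. smult (mero_const (c m)) (?f m)) \<in> ?I2 \<longrightarrow> (\<forall>m\<in>{1..Suc d}. c m = 0))"
    proof
      assume "\<forall>c :: nat \<Rightarrow> complex. (\<Sum>m=1..Suc d. smult (mero_const (c m)) (?f m)) \<in> ?I2 \<longrightarrow> (\<forall>m\<in>{1..Suc d}. c m = 0)"
      from conjI[OF hom this] have "ind (Suc d) ?f" unfolding ind_def .
      with max show False by blast
    qed
    then obtain c :: "nat \<Rightarrow> complex" and m where c: "(\<Sum>m=1..Suc d. smult (mero_const (c m)) (?f m)) \<in> ?I2"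
      "m \<in> {1..Suc d}" "c m \<noteq> 0" by blast
    have "(\<Sum>m=1..d. smult (mero_const (c m)) (?f m)) = (\<Sum>m=1..d. smult (mero_const (c m)) (f m))"
      by (intro sum.cong) auto
    then have eq: "(\<Sum>m=1..d. smult (mero_const (c m)) (f m)) + smult (mero_const (c (Suc d))) (monom g k) \<in> ?I2"
      using c(1) by simp
    have cs: "c (Suc d) \<noteq> 0"
    proof
      assume "c (Suc d) = 0"
      then have "(\<Sum>m=1..d. smult (mero_const (c m)) (f m)) \<in> ?I2" using eq by simp
      from mp[OF spec[OF conjunct2[OF f[unfolded ind_def]], of c] this] have "\<forall>m\<in>{1..d}. c m = 0" .
      then show False using c(2,3) \<open>c (Suc d) = 0\<close> by (cases "m = Suc d") auto
    qed
    let ?k = "inverse (c (Suc d))"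
    have "smult (mero_const ?k) ((\<Sum>m=1..d. smult (mero_const (c m)) (f m)) + smult (mero_const (c (Suc d))) (monom g k)) \<in> ?I2"
      using eq by (intro ideal_square_smult positive_ideal_smult)
    also have "smult (mero_const ?k) ((\<Sum>m=1..d. smult (mero_const (c m)) (f m)) + smult (mero_const (c (Suc d))) (monom g k)) =
      monom g k - (\<Sum>m=1..d. smult (mero_const (- (?k * c m))) (f m))"
    proof -
      have "mero_const ?k * mero_const (c (Suc d)) = 1" using cs by (simp flip: mero_const_mult)
      then show ?thesis
        by (simp add: smult_add_right smult_sum_right mero_const_mult mero_const_uminus sum_negf smult_monom flip: mult.assoc)
    qed
    finally show ?thesis unfolding P_def by (intro exI[of _ "\<lambda>m. - (?k * c m)"])
  qed
  have "P F" if F: "F \<in> ?I" for F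
  proof -
    have "P (\<Sum>k\<le>degree F. monom (coeff F k) k)"
      using F by (intro Psum Phom) (auto simp: positive_ideal_eq monom_positive_ideal)
    then show ?thesis by (simp add: poly_as_sum_of_monoms)
  qed
  then have "\<forall>F\<in>?I. P F" by blast
  from conjI[OF conjunct1[OF f[unfolded ind_def]] conjI[OF conjunct2[OF f[unfolded ind_def]] this[unfolded P_def]]]
  have "homogeneous_basis_mod_square \<Gamma> d f" unfolding homogeneous_basis_mod_square_def .
  then show ?thesis by blast
qed

end

subsection \<open>Finite generation\<close>

text \<open>A point of \<open>W\<close> that is not above \<open>(a0, b0)\<close> lies in a column
  \<open>a < a0\<close> or in a row \<open>b < b0\<close>; the lowest point of each such column and
  the leftmost point of each such row are added.\<close>

lemma dickson2:
  fixes W :: "(nat \<times> nat) set"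
  shows "\<exists>E. finite E \<and> E \<subseteq> W \<and> (\<forall>(a, b)\<in>W. \<exists>(a', b')\<in>E. a' \<le> a \<and> b' \<le> b)"
proof (cases "W = {}")
  case False
  then obtain a0 b0 where 0: "(a0, b0) \<in> W" by auto
  define p where "p a = (a, LEAST b. (a, b) \<in> W)" for a
  define q where "q b = (LEAST a. (a, b) \<in> W, b)" for b
  define E where "E = {(a0, b0)} \<union> ((p ` {..<a0}) \<inter> W) \<union> ((q ` {..<b0}) \<inter> W)"
  have p: "p a \<in> W \<and> snd (p a) \<le> b" if "(a, b) \<in> W" for a b
    using that unfolding p_def by (auto intro: LeastI Least_le)
  have q: "q b \<in> W \<and> fst (q b) \<le> a" if "(a, b) \<in> W" for a b
    using that unfolding q_def by (auto intro: LeastI[of "\<lambda>a. (a, b) \<in> W"] Least_le)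
  have "\<exists>(a', b')\<in>E. a' \<le> a \<and> b' \<le> b" if ab: "(a, b) \<in> W" for a b
  proof -
    consider "a0 \<le> a" "b0 \<le> b" | "a < a0" | "b < b0" by linarith
    then show ?thesis
    proof cases
      case 1 then show ?thesis by (auto simp: E_def)
    next
      case 2
      then have "p a \<in> E" using p[OF ab] by (auto simp: E_def)
      moreover have "fst (p a) \<le> a" by (simp add: p_def)
      ultimately show ?thesis using p[OF ab] by (intro bexI[of _ "p a"]) (auto simp: case_prod_unfold)
    next
      case 3
      then have "q b \<in> E" using q[OF ab] by (auto simp: E_def)
      moreover have "snd (q b) \<le> b" by (simp add: q_def)
      ultimately show ?thesis using q[OF ab] by (intro bexI[of _ "q b"]) (auto simp: case_prod_unfold)
    qed
  qed
  then show ?thesis using 0 by (intro exI[of _ E]) (auto simp: E_def)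
qed auto

text \<open>The translations are by \<open>(k0, 0)\<close> and by \<open>(4, 2 m)\<close>, the
  latter along the edge \<open>2 n = m k\<close> of the cone. Modulo them there are finitely many
  classes \<open>(r, s)\<close>. The cone condition makes the multiplicities \<open>(a, b)\<close>
  natural numbers, and Dickson's lemma is applied to these within each class.\<close>

lemma cone_cover:
  fixes T :: "(nat \<times> nat) set"
  assumes T: "\<And>k n. (k, n) \<in> T \<Longrightarrow> 2 * n \<le> m * k" and k0: "k0 > 0" and m: "m > 0"
  shows "\<exists>E. finite E \<and> E \<subseteq> T \<and> (\<forall>(k, n)\<in>T. \<exists>(k', n')\<in>E. \<exists>a b. k = k' + a * k0 + 4 * b \<and> n = n' + 2 * m * b)"
proof -
  define pt where "pt rs ab = (fst rs + fst ab * k0 + 4 * snd ab, snd rs + 2 * m * snd ab)" for rs ab :: "nat \<times> nat"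
  define B where "B = {..<k0} \<times> {..<2 * m}"
  have "\<forall>rs. \<exists>E. finite E \<and> E \<subseteq> {ab. pt rs ab \<in> T} \<and> (\<forall>(a, b)\<in>{ab. pt rs ab \<in> T}. \<exists>(a', b')\<in>E. a' \<le> a \<and> b' \<le> b)"
    using dickson2 by blast
  from choice[OF this] obtain D where D: "\<forall>rs. finite (D rs) \<and> D rs \<subseteq> {ab. pt rs ab \<in> T} \<and>
    (\<forall>(a, b)\<in>{ab. pt rs ab \<in> T}. \<exists>(a', b')\<in>D rs. a' \<le> a \<and> b' \<le> b)" ..
  define E where "E = (\<Union>rs\<in>B. pt rs ` D rs)"
  have "finite E" unfolding E_def B_def using D by auto
  moreover have "E \<subseteq> T"
  proof -
    have "D rs \<subseteq> {ab. pt rs ab \<in> T}" for rs using D by blast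
    then show ?thesis unfolding E_def by blast
  qed
  moreover have cover: "\<exists>(k', n')\<in>E. \<exists>a b. k = k' + a * k0 + 4 * b \<and> n = n' + 2 * m * b" if kn: "(k, n) \<in> T" for k n
  proof -
    define b where "b = n div (2 * m)"
    define s where "s = n mod (2 * m)"
    have n: "n = s + 2 * m * b" by (simp add: b_def s_def)
    have "m * (4 * b) \<le> 2 * n" using n by simp
    also have "\<dots> \<le> m * k" by (rule T[OF kn])
    finally have kb: "4 * b \<le> k" using m by simp
    define a where "a = (k - 4 * b) div k0"
    define r where "r = (k - 4 * b) mod k0"
    have "k - 4 * b = r + a * k0" by (simp add: a_def r_def)
    then have k: "k = r + a * k0 + 4 * b" using kb by simp
    have rs: "(r, s) \<in> B" using k0 m by (simp add: B_def r_def s_def)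
    have "pt (r, s) (a, b) = (k, n)" using k n by (simp add: pt_def)
    then have "(a, b) \<in> {ab. pt (r, s) ab \<in> T}" using kn by simp
    then obtain a' b' where ab: "(a', b') \<in> D (r, s)" "a' \<le> a" "b' \<le> b" using D by blast
    have "pt (r, s) (a', b') \<in> E" using ab rs by (auto simp: E_def)
    moreover have "k = fst (pt (r, s) (a', b')) + (a - a') * k0 + 4 * (b - b')"
      "n = snd (pt (r, s) (a', b')) + 2 * m * (b - b')"
    proof -
      obtain x y where "a = a' + x" "b = b' + y" using ab(2,3) le_Suc_ex by metis
      then show "k = fst (pt (r, s) (a', b')) + (a - a') * k0 + 4 * (b - b')"
        "n = snd (pt (r, s) (a', b')) + 2 * m * (b - b')" using k n by (auto simp: pt_def algebra_simps)
    qed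
    ultimately show ?thesis by (intro bexI[of _ "pt (r, s) (a', b')"]) (auto simp: case_prod_unfold)
  qed
  have "\<forall>x\<in>T. case x of (k, n) \<Rightarrow> \<exists>(k', n')\<in>E. \<exists>a b. k = k' + a * k0 + 4 * b \<and> n = n' + 2 * m * b"
  proof
    fix x assume "x \<in> T"
    then show "case x of (k, n) \<Rightarrow> \<exists>(k', n')\<in>E. \<exists>a b. k = k' + a * k0 + 4 * b \<and> n = n' + 2 * m * b"
      using cover[of "fst x" "snd x"] by (cases x) (simp only: fst_conv snd_conv prod.case)
  qed
  ultimately show ?thesis by (intro exI[of _ E] conjI)
qed

section \<open>Pole orders at \<open>\<i>\<close> of iterated derivatives\<close>

context fuchsian
begin

text \<open>The deviations from the law of weight 4, \<open>2 c (c z + d)^3 \<phi>\<close> and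
  \<open>c^2 (c z + d)^2\<close>, are the same for the derivative and for the square of
  \<phi>.\<close>

lemma wt_omega:
  assumes "quasi2 \<phi>" shows "mero_deriv \<phi> - \<phi>\<^sup>2 \<in> wt 4"
  unfolding wt_def
proof (intro CollectI ballI)
  fix A assume A: "A \<in> G"
  then have d: "det A = 1" by (rule G_det)
  let ?J = "autofun A" and ?c = "mero_const (of_real (A$2$1))"
  have J: "?J \<noteq> 0" using d by simp
  have \<phi>: "mcomp A \<phi> = ?J\<^sup>2 * \<phi> + ?c * ?J" using assms A by (simp add: quasi2_def)
  have "mcomp A (mero_deriv \<phi>) = mero_deriv (mcomp A \<phi>) * ?J\<^sup>2" using J by (simp add: mero_deriv_mcomp[OF d])
  also have "mero_deriv (mcomp A \<phi>) = ?J\<^sup>2 * mero_deriv \<phi> + 2 * ?J * ?c * \<phi> + ?c * ?c"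
    unfolding \<phi> by (simp add: mero_deriv_mult mero_deriv_autofun[OF d] power2_eq_square algebra_simps)
  finally have 1: "mcomp A (mero_deriv \<phi>) = (?J\<^sup>2 * mero_deriv \<phi> + 2 * ?J * ?c * \<phi> + ?c * ?c) * ?J\<^sup>2" .
  have "mcomp A (mero_deriv \<phi> - \<phi>\<^sup>2) = (?J\<^sup>2 * mero_deriv \<phi> + 2 * ?J * ?c * \<phi> + ?c * ?c) * ?J\<^sup>2 - (?J\<^sup>2 * \<phi> + ?c * ?J)\<^sup>2"
    using d by (simp add: 1 \<phi>)
  also have "\<dots> = ?J ^ 4 * (mero_deriv \<phi> - \<phi>\<^sup>2)"
    by (simp add: power2_eq_square power4_eq_xxxx algebra_simps)
  finally show "mcomp A (mero_deriv \<phi> - \<phi>\<^sup>2) = ?J powi 4 * (mero_deriv \<phi> - \<phi>\<^sup>2)" by simp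
qed

text \<open>The expression is \<open>g\<close> times the form \<open>g' / g - k \<phi>\<close> of
  weight 2.\<close>

lemma wt_D_phi:
  assumes \<phi>: "quasi2 \<phi>" and g: "g \<in> wt k"
  shows "mero_deriv g - of_int k * \<phi> * g \<in> wt (k + 2)"
proof (cases "g = 0")
  case False
  have "(mero_deriv g / g - of_int k * \<phi>) * g \<in> wt (2 + k)"
    by (intro wt_mult wt_log_deriv_diff \<phi> g False)
  then show ?thesis using False by (simp add: algebra_simps)
qed simp

text \<open>For a simple pole the leading coefficient of \<open>\<omega>\<close> is \<open>- r (r + 1)\<close>, with \<open>r\<close> the residue of \<open>\<phi>\<close>, which is positive.\<close>

lemma mord_omega:
  assumes \<phi>: "\<phi> \<in> delta_one_forms \<Gamma>"
  shows "mord \<i> (mero_deriv \<phi> - \<phi>\<^sup>2) = 2 * mord \<i> \<phi>" "mero_deriv \<phi> - \<phi>\<^sup>2 \<noteq> 0"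
proof -
  have neg: "mord \<i> \<phi> < 0" by (rule delta_one_pole[OF \<phi>])
  have \<phi>0: "\<phi> \<noteq> 0" using neg by auto
  have coeff: "fls_nth (germ \<i> (mero_deriv \<phi> - \<phi>\<^sup>2)) (2 * mord \<i> \<phi>) \<noteq> 0"
  proof (cases "mord \<i> \<phi> = -1")
    case True
    obtain r where r: "r > 0" "res \<i> \<phi> = of_real r" using quasi2_residue_positive[OF \<phi>] by blast
    have r1: "fls_nth (germ \<i> \<phi>) (-1) = of_real r" using r(2) by (simp add: res_def)
    have "fls_nth (germ \<i> \<phi> ^ 2) (int 2 * fls_subdegree (germ \<i> \<phi>)) = fls_nth (germ \<i> \<phi>) (fls_subdegree (germ \<i> \<phi>)) ^ 2"
      by (rule fls_pow_base)
    then have sq: "fls_nth (germ \<i> \<phi> ^ 2) (-2) = of_real r ^ 2" using True r1 by (simp add: mord_def)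
    have "fls_nth (germ \<i> (mero_deriv \<phi> - \<phi>\<^sup>2)) (-2) = - of_real r - of_real r ^ 2"
      using r1 sq by simp
    also have "\<dots> = - of_real (r * (1 + r))" by (simp add: power2_eq_square algebra_simps)
    also have "\<dots> \<noteq> 0" using r(1) by (auto simp: mult_eq_0_iff simp del: of_real_mult of_real_add)
    finally show ?thesis using True by simp
  next
    case False
    have "mord_ge \<i> (mero_deriv \<phi>) (mord \<i> \<phi> - 1)" by (intro mord_ge_deriv) (auto simp: mord_ge_iff)
    moreover have "2 * mord \<i> \<phi> < mord \<i> \<phi> - 1" using neg False by simp
    ultimately have "fls_nth (germ \<i> (mero_deriv \<phi>)) (2 * mord \<i> \<phi>) = 0" unfolding mord_ge_def by blast
    moreover have "mord \<i> (\<phi>\<^sup>2) = 2 * mord \<i> \<phi>" by simp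
    then have "fls_nth (germ \<i> (\<phi>\<^sup>2)) (2 * mord \<i> \<phi>) \<noteq> 0"
      using \<phi>0 germ_eq_0_iff[OF ii_uhp, of "\<phi>\<^sup>2"] nth_fls_subdegree_nonzero[of "germ \<i> (\<phi>\<^sup>2)"]
      unfolding mord_def by (metis power_eq_0_iff)
    ultimately show ?thesis
      using ii_uhp by (simp only: germ_diff fls_minus_nth) simp
  qed
  then show nz: "mero_deriv \<phi> - \<phi>\<^sup>2 \<noteq> 0" by (metis fls_zero_nth germ_0)
  have "mord_ge \<i> (mero_deriv \<phi> - \<phi>\<^sup>2) (2 * mord \<i> \<phi>)"
  proof (intro mord_ge_diff ii_uhp)
    have "mord_ge \<i> (mero_deriv \<phi>) (mord \<i> \<phi> - 1)" by (intro mord_ge_deriv) (auto simp: mord_ge_iff)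
    then show "mord_ge \<i> (mero_deriv \<phi>) (2 * mord \<i> \<phi>)" by (rule mord_ge_mono) (use neg in simp)
    show "mord_ge \<i> (\<phi>\<^sup>2) (2 * mord \<i> \<phi>)" by (simp add: mord_ge_iff)
  qed
  moreover have "mord \<i> (mero_deriv \<phi> - \<phi>\<^sup>2) \<le> 2 * mord \<i> \<phi>"
    unfolding mord_def using coeff[unfolded mord_def] by (rule fls_subdegree_leI)
  ultimately show "mord \<i> (mero_deriv \<phi> - \<phi>\<^sup>2) = 2 * mord \<i> \<phi>" using nz by (simp add: mord_ge_iff)
qed

lemma cancel_leading:
  assumes "mord \<i> g = mord \<i> p" "g \<noteq> 0" "p \<noteq> 0"
  obtains c where "mord_ge \<i> (g - mero_const c * p) (mord \<i> g + 1)"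
proof -
  define c where "c = fls_nth (germ \<i> g) (mord \<i> g) / fls_nth (germ \<i> p) (mord \<i> g)"
  have p: "fls_nth (germ \<i> p) (mord \<i> g) \<noteq> 0"
    using assms nth_fls_subdegree_nonzero[of "germ \<i> p"] by (simp add: mord_def)
  have "fls_nth (germ \<i> (g - mero_const c * p)) k = 0" if k: "k < mord \<i> g + 1" for k
  proof (cases "k = mord \<i> g")
    case True
    then show ?thesis using p by (simp add: c_def)
  next
    case False
    then have "k < mord \<i> g" using k by simp
    then have "fls_nth (germ \<i> g) k = 0" "fls_nth (germ \<i> p) k = 0" using assms(1) by (auto simp: mord_def)
    then show ?thesis by simp
  qed
  then show ?thesis using that unfolding mord_ge_def by blast
qed

text \<open>Generators of the union of the increasing family \<open>R_ring \<phi> d f N\<close>.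
  That union is closed under \<open>D_phi \<phi>\<close> by construction, so it remains to see that
  the family becomes stationary.\<close>

definition Rgens :: "merofun \<Rightarrow> nat \<Rightarrow> (nat \<Rightarrow> merofun poly) \<Rightarrow> merofun poly set" where
  "Rgens \<phi> d f = {(D_phi \<phi> ^^ j) (f m) | j m. m \<in> {1..d}} \<union> {(D_phi \<phi> ^^ l) (omega \<phi>) | l. True}"

lemma R_ring_mono: "N \<le> M \<Longrightarrow> R_ring \<phi> d f N \<subseteq> R_ring \<phi> d f M"
  unfolding R_ring_def by (intro generated_algebra_mono) (auto intro: order_trans)

lemma R_ring_subset: "R_ring \<phi> d f N \<subseteq> generated_algebra (Rgens \<phi> d f)"
  unfolding R_ring_def Rgens_def by (intro generated_algebra_mono) auto

lemma in_R_ring: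
  assumes "F \<in> generated_algebra (Rgens \<phi> d f)" shows "\<exists>N. F \<in> R_ring \<phi> d f N"
  using assms
proof (induction rule: generated_algebra.induct)
  case (const c) then show ?case unfolding R_ring_def by (auto intro: generated_algebra.const)
next
  case (gen F)
  then show ?case unfolding R_ring_def Rgens_def by (auto intro!: generated_algebra.gen)
next
  case (add F H)
  then obtain N M where "F \<in> R_ring \<phi> d f N" "H \<in> R_ring \<phi> d f M" by blast
  then have "F \<in> R_ring \<phi> d f (max N M)" "H \<in> R_ring \<phi> d f (max N M)"
    using subsetD[OF R_ring_mono[of N "max N M"]] subsetD[OF R_ring_mono[of M "max N M"]] by (meson max.cobounded1 max.cobounded2)+
  then show ?case unfolding R_ring_def by (auto intro: generated_algebra.add)
next
  case (mult F H)
  then obtain N M where "F \<in> R_ring \<phi> d f N" "H \<in> R_ring \<phi> d f M" by blast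
  then have "F \<in> R_ring \<phi> d f (max N M)" "H \<in> R_ring \<phi> d f (max N M)"
    using subsetD[OF R_ring_mono[of N "max N M"]] subsetD[OF R_ring_mono[of M "max N M"]] by (meson max.cobounded1 max.cobounded2)+
  then show ?case unfolding R_ring_def by (auto intro: generated_algebra.mult)
qed

lemma D_phi_pow_monom: "\<exists>g' k'. (D_phi \<phi> ^^ j) (monom g k) = monom g' k'"
proof (induction j)
  case (Suc j)
  then obtain g' k' where "(D_phi \<phi> ^^ j) (monom g k) = monom g' k'" by blast
  then have "(D_phi \<phi> ^^ Suc j) (monom g k) = monom (mero_deriv g' - of_nat k' * \<phi> * g') (k' + 2)"
    by (simp only: funpow.simps o_apply D_phi_monom)
  then show ?case by blast
qed auto

lemma Rgens_homogeneous:
  assumes "homogeneous_basis_mod_square \<Gamma> d f" "H \<in> Rgens \<phi> d f" shows "\<exists>g k. H = monom g k"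
proof -
  have "\<exists>g k. f m = monom g k" if "m \<in> {1..d}" for m
    using assms(1) that unfolding homogeneous_basis_mod_square_def by blast
  note fmon = this
  consider j m where "H = (D_phi \<phi> ^^ j) (f m)" "m \<in> {1..d}" | l where "H = (D_phi \<phi> ^^ l) (omega \<phi>)"
    using assms(2) unfolding Rgens_def by blast
  then show ?thesis
  proof cases
    case 1
    then obtain g k where "f m = monom g k" using fmon by blast
    then show ?thesis using D_phi_pow_monom[where \<phi> = \<phi> and j = j and g = g and k = k] 1 by simp
  next
    case 2
    then show ?thesis using D_phi_pow_monom[where \<phi> = \<phi> and j = l] 2 by (simp add: omega_def)
  qed
qed

lemma R_ring_homogeneous:
  assumes "homogeneous_basis_mod_square \<Gamma> d f" "F \<in> R_ring \<phi> d f N"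
  shows "monom (coeff F k) k \<in> R_ring \<phi> d f N"
  using assms(2) unfolding R_ring_def
proof (rule generated_algebra_component)
  fix H assume "H \<in> {(D_phi \<phi> ^^ j) (f m) | j m. j \<le> N \<and> m \<in> {1..d}} \<union> {(D_phi \<phi> ^^ l) (omega \<phi>) | l. l \<le> N}"
  then have "H \<in> Rgens \<phi> d f" unfolding Rgens_def by blast
  then show "\<exists>g k. H = monom g k" by (rule Rgens_homogeneous[OF assms(1)])
qed

lemma modular_in_R_ring:
  assumes b: "homogeneous_basis_mod_square \<Gamma> d f" and g: "g \<in> MP (int k) 0"
  shows "monom g k \<in> R_ring \<phi> d f N"
proof -
  have "(D_phi \<phi> ^^ 0) (f m) \<in> {(D_phi \<phi> ^^ j) (f m) | j m. j \<le> N \<and> m \<in> {1..d}}" if "m \<in> {1..d}" for m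
    using that by blast
  then have "f ` {1..d} \<subseteq> {(D_phi \<phi> ^^ j) (f m) | j m. j \<le> N \<and> m \<in> {1..d}} \<union> {(D_phi \<phi> ^^ l) (omega \<phi>) | l. l \<le> N}"
    by fastforce
  then have "generated_algebra (f ` {1..d}) \<subseteq> R_ring \<phi> d f N"
    unfolding R_ring_def by (rule generated_algebra_mono)
  then show ?thesis using modular_generated[OF b g] by blast
qed

lemma omega_in_R_ring: "omega \<phi> \<in> R_ring \<phi> d f N"
proof -
  have "(D_phi \<phi> ^^ 0) (omega \<phi>) \<in> {(D_phi \<phi> ^^ l) (omega \<phi>) | l. l \<le> N}" by blast
  then show ?thesis unfolding R_ring_def by (intro generated_algebra.gen) simp
qed

text \<open>Differentiation raises the pole order at \<open>\<i>\<close> by at most 1, and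
  multiplication by \<phi> by its pole order, which is at least 1.\<close>

lemma MP_D_phi:
  assumes \<phi>: "\<phi> \<in> delta_one_forms \<Gamma>" and g: "g \<in> MP (int k) n"
  shows "mero_deriv g - of_nat k * \<phi> * g \<in> MP (int (k + 2)) (n - mord \<i> \<phi>)"
proof -
  have q: "quasi2 \<phi>" and reg: "\<And>z. z \<in> uhp \<Longrightarrow> z \<notin> orb \<i> \<Longrightarrow> mord_ge z \<phi> 0"
    using \<phi> by (auto simp: delta_one_forms_iff)
  have "mero_deriv g - of_nat k * \<phi> * g \<in> wt (int (k + 2))"
    using wt_D_phi[OF q MP_wt[OF g]] by (simp add: add.commute)
  moreover have "mord_ge z (mero_deriv g - of_nat k * \<phi> * g) 0" if z: "z \<in> uhp" "z \<notin> orb \<i>" for z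
  proof (intro mord_ge_diff z(1))
    show "mord_ge z (mero_deriv g) 0" using mord_ge_deriv0 MI_regular[OF MP_MI[OF g]] z by blast
    show "mord_ge z (of_nat k * \<phi> * g) 0"
      using mord_ge_mult[OF z(1) mord_ge_mult[OF z(1) mord_ge_const[OF z(1), of "of_nat k"] reg[OF z]] MI_regular[OF MP_MI[OF g] z]]
      by (simp add: mero_const_of_nat)
  qed
  moreover have "mord_ge \<i> (mero_deriv g - of_nat k * \<phi> * g) (- (n - mord \<i> \<phi>))"
  proof (intro mord_ge_diff ii_uhp)
    have gi: "mord_ge \<i> g (- n)" using g by (simp add: MP_def)
    have "mord_ge \<i> (mero_deriv g) (- n - 1)" by (rule mord_ge_deriv[OF ii_uhp gi])
    then show "mord_ge \<i> (mero_deriv g) (- (n - mord \<i> \<phi>))"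
      by (rule mord_ge_mono) (use delta_one_pole[OF \<phi>] in simp)
    have "mord_ge \<i> \<phi> (mord \<i> \<phi>)" by (simp add: mord_ge_iff)
    from mord_ge_mult[OF ii_uhp mord_ge_mult[OF ii_uhp mord_ge_const[OF ii_uhp, of "of_nat k"] this] gi]
    show "mord_ge \<i> (of_nat k * \<phi> * g) (- (n - mord \<i> \<phi>))" by (simp add: mero_const_of_nat)
  qed
  ultimately show ?thesis by (simp add: MP_def MI_def)
qed

lemma R_slope:
  assumes \<phi>: "\<phi> \<in> delta_one_forms \<Gamma>" and b: "homogeneous_basis_mod_square \<Gamma> d f"
    and F: "F \<in> generated_algebra (Rgens \<phi> d f)" and m: "mord \<i> \<phi> = - int m"
  shows "coeff F k \<in> MP (int k) (int (m * k div 2))"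
  using F
proof (rule generated_algebra_coeff)
  let ?M = "\<lambda>k. MP (int k) (int (m * k div 2))"
  have Dstep: "\<forall>k. coeff (D_phi \<phi> H) k \<in> ?M k" if H: "\<forall>k. coeff H k \<in> ?M k" for H
  proof
    fix k
    show "coeff (D_phi \<phi> H) k \<in> ?M k"
    proof (cases "k < 2")
      case False
      then obtain j where k: "k = j + 2" by (metis add.commute le_Suc_ex not_less)
      \<comment> \<open>The weight grows by 2 and the pole order by \<open>m\<close>, so the bound
        keeps its slope \<open>m / 2\<close>, also after rounding down.\<close>
      have "m * k div 2 = m * j div 2 + m" unfolding k by (simp add: distrib_left)
      then show ?thesis using MP_D_phi[OF \<phi>, of "coeff H j" j "int (m * j div 2)"] H m False
        by (simp add: coeff_D_phi k)
    qed (simp add: coeff_D_phi)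
  qed
  have Dpow: "\<forall>k. coeff ((D_phi \<phi> ^^ j) H) k \<in> ?M k" if "\<forall>k. coeff H k \<in> ?M k" for H j
    using that by (induction j) (auto intro: Dstep[rule_format])
  have om: "\<forall>k. coeff (omega \<phi>) k \<in> ?M k"
  proof
    fix k
    have "mero_deriv \<phi> - \<phi>\<^sup>2 \<in> MP 4 (int (m * 4 div 2))"
    proof -
      have reg: "mord_ge z \<phi> 0" if "z \<in> uhp" "z \<notin> orb \<i>" for z using \<phi> that by (auto simp: delta_one_forms_iff)
      have "mord_ge z (mero_deriv \<phi> - \<phi>\<^sup>2) 0" if z: "z \<in> uhp" "z \<notin> orb \<i>" for z
        using mord_ge_mult[OF z(1) reg[OF z] reg[OF z]] mord_ge_deriv0[OF z(1) reg[OF z]] z(1)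
        by (intro mord_ge_diff) (auto simp: power2_eq_square)
      moreover have "mord_ge \<i> (mero_deriv \<phi> - \<phi>\<^sup>2) (- int (m * 4 div 2))"
        using mord_omega[OF \<phi>] m by (simp add: mord_ge_iff)
      ultimately show ?thesis using \<phi> wt_omega by (auto simp: MP_def MI_def delta_one_forms_iff)
    qed
    then show "coeff (omega \<phi>) k \<in> ?M k" by (auto simp: omega_def)
  qed
  have fm: "\<forall>k. coeff (f j) k \<in> ?M k" if j: "j \<in> {1..d}" for j
  proof
    fix k
    have "coeff (f j) k \<in> MP (int k) 0" using b j unfolding homogeneous_basis_mod_square_def positive_ideal_eq by blast
    then show "coeff (f j) k \<in> ?M k" by (rule MP_mono) simp
  qed
  show "coeff H k \<in> ?M k" if "H \<in> Rgens \<phi> d f" for H k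
    using that Dpow fm om unfolding Rgens_def by blast
  show "mero_const c \<in> ?M 0" for c by simp
  show "0 \<in> ?M k" for k by simp
  show "a + b \<in> ?M k" if "a \<in> ?M k" "b \<in> ?M k" for k a b using that by (rule MP_add)
  show "a * b \<in> ?M (k + l)" if "a \<in> ?M k" "b \<in> ?M l" for k l a b
  proof -
    have "a * b \<in> MP (int k + int l) (int (m * k div 2) + int (m * l div 2))" using that by (rule MP_mult)
    moreover have "m * k div 2 + m * l div 2 \<le> m * (k + l) div 2" by (simp add: distrib_left)
    ultimately show ?thesis using MP_mono by (metis of_nat_add of_nat_le_iff)
  qed
qed

lemma R_ring_closed_exists:
  assumes \<phi>: "\<phi> \<in> delta_one_forms \<Gamma>" and b: "homogeneous_basis_mod_square \<Gamma> d f"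
  shows "\<exists>N\<ge>1. closed_under (D_phi \<phi>) (R_ring \<phi> d f N)"
proof -
  let ?R = "generated_algebra (Rgens \<phi> d f)"
  obtain m where m: "mord \<i> \<phi> = - int m" "m > 0"
    using delta_one_pole[OF \<phi>] by (metis int_cases2 neg_0_less_iff_less of_nat_0_less_iff verit_minus_simplify(4) of_nat_less_0_iff)
  define \<omega> where "\<omega> = mero_deriv \<phi> - \<phi>\<^sup>2"
  have \<omega>: "mord \<i> \<omega> = - int (2 * m)" "\<omega> \<noteq> 0" using mord_omega[OF \<phi>] m by (auto simp: \<omega>_def)
  obtain F0 l0 where F0: "l0 > 0" "F0 \<in> MP l0 0" "mord \<i> F0 = 0" "F0 \<noteq> 0"
    using modular_form_nonvanishing[OF ii_uhp] by metis
  define k0 where "k0 = nat l0"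
  have k0: "k0 > 0" "F0 \<in> MP (int k0) 0" using F0 by (auto simp: k0_def)
  \<comment> \<open>Elements that vanish at \<open>\<i>\<close> are left out, as they are modular
    forms and already lie in every \<open>R_ring\<close>.\<close>
  define T where "T = {(k, n). \<exists>g. monom g k \<in> ?R \<and> g \<noteq> 0 \<and> mord \<i> g = - int n}"
  have Tcone: "2 * n \<le> m * k" if kn: "(k, n) \<in> T" for k n
  proof -
    obtain g where g: "monom g k \<in> ?R" "g \<noteq> 0" "mord \<i> g = - int n" using kn by (auto simp: T_def)
    have "g \<in> MP (int k) (int (m * k div 2))" using R_slope[OF \<phi> b g(1) m(1), of k] by simp
    then have "n \<le> m * k div 2" using g by (simp add: MP_def mord_ge_iff flip: of_nat_le_iff)
    then show ?thesis by linarith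
  qed
  from cone_cover[OF Tcone k0(1) m(2)] obtain E where E0: "finite E \<and> E \<subseteq> T \<and>
    (\<forall>(k, n)\<in>T. \<exists>(k', n')\<in>E. \<exists>a b. k = k' + a * k0 + 4 * b \<and> n = n' + 2 * m * b)" ..
  then have E: "finite E" "E \<subseteq> T" by auto
  have E3: "\<exists>(k', n')\<in>E. \<exists>a b. k = k' + a * k0 + 4 * b \<and> n = n' + 2 * m * b" if "(k, n) \<in> T" for k n
    using bspec[OF E0[THEN conjunct2, THEN conjunct2] that] by simp
  have "\<forall>e\<in>E. \<exists>g. monom g (fst e) \<in> ?R \<and> g \<noteq> 0 \<and> mord \<i> g = - int (snd e)" using E(2) by (auto simp: T_def)
  from bchoice[OF this] obtain \<gamma> where
    \<gamma>: "\<forall>e\<in>E. monom (\<gamma> e) (fst e) \<in> ?R \<and> \<gamma> e \<noteq> 0 \<and> mord \<i> (\<gamma> e) = - int (snd e)" ..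
  have "\<forall>e\<in>E. \<exists>N. monom (\<gamma> e) (fst e) \<in> R_ring \<phi> d f N" using \<gamma> in_R_ring by blast
  from bchoice[OF this] obtain \<nu> where \<nu>: "\<forall>e\<in>E. monom (\<gamma> e) (fst e) \<in> R_ring \<phi> d f (\<nu> e)" ..
  define N where "N = Max (insert 1 (\<nu> ` E))"
  have N1: "N \<ge> 1" unfolding N_def using E(1) by (intro Max_ge) auto
  have \<gamma>N: "monom (\<gamma> e) (fst e) \<in> R_ring \<phi> d f N" if e: "e \<in> E" for e
  proof -
    have "\<nu> e \<le> N" unfolding N_def using E(1) e by (intro Max_ge) auto
    then show ?thesis using \<nu> e R_ring_mono by blast
  qed
  \<comment> \<open>Induction on a bound for the pole order at \<open>\<i>\<close>; when no pole is
    left the form is modular, and modular forms lie in \<open>R_ring\<close>.\<close>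
  have main: "monom g k \<in> R_ring \<phi> d f N" if "monom g k \<in> ?R" "mord_ge \<i> g (- int n)" for g k n
    using that
  proof (induction n arbitrary: g)
    case 0
    have "g \<in> MP (int k) (int (m * k div 2))" using R_slope[OF \<phi> b 0(1) m(1), of k] by simp
    then have "g \<in> MP (int k) 0" using 0(2) by (simp add: MP_def)
    then show ?case by (rule modular_in_R_ring[OF b])
  next
    case (Suc n)
    show ?case
    proof (cases "mord_ge \<i> g (- int n)")
      case True
      then show ?thesis by (rule Suc.IH[OF Suc.prems(1)])
    next
      case False
      then have g0: "g \<noteq> 0" by auto
      have mg: "mord \<i> g = - int (Suc n)" using Suc.prems(2) False g0 by (simp add: mord_ge_iff)
      then have "(k, Suc n) \<in> T" using Suc.prems(1) g0 by (auto simp: T_def)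
      then obtain k' n' a c where e: "(k', n') \<in> E" "k = k' + a * k0 + 4 * c" "Suc n = n' + 2 * m * c"
        using E3 by blast
      \<comment> \<open>An element of \<open>R_ring\<close> in weight \<open>k\<close> with the same
        pole order as \<open>g\<close>, against which the leading term of \<open>g\<close> is
        cancelled.\<close>
      define p where "p = \<gamma> (k', n') * F0 ^ a * \<omega> ^ c"
      have \<gamma>e: "\<gamma> (k', n') \<noteq> 0" "mord \<i> (\<gamma> (k', n')) = - int n'" "monom (\<gamma> (k', n')) k' \<in> R_ring \<phi> d f N"
        using \<gamma> \<gamma>N[OF e(1)] e(1) by auto
      have p0: "p \<noteq> 0" using \<gamma>e \<omega> F0 by (simp add: p_def)
      have "mord \<i> p = - int n' + int c * (- int (2 * m))"
        using \<gamma>e \<omega> F0 by (simp add: p_def mord_mult)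
      also have "\<dots> = - int (Suc n)" unfolding e(3) by simp
      finally have mp: "mord \<i> p = mord \<i> g" using mg by simp
      have "monom p k = monom (\<gamma> (k', n')) k' * monom F0 k0 ^ a * omega \<phi> ^ c"
        by (simp add: p_def e(2) omega_def \<omega>_def monom_power mult_monom ac_simps)
      moreover have "monom (\<gamma> (k', n')) k' * monom F0 k0 ^ a * omega \<phi> ^ c \<in> R_ring \<phi> d f N"
        using \<gamma>e(3) modular_in_R_ring[OF b k0(2), of \<phi> N] omega_in_R_ring[of \<phi> d f N] unfolding R_ring_def
        by (intro generated_algebra.mult generated_algebra_power)
      ultimately have pR: "monom p k \<in> R_ring \<phi> d f N" by simp
      obtain x where x: "mord_ge \<i> (g - mero_const x * p) (mord \<i> g + 1)"
        using cancel_leading[OF mp[symmetric] g0 p0] by blast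
      have "monom g k - smult (mero_const x) (monom p k) \<in> ?R"
        using Suc.prems(1) pR R_ring_subset by (intro generated_algebra_diff generated_algebra_smult) blast+
      then have "monom (g - mero_const x * p) k \<in> ?R" by (simp add: smult_monom diff_monom)
      then have "monom (g - mero_const x * p) k \<in> R_ring \<phi> d f N"
        using Suc.IH x mg by simp
      then have "monom (g - mero_const x * p) k + smult (mero_const x) (monom p k) \<in> R_ring \<phi> d f N"
        using pR unfolding R_ring_def by (intro generated_algebra.add generated_algebra_smult)
      then show ?thesis by (simp add: smult_monom add_monom)
    qed
  qed
  have all: "?R \<subseteq> R_ring \<phi> d f N"
  proof
    fix F assume F: "F \<in> ?R"
    have "monom (coeff F k) k \<in> R_ring \<phi> d f N" for k
    proof (rule main)
      show "monom (coeff F k) k \<in> ?R" using F Rgens_homogeneous[OF b] by (rule generated_algebra_component)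
      show "mord_ge \<i> (coeff F k) (- int (nat (- mord \<i> (coeff F k))))" by (auto simp: mord_ge_iff)
    qed
    then have "(\<Sum>k\<le>degree F. monom (coeff F k) k) \<in> R_ring \<phi> d f N"
      unfolding R_ring_def by (intro generated_algebra_sum)
    then show "F \<in> R_ring \<phi> d f N" by (simp add: poly_as_sum_of_monoms)
  qed
  have "D_phi \<phi> F \<in> R_ring \<phi> d f N" if F: "F \<in> R_ring \<phi> d f N" for F
  proof -
    have "D_phi \<phi> H \<in> ?R" if H: "H \<in> Rgens \<phi> d f" for H
    proof -
      have D: "D_phi \<phi> ((D_phi \<phi> ^^ j) P) = (D_phi \<phi> ^^ Suc j) P" for j P by simp
      have "D_phi \<phi> H \<in> Rgens \<phi> d f"
        using H unfolding Rgens_def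
      proof (elim UnE CollectE exE conjE)
        fix j m assume "H = (D_phi \<phi> ^^ j) (f m)" "m \<in> {1..d}"
        then have "D_phi \<phi> H = (D_phi \<phi> ^^ Suc j) (f m)" "m \<in> {1..d}" using D by auto
        then show "D_phi \<phi> H \<in> {(D_phi \<phi> ^^ j) (f m) | j m. m \<in> {1..d}} \<union> {(D_phi \<phi> ^^ l) (omega \<phi>) | l. True}"
          by blast
      next
        fix l assume "H = (D_phi \<phi> ^^ l) (omega \<phi>)"
        then have "D_phi \<phi> H = (D_phi \<phi> ^^ Suc l) (omega \<phi>)" using D by simp
        then show "D_phi \<phi> H \<in> {(D_phi \<phi> ^^ j) (f m) | j m. m \<in> {1..d}} \<union> {(D_phi \<phi> ^^ l) (omega \<phi>) | l. True}"
          by blast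
      qed
      then show ?thesis by (rule generated_algebra.gen)
    qed
    then have "D_phi \<phi> F \<in> ?R" by (rule D_phi_generated_algebra[OF subsetD[OF R_ring_subset F]])
    then show ?thesis using all by blast
  qed
  then show ?thesis using N1 unfolding closed_under_def by blast
qed

end

section \<open>Quasimodular forms\<close>

lemma mcomp_mcomp:
  assumes "det A = 1" "det B = 1" shows "mcomp B (mcomp A f) = mcomp (A ** B) f"
proof (rule merofun_eqI_hol)
  fix z assume z: "z \<in> uhp"
  have "det (A ** B) = 1" using assms by (simp add: det_mul)
  then show "fun_of (mcomp B (mcomp A f)) z = fun_of (mcomp (A ** B) f) z"
    using assms z by (simp add: fun_of_mcomp moebius_mult)
qed

lemma mcomp_inj: "det A = 1 \<Longrightarrow> mcomp A f = mcomp A g \<longleftrightarrow> f = g"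
  using mcomp_eq_0_iff[of A "f - g"] by simp

lemma autofun_mult:
  assumes "det A = 1" "det B = 1" shows "autofun (A ** B) = mcomp B (autofun A) * autofun B"
proof (rule merofun_eqI_hol)
  fix z assume z: "z \<in> uhp"
  have "det (A ** B) = 1" using assms by (simp add: det_mul)
  then show "fun_of (autofun (A ** B)) z = fun_of (mcomp B (autofun A) * autofun B) z"
    using assms z by (simp add: fun_of_mcomp automorphy_mult fun_of_mult mord_mcomp)
qed

definition Xf :: "real^2^2 \<Rightarrow> merofun" where
  "Xf A = mero_const (of_real (A$2$1)) / autofun A"

lemma fun_of_Xf_power:
  assumes "det A = 1" "z \<in> uhp"
  shows "fun_of (Xf A ^ n) z = (of_real (A$2$1) / automorphy A z) ^ n" "mord_ge z (Xf A ^ n) 0"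
proof -
  have X: "Xf A ^ n = mero_const (of_real (A$2$1) ^ n) * autofun A powi (- int n)"
    by (simp add: Xf_def mero_const_power power_int_minus divide_inverse power_mult_distrib power_inverse)
  show "mord_ge z (Xf A ^ n) 0" unfolding X
    using mord_ge_mult[of z "mero_const (of_real (A$2$1) ^ n)" 0 "autofun A powi (- int n)" 0] assms
    by (simp add: mord_ge_0_iff)
  show "fun_of (Xf A ^ n) z = (of_real (A$2$1) / automorphy A z) ^ n"
  proof -
    have "fun_of (Xf A ^ n) z = fun_of (mero_const (of_real (A$2$1) ^ n)) z * fun_of (autofun A powi (- int n)) z"
      unfolding X by (rule fun_of_mult) (use assms in \<open>auto simp del: mero_const_eq_0_iff\<close>)
    also have "\<dots> = of_real (A$2$1) ^ n * automorphy A z powi (- int n)"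
      using assms by (simp only: fun_of_const fun_of_autofun_powi)
    finally show ?thesis by (simp add: power_int_minus power_divide divide_inverse power_inverse power_mult_distrib)
  qed
qed

text \<open>As \<open>Xf A\<close> is the logarithmic derivative of \<open>autofun A\<close>, this
  is the logarithmic derivative of the cocycle relation \<open>autofun_mult\<close>.\<close>

lemma Xf_mult:
  assumes d: "det A = 1" "det B = 1"
  shows "Xf (A ** B) = mcomp B (Xf A) / (autofun B)\<^sup>2 + Xf B"
proof -
  have dAB: "det (A ** B) = 1" using d by (simp add: det_mul)
  let ?a = "mcomp B (autofun A)" and ?j = "autofun B"
  let ?cA = "mero_const (of_real (A$2$1))" and ?cB = "mero_const (of_real (B$2$1))"
    and ?c = "mero_const (of_real ((A ** B)$2$1))"
  have key: "?c * ?j = ?cA + ?cB * autofun (A ** B)"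
  proof (rule merofun_eqI_hol)
    fix z assume z: "z \<in> uhp"
    have "mord_ge z (?cB * autofun (A ** B)) (0 + 0)"
      using dAB z by (intro mord_ge_mult) (auto simp: mord_ge_0_iff)
    then have m: "mord z (?cB * autofun (A ** B)) \<ge> 0" using z by (simp add: mord_ge_0_iff)
    have db: "B$1$1 * B$2$2 = 1 + B$1$2 * B$2$1" using d(2) by (simp add: det2)
    have "fun_of (?c * ?j) z - fun_of (?cA + ?cB * autofun (A ** B)) z =
       of_real (A$2$1 * (B$1$1 * B$2$2 - (1 + B$1$2 * B$2$1)))"
      using z d dAB m by (simp add: fun_of_mult fun_of_add automorphy_def mult2_nth algebra_simps)
    also have "\<dots> = 0" using db by simp
    finally show "fun_of (?c * ?j) z = fun_of (?cA + ?cB * autofun (A ** B)) z" by simp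
  qed
  have nz: "?a \<noteq> 0" "?j \<noteq> 0" using d by auto
  have ab: "autofun (A ** B) = ?a * ?j" by (rule autofun_mult[OF d])
  have "Xf (A ** B) = (?c * ?j) / (?a * ?j\<^sup>2)"
    using nz by (simp add: Xf_def ab power2_eq_square)
  also have "\<dots> = ?cA / ?a / ?j\<^sup>2 + ?cB / ?j"
    unfolding key ab using nz by (simp add: field_simps power2_eq_square)
  finally show ?thesis using d by (simp add: Xf_def)
qed

lemma mcomp_poly:
  assumes "det B = 1" shows "mcomp B (poly P x) = poly (map_poly (mcomp B) P) (mcomp B x)"
  using assms by (induction P) (simp_all add: map_poly_pCons)

lemma mero_deriv_poly:
  "mero_deriv (poly P x) = poly (map_poly mero_deriv P) x + poly (pderiv P) x * mero_deriv x"
  by (induction P) (simp_all add: map_poly_pCons pderiv_pCons mero_deriv_mult algebra_simps)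

lemma coeff_pcompose_linear:
  fixes a b :: "'a :: comm_ring_1"
  shows "coeff (pcompose P [:b, a:]) n = (\<Sum>i\<le>degree P. coeff P i * (of_nat (i choose n) * a ^ n * b ^ (i - n)))"
proof -
  have m: "pcompose (monom c i) [:b, a:] = smult c ([:b, a:] ^ i)" for c i
    by (induction i) (simp_all add: monom_0 monom_Suc pcompose_pCons)
  have "pcompose (\<Sum>i\<le>degree P. monom (coeff P i) i) [:b, a:] = (\<Sum>i\<le>degree P. smult (coeff P i) ([:b, a:] ^ i))"
    by (simp add: pcompose_sum m)
  then have "pcompose P [:b, a:] = (\<Sum>i\<le>degree P. smult (coeff P i) ([:b, a:] ^ i))"
    by (simp add: poly_as_sum_of_monoms)
  moreover have "coeff ([:b, a:] ^ i) n = of_nat (i choose n) * a ^ n * b ^ (i - n)" for i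
  proof (cases "n \<le> i")
    case False
    have "degree ([:b, a:] ^ i) \<le> i" using degree_power_le[of "[:b, a:]" i] by (auto intro: order_trans simp: degree_pCons_eq_if split: if_splits)
    then show ?thesis using False by (simp add: coeff_eq_0 binomial_eq_0)
  qed (simp add: coeff_linear_poly_power)
  ultimately show ?thesis by (simp add: coeff_sum)
qed

text \<open>Interpolation at \<open>p + 1\<close> nodes that are distinct at every point; the
  induction splits off the last node by synthetic division. It is applied to the coefficient
  functions in the definition of a quasimodular form, of which no regularity is assumed.\<close>

lemma holomorphic_coefficients:
  fixes P :: "complex \<Rightarrow> complex poly"
  assumes "\<And>z. z \<in> S \<Longrightarrow> degree (P z) \<le> p"
    and "\<And>i. i \<le> p \<Longrightarrow> x i holomorphic_on S"
    and "\<And>i j z. i < j \<Longrightarrow> j \<le> p \<Longrightarrow> z \<in> S \<Longrightarrow> x i z \<noteq> x j z"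
    and "\<And>i. i \<le> p \<Longrightarrow> (\<lambda>z. poly (P z) (x i z)) holomorphic_on S"
  shows "(\<lambda>z. coeff (P z) j) holomorphic_on S"
  using assms
proof (induction p arbitrary: P j)
  case 0
  show ?case
  proof (cases j)
    case 0
    have "(\<lambda>z. poly (P z) (x 0 z)) holomorphic_on S" using "0.prems"(4)[of 0] by simp
    then show ?thesis
    proof (rule holomorphic_transform)
      fix z assume "z \<in> S"
      then have "degree (P z) = 0" using "0.prems"(1) by simp
      then obtain c where "P z = [:c:]" by (rule degree_eq_zeroE)
      then show "poly (P z) (x 0 z) = coeff (P z) j" using 0 by simp
    qed
  next
    case (Suc i)
    have "(\<lambda>z. 0) holomorphic_on S" by simp
    then show ?thesis
    proof (rule holomorphic_transform)
      fix z assume "z \<in> S"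
      then show "0 = coeff (P z) j" using "0.prems"(1)[of z] Suc by (simp add: coeff_eq_0)
    qed
  qed
next
  case (Suc p)
  define y where "y = x (Suc p)"
  define Q where "Q z = synthetic_div (P z) (y z)" for z
  have PQ: "P z = [:- y z, 1:] * Q z + [:poly (P z) (y z):]" for z
    unfolding Q_def by (rule synthetic_div_correct'[symmetric])
  have hy: "y holomorphic_on S" and hP: "(\<lambda>z. poly (P z) (y z)) holomorphic_on S"
    using Suc.prems(2)[of "Suc p"] Suc.prems(4)[of "Suc p"] by (auto simp: y_def)
  have Q: "(\<lambda>z. coeff (Q z) j) holomorphic_on S" for j
  proof (rule Suc.IH)
    show "degree (Q z) \<le> p" if "z \<in> S" for z using Suc.prems(1)[OF that] by (simp add: Q_def degree_synthetic_div)
    show "x i holomorphic_on S" if "i \<le> p" for i using Suc.prems(2) that by simp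
    show "x i z \<noteq> x j z" if "i < j" "j \<le> p" "z \<in> S" for i j z using Suc.prems(3) that by simp
    show "(\<lambda>z. poly (Q z) (x i z)) holomorphic_on S" if i: "i \<le> p" for i
    proof -
      have ne: "x i z - y z \<noteq> 0" if "z \<in> S" for z using Suc.prems(3)[of i "Suc p" z] i that by (simp add: y_def)
      have "(\<lambda>z. (poly (P z) (x i z) - poly (P z) (y z)) / (x i z - y z)) holomorphic_on S"
        using Suc.prems(2)[of i] Suc.prems(4)[of i] i ne hy hP by (intro holomorphic_intros) auto
      then show ?thesis
      proof (rule holomorphic_transform)
        fix z assume z: "z \<in> S"
        have "poly (P z) (x i z) = (x i z - y z) * poly (Q z) (x i z) + poly (P z) (y z)"
          by (subst (1) PQ) (simp add: algebra_simps)
        then show "(poly (P z) (x i z) - poly (P z) (y z)) / (x i z - y z) = poly (Q z) (x i z)"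
          using ne[OF z] by simp
      qed
    qed
  qed
  show ?case
  proof (cases j)
    case 0
    have "(\<lambda>z. - y z * coeff (Q z) 0 + poly (P z) (y z)) holomorphic_on S"
      by (intro holomorphic_intros hy hP Q)
    moreover have "coeff (P z) j = - y z * coeff (Q z) 0 + poly (P z) (y z)" for z
      by (subst PQ) (simp add: 0)
    ultimately show ?thesis by simp
  next
    case (Suc i)
    have "(\<lambda>z. - y z * coeff (Q z) (Suc i) + coeff (Q z) i) holomorphic_on S"
      by (intro holomorphic_intros hy Q)
    moreover have "coeff (P z) j = - y z * coeff (Q z) (Suc i) + coeff (Q z) i" for z
      by (subst PQ) (simp add: Suc)
    ultimately show ?thesis by simp
  qed
qed

lemma eventually_fun_of_sum:
  assumes "z \<in> uhp"
  shows "eventually (\<lambda>w. fun_of (\<Sum>i\<le>(n::nat). f i) w = (\<Sum>i\<le>n. fun_of (f i) w)) (at z)"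
proof (induction n)
  case (Suc n)
  show ?case using Suc.IH eventually_fun_of(2)[OF assms, of "\<Sum>i\<le>n. f i" "f (Suc n)"]
    by eventually_elim simp
qed simp

lemma eventually_fun_of_quasi:
  assumes d: "det A = 1" and z: "z \<in> uhp" and p: "degree P \<le> p"
  shows "eventually (\<lambda>w. fun_of (autofun A powi k * poly P (Xf A)) w =
    automorphy A w powi k * (\<Sum>j\<le>p. fun_of (coeff P j) w * (of_real (A$2$1) / automorphy A w) ^ j)) (at z)"
proof -
  have P: "poly P (Xf A) = (\<Sum>j\<le>p. coeff P j * Xf A ^ j)"
    unfolding poly_altdef using p by (intro sum.mono_neutral_left) (auto simp: coeff_eq_0)
  have "eventually (\<lambda>w. \<forall>j\<in>{..p}. fun_of (coeff P j * Xf A ^ j) w = fun_of (coeff P j) w * fun_of (Xf A ^ j) w) (at z)"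
    by (intro eventually_ball_finite ballI eventually_fun_of(5) z) auto
  then show ?thesis
    using eventually_fun_of(5)[OF z, of "autofun A powi k" "poly P (Xf A)"]
      eventually_fun_of_sum[OF z, where n = p and f = "\<lambda>j. coeff P j * Xf A ^ j"] eventually_in_uhp[OF z]
  proof eventually_elim
    case (elim w)
    have "fun_of (poly P (Xf A)) w = (\<Sum>j\<le>p. fun_of (coeff P j) w * (of_real (A$2$1) / automorphy A w) ^ j)"
      unfolding P elim(3) using elim(1,4) d by (intro sum.cong) (auto simp: fun_of_Xf_power)
    then show ?case using elim(2,4) d by simp
  qed
qed

lemma poly_eq_on_infinite:
  fixes P Q :: "'a :: idom poly"
  assumes "infinite Y" "\<And>y. y \<in> Y \<Longrightarrow> poly P y = poly Q y" shows "P = Q"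
proof (rule ccontr)
  assume "P \<noteq> Q"
  then have "finite {y. poly (P - Q) y = 0}" by (intro poly_roots_finite) simp
  moreover have "Y \<subseteq> {y. poly (P - Q) y = 0}" using assms(2) by auto
  ultimately show False using assms(1) finite_subset by blast
qed

section \<open>Quasimodular forms as polynomials in \<open>Xf A\<close>\<close>

context fuchsian
begin

text \<open>
  If there were only finitely many functions \<open>c / (c z + d)\<close>, the negative of their average would be
  a form with \<open>\<delta> = 1\<close> without any poles.
\<close>

lemma infinite_Xf: "infinite (Xf ` G)"
proof
  let ?S = "Xf ` G"
  assume fin: "finite ?S"
  define n where "n = card ?S"
  define s where "s = \<Sum>?S"
  define \<phi> where "\<phi> = - (s / of_nat n)"
  have "n \<noteq> 0" using fin G_one by (auto simp: n_def)
  then have n: "(of_nat n :: merofun) \<noteq> 0" by (simp flip: mero_const_of_nat)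
  have "quasi2 \<phi>" unfolding quasi2_def
  proof
    fix B assume B: "B \<in> G"
    then have d: "det B = 1" by (rule G_det)
    let ?J = "autofun B" and ?c = "mero_const (of_real (B$2$1))"
    have J: "?J \<noteq> 0" using d by simp
    \<comment> \<open>By \<open>Xf_mult\<close>, \<open>h\<close> sends \<open>Xf A\<close> to
      \<open>Xf (A ** B)\<close>, so it permutes the finite set.\<close>
    define h where "h x = mcomp B x / ?J\<^sup>2 + Xf B" for x
    have "inj_on h ?S" using J mcomp_inj[OF d] by (auto simp: inj_on_def h_def)
    moreover have "h ` ?S \<subseteq> ?S"
    proof (intro subsetI, elim imageE)
      fix y x A assume "y = h x" "x = Xf A" "A \<in> G"
      then have "y = Xf (A ** B)" using Xf_mult[OF G_det d] by (simp add: h_def)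
      then show "y \<in> ?S" using G_mult[OF \<open>A \<in> G\<close> B] by simp
    qed
    ultimately have "h ` ?S = ?S" using endo_inj_surj[OF fin] by blast
    then have "s = sum h ?S" using sum.reindex[OF \<open>inj_on h ?S\<close>, of id] by (simp add: s_def)
    also have "\<dots> = mcomp B s / ?J\<^sup>2 + of_nat n * Xf B"
      using d by (simp add: h_def sum.distrib sum_divide_distrib s_def n_def)
    finally have "mcomp B s = ?J\<^sup>2 * s - of_nat n * ?c * ?J"
      using J by (simp add: Xf_def field_simps power2_eq_square)
    moreover have "mcomp B (of_nat n) = (of_nat n :: merofun)"
      using mcomp_const[OF d, of "of_nat n"] by (simp add: mero_const_of_nat)
    ultimately have "mcomp B \<phi> = - ((?J\<^sup>2 * s - of_nat n * ?c * ?J) / of_nat n)"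
      using d by (simp add: \<phi>_def)
    then show "mcomp B \<phi> = ?J\<^sup>2 * \<phi> + ?c * ?J"
      using n by (simp add: \<phi>_def field_simps)
  qed
  moreover have reg: "mord_ge z \<phi> 0" if z: "z \<in> uhp" for z
  proof -
    have "mord_ge z s 0" unfolding s_def
    proof (rule mord_ge_sum[OF z])
      fix x assume "x \<in> ?S"
      then obtain A where "A \<in> G" "x = Xf A" by blast
      then show "mord_ge z x 0" using fun_of_Xf_power(2)[of A z 1] G_det z by simp
    qed
    from mord_ge_mult[OF z mord_ge_const[OF z, of "- inverse (of_nat n)"] this]
    show ?thesis by (simp add: \<phi>_def mero_const_uminus mero_const_inverse mero_const_of_nat divide_inverse mult.commute)
  qed
  ultimately have "mord \<i> \<phi> < 0" by (intro delta_one_pole) (auto simp: delta_one_forms_iff)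
  then show False using reg[OF ii_uhp] by (simp add: mord_ge_0_iff ii_uhp)
qed

text \<open>The coefficients of \<open>P\<close> are the functions \<open>f\<^sub>0, \<dots>, f\<^sub>p\<close> of the definition of a quasimodular form.\<close>

definition quasi :: "int \<Rightarrow> merofun poly \<Rightarrow> merofun \<Rightarrow> bool" where
  "quasi k P f \<longleftrightarrow> (\<forall>A\<in>G. mcomp A f = autofun A powi k * poly P (Xf A))"

lemma quasi_add: "quasi k P f \<Longrightarrow> quasi k Q g \<Longrightarrow> quasi k (P + Q) (f + g)"
  using G_det by (simp add: quasi_def algebra_simps)

lemma quasi_diff: "quasi k P f \<Longrightarrow> quasi k Q g \<Longrightarrow> quasi k (P - Q) (f - g)"
  using G_det by (simp add: quasi_def algebra_simps)

lemma quasi_mult: "quasi k P f \<Longrightarrow> quasi l Q g \<Longrightarrow> quasi (k + l) (P * Q) (f * g)"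
  using G_det by (simp add: quasi_def power_int_add algebra_simps)

lemma quasi_wt: "f \<in> wt k \<Longrightarrow> quasi k [:f:] f"
  by (simp add: quasi_def wt_def)

lemma quasi_const_mult:
  assumes "quasi k P f" shows "quasi k (smult (mero_const c) P) (mero_const c * f)"
  using quasi_mult[OF quasi_wt[OF wt_const[of c]] assms] by simp

lemma quasi_quasi2:
  assumes "quasi2 \<phi>" shows "quasi 2 [:\<phi>, 1:] \<phi>"
  unfolding quasi_def
proof
  fix A assume A: "A \<in> G"
  then have "autofun A \<noteq> 0" using G_det by simp
  then show "mcomp A \<phi> = autofun A powi 2 * poly [:\<phi>, 1:] (Xf A)"
    using assms A by (simp add: quasi2_def Xf_def field_simps power2_eq_square)
qed

text \<open>The law for the identity matrix, where \<open>Xf\<close> is 0.\<close>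

lemma quasi_coeff_0: "quasi k P f \<Longrightarrow> f = coeff P 0"
proof -
  assume q: "quasi k P f"
  have "det (mat 1 :: real^2^2) = 1" by simp
  have "autofun (mat 1) = 1"
    by (rule merofun_eqI_hol) (simp add: automorphy_def fun_of_const[of _ 1, simplified])
  moreover have "Xf (mat 1) = 0" by (simp add: Xf_def)
  moreover have "mcomp (mat 1) f = f"
    by (rule merofun_eqI_hol) (simp add: fun_of_mcomp moebius_def automorphy_def)
  ultimately show ?thesis using q G_one by (force simp: quasi_def poly_0_coeff_0)
qed

text \<open>The pullback of \<open>f\<close> along \<open>A ** B\<close> has two expansions, both
  polynomial in the pullback of \<open>Xf A\<close> by \<open>B\<close>. They agree at infinitely
  many values, hence as polynomials.\<close>

lemma quasi_transform:
  assumes q: "quasi k P f" and B: "B \<in> G"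
  shows "pcompose P [:Xf B, inverse ((autofun B)\<^sup>2):] = smult (autofun B powi (- k)) (map_poly (mcomp B) P)"
proof (rule poly_eq_on_infinite)
  have d: "det B = 1" using B by (rule G_det)
  then have J: "autofun B \<noteq> 0" by simp
  show "infinite (mcomp B ` Xf ` G)"
    using infinite_Xf mcomp_inj[OF d] finite_image_iff[of "mcomp B" "Xf ` G"] by (auto simp: inj_on_def)
  fix y assume "y \<in> mcomp B ` Xf ` G"
  then obtain A where A: "A \<in> G" "y = mcomp B (Xf A)" by blast
  have dA: "det A = 1" using A(1) by (rule G_det)
  have nz: "mcomp B (autofun A) \<noteq> 0" using d dA by simp
  have "autofun (A ** B) powi k * poly P (Xf (A ** B)) = mcomp B (mcomp A f)"
    using q G_mult[OF A(1) B] mcomp_mcomp[OF dA d, of f] by (simp add: quasi_def)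
  also have "\<dots> = mcomp B (autofun A) powi k * poly (map_poly (mcomp B) P) y"
    using q A d by (simp add: quasi_def mcomp_poly)
  finally have "mcomp B (autofun A) powi k * (autofun B powi k * poly P (Xf (A ** B))) =
     mcomp B (autofun A) powi k * poly (map_poly (mcomp B) P) y"
    by (simp add: autofun_mult[OF dA d] power_int_mult_distrib mult.assoc)
  then have "autofun B powi k * poly P (Xf (A ** B)) = poly (map_poly (mcomp B) P) y" using nz by simp
  then have "poly P (Xf (A ** B)) = autofun B powi (- k) * poly (map_poly (mcomp B) P) y"
    using J by (simp add: power_int_minus field_simps)
  then show "poly (pcompose P [:Xf B, inverse ((autofun B)\<^sup>2):]) y = poly (smult (autofun B powi (- k)) (map_poly (mcomp B) P)) y"
    by (simp add: poly_pcompose Xf_mult[OF dA d] A(2) divide_inverse add.commute mult.commute)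
qed

lemma quasi_coeff_transform:
  assumes q: "quasi k P f" and B: "B \<in> G"
  shows "mcomp B (coeff P n) = autofun B powi k *
    (\<Sum>i\<le>degree P. coeff P i * (of_nat (i choose n) * inverse ((autofun B)\<^sup>2) ^ n * Xf B ^ (i - n)))"
proof -
  have d: "det B = 1" using B by (rule G_det)
  then have J: "autofun B \<noteq> 0" by simp
  have "coeff (pcompose P [:Xf B, inverse ((autofun B)\<^sup>2):]) n = autofun B powi (- k) * mcomp B (coeff P n)"
    unfolding quasi_transform[OF q B] using d by (simp add: coeff_map_poly)
  then show ?thesis unfolding coeff_pcompose_linear using J by (simp add: power_int_minus field_simps)
qed

text \<open>At the top index the transformation law of the coefficients reduces to a single
  term.\<close>

lemma quasi_lead:
  assumes q: "quasi k P f" shows "lead_coeff P \<in> wt (k - 2 * int (degree P))"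
  unfolding wt_def
proof (intro CollectI ballI)
  fix B assume B: "B \<in> G"
  then have J: "autofun B \<noteq> 0" using G_det by simp
  let ?p = "degree P"
  have "(\<Sum>i\<le>?p. coeff P i * (of_nat (i choose ?p) * inverse ((autofun B)\<^sup>2) ^ ?p * Xf B ^ (i - ?p))) =
     (\<Sum>i\<le>?p. if i = ?p then coeff P ?p * inverse ((autofun B)\<^sup>2) ^ ?p else 0)"
    by (intro sum.cong) (auto simp: binomial_eq_0)
  also have "\<dots> = coeff P ?p * inverse ((autofun B)\<^sup>2) ^ ?p" by simp
  finally have "mcomp B (lead_coeff P) = autofun B powi k * (lead_coeff P * inverse ((autofun B)\<^sup>2) ^ ?p)"
    using quasi_coeff_transform[OF q B, of ?p] by simp
  moreover have "autofun B powi (k - 2 * int ?p) = autofun B powi k * inverse ((autofun B)\<^sup>2) ^ ?p"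
  proof -
    have "autofun B powi (2 * int ?p) = ((autofun B)\<^sup>2) ^ ?p"
      using power_int_of_nat[of "autofun B" "2 * ?p"] by (simp add: power_mult)
    then show ?thesis using J by (simp add: power_int_diff divide_inverse power_inverse)
  qed
  ultimately show "mcomp B (lead_coeff P) = autofun B powi (k - 2 * int ?p) * lead_coeff P" by simp
qed

text \<open>Just below a constant top coefficient \<open>c\<close> two terms survive, and the upper
  one contributes \<open>Suc p\<close> times \<open>c\<close> times \<open>Xf B\<close>; the
  division normalises this to \<open>\<delta> = 1\<close>.\<close>

lemma quasi_second:
  assumes q: "quasi (2 * int (Suc p)) P f" and p: "degree P = Suc p" and c: "lead_coeff P = mero_const c"
  shows "quasi2 (coeff P p / (of_nat (Suc p) * mero_const c))"
  unfolding quasi2_def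
proof
  fix B assume B: "B \<in> G"
  have d: "det B = 1" using B by (rule G_det)
  let ?J = "autofun B" and ?n = "of_nat (Suc p) :: merofun"
  have J: "?J \<noteq> 0" using d by simp
  have "P \<noteq> 0" using p by auto
  then have c0: "mero_const c \<noteq> 0" using leading_coeff_neq_0[of P] c by simp
  have n: "?n \<noteq> 0" using mero_const_eq_0_iff[of "of_nat (Suc p)"] unfolding mero_const_of_nat
    by (simp only: of_nat_eq_0_iff)
  have "{..degree P} = insert (Suc p) (insert p {..<p})" using p by auto
  moreover have "(\<Sum>i<p. coeff P i * (of_nat (i choose p) * inverse (?J\<^sup>2) ^ p * Xf B ^ (i - p))) = 0"
    by (intro sum.neutral) (auto simp: binomial_eq_0)
  ultimately have "(\<Sum>i\<le>degree P. coeff P i * (of_nat (i choose p) * inverse (?J\<^sup>2) ^ p * Xf B ^ (i - p))) =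
     mero_const c * (?n * inverse (?J\<^sup>2) ^ p * Xf B) + coeff P p * inverse (?J\<^sup>2) ^ p"
    using c p by simp
  moreover have "?J powi (2 * int (Suc p)) = ?J\<^sup>2 * (?J\<^sup>2) ^ p"
    using power_int_of_nat[of ?J "2 * Suc p"] by (simp add: power_mult power2_eq_square)
  ultimately have "mcomp B (coeff P p) = ?J\<^sup>2 * (?J\<^sup>2) ^ p * (mero_const c * (?n * inverse (?J\<^sup>2) ^ p * Xf B) + coeff P p * inverse (?J\<^sup>2) ^ p)"
    using quasi_coeff_transform[OF q B, of p] by simp
  also have "\<dots> = ((?J\<^sup>2) ^ p * inverse (?J\<^sup>2) ^ p) * (?J\<^sup>2 * (mero_const c * (?n * Xf B) + coeff P p))"
    by (simp add: algebra_simps)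
  also have "(?J\<^sup>2) ^ p * inverse (?J\<^sup>2) ^ p = 1" using J by (simp add: power_inverse)
  finally have m: "mcomp B (coeff P p) = ?J\<^sup>2 * (mero_const c * (?n * Xf B) + coeff P p)" by simp
  have "mcomp B ?n = ?n" using mcomp_const[OF d, of "of_nat (Suc p)"] unfolding mero_const_of_nat .
  then have "mcomp B (coeff P p / (?n * mero_const c)) = ?J\<^sup>2 * (mero_const c * (?n * Xf B) + coeff P p) / (?n * mero_const c)"
    using d m by (simp only: mcomp_divide mcomp_mult mcomp_const)
  also have "\<dots> = ?J\<^sup>2 * (coeff P p / (?n * mero_const c)) + ?J\<^sup>2 * Xf B"
    using n c0 by (simp add: field_simps del: of_nat_Suc)
  also have "?J\<^sup>2 * Xf B = mero_const (of_real (B$2$1)) * ?J" using J by (simp add: Xf_def power2_eq_square)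
  finally show "mcomp B (coeff P p / (?n * mero_const c)) = ?J\<^sup>2 * (coeff P p / (?n * mero_const c)) + mero_const (of_real (B$2$1)) * ?J" .
qed

text \<open>With \<open>X = Xf A\<close> and \<open>J = autofun A\<close>, this is the product rule
  together with \<open>X' = - X^2\<close> and \<open>(J^k)' = k X J^k\<close>.\<close>

lemma quasi_deriv:
  assumes q: "quasi k P f"
  shows "quasi (k + 2) (map_poly mero_deriv P + monom (of_int k) 1 * P - monom 1 2 * pderiv P) (mero_deriv f)"
  unfolding quasi_def
proof
  fix A assume A: "A \<in> G"
  have d: "det A = 1" using A by (rule G_det)
  let ?J = "autofun A" and ?c = "mero_const (of_real (A$2$1))" and ?X = "Xf A"
  have J: "?J \<noteq> 0" using d by simp
  have cX: "?c = ?X * ?J" using J by (simp add: Xf_def)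
  have dX: "mero_deriv ?X = - (?X\<^sup>2)"
    using J by (simp add: Xf_def divide_inverse mero_deriv_mult mero_deriv_inverse mero_deriv_autofun[OF d] power2_eq_square)
  have dJ: "mero_deriv (?J powi k) = of_int k * ?X * ?J powi k"
    using J by (simp add: mero_deriv_powi mero_deriv_autofun[OF d] cX power_int_diff)
  have "mcomp A (mero_deriv f) = mero_deriv (mcomp A f) * ?J\<^sup>2" using J by (simp add: mero_deriv_mcomp[OF d])
  also have "mcomp A f = ?J powi k * poly P ?X" using q A by (simp add: quasi_def)
  also have "mero_deriv (?J powi k * poly P ?X) =
     ?J powi k * (poly (map_poly mero_deriv P) ?X + of_int k * ?X * poly P ?X - ?X\<^sup>2 * poly (pderiv P) ?X)"
    by (simp add: mero_deriv_mult mero_deriv_poly dX dJ algebra_simps)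
  finally show "mcomp A (mero_deriv f) = ?J powi (k + 2) * poly (map_poly mero_deriv P + monom (of_int k) 1 * P - monom 1 2 * pderiv P) ?X"
    using J by (simp add: power_int_add poly_monom algebra_simps)
qed

abbreviation "regular P \<equiv> \<forall>j. \<forall>z\<in>uhp. mord_ge z (coeff P j) 0"

text \<open>The step from \<open>p\<close> to \<open>p + 1\<close> raises the depth bound by 1 and
  multiplies the top coefficient by \<open>w + p\<close>. So \<open>c\<close> is the product of
  \<open>w, ..., w + p - 1\<close>, which is nonzero because \<open>w > 0\<close>.\<close>

lemma quasi_iterated_deriv:
  assumes g: "g \<in> MP (int w) 0" and w: "w > 0"
  shows "\<exists>P c. quasi (int (w + 2 * p)) P ((mero_deriv ^^ p) g) \<and> regular P \<and> degree P \<le> p \<and>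
    c \<noteq> 0 \<and> coeff P p = mero_const c * g"
proof (induction p)
  case 0
  have "regular [:g:]" using g by (auto simp: MP_0_iff coeff_pCons split: nat.split)
  then show ?case using quasi_wt[OF MP_wt[OF g]]
    by (intro exI[of _ "[:g:]"] exI[of _ 1]) simp
next
  case (Suc p)
  then obtain P c where P: "quasi (int (w + 2 * p)) P ((mero_deriv ^^ p) g)" "regular P" "degree P \<le> p"
    "c \<noteq> 0" "coeff P p = mero_const c * g" by blast
  let ?k = "int (w + 2 * p)"
  let ?Q = "map_poly mero_deriv P + monom (of_int ?k) 1 * P - monom 1 2 * pderiv P"
  have cQ: "coeff ?Q j = (case j of 0 \<Rightarrow> mero_deriv (coeff P 0) | Suc i \<Rightarrow> mero_deriv (coeff P (Suc i)) + mero_const (of_int (?k - int i)) * coeff P i)" for j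
  proof (cases j)
    case (Suc i)
    have "coeff (monom 1 2 * pderiv P) (Suc i) = of_nat i * coeff P i"
      by (cases i) (auto simp: coeff_monom_mult coeff_pderiv)
    moreover have "coeff (monom (of_int ?k) 1 * P) (Suc i) = of_int ?k * coeff P i"
      by (simp add: coeff_monom_mult)
    ultimately have "coeff ?Q (Suc i) = mero_deriv (coeff P (Suc i)) + of_int ?k * coeff P i - of_nat i * coeff P i"
      by (simp only: coeff_add coeff_diff) (simp add: coeff_map_poly)
    moreover have "mero_const (of_int (?k - int i)) = of_int ?k - of_nat i"
      unfolding mero_const_of_int by simp
    ultimately show ?thesis using Suc by (simp only: nat.case left_diff_distrib) simp
  qed (simp add: coeff_map_poly coeff_monom_mult)
  have "quasi (int (w + 2 * Suc p)) ?Q ((mero_deriv ^^ Suc p) g)"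
    using quasi_deriv[OF P(1)] by (simp add: add.commute)
  moreover have "regular ?Q"
  proof (intro allI ballI)
    fix j z assume z: "z \<in> uhp"
    have r: "mord_ge z (coeff P i) 0" for i using P(2) z by blast
    have "mord_ge z (mero_const x * coeff P i) 0" for x i
      using mord_ge_mult[OF z mord_ge_const[OF z] r, of x i] by simp
    then show "mord_ge z (coeff ?Q j) 0" unfolding cQ
      using mord_ge_deriv0[OF z r] mord_ge_add[OF z] by (auto split: nat.split)
  qed
  moreover have "degree ?Q \<le> Suc p"
  proof (rule degree_le, intro allI impI)
    fix j assume "j > Suc p"
    then obtain i where "j = Suc i" "i > p" by (cases j) auto
    then show "coeff ?Q j = 0" unfolding cQ using P(3) by (simp add: coeff_eq_0)
  qed
  moreover have "coeff ?Q (Suc p) = mero_const (of_int (?k - int p) * c) * g"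
    unfolding cQ using P(3) by (simp add: coeff_eq_0 P(5) mero_const_mult del: of_int_add of_int_diff)
  moreover have "of_int (?k - int p) * c \<noteq> 0"
  proof -
    have "?k - int p \<noteq> 0" using w by simp
    then have "(of_int (?k - int p) :: complex) \<noteq> 0" unfolding of_int_eq_0_iff .
    then show ?thesis using P(4) by (rule no_zero_divisors)
  qed
  ultimately show ?case by blast
qed

lemma quasi_in_algebra:
  assumes closed: "\<And>F. F \<in> generated_algebra S \<Longrightarrow> D_graded F \<in> generated_algebra S"
    and modular: "\<And>g k. g \<in> MP (int k) 0 \<Longrightarrow> monom g k \<in> generated_algebra S"
    and q: "quasi (int k) P f" and reg: "regular P"
  shows "monom f k \<in> generated_algebra S"
  using q reg
proof (induction "degree P" arbitrary: P f rule: less_induct)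
  case less
  have lead: "lead_coeff P \<in> MP (int k - 2 * int (degree P)) 0"
    using quasi_lead[OF less.prems(1)] less.prems(2) by (simp add: MP_0_iff)
  show ?case
  proof (cases "degree P")
    case 0
    then have "f \<in> MP (int k) 0" using lead quasi_coeff_0[OF less.prems(1)] by simp
    then show ?thesis by (rule modular)
  next
    case (Suc p)
    then have "P \<noteq> 0" by auto
    then have nz: "lead_coeff P \<noteq> 0" by (rule leading_coeff_neq_0)
    consider "int k < 2 * int (degree P)" | "int k = 2 * int (degree P)" | "int k > 2 * int (degree P)" by linarith
    then show ?thesis
    proof cases
      case 1
      then show ?thesis using MP_neg_weight[OF _ lead] nz by simp
    next
      case 2
      then obtain c where c: "lead_coeff P = mero_const c" using MP_0_const lead by auto
      define \<phi> where "\<phi> = coeff P p / (of_nat (Suc p) * mero_const c)"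
      have "quasi2 \<phi>" unfolding \<phi>_def using quasi_second[OF _ Suc c] less.prems(1) 2 Suc by simp
      moreover have reg: "mord_ge z \<phi> 0" if z: "z \<in> uhp" for z
      proof -
        have "\<phi> = mero_const (inverse (of_nat (Suc p) * c)) * coeff P p"
          unfolding \<phi>_def mero_const_inverse mero_const_mult mero_const_of_nat by (simp add: divide_inverse mult.commute)
        then show ?thesis
          using mord_ge_mult[OF z mord_ge_const[OF z, of "inverse (of_nat (Suc p) * c)"], of "coeff P p" 0] less.prems(2) z by simp
      qed
      ultimately have "mord \<i> \<phi> < 0" by (intro delta_one_pole) (auto simp: delta_one_forms_iff)
      then show ?thesis using reg[OF ii_uhp] by (simp add: mord_ge_0_iff ii_uhp)
    next
      case 3
      define w where "w = k - 2 * degree P"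
      have w: "w > 0" "k = w + 2 * degree P" using 3 by (auto simp: w_def)
      define g where "g = lead_coeff P"
      have g: "g \<in> MP (int w) 0" using lead w(2) by (simp add: g_def)
      obtain Q c where Q: "quasi (int k) Q ((mero_deriv ^^ degree P) g)" "regular Q" "degree Q \<le> degree P"
        "c \<noteq> 0" "coeff Q (degree P) = mero_const c * g"
        using quasi_iterated_deriv[OF g w(1), of "degree P"] w(2) by auto
      \<comment> \<open>Scaled so that subtracting it cancels the top coefficient of
        \<open>P\<close>; the degree of \<open>Q\<close> is at most that of
        \<open>P\<close>.\<close>
      let ?h = "mero_const (inverse c) * (mero_deriv ^^ degree P) g" and ?Q = "smult (mero_const (inverse c)) Q"
      have cQ: "coeff ?Q (degree P) = lead_coeff P"
        using Q(4,5) by (simp add: g_def mero_const_inverse)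
      have "quasi (int k) (P - ?Q) (f - ?h)"
        by (intro quasi_diff quasi_const_mult less.prems(1) Q(1))
      moreover have "degree (P - ?Q) < degree P"
      proof (rule ccontr)
        assume "\<not> degree (P - ?Q) < degree P"
        moreover have "degree (P - ?Q) \<le> degree P" using Q(3) by (intro degree_diff_le) auto
        ultimately have "degree (P - ?Q) = degree P" by simp
        then have "lead_coeff (P - ?Q) = 0" using cQ by simp
        then have "P - ?Q = 0" by (rule leading_coeff_0_iff[THEN iffD1])
        then show False using \<open>degree (P - ?Q) = degree P\<close> Suc by simp
      qed
      moreover have "regular (P - ?Q)"
      proof (intro allI ballI)
        fix j z assume z: "z \<in> uhp"
        have "mord_ge z (mero_const (inverse c) * coeff Q j) 0"
          using mord_ge_mult[OF z mord_ge_const[OF z, of "inverse c"], of "coeff Q j" 0] Q(2) z by simp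
        then show "mord_ge z (coeff (P - ?Q) j) 0"
          using mord_ge_diff[OF z] less.prems(2) z by simp
      qed
      ultimately have 1: "monom (f - ?h) k \<in> generated_algebra S" using less.hyps by blast
      have "monom ((mero_deriv ^^ i) g) (w + 2 * i) \<in> generated_algebra S" for i
      proof (induction i)
        case 0 then show ?case using modular[OF g] by simp
      next
        case (Suc i)
        then show ?case using closed[OF Suc.IH] by (simp add: D_graded_eq D_phi_monom)
      qed
      then have "monom ((mero_deriv ^^ degree P) g) k \<in> generated_algebra S" unfolding w(2) .
      then have "smult (mero_const (inverse c)) (monom ((mero_deriv ^^ degree P) g) k) \<in> generated_algebra S"
        by (rule generated_algebra_smult)
      from generated_algebra.add[OF 1 this] show ?thesis by (simp add: smult_monom add_monom)
    qed
  qed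
qed

lemma quasi_mero_quasimodular:
  assumes q: "quasi (int k) P f" shows "f \<in> mero_quasimodular_forms \<Gamma> k"
  unfolding mero_quasimodular_forms_def
proof (intro CollectI exI[of _ "degree P"] exI[of _ "coeff P"] ballI)
  fix A assume "A \<in> \<Union>\<Gamma>"
  then have A: "A \<in> G" by (simp add: G_def)
  then have d: "det A = 1" by (rule G_det)
  have "eventually (\<lambda>z. fun_of f (moebius A z) / automorphy A z ^ k =
      (\<Sum>j\<le>degree P. fun_of (coeff P j) z * (of_real (A$2$1) / automorphy A z) ^ j)) (at z)" if z: "z \<in> uhp" for z
    using eventually_fun_of_quasi[OF d z order_refl, where P = P and k = "int k"] eventually_in_uhp[OF z]
  proof eventually_elim
    case (elim w)
    have "fun_of f (moebius A w) = fun_of (mcomp A f) w" using d elim(2) by (simp add: fun_of_mcomp)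
    also have "\<dots> = automorphy A w ^ k * (\<Sum>j\<le>degree P. fun_of (coeff P j) w * (of_real (A$2$1) / automorphy A w) ^ j)"
      using q A elim(1) by (simp add: quasi_def)
    finally show ?case using d elim(2) by simp
  qed
  then show "eventually (\<lambda>z. fun_of f (moebius A z) / automorphy A z ^ k =
      (\<Sum>j\<le>degree P. fun_of (coeff P j) z * (of_real (A$2$1) / automorphy A z) ^ j)) (cosparse uhp)"
    by (simp add: eventually_cosparse_open_eq open_uhp)
qed

text \<open>The value at one point determines the ratio of the entries of the lower row. So distinct
  functions \<open>Xf A\<close> differ at every point, as \<open>holomorphic_coefficients\<close>
  demands of its nodes.\<close>

lemma Xf_eqI:
  assumes A: "A \<in> G" and B: "B \<in> G" and z: "z \<in> uhp"
    and eq: "of_real (A$2$1) / automorphy A z = of_real (B$2$1) / automorphy B z"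
  shows "Xf A = Xf B"
proof (rule merofun_eqI_hol)
  have d: "det A = 1" "det B = 1" using A B G_det by auto
  fix w assume w: "w \<in> uhp"
  have "of_real (A$2$1) * automorphy B z = of_real (B$2$1) * automorphy A z"
    using eq d z by (simp add: field_simps)
  then have "complex_of_real (A$2$1 * B$2$2) = of_real (B$2$1 * A$2$2)"
    by (simp add: automorphy_def algebra_simps)
  then have "A$2$1 * B$2$2 = B$2$1 * A$2$2" by (simp only: of_real_eq_iff)
  then have "complex_of_real (A$2$1) * of_real (B$2$2) = of_real (B$2$1) * of_real (A$2$2)"
    by (metis of_real_mult)
  then have "of_real (A$2$1) * automorphy B w = of_real (B$2$1) * automorphy A w"
    by (simp add: automorphy_def algebra_simps)
  then have "of_real (A$2$1) / automorphy A w = of_real (B$2$1) / automorphy B w"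
    using d w by (simp add: field_simps)
  then show "fun_of (Xf A) w = fun_of (Xf B) w"
    using fun_of_Xf_power(1)[of A w 1] fun_of_Xf_power(1)[of B w 1] d w by simp
qed

text \<open>At each \<open>z\<close> the numbers \<open>fs j z\<close> are the coefficients of a
  polynomial whose values at the nodes \<open>Xf (M i)\<close> depend holomorphically on
  \<open>z\<close>. By interpolation the coefficients do too, and so they define elements of
  \<open>merofun\<close>.\<close>

lemma quasimodular_quasi:
  assumes f: "f \<in> quasimodular_forms \<Gamma> k"
  shows "\<exists>P. quasi (int k) P f \<and> regular P"
proof -
  have hol: "fun_of f holomorphic_on uhp" using f by (simp add: quasimodular_forms_def)
  obtain p fs where fs: "\<forall>A\<in>\<Union>\<Gamma>. \<forall>z\<in>uhp. fun_of f (moebius A z) / automorphy A z ^ k =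
      (\<Sum>j\<le>p. fs j z * (of_real (A$2$1) / automorphy A z) ^ j)"
    using f unfolding quasimodular_forms_def by blast
  obtain e :: "nat \<Rightarrow> merofun" where e: "inj e" "range e \<subseteq> Xf ` G"
    using infinite_Xf infinite_iff_countable_subset[of "Xf ` G"] by blast
  have "\<forall>i. \<exists>A. A \<in> G \<and> e i = Xf A" using e(2) by blast
  from choice[OF this] obtain M where M: "\<forall>i. M i \<in> G \<and> e i = Xf (M i)" ..
  define P0 where "P0 z = (\<Sum>j\<le>p. monom (fs j z) j)" for z
  define x where "x i z = of_real (M i$2$1) / automorphy (M i) z" for i z
  have cP0: "coeff (P0 z) j = fs j z" if "j \<le> p" for j z
    using that by (simp add: P0_def coeff_sum)
  have holo: "(\<lambda>z. coeff (P0 z) j) holomorphic_on uhp" for j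
  proof (rule holomorphic_coefficients[where p = p and x = x])
    show "degree (P0 z) \<le> p" for z unfolding P0_def
      by (intro degree_sum_le) (auto intro: order_trans[OF degree_monom_le])
    have ha: "automorphy A holomorphic_on uhp" for A
      unfolding automorphy_def[abs_def] by (intro holomorphic_intros)
    show "x i holomorphic_on uhp" for i
      unfolding x_def[abs_def] using M G_det ha by (intro holomorphic_intros) auto
    show "x i z \<noteq> x j z" if "i < j" "z \<in> uhp" for i j z
    proof
      assume "x i z = x j z"
      then have "Xf (M i) = Xf (M j)" unfolding x_def using Xf_eqI M that(2) by blast
      then have "e i = e j" using M by simp
      then show False using e(1) that(1) by (auto dest: injD)
    qed
    show "(\<lambda>z. poly (P0 z) (x i z)) holomorphic_on uhp" for i
    proof -
      have d: "det (M i) = 1" using M G_det by blast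
      have "(fun_of f \<circ> moebius (M i)) holomorphic_on uhp"
        using d by (intro holomorphic_on_compose_gen[OF moebius_holomorphic hol]) auto
      then have "(\<lambda>z. fun_of f (moebius (M i) z) / automorphy (M i) z ^ k) holomorphic_on uhp"
        using d ha by (intro holomorphic_intros) (auto simp: o_def)
      then show ?thesis
      proof (rule holomorphic_transform)
        fix z assume z: "z \<in> uhp"
        have "M i \<in> \<Union>\<Gamma>" using M by (simp add: G_def)
        from bspec[OF bspec[OF fs this] z]
        show "fun_of f (moebius (M i) z) / automorphy (M i) z ^ k = poly (P0 z) (x i z)"
          by (simp add: P0_def poly_sum poly_monom x_def)
      qed
    qed
  qed
  have "\<forall>j. \<exists>F. \<forall>z\<in>uhp. fun_of F z = coeff (P0 z) j \<and> mord z F \<ge> 0"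
    using merofun_of_holomorphic[OF holo] by metis
  from choice[OF this] obtain F where F: "\<forall>j. \<forall>z\<in>uhp. fun_of (F j) z = coeff (P0 z) j \<and> mord z (F j) \<ge> 0" ..
  define P where "P = (\<Sum>j\<le>p. monom (F j) j)"
  have cP: "coeff P j = (if j \<le> p then F j else 0)" for j by (simp add: P_def coeff_sum)
  have deg: "degree P \<le> p" by (rule degree_le) (simp add: cP)
  have "regular P" using F by (auto simp: cP mord_ge_0_iff)
  moreover have "quasi (int k) P f" unfolding quasi_def
  proof
    fix A assume A: "A \<in> G"
    then have d: "det A = 1" by (rule G_det)
    show "mcomp A f = autofun A powi int k * poly P (Xf A)"
    proof (rule merofun_eqI)
      fix z assume z: "z \<in> uhp"
      show "eventually (\<lambda>w. fun_of (mcomp A f) w = fun_of (autofun A powi int k * poly P (Xf A)) w) (at z)"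
        using eventually_fun_of_quasi[OF d z deg, of "int k"] eventually_in_uhp[OF z]
      proof eventually_elim
        case (elim w)
        have "fun_of f (moebius A w) / automorphy A w ^ k = (\<Sum>j\<le>p. fs j w * (of_real (A$2$1) / automorphy A w) ^ j)"
          by (rule bspec[OF bspec[OF fs] elim(2)]) (use A in \<open>simp add: G_def\<close>)
        also have "\<dots> = (\<Sum>j\<le>p. fun_of (coeff P j) w * (of_real (A$2$1) / automorphy A w) ^ j)"
          using F elim(2) by (intro sum.cong) (auto simp: cP cP0)
        finally have "fun_of f (moebius A w) = automorphy A w ^ k * \<dots>"
          using d elim(2) by (simp add: field_simps)
        then show ?case using elim d by (simp add: fun_of_mcomp)
      qed
    qed
  qed
  ultimately show ?thesis by blast
qed

section \<open>The ring \<open>R[\<phi>]\<close>\<close>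

lemma adjoin_phi_finitely_generated: "finitely_generated (adjoin_phi (R_ring \<phi> d f N) \<phi>)"
proof -
  let ?S = "{(D_phi \<phi> ^^ j) (f m) | j m. j \<le> N \<and> m \<in> {1..d}} \<union> {(D_phi \<phi> ^^ l) (omega \<phi>) | l. l \<le> N}"
  have "?S \<subseteq> (\<lambda>(j, m). (D_phi \<phi> ^^ j) (f m)) ` ({..N} \<times> {1..d}) \<union> (\<lambda>l. (D_phi \<phi> ^^ l) (omega \<phi>)) ` {..N}"
    by auto
  then have "finite ?S" by (rule finite_subset) simp
  moreover have "adjoin_phi (R_ring \<phi> d f N) \<phi> = generated_algebra (?S \<union> {monom \<phi> 2})"
  proof (intro equalityI subsetI)
    fix F assume "F \<in> adjoin_phi (R_ring \<phi> d f N) \<phi>"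
    then show "F \<in> generated_algebra (?S \<union> {monom \<phi> 2})" unfolding adjoin_phi_def
    proof (rule generated_algebra_subset)
      have "R_ring \<phi> d f N \<subseteq> generated_algebra (?S \<union> {monom \<phi> 2})"
        unfolding R_ring_def by (rule generated_algebra_mono) blast
      then show "R_ring \<phi> d f N \<union> {monom \<phi> 2} \<subseteq> generated_algebra (?S \<union> {monom \<phi> 2})"
        by (simp add: generated_algebra.gen)
    qed
  next
    fix F assume F: "F \<in> generated_algebra (?S \<union> {monom \<phi> 2})"
    have "?S \<subseteq> R_ring \<phi> d f N" unfolding R_ring_def by (rule subsetI, rule generated_algebra.gen)
    then have "generated_algebra (?S \<union> {monom \<phi> 2}) \<subseteq> adjoin_phi (R_ring \<phi> d f N) \<phi>"
      unfolding adjoin_phi_def by (intro generated_algebra_mono) blast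
    then show "F \<in> adjoin_phi (R_ring \<phi> d f N) \<phi>" using F by blast
  qed
  ultimately show ?thesis unfolding finitely_generated_def
    by (intro exI[of _ "?S \<union> {monom \<phi> 2}"]) simp
qed

lemma adjoin_phi_closed:
  assumes b: "homogeneous_basis_mod_square \<Gamma> d f" and closed: "closed_under (D_phi \<phi>) (R_ring \<phi> d f N)"
  shows "closed_under D_graded (adjoin_phi (R_ring \<phi> d f N) \<phi>)"
  unfolding closed_under_def
proof
  let ?R = "R_ring \<phi> d f N" and ?A = "generated_algebra (R_ring \<phi> d f N \<union> {monom \<phi> 2})"
  have RA: "F \<in> ?A" if "F \<in> ?R" for F using that by (auto intro: generated_algebra.gen)
  have phi: "monom \<phi> 2 \<in> ?A" by (auto intro: generated_algebra.gen)
  have hom: "D_graded (monom g k) \<in> ?A" if g: "monom g k \<in> ?R" for g k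
  proof -
    have "D_phi \<phi> (monom g k) + monom \<phi> 2 * ([:mero_const (of_nat k):] * monom g k) \<in> ?A"
      using closed g by (intro generated_algebra.add generated_algebra.mult phi generated_algebra.const RA) (auto simp: closed_under_def)
    also have "D_phi \<phi> (monom g k) + monom \<phi> 2 * ([:mero_const (of_nat k):] * monom g k) = D_graded (monom g k)"
      by (simp add: D_graded_eq D_phi_monom mult_monom smult_monom add_monom mero_const_of_nat algebra_simps)
    finally show ?thesis .
  qed
  have gen: "D_graded H \<in> ?A" if H: "H \<in> ?R \<union> {monom \<phi> 2}" for H
  proof (cases "H \<in> ?R")
    case True
    have "(\<Sum>k\<le>degree H. D_graded (monom (coeff H k) k)) \<in> ?A"
      by (intro generated_algebra_sum hom R_ring_homogeneous[OF b True])
    then have "D_graded (\<Sum>k\<le>degree H. monom (coeff H k) k) \<in> ?A"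
      by (simp add: D_graded_eq D_phi_sum)
    then show ?thesis by (simp add: poly_as_sum_of_monoms)
  next
    case False
    then have "H = monom \<phi> 2" using H by simp
    moreover have "D_graded (monom \<phi> 2) = omega \<phi> + monom \<phi> 2 * monom \<phi> 2"
      by (simp add: D_graded_eq D_phi_monom omega_def mult_monom add_monom power2_eq_square)
    ultimately show ?thesis
      using generated_algebra.add[OF RA[OF omega_in_R_ring] generated_algebra.mult[OF phi phi]] by simp
  qed
  fix F assume "F \<in> adjoin_phi (R_ring \<phi> d f N) \<phi>"
  then show "D_graded F \<in> adjoin_phi (R_ring \<phi> d f N) \<phi>"
    unfolding adjoin_phi_def D_graded_eq
    by (rule D_phi_generated_algebra) (use gen in \<open>simp add: D_graded_eq\<close>)
qed

text \<open>Elements of \<open>R_ring\<close> have depth 0, and \<phi> has depth 1 with polynomial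
  \<open>[:\<phi>, 1:]\<close>; under sums and products of forms these polynomials are added and
  multiplied.\<close>

lemma adjoin_phi_mero_quasimodular:
  assumes \<phi>: "\<phi> \<in> delta_one_forms \<Gamma>" and b: "homogeneous_basis_mod_square \<Gamma> d f"
  shows "adjoin_phi (R_ring \<phi> d f N) \<phi> \<subseteq> mero_quasimodular_ring \<Gamma>"
proof
  fix F assume F: "F \<in> adjoin_phi (R_ring \<phi> d f N) \<phi>"
  let ?M = "\<lambda>k. {g. \<exists>P. quasi (int k) P g}"
  have q: "quasi2 \<phi>" using \<phi> by (simp add: delta_one_forms_iff)
  obtain m where m: "mord \<i> \<phi> = - int m"
    using delta_one_pole[OF \<phi>] by (metis int_cases2 less_imp_le nat_0_le neg_0_le_iff_le add.inverse_inverse)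
  have z: "0 \<in> ?M k" for k using quasi_wt[of 0 "int k"] by auto
  have "coeff F k \<in> ?M k" for k
    using F unfolding adjoin_phi_def
  proof (rule generated_algebra_coeff)
    show "mero_const c \<in> ?M 0" for c using quasi_wt[OF wt_const] by auto
    show "0 \<in> ?M k" for k by (rule z)
    show "coeff H k \<in> ?M k" if H: "H \<in> R_ring \<phi> d f N \<union> {monom \<phi> 2}" for H k
    proof (cases "H \<in> R_ring \<phi> d f N")
      case True
      then have "coeff H k \<in> MP (int k) (int (m * k div 2))"
        using R_slope[OF \<phi> b _ m] R_ring_subset by blast
      then show ?thesis using quasi_wt[OF MP_wt] by blast
    next
      case False
      then show ?thesis using H z[of k] quasi_quasi2[OF q] by (cases "k = 2") auto
    qed
    show "a + b \<in> ?M k" if "a \<in> ?M k" "b \<in> ?M k" for k a b using that quasi_add by blast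
    show "a * b \<in> ?M (k + l)" if ab: "a \<in> ?M k" "b \<in> ?M l" for k l a b
    proof -
      obtain P Q where "quasi (int k) P a" "quasi (int l) Q b" using ab by blast
      then have "quasi (int (k + l)) (P * Q) (a * b)" using quasi_mult by simp
      then show ?thesis by blast
    qed
  qed
  then show "F \<in> mero_quasimodular_ring \<Gamma>"
    unfolding mero_quasimodular_ring_def graded_sum_def using quasi_mero_quasimodular by blast
qed

lemma quasimodular_subset_adjoin_phi:
  assumes b: "homogeneous_basis_mod_square \<Gamma> d f" and closed: "closed_under (D_phi \<phi>) (R_ring \<phi> d f N)"
  shows "quasimodular_ring \<Gamma> \<subseteq> adjoin_phi (R_ring \<phi> d f N) \<phi>"
proof
  fix F assume F: "F \<in> quasimodular_ring \<Gamma>"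
  let ?A = "generated_algebra (R_ring \<phi> d f N \<union> {monom \<phi> 2})"
  have "monom (coeff F k) k \<in> ?A" for k
  proof -
    have "coeff F k \<in> quasimodular_forms \<Gamma> k" using F by (simp add: quasimodular_ring_def graded_sum_def)
    from quasimodular_quasi[OF this] obtain P where P: "quasi (int k) P (coeff F k) \<and> regular P" ..
    show ?thesis
    proof (rule quasi_in_algebra[OF _ _ conjunct1[OF P] conjunct2[OF P]])
      show "D_graded H \<in> ?A" if "H \<in> ?A" for H
        using adjoin_phi_closed[OF b closed] that by (simp add: closed_under_def adjoin_phi_def)
      show "monom g k \<in> ?A" if "g \<in> MP (int k) 0" for g k
        using modular_in_R_ring[OF b that] by (auto intro: generated_algebra.gen)
    qed
  qed
  then have "(\<Sum>k\<le>degree F. monom (coeff F k) k) \<in> ?A" by (intro generated_algebra_sum)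
  then show "F \<in> adjoin_phi (R_ring \<phi> d f N) \<phi>" by (simp add: poly_as_sum_of_monoms adjoin_phi_def)
qed

end

theorem mainTheorem10:
  fixes \<Gamma> :: "(real^2^2) set set"
  assumes "discrete_subgroup \<Gamma>" and "cocompact \<Gamma>"
  shows
    "(\<exists>R. finitely_generated R \<and> R \<subseteq> mero_quasimodular_ring \<Gamma> \<and>
          closed_under D_graded R \<and> quasimodular_ring \<Gamma> \<subseteq> R) \<and>
     (\<exists>\<phi>. \<phi> \<in> delta_one_forms \<Gamma>) \<and>
     (\<exists>d f. homogeneous_basis_mod_square \<Gamma> d f) \<and>
     (\<forall>\<phi> d f. \<phi> \<in> delta_one_forms \<Gamma> \<and> homogeneous_basis_mod_square \<Gamma> d f \<longrightarrow>
        (\<exists>N\<ge>1. closed_under (D_phi \<phi>) (R_ring \<phi> d f N)) \<and>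
        (\<forall>N\<ge>1. closed_under (D_phi \<phi>) (R_ring \<phi> d f N) \<longrightarrow>
           finitely_generated (adjoin_phi (R_ring \<phi> d f N) \<phi>) \<and>
           adjoin_phi (R_ring \<phi> d f N) \<phi> \<subseteq> mero_quasimodular_ring \<Gamma> \<and>
           closed_under D_graded (adjoin_phi (R_ring \<phi> d f N) \<phi>) \<and>
           quasimodular_ring \<Gamma> \<subseteq> adjoin_phi (R_ring \<phi> d f N) \<phi>))"
proof -
  interpret fuchsian \<Gamma> by unfold_locales (rule assms)+
  have ring: "finitely_generated (adjoin_phi (R_ring \<phi> d f N) \<phi>) \<and>
      adjoin_phi (R_ring \<phi> d f N) \<phi> \<subseteq> mero_quasimodular_ring \<Gamma> \<and>
      closed_under D_graded (adjoin_phi (R_ring \<phi> d f N) \<phi>) \<and>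
      quasimodular_ring \<Gamma> \<subseteq> adjoin_phi (R_ring \<phi> d f N) \<phi>"
    if "\<phi> \<in> delta_one_forms \<Gamma>" "homogeneous_basis_mod_square \<Gamma> d f"
      "closed_under (D_phi \<phi>) (R_ring \<phi> d f N)" for \<phi> d f N
    using adjoin_phi_finitely_generated adjoin_phi_mero_quasimodular[OF that(1,2)]
      adjoin_phi_closed[OF that(2,3)] quasimodular_subset_adjoin_phi[OF that(2,3)] by blast
  obtain \<phi> d f N where ex: "\<phi> \<in> delta_one_forms \<Gamma>" "homogeneous_basis_mod_square \<Gamma> d f"
    "closed_under (D_phi \<phi>) (R_ring \<phi> d f N)"
    using delta_one_exists basis_exists R_ring_closed_exists by meson
  show ?thesis
  proof (intro conjI allI impI; (elim conjE)?)
    show "\<exists>R. finitely_generated R \<and> R \<subseteq> mero_quasimodular_ring \<Gamma> \<and>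
          closed_under D_graded R \<and> quasimodular_ring \<Gamma> \<subseteq> R"
      using ring[OF ex] by (rule exI[of _ "adjoin_phi (R_ring \<phi> d f N) \<phi>"])
    show "\<exists>\<phi>. \<phi> \<in> delta_one_forms \<Gamma>" using ex(1) by (rule exI)
    show "\<exists>d f. homogeneous_basis_mod_square \<Gamma> d f" by (rule basis_exists)
  next
    fix \<phi> d f assume h: "\<phi> \<in> delta_one_forms \<Gamma>" "homogeneous_basis_mod_square \<Gamma> d f"
    show "\<exists>N\<ge>1. closed_under (D_phi \<phi>) (R_ring \<phi> d f N)" by (rule R_ring_closed_exists[OF h])
    fix N assume c: "closed_under (D_phi \<phi>) (R_ring \<phi> d f N)"
    note r = ring[OF h c]
    show "finitely_generated (adjoin_phi (R_ring \<phi> d f N) \<phi>)" using r by blast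
    show "adjoin_phi (R_ring \<phi> d f N) \<phi> \<subseteq> mero_quasimodular_ring \<Gamma>" using r by blast
    show "closed_under D_graded (adjoin_phi (R_ring \<phi> d f N) \<phi>)" using r by blast
    show "quasimodular_ring \<Gamma> \<subseteq> adjoin_phi (R_ring \<phi> d f N) \<phi>" using r by blast
  qed
qed

end
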